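(* Let $d\in\mathbb N$, $\alpha>1/2$, let $\{\gamma_j\}_{j=1}^\infty$ be positive product weights, so $\gamma_{\mathfrak u}=\prod_{j\in\mathfrak u}\gamma_j$, let $\tau\in(0,1)$ and $n\ge2$. The component-by-component and prime-by-prime construction algorithm given in the context constructs a vector $\boldsymbol z^\star\in\mathbb Z^d$ satisfying $$ e^{\mathrm{ran}}_{d,\alpha,\boldsymbol\gamma}\big(Q^{\mathrm{ran\text{-}pr}}_{d,n,\boldsymbol z^\star}\big)\le\frac{(C_{\tau,\lambda}\ln n)^{1/2}}{n^{\lambda+1/2}}\big[\mu_{d,\alpha,\boldsymbol\gamma}(\lambda)\big]^\lambda\qquad\text{for all }\lambda\in[1/2,\alpha), $$ with $C_{\tau,\lambda}>0$ a constant depending only on $\tau$ and $\lambda$, in time $O(d\,n^4/\ln n)$ and using $O(n^4/(\ln n)^2)$ memory. The generating vector can be used for any $d'\le d$: its first $d'$ components $(z_1^\star,\dots,z_{d'}^\star)$ satisfy the same bound with $d$ replaced by $d'$. The memory cost can be reduced to $O(n)$ at the expense of increasing the calculation cost by a factor $d$.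
   Context: Conventions: $\mathbb Z_m$ is identified with $\{0,\dots,m-1\}$; $\equiv_m$ means congruent modulo $m$; $\zeta$ is the Riemann zeta function; $\mathrm{supp}(\boldsymbol h)=\{j:h_j\ne0\}$. Weighted Korobov space: with $\gamma_{\mathfrak u}=\prod_{j\in\mathfrak u}\gamma_j$ put $r_{\alpha,\boldsymbol\gamma}(\boldsymbol h)=\gamma_{\mathrm{supp}(\boldsymbol h)}^{-1}\prod_{j\in\mathrm{supp}(\boldsymbol h)}|h_j|^\alpha=\prod_{j\in\mathrm{supp}(\boldsymbol h)}\gamma_j^{-1}|h_j|^\alpha$ (for $\boldsymbol h\in\mathbb Z^s$, any $s$) and $\widehat f(\boldsymbol h)=\int_{[0,1]^d}f(\boldsymbol x)e^{-2\pi\mathrm i\,\boldsymbol h\cdot\boldsymbol x}\,d\boldsymbol x$. Then $\mathcal H_{d,\alpha,\boldsymbol\gamma}=\{f\in L_2([0,1]^d):\|f\|_{d,\alpha,\boldsymbol\gamma}<\infty\}$, $\|f\|_{d,\alpha,\boldsymbol\gamma}=(\sum_{\boldsymbol h\in\mathbb Z^d}r^2_{\alpha,\boldsymbol\gamma}(\boldsymbol h)|\widehat f(\boldsymbol h)|^2)^{1/2}$; elements are identified with their continuous one-periodic representatives. For $\lambda\in[1/2,\alpha)$: $\mu_{d,\alpha,\boldsymbol\gamma}(\lambda)=\sum_{\boldsymbol h\in\mathbb Z^d\setminus\{\boldsymbol0\}}r_{\alpha,\boldsymbol\gamma}^{-1/\lambda}(\boldsymbol h)=\sum_{\emptyset\ne\mathfrak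 u\subseteq\{1,\dots,d\}}\gamma_{\mathfrak u}^{1/\lambda}(2\zeta(\alpha/\lambda))^{|\mathfrak u|}$. $I_d(f)=\int_{[0,1]^d}f$ and $Q_{d,m,\boldsymbol z}(f)=\frac1m\sum_{k=0}^{m-1}f(\frac{k\boldsymbol z\bmod m}{m})$. $\mathcal P_n$ is the set of primes $p$ with $n/2<p\le n$, and $Q^{\mathrm{ran\text{-}pr}}_{d,n,\boldsymbol z}$ draws $p$ uniformly at random from $\mathcal P_n$ and returns $Q_{d,p,\boldsymbol z}(f)$. The randomised error is $e^{\mathrm{ran}}_{d,\alpha,\boldsymbol\gamma}(A)=\sup_{\|f\|_{d,\alpha,\boldsymbol\gamma}\le1}\mathbb E[|A(f)-I_d(f)|]$. Search criteria: for $s\ge1$, $\boldsymbol z'\in\mathbb Z^{s-1}$, $\boldsymbol h=(\boldsymbol h',h_s)\in\mathbb Z^s$, prime $p$, $z_s\in\mathbb Z_p$, $\boldsymbol z=(\boldsymbol z',z_s)$, $$\theta_s^{(p)}(z_s)=\sum_{\substack{\boldsymbol h\in\mathbb Z^s,\ h_s\ne0\\ \boldsymbol h\cdot\boldsymbol z\equiv_p0}}r_{\alpha,\boldsymbol\gamma}^{-2}(\boldsymbol h),$$ $$T_s^{(p)}\big(z_s^{(p)};\{z_s^{(q)}\}_{q\in\mathcal P_n,q<p}\big)=\theta_s^{(p)}(z_s^{(p)})+2\sum_{\substack{q\in\mathcal P_n\\ q<p}}\ \sum_{\substack{\boldsymbol h\in\mathbb Z^s,\ h_s\ne0,\ h_s\not\equiv_p0\\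 \boldsymbol h\cdot\boldsymbol z\equiv_p0,\ \boldsymbol h\cdot\boldsymbol z\equiv_q0}}r_{\alpha,\boldsymbol\gamma}^{-2}(\boldsymbol h)+2\sum_{\substack{q\in\mathcal P_n\\ q>p}}\ \sum_{\substack{\boldsymbol h\in\mathbb Z^s,\ h_s\ne0,\ h_s\equiv_q0\\ \boldsymbol h\cdot\boldsymbol z\equiv_p0,\ \boldsymbol h'\cdot\boldsymbol z'\equiv_q0}}r_{\alpha,\boldsymbol\gamma}^{-2}(\boldsymbol h),$$ where $\boldsymbol h\cdot\boldsymbol z\equiv_p0$ means $\boldsymbol h'\cdot\boldsymbol z'+h_sz_s^{(p)}\equiv_p0$ and $\boldsymbol h\cdot\boldsymbol z\equiv_q0$ (for $q<p$) means $\boldsymbol h'\cdot\boldsymbol z'+h_sz_s^{(q)}\equiv_q0$. The construction algorithm: set $z_1^\star=1$. For $s=2,\dots,d$, and for each $p\in\mathcal P_n$ in increasing order: with $\boldsymbol z'=(z_1^\star,\dots,z_{s-1}^\star)$ and the already chosen $z_{s,\star}^{(q)}$, $q<p$, compute $\theta_s^{(p)}(z)$ and $T_s^{(p)}(z;\{z_{s,\star}^{(q)}\}_{q<p})$ for all $z\in\mathbb Z_p$; among the $\lceil\tau p\rceil$ values $z\in\mathbb Z_p$ with the smallest $\theta_s^{(p)}(z)$, let $z_{s,\star}^{(p)}$ be one that minimises $T_s^{(p)}$. The component $z_s^\star$ is represented by its residues $z_{s,\star}^{(p)}$, $p\in\mathcal P_n$; it is the unique element of $\mathbb Z_N$, $N=\prod_{p\in\mathcal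 P_n}p$, with $z_s^\star\equiv_pz_{s,\star}^{(p)}$ for all $p\in\mathcal P_n$. Cost convention: time counts elementary real-arithmetic operations and memory counts stored numbers; evaluating $\sigma_\alpha(x)=\sum_{h\in\mathbb Z\setminus\{0\}}e^{2\pi\mathrm ihx}/|h|^{2\alpha}$ at a point $x\in[0,1]$ counts as an elementary operation (for integer $\alpha$ it is a multiple of the Bernoulli polynomial of degree $2\alpha$). *)

theory Defs
  imports
    "HOL-Probability.Probability"
    "HOL-Computational_Algebra.Primes"
begin

section \<open>Weighted Korobov spaces\<close>

text \<open>
  The dimension varies inside the statements, so integer vectors and points are functions on
  \<open>nat\<close>, of which the coordinates \<open>1, \<dots>, d\<close> matter. An integer frequency vanishes outside
  \<open>{1..d}\<close>; in this way \<open>Zvec s\<close> is contained in \<open>Zvec d\<close> for \<open>s \<le> d\<close>.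
\<close>

definition Zvec :: "nat \<Rightarrow> (nat \<Rightarrow> int) set" where
  "Zvec d = {h. \<forall>j. j \<notin> {1..d} \<longrightarrow> h j = 0}"

definition supp :: "(nat \<Rightarrow> int) \<Rightarrow> nat set" where
  "supp h = {j. h j \<noteq> 0}"

definition r_weight :: "real \<Rightarrow> (nat \<Rightarrow> real) \<Rightarrow> (nat \<Rightarrow> int) \<Rightarrow> real" where
  "r_weight \<alpha> \<gamma> h = inverse (\<Prod>j\<in>supp h. \<gamma> j) * (\<Prod>j\<in>supp h. \<bar>real_of_int (h j)\<bar> powr \<alpha>)"

definition cube :: "nat \<Rightarrow> (nat \<Rightarrow> real) measure" where
  "cube d = Pi\<^sub>M {1..d} (\<lambda>_. restrict_space lborel {0..1})"

definition I_d :: "nat \<Rightarrow> ((nat \<Rightarrow> real) \<Rightarrow> complex) \<Rightarrow> complex" where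
  "I_d d f = (LINT x|cube d. f x)"

definition fourier_coeff ::
    "nat \<Rightarrow> ((nat \<Rightarrow> real) \<Rightarrow> complex) \<Rightarrow> (nat \<Rightarrow> int) \<Rightarrow> complex" where
  "fourier_coeff d f h =
     (LINT x|cube d. f x * exp (- 2 * of_real pi * \<i> * of_real (\<Sum>j\<in>{1..d}. of_int (h j) * x j)))"

text \<open>
  The elements of the space are the continuous one-periodic representatives, that is, functions
  of the coordinates \<open>1, \<dots>, d\<close> alone. Continuity refers to the product topology.
\<close>

definition korobov_space ::
    "nat \<Rightarrow> real \<Rightarrow> (nat \<Rightarrow> real) \<Rightarrow> ((nat \<Rightarrow> real) \<Rightarrow> complex) set" where
  "korobov_space d \<alpha> \<gamma> =
     {f. (\<forall>x y. (\<forall>j\<in>{1..d}. x j = y j) \<longrightarrow> f x = f y)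
       \<and> continuous_on UNIV f
       \<and> (\<forall>x. \<forall>j\<in>{1..d}. f (x(j := x j + 1)) = f x)
       \<and> integrable (cube d) (\<lambda>x. (cmod (f x))\<^sup>2)
       \<and> (\<lambda>h. (r_weight \<alpha> \<gamma> h)\<^sup>2 * (cmod (fourier_coeff d f h))\<^sup>2) summable_on Zvec d}"

definition korobov_norm ::
    "nat \<Rightarrow> real \<Rightarrow> (nat \<Rightarrow> real) \<Rightarrow> ((nat \<Rightarrow> real) \<Rightarrow> complex) \<Rightarrow> real" where
  "korobov_norm d \<alpha> \<gamma> f =
     sqrt (\<Sum>\<^sub>\<infinity>h\<in>Zvec d. (r_weight \<alpha> \<gamma> h)\<^sup>2 * (cmod (fourier_coeff d f h))\<^sup>2)"

definition mu_sum :: "nat \<Rightarrow> real \<Rightarrow> (nat \<Rightarrow> real) \<Rightarrow> real \<Rightarrow> real" where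
  "mu_sum d \<alpha> \<gamma> lam = (\<Sum>\<^sub>\<infinity>h\<in>Zvec d - {\<lambda>_. 0}. r_weight \<alpha> \<gamma> h powr (- (1 / lam)))"


section \<open>The randomised lattice rule and its error\<close>

definition Q_lattice ::
    "nat \<Rightarrow> (nat \<Rightarrow> int) \<Rightarrow> ((nat \<Rightarrow> real) \<Rightarrow> complex) \<Rightarrow> complex" where
  "Q_lattice m z f =
     (1 / of_nat m) *
     (\<Sum>k<m. f (\<lambda>j. real_of_int ((int k * z j) mod int m) / real m))"

definition primes_P :: "nat \<Rightarrow> nat set" where
  "primes_P n = {p. prime p \<and> real n / 2 < real p \<and> p \<le> n}"

definition Q_ran_pr ::
    "nat \<Rightarrow> (nat \<Rightarrow> int) \<Rightarrow> ((nat \<Rightarrow> real) \<Rightarrow> complex) \<Rightarrow> complex pmf" where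
  "Q_ran_pr n z f = map_pmf (\<lambda>p. Q_lattice p z f) (pmf_of_set (primes_P n))"

definition e_ran ::
    "nat \<Rightarrow> real \<Rightarrow> (nat \<Rightarrow> real) \<Rightarrow> (((nat \<Rightarrow> real) \<Rightarrow> complex) \<Rightarrow> complex pmf) \<Rightarrow> ereal" where
  "e_ran d \<alpha> \<gamma> A =
     (SUP f\<in>{f \<in> korobov_space d \<alpha> \<gamma>. korobov_norm d \<alpha> \<gamma> f \<le> 1}.
        ereal (measure_pmf.expectation (A f) (\<lambda>y. cmod (y - I_d d f))))"


section \<open>The construction\<close>

text \<open>\<open>dot s h z v\<close> is \<open>h' \<cdot> z' + h\<^sub>s v\<close>; only \<open>z 1, \<dots>, z (s - 1)\<close> enter.\<close>

definition dot :: "nat \<Rightarrow> (nat \<Rightarrow> int) \<Rightarrow> (nat \<Rightarrow> int) \<Rightarrow> int \<Rightarrow> int" where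
  "dot s h z v = (\<Sum>j\<in>{1..<s}. h j * z j) + h s * v"

definition theta ::
    "real \<Rightarrow> (nat \<Rightarrow> real) \<Rightarrow> nat \<Rightarrow> (nat \<Rightarrow> int) \<Rightarrow> nat \<Rightarrow> int \<Rightarrow> real" where
  "theta \<alpha> \<gamma> s z p v =
     (\<Sum>\<^sub>\<infinity>h\<in>{h \<in> Zvec s. h s \<noteq> 0 \<and> int p dvd dot s h z v}. r_weight \<alpha> \<gamma> h powr (- 2))"

text \<open>\<open>w q\<close> is the already chosen residue modulo \<open>q\<close>, for \<open>q < p\<close>.\<close>

definition T_crit ::
    "real \<Rightarrow> (nat \<Rightarrow> real) \<Rightarrow> nat \<Rightarrow> nat \<Rightarrow> (nat \<Rightarrow> int) \<Rightarrow> nat \<Rightarrow> int \<Rightarrow> (nat \<Rightarrow> int) \<Rightarrow> real" where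
  "T_crit \<alpha> \<gamma> n s z p v w =
     theta \<alpha> \<gamma> s z p v
     + 2 * (\<Sum>q\<in>{q \<in> primes_P n. q < p}.
          \<Sum>\<^sub>\<infinity>h\<in>{h \<in> Zvec s. h s \<noteq> 0 \<and> \<not> int p dvd h s
                     \<and> int p dvd dot s h z v \<and> int q dvd dot s h z (w q)}.
             r_weight \<alpha> \<gamma> h powr (- 2))
     + 2 * (\<Sum>q\<in>{q \<in> primes_P n. p < q}.
          \<Sum>\<^sub>\<infinity>h\<in>{h \<in> Zvec s. h s \<noteq> 0 \<and> int q dvd h s
                     \<and> int p dvd dot s h z v \<and> int q dvd (\<Sum>j\<in>{1..<s}. h j * z j)}.
             r_weight \<alpha> \<gamma> h powr (- 2))"

text \<open>
  \<open>G\<close> is a choice of the \<open>\<lceil>\<tau>p\<rceil>\<close> residues with the smallest values of \<open>theta\<close>. Ties, here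
  and in the minimisation of \<open>T_crit\<close>, may be broken arbitrarily.
\<close>

definition smallest_theta ::
    "real \<Rightarrow> (nat \<Rightarrow> real) \<Rightarrow> real \<Rightarrow> nat \<Rightarrow> (nat \<Rightarrow> int) \<Rightarrow> nat \<Rightarrow> int set \<Rightarrow> bool" where
  "smallest_theta \<alpha> \<gamma> \<tau> s z p G \<longleftrightarrow>
     G \<subseteq> {0..<int p} \<and> int (card G) = \<lceil>\<tau> * real p\<rceil>
     \<and> (\<forall>u\<in>G. \<forall>v\<in>{0..<int p} - G. theta \<alpha> \<gamma> s z p u \<le> theta \<alpha> \<gamma> s z p v)"

definition selected ::
    "real \<Rightarrow> (nat \<Rightarrow> real) \<Rightarrow> real \<Rightarrow> nat \<Rightarrow> nat \<Rightarrow> (nat \<Rightarrow> int) \<Rightarrow> nat \<Rightarrow> (nat \<Rightarrow> int) \<Rightarrow> int \<Rightarrow> bool"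
  where
  "selected \<alpha> \<gamma> \<tau> n s z p w v \<longleftrightarrow>
     (\<exists>G. smallest_theta \<alpha> \<gamma> \<tau> s z p G \<and> v \<in> G
        \<and> (\<forall>u\<in>G. T_crit \<alpha> \<gamma> n s z p v w \<le> T_crit \<alpha> \<gamma> n s z p u w))"

text \<open>
  \<open>z\<close> is a possible outcome of the component-by-component and prime-by-prime construction. The
  residue chosen for \<open>p\<close> in step \<open>s\<close> is \<open>z s mod p\<close>; its selection refers only to
  \<open>z 1, \<dots>, z (s - 1)\<close> and to the residues for primes \<open>q < p\<close>.
\<close>

definition cbc_pbp ::
    "real \<Rightarrow> (nat \<Rightarrow> real) \<Rightarrow> real \<Rightarrow> nat \<Rightarrow> nat \<Rightarrow> (nat \<Rightarrow> int) \<Rightarrow> bool" where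
  "cbc_pbp \<alpha> \<gamma> \<tau> n d z \<longleftrightarrow>
     z 1 = 1
     \<and> (\<forall>s\<in>{2..d}. z s \<in> {0..<int (\<Prod>(primes_P n))}
          \<and> (\<forall>p\<in>primes_P n.
               selected \<alpha> \<gamma> \<tau> n s z p (\<lambda>q. z s mod int q) (z s mod int p)))"


section \<open>The machine model\<close>

text \<open>
  A real random access machine with an integer memory and a real memory, executing structured
  programs. Integers convert to reals, whereas reals influence integers only through
  comparisons (there is no rounding operation). The real operations are the four arithmetic
  operations, square roots (from which the roots of unity of the fast Fourier transform are
  obtained) and evaluation of \<open>\<sigma>\<^sub>\<alpha>\<close> on \<open>[0,1]\<close>; the machine has no other access to \<open>\<alpha>\<close>. A
  program is a single finite object for all inputs.

  The weights are read-only input. Results are appended to an output list, which can be read but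
  not overwritten, so that it cannot serve as working memory.
\<close>

text \<open>The two halves of the series are complex conjugates, so its value is real.\<close>

definition sigma :: "real \<Rightarrow> real \<Rightarrow> real" where
  "sigma \<alpha> x =
     Re (\<Sum>\<^sub>\<infinity>h\<in>UNIV - {0::int}.
           exp (2 * of_real pi * \<i> * of_real (of_int h * x))
             / of_real (\<bar>real_of_int h\<bar> powr (2 * \<alpha>)))"

record input =
  in_dim :: int
  in_size :: int
  in_tau :: real
  in_weight :: "nat \<Rightarrow> real"
  in_sigma :: "real \<Rightarrow> real"

record state =
  imem :: "nat \<Rightarrow> int"
  rmem :: "nat \<Rightarrow> real"
  outlist :: "int list"

datatype iop = IAdd | ISub | IMul | IDiv | IMod

datatype rop = RAdd | RSub | RMul | RDiv

datatype iexp =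
    IConst int
  | IDim
  | ISize
  | ILoad iexp
  | IOut iexp
  | IBin iop iexp iexp

datatype rexp =
    RCast iexp
  | RTau
  | RWeight iexp
  | RLoad iexp
  | RBin rop rexp rexp
  | RSqrt rexp
  | RSigma rexp

datatype bexp =
    ILe iexp iexp
  | RLe rexp rexp
  | BNot bexp
  | BAnd bexp bexp

datatype com =
    Skip
  | IStore iexp iexp
  | RStore iexp rexp
  | Emit iexp
  | Seq com com
  | Cond bexp com com
  | While bexp com

fun iop_sem :: "iop \<Rightarrow> int \<Rightarrow> int \<Rightarrow> int option" where
  "iop_sem IAdd a b = Some (a + b)"
| "iop_sem ISub a b = Some (a - b)"
| "iop_sem IMul a b = Some (a * b)"
| "iop_sem IDiv a b = (if b = 0 then None else Some (a div b))"
| "iop_sem IMod a b = (if b = 0 then None else Some (a mod b))"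

fun rop_sem :: "rop \<Rightarrow> real \<Rightarrow> real \<Rightarrow> real option" where
  "rop_sem RAdd a b = Some (a + b)"
| "rop_sem RSub a b = Some (a - b)"
| "rop_sem RMul a b = Some (a * b)"
| "rop_sem RDiv a b = (if b = 0 then None else Some (a / b))"

text \<open>
  \<open>M\<close> is the number of cells of each of the two memories. Evaluation is undefined upon access to
  a cell that does not exist.
\<close>

definition addr :: "nat \<Rightarrow> int \<Rightarrow> nat option" where
  "addr M a = (if 0 \<le> a \<and> a < int M then Some (nat a) else None)"

primrec ival :: "input \<Rightarrow> nat \<Rightarrow> state \<Rightarrow> iexp \<Rightarrow> int option" where
  "ival I M st (IConst c) = Some c"
| "ival I M st IDim = Some (in_dim I)"
| "ival I M st ISize = Some (in_size I)"
| "ival I M st (ILoad e) =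
     Option.bind (ival I M st e) (\<lambda>a. map_option (imem st) (addr M a))"
| "ival I M st (IOut e) =
     Option.bind (ival I M st e)
       (\<lambda>a. map_option (\<lambda>i. outlist st ! i) (addr (length (outlist st)) a))"
| "ival I M st (IBin f e1 e2) =
     Option.bind (ival I M st e1) (\<lambda>a. Option.bind (ival I M st e2) (iop_sem f a))"

primrec rval :: "input \<Rightarrow> nat \<Rightarrow> state \<Rightarrow> rexp \<Rightarrow> real option" where
  "rval I M st (RCast e) = map_option real_of_int (ival I M st e)"
| "rval I M st RTau = Some (in_tau I)"
| "rval I M st (RWeight e) =
     Option.bind (ival I M st e)
       (\<lambda>a. if 1 \<le> a \<and> a \<le> in_dim I then Some (in_weight I (nat a)) else None)"
| "rval I M st (RLoad e) =
     Option.bind (ival I M st e) (\<lambda>a. map_option (rmem st) (addr M a))"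
| "rval I M st (RBin f e1 e2) =
     Option.bind (rval I M st e1) (\<lambda>a. Option.bind (rval I M st e2) (rop_sem f a))"
| "rval I M st (RSqrt e) =
     Option.bind (rval I M st e) (\<lambda>x. if 0 \<le> x then Some (sqrt x) else None)"
| "rval I M st (RSigma e) =
     Option.bind (rval I M st e) (\<lambda>x. if 0 \<le> x \<and> x \<le> 1 then Some (in_sigma I x) else None)"

primrec bval :: "input \<Rightarrow> nat \<Rightarrow> state \<Rightarrow> bexp \<Rightarrow> bool option" where
  "bval I M st (ILe e1 e2) =
     Option.bind (ival I M st e1) (\<lambda>a. map_option (\<lambda>b. a \<le> b) (ival I M st e2))"
| "bval I M st (RLe e1 e2) =
     Option.bind (rval I M st e1) (\<lambda>a. map_option (\<lambda>b. a \<le> b) (rval I M st e2))"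
| "bval I M st (BNot b) = map_option Not (bval I M st b)"
| "bval I M st (BAnd b1 b2) =
     Option.bind (bval I M st b1) (\<lambda>u. map_option (\<lambda>v. u \<and> v) (bval I M st b2))"

text \<open>Every node of an expression costs one time unit whenever it is evaluated.\<close>

primrec icost :: "iexp \<Rightarrow> nat" where
  "icost (IConst c) = 1"
| "icost IDim = 1"
| "icost ISize = 1"
| "icost (ILoad e) = icost e + 1"
| "icost (IOut e) = icost e + 1"
| "icost (IBin f e1 e2) = icost e1 + icost e2 + 1"

primrec rcost :: "rexp \<Rightarrow> nat" where
  "rcost (RCast e) = icost e + 1"
| "rcost RTau = 1"
| "rcost (RWeight e) = icost e + 1"
| "rcost (RLoad e) = icost e + 1"
| "rcost (RBin f e1 e2) = rcost e1 + rcost e2 + 1"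
| "rcost (RSqrt e) = rcost e + 1"
| "rcost (RSigma e) = rcost e + 1"

primrec bcost :: "bexp \<Rightarrow> nat" where
  "bcost (ILe e1 e2) = icost e1 + icost e2 + 1"
| "bcost (RLe e1 e2) = rcost e1 + rcost e2 + 1"
| "bcost (BNot b) = bcost b + 1"
| "bcost (BAnd b1 b2) = bcost b1 + bcost b2 + 1"

text \<open>
  \<open>exec I M c st t st'\<close>: on input \<open>I\<close> and with \<open>M\<close> cells in each memory, \<open>c\<close> started in \<open>st\<close>
  terminates in \<open>st'\<close> after time \<open>t\<close>.
\<close>

inductive exec :: "input \<Rightarrow> nat \<Rightarrow> com \<Rightarrow> state \<Rightarrow> nat \<Rightarrow> state \<Rightarrow> bool"
  for I :: input and M :: nat where
  Skip: "exec I M Skip st 1 st"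
| IStore: "\<lbrakk>ival I M st e1 = Some a; addr M a = Some i; ival I M st e2 = Some x\<rbrakk>
    \<Longrightarrow> exec I M (IStore e1 e2) st (icost e1 + icost e2 + 1) (st\<lparr>imem := (imem st)(i := x)\<rparr>)"
| RStore: "\<lbrakk>ival I M st e1 = Some a; addr M a = Some i; rval I M st e2 = Some x\<rbrakk>
    \<Longrightarrow> exec I M (RStore e1 e2) st (icost e1 + rcost e2 + 1) (st\<lparr>rmem := (rmem st)(i := x)\<rparr>)"
| Emit: "ival I M st e = Some x
    \<Longrightarrow> exec I M (Emit e) st (icost e + 1) (st\<lparr>outlist := outlist st @ [x]\<rparr>)"
| Seq: "\<lbrakk>exec I M c1 st t1 st1; exec I M c2 st1 t2 st2\<rbrakk>
    \<Longrightarrow> exec I M (Seq c1 c2) st (t1 + t2 + 1) st2"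
| CondTrue: "\<lbrakk>bval I M st b = Some True; exec I M c1 st t st1\<rbrakk>
    \<Longrightarrow> exec I M (Cond b c1 c2) st (bcost b + t + 1) st1"
| CondFalse: "\<lbrakk>bval I M st b = Some False; exec I M c2 st t st1\<rbrakk>
    \<Longrightarrow> exec I M (Cond b c1 c2) st (bcost b + t + 1) st1"
| WhileFalse: "bval I M st b = Some False
    \<Longrightarrow> exec I M (While b c) st (bcost b + 1) st"
| WhileTrue: "\<lbrakk>bval I M st b = Some True; exec I M c st t1 st1; exec I M (While b c) st1 t2 st2\<rbrakk>
    \<Longrightarrow> exec I M (While b c) st (bcost b + t1 + t2 + 1) st2"

definition init_state :: state where
  "init_state = \<lparr>imem = (\<lambda>_. 0), rmem = (\<lambda>_. 0), outlist = []\<rparr>"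

definition problem_input :: "real \<Rightarrow> (nat \<Rightarrow> real) \<Rightarrow> real \<Rightarrow> nat \<Rightarrow> nat \<Rightarrow> input" where
  "problem_input \<alpha> \<gamma> \<tau> n d =
     \<lparr>in_dim = int d, in_size = int n, in_tau = \<tau>, in_weight = \<gamma>, in_sigma = sigma \<alpha>\<rparr>"

text \<open>The vector is represented by its residues, component by component, primes increasing.\<close>

definition residues_of :: "nat \<Rightarrow> nat \<Rightarrow> (nat \<Rightarrow> int) \<Rightarrow> int list" where
  "residues_of n d z =
     concat (map (\<lambda>s. map (\<lambda>p. z s mod int p) (sorted_list_of_set (primes_P n))) [1..<Suc d])"

text \<open>
  \<open>constructs_within c time mem\<close>: up to a constant factor, which depends on no parameter, the
  program \<open>c\<close> carries out the construction within time \<open>time d n\<close> and with \<open>mem n\<close> stored numbers.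
  The memory used is that of both memories together.
\<close>

definition constructs_within ::
    "com \<Rightarrow> (nat \<Rightarrow> nat \<Rightarrow> real) \<Rightarrow> (nat \<Rightarrow> real) \<Rightarrow> bool" where
  "constructs_within c time mem \<longleftrightarrow>
     (\<exists>K>0. \<forall>d \<alpha> \<gamma> \<tau> n.
        1 \<le> d \<longrightarrow> 1 / 2 < \<alpha> \<longrightarrow> (\<forall>j\<ge>1. 0 < \<gamma> j) \<longrightarrow> 0 < \<tau> \<longrightarrow> \<tau> < 1 \<longrightarrow> 2 \<le> n \<longrightarrow>
        (\<exists>z M t st.
           cbc_pbp \<alpha> \<gamma> \<tau> n d z
           \<and> exec (problem_input \<alpha> \<gamma> \<tau> n d) M c init_state t st
           \<and> outlist st = residues_of n d z
           \<and> real t \<le> K * time d n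
           \<and> real (2 * M) \<le> K * mem n))"

end

theory Submission
  imports Defs "HOL-Number_Theory.Residue_Primitive_Roots"
begin

text \<open>
  The error of the lattice rule for \<open>p\<close> is a sum of Fourier coefficients over the dual lattice of
  \<open>p\<close>. By the Cauchy--Schwarz inequality the expected error is therefore at most
  \<open>1 / card P\<^sub>n\<close> times the square root of the sum, over all pairs \<open>p, q\<close>, of \<open>r powr (-2)\<close> over the nonzero
  frequencies lying in both dual lattices. Sorted by their last nonzero component,
  these contributions are the values of \<open>T_crit\<close> at the chosen residues. A residue
  among the \<open>\<lceil>\<tau>p\<rceil>\<close> best ones has \<open>theta\<close> at most \<open>(\<mu> / n) powr (2 * \<lambda>)\<close> up to a constant, since \<open>(1 - \<tau>) p\<close>
  residues are no better and the average of \<open>theta\<close> to the power \<open>1 / (2\<lambda>)\<close> is controlled; averaging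
  the other two parts of \<open>T_crit\<close> over these residues bounds the minimum. The final factor \<open>ln n\<close>
  is Chebyshev's lower bound for \<open>card P\<^sub>n\<close>.

  For the algorithm, character sums turn \<open>theta\<close> and \<open>T_crit\<close>, up to terms that do not depend on the
  residue \<open>v\<close> to be chosen, into finite sums of product kernels. For fixed \<open>q\<close> and \<open>l\<close>, ordering the
  nonzero \<open>k\<close> and \<open>v\<close> modulo \<open>p\<close> by the powers of a primitive root turns the sum over \<open>k\<close> into a cyclic
  correlation of length \<open>p - 1\<close>, which a fast Fourier transform of length a power of two diagonalises.
  The transforms for all \<open>q < p\<close> and \<open>l < q\<close> are added up before a single inverse transform, so
  that the time per component is \<open>card P\<^sub>n\<^sup>2 n\<^sup>2 ln n\<close>. Keeping the product kernels for all \<open>p, q, k, l\<close>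
  takes \<open>card P\<^sub>n\<^sup>2 n\<^sup>2\<close> numbers; computing them anew whenever they are needed takes a factor \<open>d\<close> in time.
\<close>

section \<open>Counting primes\<close>

text \<open>The bound is claimed for every \<open>n \<ge> 2\<close>, so \<open>primes_P n\<close>
  must be nonempty and of order \<open>n / ln n\<close> throughout. Central binomial coefficients
  give this from 8192 on, an explicit chain of primes below; the constant 12288 is 8192 divided by
  2/3, a lower bound for \<open>ln 2\<close>. The opposite Chebyshev bound, from the primorial,
  turns \<open>card P\<^sub>n\<^sup>2 n\<^sup>2\<close> into the claimed time and memory. A lattice
  rule evaluates at points, so a pointwise Fourier expansion is needed. It rests on the uniqueness
  of the Fourier coefficients of continuous periodic functions, shown with Fejer kernels. The
  machine has neither rounding nor access to \<alpha>. Hence \<open>\<lceil>\<tau>p\<rceil>\<close>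
  is never computed: a residue is kept if its rank in the order of \<open>theta\<close> is below
  \<open>\<tau> * p\<close>. The powers \<open>q powr (- (2 * \<alpha>))\<close> are obtained as
  quotients of values of \<open>sigma\<close>. Chosen residues are read back from the output list,
  so they take up no working memory.\<close>

lemma multiplicity_eq_card:
  assumes "prime (p::nat)" "0 < n" "n \<le> b"
  shows "multiplicity p n = card {k \<in> {1..b}. p ^ k dvd n}"
proof -
  have p: "1 < p" using assms(1) prime_gt_1_nat by blast
  have "{k \<in> {1..b}. p ^ k dvd n} = {1..multiplicity p n}"
  proof (intro Set.set_eqI iffI)
    fix k assume "k \<in> {k \<in> {1..b}. p ^ k dvd n}"
    then show "k \<in> {1..multiplicity p n}"
      using assms p by (auto intro!: multiplicity_geI)
  next
    fix k assume k: "k \<in> {1..multiplicity p n}"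
    have "p ^ k dvd n" using k by (intro multiplicity_dvd') auto
    \<comment> \<open>This caps the exponents: \<open>p ^ k dvd n\<close> gives
      \<open>k < p ^ k \<le> n \<le> b\<close>. Any \<open>b\<close> at least \<open>n\<close> will
      do, so several factorials can share one summation range.\<close>
    moreover have "k < p ^ k" using p by (rule power_gt_expt[unfolded One_nat_def[symmetric]])
    ultimately have "k \<le> b" using assms dvd_imp_le by (metis le_trans less_imp_le)
    then show "k \<in> {k \<in> {1..b}. p ^ k dvd n}" using k \<open>p ^ k dvd n\<close> by simp
  qed
  then show ?thesis by simp
qed

text \<open>Legendre's formula. Passing from \<open>n\<close> to \<open>Suc n\<close> raises
  \<open>n div p ^ k\<close> by one exactly for those \<open>k\<close> with
  \<open>p ^ k dvd Suc n\<close>.\<close>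

lemma multiplicity_fact:
  assumes "prime (p::nat)" "n \<le> b"
  shows "multiplicity p (fact n) = (\<Sum>k\<in>{1..b}. n div p ^ k)"
  using assms(2)
proof (induction n)
  case (Suc n)
  have "multiplicity p (fact (Suc n)) = multiplicity p (Suc n) + multiplicity p (fact n)"
    using prime_elem_multiplicity_mult_distrib[of p "Suc n" "fact n"] assms(1) by (simp only: fact_Suc of_nat_id) simp
  also have "multiplicity p (Suc n) = (\<Sum>k\<in>{1..b}. if p ^ k dvd Suc n then 1 else 0)"
    using multiplicity_eq_card[OF assms(1), of "Suc n" b] Suc.prems by (simp add: sum.If_cases Int_def)
  also have "\<dots> + multiplicity p (fact n) = (\<Sum>k\<in>{1..b}. (if p ^ k dvd Suc n then 1 else 0) + n div p ^ k)"
    using Suc by (simp add: sum.distrib)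
  also have "\<dots> = (\<Sum>k\<in>{1..b}. Suc n div p ^ k)"
    by (rule sum.cong) (auto simp: div_Suc dvd_eq_mod_eq_0)
  finally show ?case .
qed simp

lemma multiplicity_central_binomial:
  assumes "prime (p::nat)"
  shows "multiplicity p ((2 * m) choose m) = (\<Sum>k\<in>{1..2 * m}. 2 * m div p ^ k - 2 * (m div p ^ k))"
proof -
  have "fact m * fact m * ((2 * m) choose m) = (fact (2 * m) :: nat)"
    using binomial_fact_lemma[of m "2 * m"] by simp
  then have "multiplicity p (fact (2 * m) :: nat) = multiplicity p (fact m * fact m * ((2 * m) choose m))" by simp
  also have "\<dots> = 2 * multiplicity p (fact m) + multiplicity p ((2 * m) choose m)"
    using assms by (simp add: prime_elem_multiplicity_mult_distrib)
  finally have "multiplicity p ((2 * m) choose m) = (\<Sum>k\<in>{1..2 * m}. 2 * m div p ^ k) - (\<Sum>k\<in>{1..2 * m}. 2 * (m div p ^ k))"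
    using multiplicity_fact[OF assms, of "2 * m" "2 * m"] multiplicity_fact[OF assms, of m "2 * m"]
    by (simp add: sum_distrib_left)
  \<comment> \<open>Truncated subtraction distributes over the sum only because every term of the
    subtrahend is at most its partner.\<close>
  also have "\<dots> = (\<Sum>k\<in>{1..2 * m}. 2 * m div p ^ k - 2 * (m div p ^ k))"
  proof (rule sum_subtractf_nat[symmetric])
    fix k
    have "(2 * (m div p ^ k)) * p ^ k \<le> 2 * m"
      using div_times_less_eq_dividend[of m "p ^ k"] by (simp add: mult.assoc)
    moreover have "0 < p ^ k" using assms by (simp add: prime_gt_0_nat)
    ultimately show "2 * (m div p ^ k) \<le> 2 * m div p ^ k" by (simp add: less_eq_div_iff_mult_less_eq)
  qed
  finally show ?thesis .
qed

text \<open>Each difference \<open>2 * m div p ^ k - 2 * (m div p ^ k)\<close> is 0 or 1, and 0 once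
  \<open>p ^ k > 2 * m\<close>.\<close>

lemma multiplicity_central_binomial_le:
  assumes "prime (p::nat)"
  shows "multiplicity p ((2 * m) choose m) \<le> card {k \<in> {1..2 * m}. p ^ k \<le> 2 * m}"
proof -
  have "2 * m div p ^ k - 2 * (m div p ^ k) \<le> (if p ^ k \<le> 2 * m then 1 else 0)" for k
  proof (cases "p ^ k \<le> 2 * m")
    case True
    have pos: "0 < p ^ k" using assms by (simp add: prime_gt_0_nat)
    have "m = p ^ k * (m div p ^ k) + m mod p ^ k" by simp
    moreover have "m mod p ^ k < p ^ k" using pos by simp
    ultimately have "2 * m < 2 * (p ^ k * (m div p ^ k)) + 2 * p ^ k" by linarith
    then have "2 * m < p ^ k * (2 * (m div p ^ k) + 2)" by (simp only: distrib_left mult.left_commute mult.commute)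
    then have "2 * m div p ^ k < 2 * (m div p ^ k) + 2" using pos by (simp add: div_less_iff_less_mult mult.commute)
    then show ?thesis using True by simp
  qed simp
  then have "multiplicity p ((2 * m) choose m) \<le> (\<Sum>k\<in>{1..2 * m}. if p ^ k \<le> 2 * m then 1 else 0)"
    unfolding multiplicity_central_binomial[OF assms] by (intro sum_mono)
  then show ?thesis by (simp add: sum.If_cases Int_def)
qed

text \<open>The exponents counted before number at most the largest of them, whose power is still at
  most \<open>2 * m\<close>.\<close>

lemma prime_power_central_binomial_le:
  assumes "prime (p::nat)" "0 < m"
  shows "p ^ multiplicity p ((2 * m) choose m) \<le> 2 * m"
proof -
  let ?S = "{k \<in> {1..2 * m}. p ^ k \<le> 2 * m}"
  show ?thesis
  proof (cases "?S = {}")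
    case True
    then have "card ?S = 0" by (simp only: card.empty)
    then have "multiplicity p ((2 * m) choose m) = 0"
      using multiplicity_central_binomial_le[OF assms(1), of m] by linarith
    then show ?thesis using assms(2) by simp
  next
    case False
    have "?S \<subseteq> {1..Max ?S}" by auto
    then have "card ?S \<le> Max ?S" using card_mono[of "{1..Max ?S}" ?S] by simp
    then have "multiplicity p ((2 * m) choose m) \<le> Max ?S"
      using multiplicity_central_binomial_le[OF assms(1), of m] by simp
    then have "p ^ multiplicity p ((2 * m) choose m) \<le> p ^ Max ?S"
      using assms(1) by (intro power_increasing) (auto simp: Suc_leI prime_gt_0_nat)
    moreover have "Max ?S \<in> ?S" using False by (intro Max_in) auto
    ultimately show ?thesis by auto
  qed
qed

lemma multiplicity_central_binomial_le_1:
  assumes "prime (p::nat)" "2 * m < p\<^sup>2"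
  shows "multiplicity p ((2 * m) choose m) \<le> 1"
proof -
  have "{k \<in> {1..2 * m}. p ^ k \<le> 2 * m} \<subseteq> {1}"
  proof
    fix k assume k: "k \<in> {k \<in> {1..2 * m}. p ^ k \<le> 2 * m}"
    have "\<not> 2 \<le> k"
    proof
      assume "2 \<le> k"
      then have "p\<^sup>2 \<le> p ^ k" using assms(1) by (intro power_increasing) (auto simp: Suc_leI prime_gt_0_nat)
      with k assms(2) show False by simp
    qed
    with k show "k \<in> {1}" by auto
  qed
  from card_mono[OF _ this] show ?thesis using multiplicity_central_binomial_le[OF assms(1), of m] by simp
qed

text \<open>In this range \<open>2 * m div p\<close> and \<open>2 * (m div p)\<close> are both 2,
  and \<open>p\<^sup>2 \<ge> 3 * p\<close> already exceeds \<open>2 * m\<close>. That these primes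
  are absent is the gain behind Chebyshev's estimate.\<close>

lemma multiplicity_central_binomial_eq_0:
  assumes "prime (p::nat)" "2 * m < 3 * p" "p \<le> m" "3 \<le> m"
  shows "multiplicity p ((2 * m) choose m) = 0"
proof -
  have p3: "3 \<le> p" using assms by linarith
  have "2 * m div p ^ k - 2 * (m div p ^ k) = 0" if k: "k \<in> {1..2 * m}" for k
  proof (cases "k = 1")
    case True
    have "m div p = 1" using assms p3 by (intro div_nat_eqI) auto
    moreover have "2 * m div p = 2" using assms p3 by (intro div_nat_eqI) auto
    ultimately show ?thesis using True by simp
  next
    case False
    then have "p\<^sup>2 \<le> p ^ k" using k p3 by (intro power_increasing) auto
    moreover have "3 * p \<le> p\<^sup>2" using p3 by (simp add: power2_eq_square)
    ultimately show ?thesis using assms(2) by simp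
  qed
  then show ?thesis unfolding multiplicity_central_binomial[OF assms(1)] by simp
qed

lemma prod_primes_dvd:
  assumes "finite A" "\<And>p. p \<in> A \<Longrightarrow> prime p" "\<And>p. p \<in> A \<Longrightarrow> p dvd (n::nat)"
  shows "\<Prod>A dvd n"
  using assms
proof (induction A rule: finite_induct)
  case (insert p A)
  have "coprime p (\<Prod>A)"
    using insert by (intro prod_coprime_right) (auto intro!: primes_coprime)
  then show ?case using insert by (auto intro: divides_mult)
qed simp

text \<open>Only odd \<open>n = 2 * m + 1\<close> needs an argument: the primes between
  \<open>m + 2\<close> and \<open>n\<close> divide \<open>n choose m\<close>, which occurs twice in
  the row sum \<open>2 ^ n\<close> and so is at most \<open>4 ^ m\<close>. Even \<open>n > 2\<close>
  adds no prime.\<close>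

lemma primorial_le: "\<Prod>{p. prime p \<and> p \<le> n} \<le> (4::nat) ^ n"
proof (induction n rule: less_induct)
  case (less n)
  let ?P = "\<lambda>n. {p::nat. prime p \<and> p \<le> n}"
  have fin: "finite (?P k)" for k by (rule finite_subset[of _ "{..k}"]) auto
  consider "n = 0" | "n = 1" | "n = 2" | "even n" "2 < n" | "odd n" "2 < n"
    by (cases "n \<le> 2") (auto simp: le_Suc_eq numeral_2_eq_2)
  then show ?case
  proof cases
    case 1
    then have "?P n = {}" by auto
    then show ?thesis using 1 by (simp only: prod.empty) simp
  next
    case 2
    then have "?P n = {}" by (auto dest: prime_ge_2_nat)
    then show ?thesis using 2 by (simp only: prod.empty) simp
  next
    case 3
    then have "?P n = {2}" by (auto dest: prime_ge_2_nat)
    then show ?thesis using 3 by simp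
  next
    case 4
    then have "\<not> prime n" using prime_odd_nat[of n] by auto
    have "p \<le> n \<longleftrightarrow> p \<le> n - 1" if "prime p" for p
      using that \<open>\<not> prime n\<close> by (cases "p = n") auto
    then have "?P n = ?P (n - 1)" by blast
    then have "\<Prod>(?P n) \<le> 4 ^ (n - 1)" using less[of "n - 1"] 4 by simp
    also have "\<dots> \<le> 4 ^ n" by (intro power_increasing) auto
    finally show ?thesis .
  next
    case 5
    then obtain m where m: "n = 2 * m + 1" by (auto elim: oddE)
    let ?Q = "{p. prime p \<and> m + 1 < p \<and> p \<le> n}"
    have finQ: "finite ?Q" by (rule finite_subset[of _ "{..n}"]) auto
    have "?P n = ?P (m + 1) \<union> ?Q" using m by auto
    then have E: "\<Prod>(?P n) = \<Prod>(?P (m + 1)) * \<Prod>?Q"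
      using prod.union_disjoint[OF fin finQ, of "m + 1" "\<lambda>x. x"] by (simp add: disjoint_iff)
    have L1: "\<Prod>(?P (m + 1)) \<le> 4 ^ (m + 1)" using less[of "m + 1"] m 5 by auto
    have L2: "\<Prod>?Q \<le> 4 ^ m"
    proof -
      have "p dvd n choose m" if p: "p \<in> ?Q" for p
      proof -
        have e: "fact m * fact (n - m) * (n choose m) = (fact n :: nat)"
          using binomial_fact_lemma[of m n] m by simp
        have "p dvd fact n" using p by (auto simp: prime_dvd_fact_iff)
        moreover have "\<not> p dvd fact m" "\<not> p dvd fact (n - m)"
          using p m prime_dvd_fact_iff[of p m] prime_dvd_fact_iff[of p "n - m"] by (simp_all del: fact_Suc)
        ultimately show ?thesis using p e by (metis (no_types, lifting) mem_Collect_eq prime_dvd_mult_iff)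
      qed
      then have "\<Prod>?Q dvd n choose m" by (intro prod_primes_dvd finQ) auto
      then have "\<Prod>?Q \<le> n choose m" using m by (intro dvd_imp_le) (auto simp: zero_less_binomial_iff)
      moreover have "2 * (n choose m) \<le> 2 ^ n"
      proof -
        have "(n choose m) + (n choose (m + 1)) = (\<Sum>k\<in>{m, m + 1}. n choose k)" by simp
        also have "\<dots> \<le> (\<Sum>k\<le>n. n choose k)" by (rule sum_mono2) (use m 5 in auto)
        also have "\<dots> = 2 ^ n" by (rule choose_row_sum)
        finally show ?thesis using binomial_symmetric[of m n] m by simp
      qed
      ultimately show ?thesis using m by (simp add: power_mult)
    qed
    have "\<Prod>(?P n) \<le> 4 ^ (m + 1) * 4 ^ m" unfolding E by (rule mult_le_mono[OF L1 L2])
    also have "\<dots> = 4 ^ n" using m by (simp add: power_add[symmetric] mult_2)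
    finally show ?thesis .
  qed
qed

lemma prod_subset_le:
  fixes B :: "nat set"
  assumes "finite B" "A \<subseteq> B" "\<And>x. x \<in> B \<Longrightarrow> 0 < x"
  shows "\<Prod>A \<le> \<Prod>B"
  using assms by (intro dvd_imp_le prod_dvd_prod_subset prod_pos) auto

text \<open>The primes are sorted by size. Up to the square root each prime power is at most
  \<open>2 * m\<close>; up to \<open>2 * m div 3\<close> the exponent is at most one and the
  primorial bound applies; from there to \<open>m\<close> there are none; the last factor is left as
  the count to be estimated.\<close>

lemma central_binomial_upper:
  assumes "3 \<le> m"
  shows "(2 * m) choose m \<le> (2 * m) ^ card {p. prime p \<and> p\<^sup>2 \<le> 2 * m} * 4 ^ (2 * m div 3) *
    (2 * m) ^ card {p. prime p \<and> m < p \<and> p \<le> 2 * m}"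
proof -
  let ?C = "(2 * m) choose m"
  let ?e = "\<lambda>p. multiplicity p ?C"
  let ?A = "{p. prime p \<and> p\<^sup>2 \<le> 2 * m}" and ?D = "{p. prime p \<and> m < p \<and> p \<le> 2 * m}"
  let ?B = "{p. prime p \<and> p \<le> 2 * m div 3}"
  let ?B' = "?B - ?A"
  have sq: "p \<le> p\<^sup>2" for p :: nat by (cases p) (auto simp: power2_eq_square)
  have finA: "finite ?A" by (rule finite_subset[of _ "{..2 * m}"]) (use sq le_trans in blast, simp)
  have finB: "finite ?B" by (rule finite_subset[of _ "{..2 * m}"]) auto
  have finD: "finite ?D" by (rule finite_subset[of _ "{..2 * m}"]) auto
  have AD: "?A \<inter> ?D = {}"
  proof -
    have False if "m < p" "p\<^sup>2 \<le> 2 * m" for p :: nat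
    proof -
      have "3 * p \<le> p\<^sup>2" using that assms by (simp add: power2_eq_square)
      then show False using that by linarith
    qed
    then show ?thesis by auto
  qed
  have pf: "prime_factors ?C \<subseteq> ?A \<union> ?B' \<union> ?D"
  proof
    fix p assume "p \<in> prime_factors ?C"
    then have p: "prime p" "p dvd ?C" by auto
    have "?C dvd fact (2 * m)" using binomial_fact_lemma[of m "2 * m"] by (metis dvd_triv_right le_add1 mult_2)
    then have "p \<le> 2 * m" using p prime_dvd_fact_iff dvd_trans by blast
    moreover have "\<not> (2 * m < 3 * p \<and> p \<le> m)"
    proof
      assume "2 * m < 3 * p \<and> p \<le> m"
      then have "?e p = 0" using multiplicity_central_binomial_eq_0 p(1) assms by blast
      moreover have "0 < ?e p" using p by (intro multiplicity_gt_zero_iff[THEN iffD2]) (auto simp: prime_gt_1_nat)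
      ultimately show False by simp
    qed
    moreover have "p \<le> 2 * m div 3" if "\<not> 2 * m < 3 * p" using that by simp
    ultimately show "p \<in> ?A \<union> ?B' \<union> ?D" using p(1) by auto
  qed
  have C0: "?C \<noteq> 0" by simp
  have "?C = (\<Prod>p\<in>prime_factors ?C. p ^ ?e p)"
    using prime_factorization_nat[of ?C] C0 by simp
  also have "\<dots> = (\<Prod>p\<in>?A \<union> ?B' \<union> ?D. p ^ ?e p)"
    by (rule prod.mono_neutral_left)
      (use pf finA finB finD in \<open>auto simp: prime_factors_multiplicity\<close>)
  also have "\<dots> = (\<Prod>p\<in>?A \<union> ?B'. p ^ ?e p) * (\<Prod>p\<in>?D. p ^ ?e p)"
    using finA finB finD AD assms by (intro prod.union_disjoint) auto
  also have "(\<Prod>p\<in>?A \<union> ?B'. p ^ ?e p) = (\<Prod>p\<in>?A. p ^ ?e p) * (\<Prod>p\<in>?B'. p ^ ?e p)"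
    using finA finB by (intro prod.union_disjoint) auto
  also have "(\<Prod>p\<in>?A. p ^ ?e p) \<le> (\<Prod>p\<in>?A. 2 * m)"
    using prime_power_central_binomial_le assms by (intro prod_mono) auto
  also have "(\<Prod>p\<in>?A. 2 * m) = (2 * m) ^ card ?A" by simp
  also have "(\<Prod>p\<in>?D. p ^ ?e p) \<le> (\<Prod>p\<in>?D. 2 * m)"
    using prime_power_central_binomial_le assms by (intro prod_mono) auto
  also have "(\<Prod>p\<in>?D. 2 * m) = (2 * m) ^ card ?D" by simp
  also have "(\<Prod>p\<in>?B'. p ^ ?e p) \<le> (\<Prod>p\<in>?B'. p)"
  proof (rule prod_mono)
    fix p assume "p \<in> ?B'"
    then have p: "prime p" "2 * m < p\<^sup>2" by auto
    have "p ^ ?e p \<le> p ^ 1"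
      using multiplicity_central_binomial_le_1[OF p] prime_ge_1_nat[OF p(1)] by (intro power_increasing)
    then show "0 \<le> p ^ ?e p \<and> p ^ ?e p \<le> p" by simp
  qed
  also have "(\<Prod>p\<in>?B'. p) \<le> (\<Prod>p\<in>?B. p)"
    by (rule prod_subset_le) (use finB in \<open>auto simp: prime_gt_0_nat\<close>)
  also have "(\<Prod>p\<in>?B. p) \<le> 4 ^ (2 * m div 3)" by (rule primorial_le)
  finally show ?thesis by simp
qed

text \<open>The estimate that absorbs the primes up to the square root. The comparison point 8192 is
  a power of two, so its logarithm is known through \<open>ln 2\<close>; the decimals are rounded
  generously.\<close>

lemma ln_sqrt_bound:
  assumes "8192 \<le> (x::real)"
  shows "(sqrt x + 1) * ln x \<le> x / 9"
proof -
  have s: "90 \<le> sqrt x" by (rule real_le_rsqrt) (use assms in simp)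
  have t: "ln (x / 8192) \<le> 2 * (sqrt (x / 8192) - 1)"
  proof -
    have "ln (x / 8192) = 2 * ln (sqrt (x / 8192))" using assms by (simp add: ln_sqrt)
    also have "\<dots> \<le> 2 * (sqrt (x / 8192) - 1)" using assms by (intro mult_left_mono ln_le_minus_one) auto
    finally show ?thesis .
  qed
  have q: "sqrt (x / 8192) \<le> sqrt x / 90"
  proof -
    have "90 \<le> sqrt (8192::real)" by (rule real_le_rsqrt) simp
    then show ?thesis unfolding real_sqrt_divide using assms by (intro divide_left_mono) auto
  qed
  have "ln (8192::real) = ln (2 ^ 13)" by simp
  also have "\<dots> = 13 * ln 2" by (subst ln_realpow) auto
  also have "\<dots> \<le> 13 * (25 / 36)" using ln2_le_25_over_36 by simp
  finally have "ln (8192::real) \<le> 9.03" by simp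
  moreover have "ln x = ln 8192 + ln (x / 8192)" using assms by (simp add: ln_div)
  ultimately have "ln x \<le> 7.03 + sqrt x / 45" using t q by simp
  also have "\<dots> \<le> sqrt x * (0.0782 + 1 / 45)" using s by (simp add: algebra_simps)
  also have "\<dots> \<le> sqrt x * 0.101" using assms by (intro mult_left_mono) auto
  finally have l: "ln x \<le> 0.101 * sqrt x" by simp
  have "(sqrt x + 1) * ln x \<le> (sqrt x + sqrt x / 90) * (0.101 * sqrt x)"
    using s l assms by (intro mult_mono) auto
  also have "\<dots> = (91 / 90 * 0.101) * (sqrt x * sqrt x)" by (simp add: algebra_simps)
  also have "\<dots> = (91 / 90 * 0.101) * x" using assms by simp
  also have "\<dots> \<le> x / 9" using assms by simp
  finally show ?thesis .
qed

text \<open>Of the logarithm \<open>m * ln 4\<close> of the main term, the primorial uses up two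
  thirds. The remaining third is at least \<open>4 * m / 9\<close>, the primes up to the square root
  take at most \<open>2 * m / 9\<close>, and the primes between \<open>m\<close> and
  \<open>2 * m\<close> must supply the rest.\<close>

lemma card_primes_dyadic:
  assumes m: "4096 \<le> m"
  shows "real m * (2 / 9) \<le> real (card {p. prime p \<and> m < p \<and> p \<le> 2 * m}) * ln (real (2 * m))"
proof -
  let ?D = "{p. prime p \<and> m < p \<and> p \<le> 2 * m}" and ?A = "{p. prime p \<and> p\<^sup>2 \<le> 2 * m}"
  let ?x = "real (2 * m)"
  have x: "8192 \<le> ?x" using m by simp
  have cA: "real (card ?A) \<le> sqrt ?x"
  proof -
    have "?A \<subseteq> {1..nat \<lfloor>sqrt ?x\<rfloor>}"
    proof
      fix p assume "p \<in> ?A"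
      then have "real (p\<^sup>2) \<le> ?x" "1 \<le> p" by (auto simp: Suc_leI prime_gt_0_nat simp del: of_nat_mult of_nat_power)
      then have "real p \<le> sqrt ?x" by (intro real_le_rsqrt) simp
      then show "p \<in> {1..nat \<lfloor>sqrt ?x\<rfloor>}" using \<open>1 \<le> p\<close> by (simp add: le_nat_floor)
    qed
    then have "card ?A \<le> nat \<lfloor>sqrt ?x\<rfloor>" using card_mono[of "{1..nat \<lfloor>sqrt ?x\<rfloor>}" ?A] by simp
    moreover have "real (nat \<lfloor>sqrt ?x\<rfloor>) \<le> sqrt ?x" by (rule of_nat_floor) simp
    ultimately show ?thesis by linarith
  qed
  have "4 ^ m / ?x \<le> real ((2 * m) choose m)"
    using central_binomial_lower_bound[of m] m by simp
  also have "\<dots> \<le> real ((2 * m) ^ card ?A * 4 ^ (2 * m div 3) * (2 * m) ^ card ?D)"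
    using central_binomial_upper[of m] m by (simp only: of_nat_le_iff)
  finally have "4 ^ m \<le> ?x * (?x ^ card ?A * 4 ^ (2 * m div 3) * ?x ^ card ?D)"
    using x by (simp add: field_simps)
  then have "ln (4 ^ m) \<le> ln (?x * (?x ^ card ?A * 4 ^ (2 * m div 3) * ?x ^ card ?D))"
    using x by (subst ln_le_cancel_iff) auto
  also have "\<dots> = ln ?x + (real (card ?A) * ln ?x + real (2 * m div 3) * ln 4 + real (card ?D) * ln ?x)"
    using x m by (simp add: ln_mult ln_realpow algebra_simps)
  finally have "real m * ln 4 \<le> (1 + real (card ?A) + real (card ?D)) * ln ?x + real (2 * m div 3) * ln 4"
    by (simp add: ln_realpow algebra_simps)
  moreover have "real (2 * m div 3) * ln 4 \<le> (2 / 3 * real m) * ln 4"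
    by (intro mult_right_mono) (linarith, simp)
  then have "real (2 * m div 3) * ln 4 \<le> real m * ln 4 - real m / 3 * ln 4"
    by (simp only: mult.assoc)
  ultimately have "real m / 3 * ln 4 \<le> (1 + real (card ?A) + real (card ?D)) * ln ?x"
    by linarith
  also have "\<dots> \<le> (1 + sqrt ?x + real (card ?D)) * ln ?x"
    using cA x by (intro mult_right_mono) auto
  also have "\<dots> = (sqrt ?x + 1) * ln ?x + real (card ?D) * ln ?x" by (simp add: algebra_simps)
  also have "\<dots> \<le> ?x / 9 + real (card ?D) * ln ?x" using ln_sqrt_bound[OF x] by simp
  finally have 1: "real m / 3 * ln 4 \<le> ?x / 9 + real (card ?D) * ln ?x" .
  have "ln (4::real) = 2 * ln 2" using ln_realpow[of 2 2] by simp
  then have "4 / 3 \<le> ln (4::real)" using ln2_ge_two_thirds by simp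
  then have "real m / 3 * (4 / 3) \<le> real m / 3 * ln 4" by (intro mult_left_mono) auto
  with 1 show ?thesis by simp
qed

text \<open>Trial division with an explicit list of divisors, so that numerals can be checked by
  evaluation.\<close>

lemma prime_trial:
  fixes p b :: nat
  assumes "1 < p" "p < b\<^sup>2" "\<forall>k\<in>set [2..<b]. \<not> k dvd p"
  shows "prime p"
proof (rule ccontr)
  assume "\<not> prime p"
  then obtain q where q: "prime q" "q dvd p" "q\<^sup>2 \<le> p"
  proof -
    obtain a b where ab: "p = a * b" "1 < a" "1 < b"
      using \<open>\<not> prime p\<close> assms(1) unfolding prime_nat_iff
      by (metis One_nat_def Suc_lessI dvdE dvd_pos_nat gr0I less_numeral_extra(3) mult_0_right mult_cancel1 nat_mult_1_right)
    have "\<exists>c. c dvd p \<and> 1 < c \<and> c\<^sup>2 \<le> p"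
    proof (cases "a \<le> b")
      case True
      then show ?thesis using ab by (intro exI[of _ a]) (auto simp: power2_eq_square)
    next
      case False
      then show ?thesis using ab by (intro exI[of _ b]) (auto simp: power2_eq_square)
    qed
    then obtain c where c: "c dvd p" "1 < c" "c\<^sup>2 \<le> p" by blast
    obtain q where "prime q" "q dvd c" using c(2) prime_factor_nat[of c] by auto
    moreover from this have "q \<le> c" using c(2) by (intro dvd_imp_le) auto
    then have "q\<^sup>2 \<le> c\<^sup>2" by (rule power_mono) simp
    then have "q\<^sup>2 \<le> p" using c(3) by (rule order_trans)
    ultimately show ?thesis using c(1) that dvd_trans by blast
  qed
  have "q < b" using q(3) assms(2) power_less_imp_less_base[of q 2 b] by linarith
  then show False using assms(3) q(1,2) prime_ge_2_nat[of q] by auto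
qed

text \<open>Each prime of the list is smaller than twice its predecessor, so a number that misses
  all intervals from \<open>p\<close> to \<open>2 * p - 1\<close> would have to be at least
  \<open>2 * 5003\<close>.\<close>

lemma bertrand_small:
  assumes "2 \<le> n" "n < 8192"
  shows "primes_P n \<noteq> {}"
proof -
  have "prime (2::nat)" "prime (3::nat)" "prime (5::nat)" "prime (7::nat)" "prime (13::nat)" "prime (23::nat)"
    "prime (43::nat)" "prime (83::nat)" "prime (163::nat)" "prime (317::nat)" by simp_all
  moreover have "prime (631::nat)" "prime (1259::nat)" "prime (2503::nat)" "prime (5003::nat)"
    \<comment> \<open>The square of 71 is 5041, just above the largest prime 5003.\<close>
    by (rule prime_trial[where b = 71]; simp)+
  moreover have "\<exists>p\<in>{2,3,5,7,13,23,43,83,163,317,631,1259,2503,5003}. p \<le> n \<and> n < 2 * p"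
  proof (rule ccontr)
    assume "\<not> ?thesis"
    then have c: "2 * p \<le> n" if "p \<in> {2,3,5,7,13,23,43,83,163,317,631,1259,2503,5003}" "p \<le> n" for p
      using that by (meson not_less)
    have "4 \<le> n" using c[of 2] assms by simp
    have "6 \<le> n" using c[of 3] \<open>4 \<le> n\<close> by simp
    have "10 \<le> n" using c[of 5] \<open>6 \<le> n\<close> by simp
    have "14 \<le> n" using c[of 7] \<open>10 \<le> n\<close> by simp
    have "26 \<le> n" using c[of 13] \<open>14 \<le> n\<close> by simp
    have "46 \<le> n" using c[of 23] \<open>26 \<le> n\<close> by simp
    have "86 \<le> n" using c[of 43] \<open>46 \<le> n\<close> by simp
    have "166 \<le> n" using c[of 83] \<open>86 \<le> n\<close> by simp
    have "326 \<le> n" using c[of 163] \<open>166 \<le> n\<close> by simp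
    have "634 \<le> n" using c[of 317] \<open>326 \<le> n\<close> by simp
    have "1262 \<le> n" using c[of 631] \<open>634 \<le> n\<close> by simp
    have "2518 \<le> n" using c[of 1259] \<open>1262 \<le> n\<close> by simp
    have "5006 \<le> n" using c[of 2503] \<open>2518 \<le> n\<close> by simp
    have "10006 \<le> n" using c[of 5003] \<open>5006 \<le> n\<close> by simp
    with assms show False by simp
  qed
  ultimately obtain p where "prime p" "p \<le> n" "n < 2 * p" by blast
  then show ?thesis by (auto simp: primes_P_def intro!: exI[of _ p])
qed

text \<open>The small range fixes the constant: there a single prime and
  \<open>ln n \<ge> 2 / 3\<close> must suffice, and 12288 times 2/3 is 8192. Beyond it,
  \<open>m = n div 2\<close> reduces the claim to the dyadic estimate.\<close>

lemma card_primes_P_lower: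
  assumes "2 \<le> n"
  shows "real n \<le> 12288 * (ln (real n) * real (card (primes_P n)))"
proof (cases "n < 8192")
  case True
  have fin: "finite (primes_P n)" by (rule finite_subset[of _ "{..n}"]) (auto simp: primes_P_def)
  have "0 < card (primes_P n)" using bertrand_small[OF assms True] fin by (simp add: card_gt_0_iff)
  then have "1 \<le> real (card (primes_P n))" by simp
  moreover have "2 / 3 \<le> ln (real n)"
  proof -
    have "ln 2 \<le> ln (real n)" using assms by simp
    then show ?thesis using ln2_ge_two_thirds by linarith
  qed
  ultimately have "2 / 3 * 1 \<le> ln (real n) * real (card (primes_P n))" by (intro mult_mono) auto
  then show ?thesis using True by simp
next
  case False
  define m where "m = n div 2"
  have m: "4096 \<le> m" "2 * m \<le> n" "n \<le> 2 * m + 1" using False by (auto simp: m_def)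
  have fin: "finite (primes_P n)" by (rule finite_subset[of _ "{..n}"]) (auto simp: primes_P_def)
  have "{p. prime p \<and> m < p \<and> p \<le> 2 * m} \<subseteq> primes_P n"
    using m by (auto simp: primes_P_def)
  then have c: "card {p. prime p \<and> m < p \<and> p \<le> 2 * m} \<le> card (primes_P n)" by (rule card_mono[OF fin])
  have "real m * (2 / 9) \<le> real (card {p. prime p \<and> m < p \<and> p \<le> 2 * m}) * ln (real (2 * m))"
    by (rule card_primes_dyadic[OF m(1)])
  also have "\<dots> \<le> real (card (primes_P n)) * ln (real n)"
    using c m by (intro mult_mono) auto
  finally show ?thesis using m by (simp add: mult.commute)
qed

lemma primes_P_nonempty: "2 \<le> n \<Longrightarrow> primes_P n \<noteq> {}"
  using card_primes_P_lower[of n] by (auto simp: not_le)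

text \<open>All these primes exceed \<open>n / 2\<close>, so
  \<open>(n / 2) ^ card (primes_P n)\<close> is at most the primorial. From \<open>n = 4\<close> on,
  \<open>ln (n / 2)\<close> is at least half of \<open>ln n\<close>.\<close>

lemma card_primes_P_upper:
  assumes "2 \<le> n"
  shows "real (card (primes_P n)) * ln (real n) \<le> 3 * real n"
proof (cases "n < 4")
  case True
  have "primes_P n \<subseteq> {1..n}" by (auto simp: primes_P_def prime_ge_1_nat)
  then have "card (primes_P n) \<le> n" using card_mono[of "{1..n}"] by fastforce
  moreover have "ln (real n) \<le> 3" using ln_le_minus_one[of "real n"] assms True by simp
  ultimately have "real (card (primes_P n)) * ln (real n) \<le> real n * 3"
    using assms by (intro mult_mono) auto
  then show ?thesis by simp
next
  case False
  let ?P = "{p. prime p \<and> p \<le> n}"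
  have fin: "finite ?P" by (rule finite_subset[of _ "{..n}"]) auto
  have sub: "primes_P n \<subseteq> ?P" by (auto simp: primes_P_def)
  have "(real n / 2) ^ card (primes_P n) = (\<Prod>p\<in>primes_P n. real n / 2)" by simp
  also have "\<dots> \<le> (\<Prod>p\<in>primes_P n. real p)"
    by (rule prod_mono) (auto simp: primes_P_def)
  also have "\<dots> = real (\<Prod>(primes_P n))" by simp
  also have "\<Prod>(primes_P n) \<le> \<Prod>?P"
    by (rule prod_subset_le[OF fin sub]) (auto simp: prime_gt_0_nat)
  also have "\<Prod>?P \<le> 4 ^ n" by (rule primorial_le)
  finally have "(real n / 2) ^ card (primes_P n) \<le> 4 ^ n" by simp
  then have "ln ((real n / 2) ^ card (primes_P n)) \<le> ln (4 ^ n)"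
    using False by (subst ln_le_cancel_iff) auto
  then have 1: "real (card (primes_P n)) * ln (real n / 2) \<le> real n * ln 4"
    using False by (simp add: ln_realpow)
  have ln4: "ln (4::real) = 2 * ln 2" using ln_realpow[of 2 2] by simp
  have "ln (real n / 2) = ln (real n) - ln 2" using False by (simp add: ln_div)
  moreover have "ln 4 \<le> ln (real n)" using False by (intro ln_mono) auto
  ultimately have "ln (real n) \<le> 2 * ln (real n / 2)" using ln4 by linarith
  then have "real (card (primes_P n)) * ln (real n) \<le> 2 * (real (card (primes_P n)) * ln (real n / 2))"
    using mult_left_mono[of "ln (real n)" "2 * ln (real n / 2)" "real (card (primes_P n))"] by simp
  also have "\<dots> \<le> 2 * (real n * ln 4)" using 1 by simp
  also have "\<dots> = real n * (4 * ln 2)" unfolding ln4 by simp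
  also have "\<dots> \<le> real n * 3" using ln2_le_25_over_36 by (intro mult_left_mono) auto
  finally show ?thesis by simp
qed

text \<open>Two theories of unordered summation declare this notation; the one that goes with
  \<open>infsum\<close> is kept.\<close>

no_notation Infinite_Set_Sum.abs_summable_on (infix \<open>abs'_summable'_on\<close> 50)

section \<open>Sums over frequencies\<close>

text \<open>No summability is assumed: \<open>f\<close> and its complex copy are summable together,
  and otherwise both sums are 0.\<close>

lemma infsum_of_real: "(\<Sum>\<^sub>\<infinity>x\<in>A. complex_of_real (f x)) = of_real (infsum f A)"
proof (rule infsum_bounded_linear_strong[OF _ bounded_linear_of_real])
  show "(\<lambda>x. complex_of_real (f x)) summable_on A \<longleftrightarrow> f summable_on A"
    using summable_on_Re[of "\<lambda>x. complex_of_real (f x)" A] summable_on_of_real[of f A] by auto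
qed

lemma infsum_finite_sum:
  fixes f :: "'a \<Rightarrow> 'b \<Rightarrow> 'c::banach"
  assumes "finite K" "\<And>k. k \<in> K \<Longrightarrow> f k summable_on A"
  shows "(\<lambda>x. \<Sum>k\<in>K. f k x) summable_on A \<and>
    (\<Sum>\<^sub>\<infinity>x\<in>A. \<Sum>k\<in>K. f k x) = (\<Sum>k\<in>K. \<Sum>\<^sub>\<infinity>x\<in>A. f k x)"
  using assms by (induction rule: finite_induct) (auto simp: infsum_add summable_on_add)

lemma Zvec_0: "Zvec 0 = {\<lambda>_. 0}"
  by (auto simp: Zvec_def)

lemma zero_in_Zvec [simp]: "(\<lambda>_. 0) \<in> Zvec s"
  by (simp add: Zvec_def)

lemma Zvec_Suc_bij: "bij_betw (\<lambda>(h, y). h(Suc s := y)) (Zvec s \<times> UNIV) (Zvec (Suc s))"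
proof (rule bij_betw_byWitness[where f' = "\<lambda>h. (h(Suc s := 0), h (Suc s))"])
  show "\<forall>a\<in>Zvec s \<times> UNIV. (\<lambda>h. (h(Suc s := 0), h (Suc s))) ((\<lambda>(h, y). h(Suc s := y)) a) = a"
    by (auto simp: Zvec_def fun_eq_iff)
qed (auto simp: Zvec_def)

text \<open>Induction on the dimension: \<open>Zvec_Suc_bij\<close> splits off the last coordinate,
  and absolute summability over the product set is checked iteratively.\<close>

lemma Zvec_prod_summable:
  fixes f :: "nat \<Rightarrow> int \<Rightarrow> 'c::{real_normed_field,banach}"
  assumes "\<And>j. j \<in> {1..s} \<Longrightarrow> f j abs_summable_on UNIV"
  shows "(\<lambda>h. \<Prod>j\<in>{1..s}. f j (h j)) abs_summable_on Zvec s"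
  using assms
proof (induction s)
  case 0
  then show ?case by (simp add: Zvec_0)
next
  case (Suc s)
  let ?F = "\<lambda>h. \<Prod>j\<in>{1..s}. f j (h j)"
  have 1: "?F abs_summable_on Zvec s" using Suc by simp
  have 2: "f (Suc s) abs_summable_on UNIV" using Suc by simp
  have "(\<lambda>(h, y). ?F h * f (Suc s) y) abs_summable_on Zvec s \<times> UNIV"
  proof (rule Infinite_Sum.abs_summable_on_Sigma_iff[THEN iffD2], intro conjI ballI)
    fix h :: "nat \<Rightarrow> int"
    show "(\<lambda>y. case (h, y) of (h, y) \<Rightarrow> ?F h * f (Suc s) y) abs_summable_on UNIV"
      using summable_on_cmult_right[OF 2, of "norm (?F h)"] by (simp add: norm_mult)
  next
    have "(\<Sum>\<^sub>\<infinity>y. norm (?F h * f (Suc s) y)) = norm (?F h) * (\<Sum>\<^sub>\<infinity>y. norm (f (Suc s) y))" for h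
      by (simp add: norm_mult infsum_cmult_right')
    then show "(\<lambda>x. \<Sum>\<^sub>\<infinity>y. norm (case (x, y) of (h, y) \<Rightarrow> ?F h * f (Suc s) y)) abs_summable_on Zvec s"
      using summable_on_cmult_left[OF 1, of "norm (\<Sum>\<^sub>\<infinity>y. norm (f (Suc s) y))"]
      by (simp add: norm_mult abs_mult)
  qed
  then have "((\<lambda>h. norm (\<Prod>j\<in>{1..Suc s}. f j (h j))) \<circ> (\<lambda>(h, y). h(Suc s := y))) summable_on Zvec s \<times> UNIV"
    by (rule back_subst[of "\<lambda>f. f summable_on _"]) (auto simp: fun_eq_iff intro!: arg_cong[of _ _ norm])
  then show ?case
    using summable_on_reindex_bij_betw[OF Zvec_Suc_bij[of s], of "\<lambda>h. norm (\<Prod>j\<in>{1..Suc s}. f j (h j))"]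
    by (simp add: o_def)
qed

lemma Zvec_prod_infsum:
  fixes f :: "nat \<Rightarrow> int \<Rightarrow> 'c::{real_normed_field,banach}"
  assumes "\<And>j. j \<in> {1..s} \<Longrightarrow> f j abs_summable_on UNIV"
  shows "(\<Sum>\<^sub>\<infinity>h\<in>Zvec s. \<Prod>j\<in>{1..s}. f j (h j)) = (\<Prod>j\<in>{1..s}. \<Sum>\<^sub>\<infinity>k. f j k)"
  using assms
proof (induction s)
  case 0
  then show ?case by (simp add: Zvec_0)
next
  case (Suc s)
  let ?F = "\<lambda>h. \<Prod>j\<in>{1..s}. f j (h j)"
  let ?G = "\<lambda>h. \<Prod>j\<in>{1..Suc s}. f j (h j)"
  have eq: "?G ((\<lambda>(h, y). h(Suc s := y)) p) = (case p of (h, y) \<Rightarrow> ?F h * f (Suc s) y)" for p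
    by (cases p) (auto intro!: prod.cong)
  then have eq': "(\<lambda>p. ?G ((\<lambda>(h, y). h(Suc s := y)) p)) = (\<lambda>(h, y). ?F h * f (Suc s) y)"
    by (rule ext)
  have "?G abs_summable_on Zvec (Suc s)" by (rule Zvec_prod_summable) (use Suc in auto)
  then have "?G summable_on Zvec (Suc s)" by (rule abs_summable_summable)
  then have sm: "(\<lambda>(h, y). ?F h * f (Suc s) y) summable_on Zvec s \<times> UNIV"
    using summable_on_reindex_bij_betw[OF Zvec_Suc_bij[of s], of ?G] unfolding eq' by blast
  have "infsum ?G (Zvec (Suc s)) = (\<Sum>\<^sub>\<infinity>(h, y)\<in>Zvec s \<times> UNIV. ?F h * f (Suc s) y)"
    using infsum_reindex_bij_betw[OF Zvec_Suc_bij[of s], of ?G] unfolding eq' by (rule sym)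
  also have "\<dots> = (\<Sum>\<^sub>\<infinity>h\<in>Zvec s. \<Sum>\<^sub>\<infinity>y. ?F h * f (Suc s) y)"
    using infsum_Sigma'_banach[OF sm] by simp
  also have "\<dots> = (\<Sum>\<^sub>\<infinity>h\<in>Zvec s. ?F h) * (\<Sum>\<^sub>\<infinity>y. f (Suc s) y)"
    by (simp add: infsum_cmult_right' infsum_cmult_left')
  finally show ?case using Suc by simp
qed

lemma summable_powr_int:
  assumes "1 < \<kappa>"
  shows "(\<lambda>h::int. \<bar>real_of_int h\<bar> powr (-\<kappa>)) summable_on UNIV"
proof -
  let ?f = "\<lambda>h::int. \<bar>real_of_int h\<bar> powr (-\<kappa>)"
  have s: "(\<lambda>n. real n powr (-\<kappa>)) summable_on UNIV"
    using summable_on_UNIV_nonneg_real_iff[of "\<lambda>n. real n powr (-\<kappa>)"] summable_real_powr_iff[of "-\<kappa>"]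
      assms by simp
  have "?f summable_on range int"
    using s by (subst summable_on_reindex) (auto simp: o_def)
  moreover have "?f summable_on range (\<lambda>n. - int n)"
    using s by (subst summable_on_reindex) (auto simp: o_def inj_on_def)
  then have "?f summable_on {..<0}"
  proof (rule summable_on_subset)
    show "{..<0} \<subseteq> range (\<lambda>n. - int n)"
    proof
      fix x :: int assume "x \<in> {..<0}"
      then have "x = - int (nat (- x))" by simp
      then show "x \<in> range (\<lambda>n. - int n)" by blast
    qed
  qed
  moreover have "{..<0} \<inter> range int = {}" by auto
  ultimately have "?f summable_on {..<0} \<union> range int"
    by (intro summable_on_Un_disjoint)
  moreover have "{..<0} \<union> range int = UNIV"
    by auto (metis nonneg_int_cases not_le rangeI)
  ultimately show ?thesis by simp
qed

text \<open>
  The one-dimensional factors of the powers of \<open>r_weight\<close>.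
\<close>

definition kor_wt :: "real \<Rightarrow> real \<Rightarrow> int \<Rightarrow> real" where
  "kor_wt g \<kappa> h = (if h = 0 then 1 else g * \<bar>real_of_int h\<bar> powr (-\<kappa>))"

lemma kor_wt_abs_summable:
  assumes "1 < \<kappa>"
  shows "kor_wt g \<kappa> abs_summable_on UNIV"
proof -
  let ?a = "\<lambda>h::int. \<bar>g\<bar> * \<bar>real_of_int h\<bar> powr (-\<kappa>)"
  have "?a summable_on UNIV - {0}"
    by (intro summable_on_cmult_right summable_on_subset[OF summable_powr_int[OF assms]]) auto
  then have "(\<lambda>h. norm (kor_wt g \<kappa> h)) summable_on UNIV - {0}"
    by (rule summable_on_cong[THEN iffD1, rotated]) (auto simp: kor_wt_def abs_mult)
  moreover have "(\<lambda>h. norm (kor_wt g \<kappa> h)) summable_on {0}" by simp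
  ultimately have "(\<lambda>h. norm (kor_wt g \<kappa> h)) summable_on (UNIV - {0}) \<union> {0}"
    by (intro summable_on_Un_disjoint) auto
  then show ?thesis by (simp add: insert_absorb Un_commute)
qed

context
  fixes \<alpha> :: real and \<gamma> :: "nat \<Rightarrow> real"
  assumes \<gamma>: "\<And>j. 1 \<le> j \<Longrightarrow> 0 < \<gamma> j"
begin

lemma r_weight_eq:
  assumes "h \<in> Zvec s"
  shows "r_weight \<alpha> \<gamma> h = (\<Prod>j\<in>{1..s}. if h j = 0 then 1 else inverse (\<gamma> j) * \<bar>real_of_int (h j)\<bar> powr \<alpha>)"
proof -
  have sub: "supp h \<subseteq> {1..s}" using assms by (auto simp: supp_def Zvec_def)
  have "r_weight \<alpha> \<gamma> h = (\<Prod>j\<in>supp h. inverse (\<gamma> j) * \<bar>real_of_int (h j)\<bar> powr \<alpha>)"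
    unfolding r_weight_def prod.distrib by (simp add: prod_inversef[symmetric] o_def)
  also have "\<dots> = (\<Prod>j\<in>supp h. if h j = 0 then 1 else inverse (\<gamma> j) * \<bar>real_of_int (h j)\<bar> powr \<alpha>)"
    by (intro prod.cong) (auto simp: supp_def)
  also have "\<dots> = (\<Prod>j\<in>{1..s}. if h j = 0 then 1 else inverse (\<gamma> j) * \<bar>real_of_int (h j)\<bar> powr \<alpha>)"
    by (rule prod.mono_neutral_left) (use sub in \<open>auto simp: supp_def\<close>)
  finally show ?thesis .
qed

lemma r_weight_pos:
  assumes "h \<in> Zvec s"
  shows "0 < r_weight \<alpha> \<gamma> h"
  unfolding r_weight_eq[OF assms] by (intro prod_pos) (auto simp: \<gamma>)

text \<open>The support disappears, because a vanishing coordinate contributes the factor 1. In this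
  product form the sums over \<open>Zvec\<close> factorise.\<close>

lemma r_weight_powr:
  assumes "h \<in> Zvec s"
  shows "r_weight \<alpha> \<gamma> h powr (-e) = (\<Prod>j\<in>{1..s}. kor_wt (\<gamma> j powr e) (\<alpha> * e) (h j))"
proof -
  have "0 < (if h j = 0 then 1 else inverse (\<gamma> j) * \<bar>real_of_int (h j)\<bar> powr \<alpha>)" if "j \<in> {1..s}" for j
    using \<gamma>[of j] that by auto
  then have "r_weight \<alpha> \<gamma> h powr (-e) =
      (\<Prod>j\<in>{1..s}. (if h j = 0 then 1 else inverse (\<gamma> j) * \<bar>real_of_int (h j)\<bar> powr \<alpha>) powr (-e))"
    unfolding r_weight_eq[OF assms]
    by (induction s) (auto simp: powr_mult prod_nonneg less_imp_le simp del: mult_minus_right)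
  also have "\<dots> = (\<Prod>j\<in>{1..s}. kor_wt (\<gamma> j powr e) (\<alpha> * e) (h j))"
  proof (rule prod.cong)
    fix j assume "j \<in> {1..s}"
    then have "0 < \<gamma> j" using \<gamma> by simp
    then show "(if h j = 0 then 1 else inverse (\<gamma> j) * \<bar>real_of_int (h j)\<bar> powr \<alpha>) powr (-e) =
        kor_wt (\<gamma> j powr e) (\<alpha> * e) (h j)"
      by (auto simp: kor_wt_def powr_mult powr_powr powr_minus inverse_powr simp flip: powr_minus)
  qed simp
  finally show ?thesis .
qed

lemma r_weight_powr_summable:
  assumes "1 < \<alpha> * e"
  shows "(\<lambda>h. r_weight \<alpha> \<gamma> h powr (-e)) summable_on Zvec s"
proof -
  have "(\<lambda>h. \<Prod>j\<in>{1..s}. kor_wt (\<gamma> j powr e) (\<alpha> * e) (h j)) abs_summable_on Zvec s"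
    by (rule Zvec_prod_summable) (rule kor_wt_abs_summable[OF assms])
  then have "(\<lambda>h. \<Prod>j\<in>{1..s}. kor_wt (\<gamma> j powr e) (\<alpha> * e) (h j)) summable_on Zvec s"
    by (rule abs_summable_summable)
  then show ?thesis
    by (rule summable_on_cong[THEN iffD2, rotated]) (rule r_weight_powr)
qed

end

section \<open>The kernel\<close>

definition expi :: "real \<Rightarrow> complex" where
  "expi x = cis (2 * pi * x)"

lemma expi_add: "expi (x + y) = expi x * expi y"
  by (simp add: expi_def cis_mult algebra_simps)

lemma expi_int [simp]: "expi (real_of_int k) = 1"
  by (simp add: expi_def cis_multiple_2pi)

lemma expi_0 [simp]: "expi 0 = 1"
  by (simp add: expi_def)

lemma norm_expi [simp]: "norm (expi x) = 1"
  by (simp add: expi_def)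

lemma expi_sum: "finite A \<Longrightarrow> expi (sum f A) = (\<Prod>a\<in>A. expi (f a))"
  by (induction rule: finite_induct) (auto simp: expi_add)

lemma expi_cnj: "cnj (expi x) = expi (-x)"
  by (simp add: expi_def cis_cnj)

lemma expi_exp: "exp (2 * of_real pi * \<i> * of_real x) = expi x"
  by (simp add: expi_def cis_conv_exp algebra_simps)

lemma expi_power: "expi x ^ n = expi (real n * x)"
  by (simp add: expi_def Complex.DeMoivre algebra_simps)

lemma expi_eq_1_iff: "expi x = 1 \<longleftrightarrow> x \<in> \<int>"
proof
  assume "expi x = 1"
  then have "cos (2 * pi * x) = 1" by (simp add: expi_def complex_eq_iff)
  then obtain n :: int where "2 * pi * x = of_int n * 2 * pi"
    using cos_one_2pi_int by auto
  then have "x = of_int n" by simp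
  then show "x \<in> \<int>" by simp
qed (auto elim!: Ints_cases)

text \<open>Orthogonality of the characters modulo \<open>p\<close>; in the second case a geometric
  sum whose ratio is a nontrivial \<open>p\<close>-th root of unity.\<close>

lemma sum_expi:
  assumes "0 < p"
  shows "(\<Sum>k<p. expi (real k * real_of_int a / real p)) = (if int p dvd a then of_nat p else 0)"
proof (cases "int p dvd a")
  case True
  then obtain b where a: "a = int p * b" by auto
  have "expi (real k * real_of_int a / real p) = 1" for k
  proof -
    have "real k * real_of_int a / real p = real_of_int (int k * b)" using assms a by simp
    then show ?thesis by (simp only: expi_int)
  qed
  then show ?thesis using True by simp
next
  case False
  let ?w = "expi (real_of_int a / real p)"
  have w: "?w \<noteq> 1"
  proof
    assume "?w = 1"
    then obtain b :: int where "real_of_int a / real p = real_of_int b"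
      unfolding expi_eq_1_iff by (auto elim!: Ints_cases)
    then have "real_of_int a = real_of_int (int p * b)" using assms by (simp add: field_simps)
    then have "a = int p * b" by (simp only: of_int_eq_iff)
    with False show False by simp
  qed
  have "?w ^ p = 1" using assms by (simp add: expi_power)
  then have "(\<Sum>k<p. ?w ^ k) = 0" using w by (simp add: sum_gp_strict)
  then show ?thesis using False by (simp add: expi_power)
qed

text \<open>The divisibility condition is replaced by the average of the \<open>p\<close>
  characters.\<close>

lemma infsum_dvd:
  fixes A :: "'a \<Rightarrow> int" and f :: "'a \<Rightarrow> complex"
  assumes "f abs_summable_on H" "0 < p"
  shows "(\<Sum>\<^sub>\<infinity>h\<in>{h \<in> H. int p dvd A h}. f h) =
           (1 / of_nat p) * (\<Sum>k<p. \<Sum>\<^sub>\<infinity>h\<in>H. f h * expi (real k * real_of_int (A h) / real p))"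
proof -
  have sm: "(\<lambda>h. f h * expi (real k * real_of_int (A h) / real p)) summable_on H" for k
    by (rule abs_summable_summable) (use assms(1) in \<open>simp add: norm_mult\<close>)
  have "(\<Sum>k<p. \<Sum>\<^sub>\<infinity>h\<in>H. f h * expi (real k * real_of_int (A h) / real p)) =
      (\<Sum>\<^sub>\<infinity>h\<in>H. \<Sum>k<p. f h * expi (real k * real_of_int (A h) / real p))"
    by (rule infsum_finite_sum[THEN conjunct2, symmetric]) (auto intro: sm)
  also have "\<dots> = (\<Sum>\<^sub>\<infinity>h\<in>H. of_nat p * (if int p dvd A h then f h else 0))"
    by (rule infsum_cong) (simp add: sum_distrib_left[symmetric] sum_expi[OF assms(2)])
  also have "\<dots> = of_nat p * (\<Sum>\<^sub>\<infinity>h\<in>H. (if int p dvd A h then f h else 0))"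
    by (rule infsum_cmult_right')
  also have "(\<Sum>\<^sub>\<infinity>h\<in>H. (if int p dvd A h then f h else 0)) = (\<Sum>\<^sub>\<infinity>h\<in>{h \<in> H. int p dvd A h}. f h)"
    by (rule infsum_cong_neutral) auto
  finally show ?thesis using assms(2) by simp
qed

lemma sigma_summable:
  assumes "1 / 2 < \<alpha>"
  shows "(\<lambda>h. expi (real_of_int h * x) / of_real (\<bar>real_of_int h\<bar> powr (2 * \<alpha>))) abs_summable_on A"
proof -
  have "(\<lambda>h::int. \<bar>real_of_int h\<bar> powr (-(2 * \<alpha>))) summable_on A"
    by (rule summable_on_subset[OF summable_powr_int]) (use assms in auto)
  then show ?thesis
    by (simp add: norm_divide powr_minus divide_inverse norm_mult norm_inverse)
qed

text \<open>Reflection of the summation index conjugates the series, so taking the real part in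
  \<open>sigma\<close> loses nothing.\<close>

lemma sigma_complex:
  assumes "1 / 2 < \<alpha>"
  shows "of_real (sigma \<alpha> x) =
    (\<Sum>\<^sub>\<infinity>h\<in>UNIV - {0::int}. expi (real_of_int h * x) / of_real (\<bar>real_of_int h\<bar> powr (2 * \<alpha>)))"
    (is "_ = ?S")
proof -
  let ?f = "\<lambda>h::int. expi (real_of_int h * x) / of_real (\<bar>real_of_int h\<bar> powr (2 * \<alpha>))"
  have "cnj ?S = (\<Sum>\<^sub>\<infinity>h\<in>UNIV - {0::int}. cnj (?f h))"
    by (rule infsum_cnj[symmetric])
  also have "\<dots> = (\<Sum>\<^sub>\<infinity>h\<in>UNIV - {0::int}. ?f (- h))"
    by (simp add: expi_cnj)
  also have "\<dots> = ?S"
    by (rule infsum_reindex_bij_witness[of _ uminus uminus]) auto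
  finally have "?S \<in> \<real>" using Reals_cnj_iff by blast
  moreover have "sigma \<alpha> x = Re ?S"
    unfolding sigma_def expi_exp by simp
  ultimately show ?thesis by simp
qed

lemma sigma_shift:
  assumes "x - y \<in> \<int>"
  shows "sigma \<alpha> x = sigma \<alpha> y"
proof -
  obtain k :: int where k: "x = y + real_of_int k" using assms by (auto elim!: Ints_cases simp: algebra_simps)
  have "expi (real_of_int h * x) = expi (real_of_int h * y)" for h
    using expi_int[of "h * k"] unfolding k ring_distribs expi_add of_int_mult[symmetric] by simp
  then show ?thesis unfolding sigma_def expi_exp by simp
qed

text \<open>Averaging over the shifts by \<open>a / q\<close> keeps the frequencies divisible by
  \<open>q\<close>, and \<open>h = q * t\<close> pulls out \<open>q powr (- (2 * \<alpha>))\<close>.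
  The identity serves twice: in the third part of \<open>T_crit\<close>, and to let the program
  compute this power from \<open>sigma\<close> alone.\<close>

lemma sum_sigma_shift:
  assumes "1 / 2 < \<alpha>" "0 < q"
  shows "(\<Sum>a<q. sigma \<alpha> (y + real a / real q)) = real q powr (1 - 2 * \<alpha>) * sigma \<alpha> (real q * y)"
proof -
  let ?g = "\<lambda>y h. expi (real_of_int h * y) / of_real (\<bar>real_of_int h\<bar> powr (2 * \<alpha>))"
  let ?Q = "{h \<in> UNIV - {0::int}. int q dvd h}"
  have bij: "bij_betw (\<lambda>t. int q * t) (UNIV - {0}) ?Q"
    using assms(2) by (intro bij_betw_byWitness[where f' = "\<lambda>h. h div int q"]) auto
  have "(\<Sum>\<^sub>\<infinity>h\<in>?Q. ?g y h) = (1 / of_nat q) * (\<Sum>a<q. \<Sum>\<^sub>\<infinity>h\<in>UNIV - {0}. ?g y h * expi (real a * real_of_int h / real q))"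
    by (rule infsum_dvd[OF sigma_summable[OF assms(1)] assms(2)])
  also have "\<dots> = (1 / of_nat q) * (\<Sum>a<q. of_real (sigma \<alpha> (y + real a / real q)))"
    by (simp add: sigma_complex[OF assms(1)] ring_distribs expi_add mult.commute)
  finally have 1: "(\<Sum>\<^sub>\<infinity>h\<in>?Q. ?g y h) = (1 / of_nat q) * (\<Sum>a<q. of_real (sigma \<alpha> (y + real a / real q)))" .
  have "(\<Sum>\<^sub>\<infinity>h\<in>?Q. ?g y h) = (\<Sum>\<^sub>\<infinity>t\<in>UNIV - {0}. ?g y (int q * t))"
    by (rule infsum_reindex_bij_betw[OF bij, symmetric])
  also have "\<dots> = (\<Sum>\<^sub>\<infinity>t\<in>UNIV - {0}. of_real (real q powr (- (2 * \<alpha>))) * ?g (real q * y) t)"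
    by (rule infsum_cong) (use assms(2) in \<open>simp add: powr_mult abs_mult powr_minus field_simps\<close>)
  also have "\<dots> = of_real (real q powr (- (2 * \<alpha>))) * of_real (sigma \<alpha> (real q * y))"
    unfolding sigma_complex[OF assms(1)] by (rule infsum_cmult_right')
  finally have "complex_of_real (\<Sum>a<q. sigma \<alpha> (y + real a / real q)) =
      of_real (real q * (real q powr (- (2 * \<alpha>)) * sigma \<alpha> (real q * y)))"
    using 1 assms(2) by (simp add: field_simps)
  then have "(\<Sum>a<q. sigma \<alpha> (y + real a / real q)) = real q * (real q powr (- (2 * \<alpha>)) * sigma \<alpha> (real q * y))"
    by (simp only: of_real_eq_iff)
  also have "real q * real q powr (- (2 * \<alpha>)) = real q powr (1 - 2 * \<alpha>)"
    using assms(2) powr_add[of "real q" 1 "- (2 * \<alpha>)"] by simp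
  ultimately show ?thesis by (simp add: mult.assoc[symmetric])
qed

lemma sigma_0_pos:
  assumes "1 / 2 < \<alpha>"
  shows "0 < sigma \<alpha> 0"
proof -
  let ?g = "\<lambda>h::int. 1 / \<bar>real_of_int h\<bar> powr (2 * \<alpha>)"
  have g: "?g = (\<lambda>h. \<bar>real_of_int h\<bar> powr (-(2 * \<alpha>)))"
    by (rule ext) (rule powr_minus_divide[symmetric])
  have sm: "?g summable_on A" for A
    unfolding g by (rule summable_on_subset[OF summable_powr_int]) (use assms in auto)
  have "of_real (sigma \<alpha> 0) = (\<Sum>\<^sub>\<infinity>h\<in>UNIV - {0}. complex_of_real (?g h))"
    by (simp add: sigma_complex[OF assms])
  also have "\<dots> = of_real (infsum ?g (UNIV - {0}))"
    by (rule infsum_of_real)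
  finally have "sigma \<alpha> 0 = infsum ?g (UNIV - {0})" by (simp only: of_real_eq_iff)
  moreover have "infsum ?g {1} \<le> infsum ?g (UNIV - {0})"
    by (rule infsum_mono_neutral) (use sm in auto)
  ultimately show ?thesis by simp
qed

lemma dot_expand: "1 \<le> s \<Longrightarrow> dot s h z v = (\<Sum>j\<in>{1..s}. h j * (z(s := v)) j)"
proof -
  assume "1 \<le> s"
  then have "{1..s} = insert s {1..<s}" by auto
  then have "(\<Sum>j\<in>{1..s}. h j * (z(s := v)) j) = h s * v + (\<Sum>j\<in>{1..<s}. h j * (z(s := v)) j)"
    by simp
  also have "(\<Sum>j\<in>{1..<s}. h j * (z(s := v)) j) = (\<Sum>j\<in>{1..<s}. h j * z j)"
    by (intro sum.cong) auto
  finally show ?thesis by (simp add: dot_def)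
qed

text \<open>The product stops before \<open>s\<close>: in coordinate \<open>s\<close> the zero
  frequency is excluded, and its factor is the only one that contains the residue to be
  chosen.\<close>

definition ker :: "real \<Rightarrow> (nat \<Rightarrow> real) \<Rightarrow> nat \<Rightarrow> (nat \<Rightarrow> real) \<Rightarrow> real" where
  "ker \<alpha> \<gamma> s x = (\<Prod>j\<in>{1..<s}. 1 + (\<gamma> j)\<^sup>2 * sigma \<alpha> (x j))"

context
  fixes \<alpha> :: real and \<gamma> :: "nat \<Rightarrow> real"
  assumes \<alpha>: "1 / 2 < \<alpha>" and \<gamma>: "\<And>j. 1 \<le> j \<Longrightarrow> 0 < \<gamma> j"
begin

lemma rw2_abs_summable:
  assumes "H \<subseteq> Zvec s"
  shows "(\<lambda>h. complex_of_real (r_weight \<alpha> \<gamma> h powr (-2))) abs_summable_on H"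
  using summable_on_subset[OF r_weight_powr_summable[of \<gamma> \<alpha> 2 s, OF \<gamma>] assms] \<alpha>
  by simp

lemma infsum_ker:
  assumes "1 \<le> s"
  shows "(\<Sum>\<^sub>\<infinity>h\<in>{h \<in> Zvec s. h s \<noteq> 0}. complex_of_real (r_weight \<alpha> \<gamma> h powr (-2)) *
             expi (\<Sum>j\<in>{1..s}. real_of_int (h j) * x j))
           = of_real ((\<gamma> s)\<^sup>2 * ker \<alpha> \<gamma> s x * sigma \<alpha> (x s))"
proof -
  \<comment> \<open>The condition \<open>h s \<noteq> 0\<close> is encoded in the factor of
    coordinate \<open>s\<close>, which vanishes at 0. The sum then runs over all of
    \<open>Zvec s\<close> and factorises.\<close>
  define f :: "nat \<Rightarrow> int \<Rightarrow> complex" where "f = (\<lambda>j k.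
    (if j = s \<and> k = 0 then 0 else of_real (kor_wt ((\<gamma> j)\<^sup>2) (2 * \<alpha>) k) * expi (real_of_int k * x j)))"
  have fs: "f j abs_summable_on UNIV" for j
  proof (rule Infinite_Sum.abs_summable_on_comparison_test)
    show "kor_wt ((\<gamma> j)\<^sup>2) (2 * \<alpha>) abs_summable_on UNIV"
      by (rule kor_wt_abs_summable) (use \<alpha> in auto)
  qed (auto simp: f_def norm_mult)
  have g2: "\<gamma> j powr 2 = (\<gamma> j)\<^sup>2" if "1 \<le> j" for j using \<gamma>[OF that] by simp
  have eq: "(if h s \<noteq> 0 then complex_of_real (r_weight \<alpha> \<gamma> h powr (-2)) *
             expi (\<Sum>j\<in>{1..s}. real_of_int (h j) * x j) else 0) = (\<Prod>j\<in>{1..s}. f j (h j))"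
    if "h \<in> Zvec s" for h
  proof (cases "h s = 0")
    case True
    then have "f s (h s) = 0" by (simp add: f_def)
    then have "(\<Prod>j\<in>{1..s}. f j (h j)) = 0" using assms by (intro prod_zero) auto
    then show ?thesis using True by simp
  next
    case False
    have "(\<Prod>j\<in>{1..s}. f j (h j)) =
       (\<Prod>j\<in>{1..s}. of_real (kor_wt (\<gamma> j powr 2) (\<alpha> * 2) (h j)) * expi (real_of_int (h j) * x j))"
      by (rule prod.cong) (use False in \<open>auto simp: f_def g2 mult.commute\<close>)
    then show ?thesis using False
      by (simp add: r_weight_powr[of \<gamma>, OF \<gamma> that] prod.distrib expi_sum)
  qed
  have split0: "(\<Sum>\<^sub>\<infinity>k. f j k) = f j 0 + of_real ((\<gamma> j)\<^sup>2 * sigma \<alpha> (x j))" for j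
  proof -
    have "(\<Sum>\<^sub>\<infinity>k\<in>UNIV - {0}. f j k) = (\<Sum>\<^sub>\<infinity>k\<in>UNIV - {0}. of_real ((\<gamma> j)\<^sup>2) *
        (expi (real_of_int k * x j) / of_real (\<bar>real_of_int k\<bar> powr (2 * \<alpha>))))"
      by (rule infsum_cong) (auto simp: f_def kor_wt_def powr_minus field_simps)
    also have "\<dots> = of_real ((\<gamma> j)\<^sup>2 * sigma \<alpha> (x j))"
      unfolding of_real_mult sigma_complex[OF \<alpha>] by (rule infsum_cmult_right')
    finally have 1: "(\<Sum>\<^sub>\<infinity>k\<in>UNIV - {0}. f j k) = of_real ((\<gamma> j)\<^sup>2 * sigma \<alpha> (x j))" .
    have "(\<Sum>\<^sub>\<infinity>k\<in>{0} \<union> (UNIV - {0}). f j k) = (\<Sum>\<^sub>\<infinity>k\<in>{0}. f j k) + (\<Sum>\<^sub>\<infinity>k\<in>UNIV - {0}. f j k)"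
    proof (rule infsum_Un_disjoint)
      show "f j summable_on UNIV - {0}"
        by (rule summable_on_subset[OF abs_summable_summable[OF fs]]) auto
    qed auto
    moreover have "{0} \<union> (UNIV - {0}) = (UNIV :: int set)" by auto
    ultimately show ?thesis using 1 by simp
  qed
  have "(\<Sum>\<^sub>\<infinity>h\<in>{h \<in> Zvec s. h s \<noteq> 0}. complex_of_real (r_weight \<alpha> \<gamma> h powr (-2)) *
             expi (\<Sum>j\<in>{1..s}. real_of_int (h j) * x j)) = (\<Sum>\<^sub>\<infinity>h\<in>Zvec s. \<Prod>j\<in>{1..s}. f j (h j))"
  proof (rule infsum_cong_neutral)
    fix h assume "h \<in> Zvec s - {h \<in> Zvec s. h s \<noteq> 0}"
    then show "(\<Prod>j\<in>{1..s}. f j (h j)) = 0" using eq[of h] by simp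
  next
    fix h assume "h \<in> {h \<in> Zvec s. h s \<noteq> 0} \<inter> Zvec s"
    then show "complex_of_real (r_weight \<alpha> \<gamma> h powr (-2)) * expi (\<Sum>j\<in>{1..s}. real_of_int (h j) * x j) =
        (\<Prod>j\<in>{1..s}. f j (h j))" using eq[of h] by simp
  qed auto
  also have "\<dots> = (\<Prod>j\<in>{1..s}. f j 0 + of_real ((\<gamma> j)\<^sup>2 * sigma \<alpha> (x j)))"
    using Zvec_prod_infsum[of s f, OF fs] split0 by simp
  also have "(\<Prod>j\<in>{1..s}. f j 0 + of_real ((\<gamma> j)\<^sup>2 * sigma \<alpha> (x j))) =
      of_real ((\<gamma> s)\<^sup>2 * sigma \<alpha> (x s)) * (\<Prod>j\<in>{1..<s}. f j 0 + of_real ((\<gamma> j)\<^sup>2 * sigma \<alpha> (x j)))"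
  proof -
    have "{1..s} = insert s {1..<s}" using assms by auto
    then show ?thesis by (simp add: f_def)
  qed
  also have "(\<Prod>j\<in>{1..<s}. f j 0 + of_real ((\<gamma> j)\<^sup>2 * sigma \<alpha> (x j))) = of_real (ker \<alpha> \<gamma> s x)"
    unfolding ker_def of_real_prod by (intro prod.cong) (auto simp: f_def kor_wt_def)
  finally show ?thesis by (simp add: mult_ac)
qed

section \<open>Sums over dual lattices as finite kernel sums\<close>

lemma expi_dot_add:
  "expi (\<Sum>j\<in>S. real_of_int (h j) * x j) * expi (c * real_of_int (\<Sum>j\<in>S. h j * y j) / b) =
     expi (\<Sum>j\<in>S. real_of_int (h j) * (x j + c * real_of_int (y j) / b))"
  unfolding expi_add[symmetric]
  by (rule arg_cong[of _ _ expi])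
    (simp add: ring_distribs sum.distrib sum_distrib_left sum_divide_distrib mult_ac)

lemma infsum_dual1:
  assumes "1 \<le> s" "0 < p"
  shows "(\<Sum>\<^sub>\<infinity>h\<in>{h \<in> Zvec s. h s \<noteq> 0 \<and> int p dvd dot s h z v}. r_weight \<alpha> \<gamma> h powr (-2)) =
    (\<gamma> s)\<^sup>2 / real p * (\<Sum>k<p. ker \<alpha> \<gamma> s (\<lambda>j. real k * real_of_int (z j) / real p) * sigma \<alpha> (real k * real_of_int v / real p))"
proof -
  let ?H = "{h \<in> Zvec s. h s \<noteq> 0}"
  let ?r = "\<lambda>h. complex_of_real (r_weight \<alpha> \<gamma> h powr (-2))"
  have "complex_of_real (\<Sum>\<^sub>\<infinity>h\<in>{h \<in> Zvec s. h s \<noteq> 0 \<and> int p dvd dot s h z v}. r_weight \<alpha> \<gamma> h powr (-2)) =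
    (\<Sum>\<^sub>\<infinity>h\<in>{h \<in> ?H. int p dvd dot s h z v}. ?r h)"
    by (simp add: infsum_of_real conj_assoc)
  also have "\<dots> = (1 / of_nat p) * (\<Sum>k<p. \<Sum>\<^sub>\<infinity>h\<in>?H. ?r h * expi (real k * real_of_int (dot s h z v) / real p))"
    by (rule infsum_dvd) (use rw2_abs_summable[of ?H s] assms in auto)
  also have "\<dots> = (1 / of_nat p) * (\<Sum>k<p. of_real ((\<gamma> s)\<^sup>2 *
      ker \<alpha> \<gamma> s (\<lambda>j. real k * real_of_int (z j) / real p) * sigma \<alpha> (real k * real_of_int v / real p)))"
  proof (rule arg_cong[of _ _ "\<lambda>x. _ * x"], rule sum.cong[OF refl])
    fix k
    have "expi (real k * real_of_int (dot s h z v) / real p) =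
        expi (\<Sum>j\<in>{1..s}. real_of_int (h j) * (real k * real_of_int ((z(s := v)) j) / real p))" for h
      using expi_dot_add[of h "\<lambda>_. 0" "{1..s}" "real k" "z(s := v)" "real p"]
      unfolding dot_expand[OF assms(1)] by simp
    then have "(\<Sum>\<^sub>\<infinity>h\<in>?H. ?r h * expi (real k * real_of_int (dot s h z v) / real p)) =
        of_real ((\<gamma> s)\<^sup>2 * ker \<alpha> \<gamma> s (\<lambda>j. real k * real_of_int ((z(s := v)) j) / real p) *
          sigma \<alpha> (real k * real_of_int ((z(s := v)) s) / real p))"
      using infsum_ker[OF assms(1), of "\<lambda>j. real k * real_of_int ((z(s := v)) j) / real p"] by simp
    also have "ker \<alpha> \<gamma> s (\<lambda>j. real k * real_of_int ((z(s := v)) j) / real p) = ker \<alpha> \<gamma> s (\<lambda>j. real k * real_of_int (z j) / real p)"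
      unfolding ker_def by (intro prod.cong) auto
    finally show "(\<Sum>\<^sub>\<infinity>h\<in>?H. ?r h * expi (real k * real_of_int (dot s h z v) / real p)) =
        of_real ((\<gamma> s)\<^sup>2 * ker \<alpha> \<gamma> s (\<lambda>j. real k * real_of_int (z j) / real p) *
          sigma \<alpha> (real k * real_of_int v / real p))" by simp
  qed
  also have "\<dots> = complex_of_real ((\<gamma> s)\<^sup>2 / real p * (\<Sum>k<p. ker \<alpha> \<gamma> s (\<lambda>j. real k * real_of_int (z j) / real p) * sigma \<alpha> (real k * real_of_int v / real p)))"
    by (simp add: sum_distrib_left mult_ac)
  finally show ?thesis by (simp only: of_real_eq_iff)
qed

text \<open>Two applications of \<open>infsum_dvd\<close>, one after the other, so the two
  congruences may have different last components \<open>v\<close> and \<open>w\<close>.\<close>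

lemma infsum_dual2:
  assumes "1 \<le> s" "0 < p" "0 < q"
  shows "(\<Sum>\<^sub>\<infinity>h\<in>{h \<in> Zvec s. h s \<noteq> 0 \<and> int p dvd dot s h z v \<and> int q dvd dot s h z w}. r_weight \<alpha> \<gamma> h powr (-2)) =
    (\<gamma> s)\<^sup>2 / (real p * real q) * (\<Sum>l<q. \<Sum>k<p.
       ker \<alpha> \<gamma> s (\<lambda>j. real k * real_of_int (z j) / real p + real l * real_of_int (z j) / real q) *
       sigma \<alpha> (real k * real_of_int v / real p + real l * real_of_int w / real q))"
proof -
  let ?H = "{h \<in> Zvec s. h s \<noteq> 0}"
  let ?Hp = "{h \<in> ?H. int p dvd dot s h z v}"
  let ?r = "\<lambda>h. complex_of_real (r_weight \<alpha> \<gamma> h powr (-2))"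
  let ?e = "\<lambda>l h. expi (real l * real_of_int (dot s h z w) / real q)"
  have "complex_of_real (\<Sum>\<^sub>\<infinity>h\<in>{h \<in> Zvec s. h s \<noteq> 0 \<and> int p dvd dot s h z v \<and> int q dvd dot s h z w}. r_weight \<alpha> \<gamma> h powr (-2)) =
    (\<Sum>\<^sub>\<infinity>h\<in>{h \<in> ?Hp. int q dvd dot s h z w}. ?r h)"
    by (simp add: infsum_of_real conj_assoc)
  also have "\<dots> = (1 / of_nat q) * (\<Sum>l<q. \<Sum>\<^sub>\<infinity>h\<in>?Hp. ?r h * ?e l h)"
    by (rule infsum_dvd) (use rw2_abs_summable[of ?Hp s] assms in auto)
  also have "\<dots> = (1 / of_nat q) * (\<Sum>l<q. (1 / of_nat p) * (\<Sum>k<p. \<Sum>\<^sub>\<infinity>h\<in>?H. (?r h * ?e l h) * expi (real k * real_of_int (dot s h z v) / real p)))"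
  proof (rule arg_cong[of _ _ "\<lambda>x. _ * x"], rule sum.cong[OF refl], rule infsum_dvd)
    fix l
    show "(\<lambda>h. ?r h * ?e l h) abs_summable_on ?H"
      using rw2_abs_summable[of ?H s] by (simp add: norm_mult)
  qed (use assms in auto)
  also have "\<dots> = (1 / of_nat q) * (\<Sum>l<q. (1 / of_nat p) * (\<Sum>k<p. of_real ((\<gamma> s)\<^sup>2 *
      ker \<alpha> \<gamma> s (\<lambda>j. real k * real_of_int (z j) / real p + real l * real_of_int (z j) / real q) *
       sigma \<alpha> (real k * real_of_int v / real p + real l * real_of_int w / real q))))"
  proof (rule arg_cong[of _ _ "\<lambda>x. _ * x"], rule sum.cong[OF refl],
      rule arg_cong[of _ _ "\<lambda>x. _ * x"], rule sum.cong[OF refl])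
    fix k l
    let ?x = "\<lambda>j. real k * real_of_int ((z(s := v)) j) / real p + real l * real_of_int ((z(s := w)) j) / real q"
    have "expi (real k * real_of_int (dot s h z v) / real p) * ?e l h =
        expi (\<Sum>j\<in>{1..s}. real_of_int (h j) * ?x j)" for h
      using expi_dot_add[of h "\<lambda>_. 0" "{1..s}" "real k" "z(s := v)" "real p"]
        expi_dot_add[of h "\<lambda>j. real k * real_of_int ((z(s := v)) j) / real p" "{1..s}" "real l" "z(s := w)" "real q"]
      unfolding dot_expand[OF assms(1)] by simp
    then have "(\<Sum>\<^sub>\<infinity>h\<in>?H. (?r h * ?e l h) * expi (real k * real_of_int (dot s h z v) / real p)) =
        of_real ((\<gamma> s)\<^sup>2 * ker \<alpha> \<gamma> s ?x * sigma \<alpha> (?x s))"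
      using infsum_ker[OF assms(1), of ?x] by (simp add: mult.assoc mult.commute[of "?e l _"])
    also have "ker \<alpha> \<gamma> s ?x = ker \<alpha> \<gamma> s (\<lambda>j. real k * real_of_int (z j) / real p + real l * real_of_int (z j) / real q)"
      unfolding ker_def by (intro prod.cong) auto
    finally show "(\<Sum>\<^sub>\<infinity>h\<in>?H. (?r h * ?e l h) * expi (real k * real_of_int (dot s h z v) / real p)) =
        of_real ((\<gamma> s)\<^sup>2 * ker \<alpha> \<gamma> s (\<lambda>j. real k * real_of_int (z j) / real p + real l * real_of_int (z j) / real q) *
          sigma \<alpha> (real k * real_of_int v / real p + real l * real_of_int w / real q))" by simp
  qed
  also have "\<dots> = complex_of_real ((\<gamma> s)\<^sup>2 / (real p * real q) * (\<Sum>l<q. \<Sum>k<p.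
       ker \<alpha> \<gamma> s (\<lambda>j. real k * real_of_int (z j) / real p + real l * real_of_int (z j) / real q) *
       sigma \<alpha> (real k * real_of_int v / real p + real l * real_of_int w / real q)))"
    by (simp add: sum_distrib_left mult_ac)
  finally show ?thesis by (simp only: of_real_eq_iff)
qed

text \<open>Splitting off \<open>q dvd h s\<close> by the average of the shifts of the last argument.\<close>

lemma infsum_dual3:
  assumes "1 \<le> s" "0 < p" "0 < q"
  shows "(\<Sum>\<^sub>\<infinity>h\<in>{h \<in> Zvec s. h s \<noteq> 0 \<and> int q dvd h s \<and> int p dvd dot s h z v \<and> int q dvd (\<Sum>j\<in>{1..<s}. h j * z j)}. r_weight \<alpha> \<gamma> h powr (-2)) =
    (\<gamma> s)\<^sup>2 / (real p * real q) * real q powr (- (2 * \<alpha>)) * (\<Sum>k<p. (\<Sum>l<q.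
       ker \<alpha> \<gamma> s (\<lambda>j. real k * real_of_int (z j) / real p + real l * real_of_int (z j) / real q)) *
       sigma \<alpha> (real q * (real k * real_of_int v / real p)))"
proof -
  let ?H = "{h \<in> Zvec s. h s \<noteq> 0}"
  let ?D = "\<lambda>w. {h \<in> Zvec s. h s \<noteq> 0 \<and> int p dvd dot s h z v \<and> int q dvd dot s h z w}"
  let ?K = "\<lambda>k l. ker \<alpha> \<gamma> s (\<lambda>j. real k * real_of_int (z j) / real p + real l * real_of_int (z j) / real q)"
  let ?E = "{h \<in> ?D 0. int q dvd h s}"
  let ?r = "\<lambda>h. complex_of_real (r_weight \<alpha> \<gamma> h powr (-2))"
  \<comment> \<open>Once \<open>q\<close> divides \<open>h s\<close>, the last component is
    irrelevant modulo \<open>q\<close> and may be taken to be 0. Three divisibility conditions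
    remain, each to be expanded by characters.\<close>
  have set: "{h \<in> Zvec s. h s \<noteq> 0 \<and> int q dvd h s \<and> int p dvd dot s h z v \<and> int q dvd (\<Sum>j\<in>{1..<s}. h j * z j)} = ?E"
    by (auto simp: dot_def)
  have e: "?E = {h \<in> {h \<in> {h \<in> ?H. int p dvd dot s h z v}. int q dvd dot s h z 0}. int q dvd h s}" by auto
  have "complex_of_real (\<Sum>\<^sub>\<infinity>h\<in>?E. r_weight \<alpha> \<gamma> h powr (-2)) = (\<Sum>\<^sub>\<infinity>h\<in>?E. ?r h)"
    by (simp add: infsum_of_real)
  also have "\<dots> = (1 / of_nat q) * (\<Sum>a<q. \<Sum>\<^sub>\<infinity>h\<in>{h \<in> {h \<in> ?H. int p dvd dot s h z v}. int q dvd dot s h z 0}. ?r h * expi (real a * real_of_int (h s) / real q))"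
    unfolding e by (rule infsum_dvd) (use rw2_abs_summable[of "{h \<in> {h \<in> ?H. int p dvd dot s h z v}. int q dvd dot s h z 0}" s] assms in auto)
  also have "\<dots> = (1 / of_nat q) * (\<Sum>a<q. (1 / of_nat q) * (\<Sum>l<q. (1 / of_nat p) * (\<Sum>k<p. \<Sum>\<^sub>\<infinity>h\<in>?H. ?r h * expi (real a * real_of_int (h s) / real q) *
      expi (real l * real_of_int (dot s h z 0) / real q) * expi (real k * real_of_int (dot s h z v) / real p))))"
  proof (rule arg_cong[of _ _ "\<lambda>x. _ * x"], rule sum.cong[OF refl], subst infsum_dvd)
    fix a
    show "(\<lambda>h. ?r h * expi (real a * real_of_int (h s) / real q)) abs_summable_on {h \<in> ?H. int p dvd dot s h z v}"
      using rw2_abs_summable[of "{h \<in> ?H. int p dvd dot s h z v}" s] by (simp add: norm_mult)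
    show "1 / of_nat q * (\<Sum>l<q. \<Sum>\<^sub>\<infinity>h\<in>{h \<in> ?H. int p dvd dot s h z v}. ?r h * expi (real a * real_of_int (h s) / real q) *
           expi (real l * real_of_int (dot s h z 0) / real q)) =
         1 / of_nat q * (\<Sum>l<q. (1 / of_nat p) * (\<Sum>k<p. \<Sum>\<^sub>\<infinity>h\<in>?H. ?r h * expi (real a * real_of_int (h s) / real q) *
      expi (real l * real_of_int (dot s h z 0) / real q) * expi (real k * real_of_int (dot s h z v) / real p)))"
    proof (rule arg_cong[of _ _ "\<lambda>x. _ * x"], rule sum.cong[OF refl], rule infsum_dvd)
      fix l
      show "(\<lambda>h. ?r h * expi (real a * real_of_int (h s) / real q) * expi (real l * real_of_int (dot s h z 0) / real q)) abs_summable_on ?H"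
        using rw2_abs_summable[of ?H s] by (simp add: norm_mult)
    qed (use assms in auto)
  qed (use assms in auto)
  also have "\<dots> = (1 / of_nat q) * (\<Sum>a<q. (1 / of_nat q) * (\<Sum>l<q. (1 / of_nat p) * (\<Sum>k<p.
      of_real ((\<gamma> s)\<^sup>2 * ?K k l * sigma \<alpha> (real k * real_of_int v / real p + real a / real q)))))"
  proof (rule arg_cong[of _ _ "\<lambda>x. _ * x"], rule sum.cong[OF refl], rule arg_cong[of _ _ "\<lambda>x. _ * x"], rule sum.cong[OF refl],
      rule arg_cong[of _ _ "\<lambda>x. _ * x"], rule sum.cong[OF refl])
    fix a l k
    let ?x = "\<lambda>j. real k * real_of_int ((z(s := v)) j) / real p + real l * real_of_int ((z(s := 0)) j) / real q
        + real a * real_of_int ((if j = s then 1 else 0)) / real q"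
    have hs: "h s = (\<Sum>j\<in>{1..s}. h j * (if j = s then 1 else 0))" for h :: "nat \<Rightarrow> int"
      using assms(1) by (simp add: if_distrib[of "\<lambda>x. _ * x"] sum.delta' cong: if_cong)
    let ?ek = "\<lambda>h. expi (real k * real_of_int (dot s h z v) / real p)"
    let ?el = "\<lambda>h. expi (real l * real_of_int (dot s h z 0) / real q)"
    let ?ea = "\<lambda>h. expi (real a * real_of_int (h s) / real q)"
    have e: "?ek h * ?el h * ?ea h = expi (\<Sum>j\<in>{1..s}. real_of_int (h j) * ?x j)" for h
      using expi_dot_add[of h "\<lambda>_. 0" "{1..s}" "real k" "z(s := v)" "real p"]
        expi_dot_add[of h "\<lambda>j. real k * real_of_int ((z(s := v)) j) / real p" "{1..s}" "real l" "z(s := 0)" "real q"]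
        expi_dot_add[of h "\<lambda>j. real k * real_of_int ((z(s := v)) j) / real p + real l * real_of_int ((z(s := 0)) j) / real q" "{1..s}" "real a" "\<lambda>j. if j = s then 1 else 0" "real q"]
      unfolding dot_expand[OF assms(1)] hs[of h, symmetric] by simp
    have "?r h * ?ea h * ?el h * ?ek h = ?r h * (?ek h * ?el h * ?ea h)" for h by (simp only: mult_ac)
    then have "(\<Sum>\<^sub>\<infinity>h\<in>?H. ?r h * ?ea h * ?el h * ?ek h) = of_real ((\<gamma> s)\<^sup>2 * ker \<alpha> \<gamma> s ?x * sigma \<alpha> (?x s))"
      unfolding e by (simp only: infsum_ker[OF assms(1), of ?x])
    also have "ker \<alpha> \<gamma> s ?x = ?K k l"
      unfolding ker_def by (intro prod.cong) auto
    finally show "(\<Sum>\<^sub>\<infinity>h\<in>?H. ?r h * expi (real a * real_of_int (h s) / real q) *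
      expi (real l * real_of_int (dot s h z 0) / real q) * expi (real k * real_of_int (dot s h z v) / real p)) =
        of_real ((\<gamma> s)\<^sup>2 * ?K k l * sigma \<alpha> (real k * real_of_int v / real p + real a / real q))" by simp
  qed
  also have "\<dots> = complex_of_real ((\<gamma> s)\<^sup>2 / (real p * real q * real q) * (\<Sum>a<q. \<Sum>l<q. \<Sum>k<p. ?K k l * sigma \<alpha> (real k * real_of_int v / real p + real a / real q)))"
    by (simp add: sum_distrib_left mult_ac)
  finally have "(\<Sum>\<^sub>\<infinity>h\<in>?E. r_weight \<alpha> \<gamma> h powr (-2)) = (\<gamma> s)\<^sup>2 / (real p * real q * real q) *
      (\<Sum>a<q. \<Sum>l<q. \<Sum>k<p. ?K k l * sigma \<alpha> (real k * real_of_int v / real p + real a / real q))"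
    by (simp only: of_real_eq_iff)
  also have "(\<Sum>a<q. \<Sum>l<q. \<Sum>k<p. ?K k l * sigma \<alpha> (real k * real_of_int v / real p + real a / real q)) =
      (\<Sum>l<q. \<Sum>k<p. ?K k l * (\<Sum>a<q. sigma \<alpha> (real k * real_of_int v / real p + real a / real q)))"
  proof -
    have "(\<Sum>a<q. \<Sum>l<q. \<Sum>k<p. g a l k) = (\<Sum>l<q. \<Sum>k<p. \<Sum>a<q. g a l k)" for g :: "nat \<Rightarrow> nat \<Rightarrow> nat \<Rightarrow> real"
      by (subst sum.swap) (intro sum.cong refl sum.swap)
    then show ?thesis unfolding sum_distrib_left .
  qed
  \<comment> \<open>The character index \<open>a\<close> belonging to \<open>q dvd h s\<close>
    shifts only the argument of the last factor, so the sum over it has a closed form.\<close>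
  also have "\<dots> = (\<Sum>l<q. \<Sum>k<p. ?K k l * (real q powr (1 - 2 * \<alpha>) * sigma \<alpha> (real q * (real k * real_of_int v / real p))))"
    by (simp only: sum_sigma_shift[OF \<alpha> assms(3)])
  also have "\<dots> = real q powr (1 - 2 * \<alpha>) * (\<Sum>k<p. (\<Sum>l<q. ?K k l) * sigma \<alpha> (real q * (real k * real_of_int v / real p)))"
    by (subst sum.swap) (simp add: sum_distrib_left sum_distrib_right mult_ac)
  also have "real q powr (1 - 2 * \<alpha>) = real q * real q powr (- (2 * \<alpha>))"
    using assms(3) powr_add[of "real q" 1 "- (2 * \<alpha>)"] by simp
  finally show ?thesis unfolding set using assms(3) by (simp add: field_simps)
qed

end

section \<open>The averaging argument\<close>

text \<open>Every term is at most the total \<open>S\<close>, hence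
  \<open>g x powr b \<le> S powr (b - 1) * g x\<close>. This moves estimates for
  \<open>r powr (-2)\<close> to the exponent \<open>1 / lam\<close>.\<close>

lemma infsum_powr_le:
  fixes g :: "'a \<Rightarrow> real"
  assumes "g summable_on A" "\<And>x. x \<in> A \<Longrightarrow> 0 \<le> g x" "1 \<le> b"
  shows "(\<lambda>x. g x powr b) summable_on A" "(\<Sum>\<^sub>\<infinity>x\<in>A. g x powr b) \<le> (\<Sum>\<^sub>\<infinity>x\<in>A. g x) powr b"
proof -
  define S where "S = (\<Sum>\<^sub>\<infinity>x\<in>A. g x)"
  have le: "g x powr b \<le> S powr (b - 1) * g x" if x: "x \<in> A" for x
  proof (cases "g x = 0")
    case False
    then have pos: "0 < g x" using assms(2)[OF x] by simp
    have "infsum g {x} \<le> S"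
      unfolding S_def by (rule infsum_mono_neutral) (use assms x in auto)
    then have "g x \<le> S" by simp
    then have "g x powr (b - 1) \<le> S powr (b - 1)" using pos assms(3) by (intro powr_mono2) auto
    then have "g x powr (b - 1) * g x \<le> S powr (b - 1) * g x" using pos by simp
    then show ?thesis using pos powr_add[of "g x" "b - 1" 1] by simp
  qed simp
  show sm: "(\<lambda>x. g x powr b) summable_on A"
    by (rule summable_on_comparison_test[OF summable_on_cmult_right[OF assms(1)]]) (use le in auto)
  have "(\<Sum>\<^sub>\<infinity>x\<in>A. g x powr b) \<le> (\<Sum>\<^sub>\<infinity>x\<in>A. S powr (b - 1) * g x)"
    by (rule infsum_mono[OF sm summable_on_cmult_right[OF assms(1)]]) (rule le)
  also have "\<dots> = S powr (b - 1) * S" by (simp add: infsum_cmult_right' S_def)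
  also have "\<dots> = S powr b"
  proof (cases "S = 0")
    case False
    moreover have "0 \<le> S" unfolding S_def by (rule infsum_nonneg) (rule assms(2))
    ultimately have "0 < S" by simp
    then show ?thesis using powr_add[of S "b - 1" 1] by simp
  qed simp
  finally show "(\<Sum>\<^sub>\<infinity>x\<in>A. g x powr b) \<le> (\<Sum>\<^sub>\<infinity>x\<in>A. g x) powr b" unfolding S_def .
qed

lemma finite_primes_P [simp]: "finite (primes_P n)"
  by (rule finite_subset[of _ "{..n}"]) (auto simp: primes_P_def)

text \<open>The primes lie above \<open>n / 2\<close> and up to \<open>n\<close>, an interval with
  no more integers than the size of any of its members. The first bound lets the number of partners
  \<open>q\<close> of \<open>p\<close> be paid for by the number of residues modulo
  \<open>p\<close>.\<close>

lemma card_primes_P_le: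
  assumes "p \<in> primes_P n"
  shows "card (primes_P n) \<le> p" "real (card (primes_P n)) \<le> real n"
proof -
  have "primes_P n \<subseteq> {n div 2<..n}"
    by (auto simp: primes_P_def)
  then have "card (primes_P n) \<le> card {n div 2<..n}" by (intro card_mono) auto
  also have "\<dots> = n - n div 2" by simp
  finally have c: "card (primes_P n) \<le> n - n div 2" .
  have "n div 2 < p" using assms by (auto simp: primes_P_def)
  then show "card (primes_P n) \<le> p" using c by linarith
  show "real (card (primes_P n)) \<le> real n" using c by linarith
qed

lemma primes_P_D:
  assumes "p \<in> primes_P n"
  shows "prime p" "real n / 2 < real p" "p \<le> n" "0 < p" "2 \<le> p"
  using assms prime_ge_2_nat[of p] by (auto simp: primes_P_def prime_gt_0_nat)

text \<open>For two solutions \<open>p\<close> divides \<open>h s * (v - u)\<close>; here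
  \<open>h s\<close> can be cancelled, and residues below \<open>p\<close> are then equal.\<close>

lemma card_dvd_dot:
  assumes "prime p" "G \<subseteq> {0..<int p}" "\<not> int p dvd h s"
  shows "card {v \<in> G. int p dvd dot s h z v} \<le> 1"
proof -
  have fin: "finite G" using assms(2) finite_subset by blast
  have "v = u" if "v \<in> G" "u \<in> G" "int p dvd dot s h z v" "int p dvd dot s h z u" for u v
  proof -
    have "int p dvd dot s h z v - dot s h z u" using that by simp
    also have "dot s h z v - dot s h z u = h s * (v - u)" by (simp add: dot_def algebra_simps)
    finally have "int p dvd v - u" using assms(1,3) by (simp add: prime_dvd_mult_iff)
    moreover have "v \<in> {0..<int p}" "u \<in> {0..<int p}" using that assms(2) by auto
    then have "\<bar>v - u\<bar> < int p" by auto
    ultimately show ?thesis using zdvd_not_zless[of "\<bar>v - u\<bar>" "int p"] by fastforce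
  qed
  then show ?thesis using fin card_le_Suc0_iff_eq[of "{v \<in> G. int p dvd dot s h z v}"] by auto
qed

lemma sum_infsum_count:
  fixes f :: "(nat \<Rightarrow> int) \<Rightarrow> real"
  assumes "finite V" "f summable_on H"
  shows "(\<Sum>v\<in>V. \<Sum>\<^sub>\<infinity>h\<in>{h \<in> H. P h v}. f h) = (\<Sum>\<^sub>\<infinity>h\<in>H. real (card {v \<in> V. P h v}) * f h)"
    "(\<lambda>h. real (card {v \<in> V. P h v}) * f h) summable_on H"
proof -
  let ?g = "\<lambda>v h. if P h v then f h else 0"
  have sm: "?g v summable_on H" for v
  proof -
    have "f summable_on {h \<in> H. P h v}" by (rule summable_on_subset[OF assms(2)]) auto
    then show ?thesis by (rule summable_on_cong_neutral[THEN iffD1, rotated -1]) auto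
  qed
  have cnt: "(\<Sum>v\<in>V. ?g v h) = real (card {v \<in> V. P h v}) * f h" for h
    using assms(1) by (simp add: sum.If_cases Int_def)
  have "(\<Sum>v\<in>V. \<Sum>\<^sub>\<infinity>h\<in>{h \<in> H. P h v}. f h) = (\<Sum>v\<in>V. \<Sum>\<^sub>\<infinity>h\<in>H. ?g v h)"
    by (intro sum.cong refl infsum_cong_neutral) auto
  also have "\<dots> = (\<Sum>\<^sub>\<infinity>h\<in>H. \<Sum>v\<in>V. ?g v h)"
    using infsum_finite_sum[of V ?g H] assms(1) sm by simp
  finally show "(\<Sum>v\<in>V. \<Sum>\<^sub>\<infinity>h\<in>{h \<in> H. P h v}. f h) = (\<Sum>\<^sub>\<infinity>h\<in>H. real (card {v \<in> V. P h v}) * f h)"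
    by (simp only: cnt)
  show "(\<lambda>h. real (card {v \<in> V. P h v}) * f h) summable_on H"
    using infsum_finite_sum[of V ?g H] assms(1) sm by (simp only: cnt)
qed

definition pair_sum :: "real \<Rightarrow> (nat \<Rightarrow> real) \<Rightarrow> nat \<Rightarrow> (nat \<Rightarrow> int) \<Rightarrow> nat \<Rightarrow> nat \<Rightarrow> real" where
  "pair_sum \<alpha> \<gamma> d z p q = (\<Sum>\<^sub>\<infinity>h\<in>{h \<in> Zvec d - {\<lambda>_. 0}. int p dvd (\<Sum>j\<in>{1..d}. h j * z j) \<and>
      int q dvd (\<Sum>j\<in>{1..d}. h j * z j)}. r_weight \<alpha> \<gamma> h powr (-2))"

text \<open>The first summand comes from \<open>theta\<close> and the smaller primes, the second
  from the larger ones. In \<open>4 / (1 - \<tau>)\<close> one factor 2 is from the average of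
  \<open>theta\<close>, the other from \<open>p > n / 2\<close>. The divisions by \<tau> come from
  replacing \<open>p\<close> by \<open>card G / \<tau>\<close>.\<close>

definition K0 :: "real \<Rightarrow> real \<Rightarrow> real" where
  "K0 lam \<tau> = (1 + 2 / \<tau>) * (4 / (1 - \<tau>)) powr (2 * lam) + (2 / \<tau> + 4) * 2 powr (2 * lam)"

context
  fixes \<alpha> lam :: real and \<gamma> :: "nat \<Rightarrow> real"
  assumes lam: "1 / 2 \<le> lam" "lam < \<alpha>" and \<gamma>: "\<And>j. 1 \<le> j \<Longrightarrow> 0 < \<gamma> j"
begin

text \<open>The exponent is that of \<open>mu_sum\<close>. It is summable because
  \<open>\<alpha> / lam > 1\<close>, and \<open>rho h powr (2 * lam)\<close> is
  \<open>r powr (-2)\<close> with \<open>2 * lam \<ge> 1\<close>, as \<open>infsum_powr_le\<close>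
  requires.\<close>

definition rho :: "(nat \<Rightarrow> int) \<Rightarrow> real" where
  "rho h = r_weight \<alpha> \<gamma> h powr (- (1 / lam))"

text \<open>The share in \<open>mu_sum\<close> of the frequencies whose last nonzero component is
  the one at \<open>s\<close>.\<close>

definition M :: "nat \<Rightarrow> real" where
  "M s = (\<Sum>\<^sub>\<infinity>h\<in>{h \<in> Zvec s. h s \<noteq> 0}. rho h)"

lemma rho_nonneg: "0 \<le> rho h"
  by (simp add: rho_def)

lemma rho_summable: "H \<subseteq> Zvec s \<Longrightarrow> rho summable_on H"
  unfolding rho_def
  using summable_on_subset[OF r_weight_powr_summable[of \<gamma> \<alpha> "1 / lam" s, OF \<gamma>]] lam
  by (simp add: field_simps)

lemma rho_powr: "r_weight \<alpha> \<gamma> h powr (-2) = rho h powr (2 * lam)"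
  using lam by (simp add: rho_def powr_powr)

lemma rw2_summable: "H \<subseteq> Zvec s \<Longrightarrow> (\<lambda>h. r_weight \<alpha> \<gamma> h powr (-2)) summable_on H"
  unfolding rho_powr by (rule infsum_powr_le) (use lam rho_summable rho_nonneg in auto)

lemma rw2_le:
  assumes "H \<subseteq> Zvec s"
  shows "(\<Sum>\<^sub>\<infinity>h\<in>H. r_weight \<alpha> \<gamma> h powr (-2)) \<le> (\<Sum>\<^sub>\<infinity>h\<in>H. rho h) powr (2 * lam)"
  unfolding rho_powr
  by (rule infsum_powr_le) (use lam rho_summable[OF assms] rho_nonneg in auto)

lemma M_nonneg: "0 \<le> M s"
  unfolding M_def by (rule infsum_nonneg) (rule rho_nonneg)

text \<open>Multiplying \<open>h s\<close> by \<open>m\<close> multiplies \<open>rho\<close> by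
  \<open>m powr (- (\<alpha> / lam))\<close>, which is at most \<open>1 / m\<close>.\<close>

lemma rho_dvd_sum:
  assumes "1 \<le> s" "0 < m"
  shows "(\<Sum>\<^sub>\<infinity>h\<in>{h \<in> Zvec s. h s \<noteq> 0 \<and> int m dvd h s}. rho h) \<le> M s / real m"
proof -
  let ?A = "{h \<in> Zvec s. h s \<noteq> 0}" and ?B = "{h \<in> Zvec s. h s \<noteq> 0 \<and> int m dvd h s}"
  let ?f = "\<lambda>h. h(s := int m * h s)"
  have bij: "bij_betw ?f ?A ?B"
    using assms by (intro bij_betw_byWitness[where f' = "\<lambda>h. h(s := h s div int m)"]) (auto simp: Zvec_def)
  have eq: "rho (?f h) = real m powr (- (\<alpha> * (1 / lam))) * rho h" if h: "h \<in> ?A" for h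
  proof -
    let ?w = "\<lambda>j. kor_wt (\<gamma> j powr (1 / lam)) (\<alpha> * (1 / lam))"
    have rho: "rho g = ?w s (g s) * (\<Prod>j\<in>{1..<s}. ?w j (g j))" if "g \<in> Zvec s" for g
    proof -
      have "{1..s} = insert s {1..<s}" using assms by auto
      moreover have "r_weight \<alpha> \<gamma> g powr (- (1 / lam)) = (\<Prod>j\<in>{1..s}. ?w j (g j))"
        by (rule r_weight_powr[OF _ that]) (rule \<gamma>)
      ultimately show ?thesis unfolding rho_def by simp
    qed
    have "?f h \<in> Zvec s" using h assms(1) by (auto simp: Zvec_def)
    note fh = rho[OF this]
    have "(\<Prod>j\<in>{1..<s}. ?w j (?f h j)) = (\<Prod>j\<in>{1..<s}. ?w j (h j))"
      by (rule prod.cong) auto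
    then have "rho (?f h) = ?w s (int m * h s) * (\<Prod>j\<in>{1..<s}. ?w j (h j))"
      using fh by (simp del: fun_upd_apply add: fun_upd_same)
    moreover have "?w s (int m * h s) = real m powr (- (\<alpha> * (1 / lam))) * ?w s (h s)"
      using h assms by (simp add: kor_wt_def abs_mult powr_mult)
    ultimately show ?thesis using rho[of h] h by simp
  qed
  have "infsum rho ?B = (\<Sum>\<^sub>\<infinity>h\<in>?A. rho (?f h))"
    by (rule infsum_reindex_bij_betw[OF bij, symmetric])
  also have "\<dots> = (\<Sum>\<^sub>\<infinity>h\<in>?A. real m powr (- (\<alpha> * (1 / lam))) * rho h)"
    by (rule infsum_cong) (rule eq)
  also have "\<dots> = real m powr (- (\<alpha> * (1 / lam))) * M s"
    unfolding M_def by (rule infsum_cmult_right')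
  also have "\<dots> \<le> real m powr (- 1) * M s"
    using lam assms(2) M_nonneg by (intro mult_right_mono powr_mono) (auto simp: field_simps)
  also have "\<dots> = M s / real m" using assms(2) by (simp add: powr_minus_divide)
  finally show ?thesis .
qed

lemma rw2_dvd_sum:
  assumes "1 \<le> s" "0 < m" "H \<subseteq> {h \<in> Zvec s. h s \<noteq> 0 \<and> int m dvd h s}"
  shows "(\<Sum>\<^sub>\<infinity>h\<in>H. r_weight \<alpha> \<gamma> h powr (-2)) \<le> real m powr (- (2 * lam)) * M s powr (2 * lam)"
proof -
  have HZ: "H \<subseteq> Zvec s" using assms(3) by auto
  have "(\<Sum>\<^sub>\<infinity>h\<in>H. rho h) \<le> (\<Sum>\<^sub>\<infinity>h\<in>{h \<in> Zvec s. h s \<noteq> 0 \<and> int m dvd h s}. rho h)"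
    by (rule infsum_mono_neutral) (use assms(3) rho_nonneg in \<open>auto intro!: rho_summable[of _ s]\<close>)
  also have "\<dots> \<le> M s / real m" by (rule rho_dvd_sum[OF assms(1,2)])
  finally have "(\<Sum>\<^sub>\<infinity>h\<in>H. rho h) powr (2 * lam) \<le> (M s / real m) powr (2 * lam)"
    using lam by (intro powr_mono2 infsum_nonneg rho_nonneg) auto
  also have "\<dots> = real m powr (- (2 * lam)) * M s powr (2 * lam)"
    using assms(2) M_nonneg by (simp add: powr_divide powr_minus_divide)
  finally show ?thesis using rw2_le[OF HZ] by simp
qed

text \<open>
  Frequencies with \<open>p\<close> not dividing the last component are met by at most one residue, the others
  possibly by all, but they are rare.
\<close>

lemma sum_infsum_dot_le:
  fixes f :: "(nat \<Rightarrow> int) \<Rightarrow> real"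
  assumes "prime p" "G \<subseteq> {0..<int p}" "f summable_on H" "\<And>h. h \<in> H \<Longrightarrow> 0 \<le> f h"
  shows "(\<Sum>v\<in>G. \<Sum>\<^sub>\<infinity>h\<in>{h \<in> H. int p dvd dot s h z v}. f h) \<le>
    (\<Sum>\<^sub>\<infinity>h\<in>H. f h) + real (card G) * (\<Sum>\<^sub>\<infinity>h\<in>{h \<in> H. int p dvd h s}. f h)"
proof -
  have fin: "finite G" using assms(2) finite_subset by blast
  note c = sum_infsum_count[OF fin assms(3), of "\<lambda>h v. int p dvd dot s h z v"]
  let ?g = "\<lambda>h. if int p dvd h s then real (card G) * f h else 0"
  have "(\<lambda>h. real (card G) * f h) summable_on {h \<in> H. int p dvd h s}"
    by (rule summable_on_cmult_right) (rule summable_on_subset[OF assms(3)], auto)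
  then have gs: "?g summable_on H"
    by (rule summable_on_cong_neutral[THEN iffD1, rotated -1]) auto
  have "(\<Sum>\<^sub>\<infinity>h\<in>H. real (card {v \<in> G. int p dvd dot s h z v}) * f h) \<le> (\<Sum>\<^sub>\<infinity>h\<in>H. f h + ?g h)"
  proof (rule infsum_mono[OF c(2) summable_on_add[OF assms(3) gs]])
    fix h assume h: "h \<in> H"
    show "real (card {v \<in> G. int p dvd dot s h z v}) * f h \<le> f h + ?g h"
    proof (cases "int p dvd h s")
      case True
      have "card {v \<in> G. int p dvd dot s h z v} \<le> card G" using fin by (intro card_mono) auto
      then have "real (card {v \<in> G. int p dvd dot s h z v}) * f h \<le> real (card G) * f h"
        using assms(4)[OF h] by (intro mult_right_mono) auto
      then show ?thesis using True assms(4)[OF h] by simp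
    next
      case False
      have "real (card {v \<in> G. int p dvd dot s h z v}) * f h \<le> 1 * f h"
        using card_dvd_dot[where h = h and s = s and z = z, OF assms(1,2) False] assms(4)[OF h]
        by (intro mult_right_mono) auto
      then show ?thesis using False by simp
    qed
  qed
  also have "\<dots> = (\<Sum>\<^sub>\<infinity>h\<in>H. f h) + (\<Sum>\<^sub>\<infinity>h\<in>H. ?g h)"
    by (rule infsum_add[OF assms(3) gs])
  also have "(\<Sum>\<^sub>\<infinity>h\<in>H. ?g h) = (\<Sum>\<^sub>\<infinity>h\<in>{h \<in> H. int p dvd h s}. real (card G) * f h)"
    by (rule infsum_cong_neutral) auto
  also have "\<dots> = real (card G) * (\<Sum>\<^sub>\<infinity>h\<in>{h \<in> H. int p dvd h s}. f h)"
    by (rule infsum_cmult_right')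
  finally show ?thesis using c(1) by simp
qed

text \<open>If at least \<open>(1 - \<tau>) * p\<close> residues have a sum of \<open>rho\<close> no
  smaller than some value, while the sums of all residues total at most \<open>2 * M s\<close>, then
  this value is at most the base of the power.\<close>

definition Theta :: "real \<Rightarrow> nat \<Rightarrow> nat \<Rightarrow> real" where
  "Theta \<tau> s p = (2 * M s / ((1 - \<tau>) * real p)) powr (2 * lam)"

lemma theta_le:
  assumes "smallest_theta \<alpha> \<gamma> \<tau> s z p G" "prime p" "1 \<le> s" "v \<in> G" "0 < \<tau>" "\<tau> < 1"
  shows "theta \<alpha> \<gamma> s z p v \<le> Theta \<tau> s p"
proof -
  have p0: "0 < p" using assms(2) prime_gt_0_nat by simp
  have G: "G \<subseteq> {0..<int p}" "int (card G) = \<lceil>\<tau> * real p\<rceil>"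
    and ord: "\<And>u. u \<in> {0..<int p} - G \<Longrightarrow> theta \<alpha> \<gamma> s z p v \<le> theta \<alpha> \<gamma> s z p u"
    using assms(1,4) by (auto simp: smallest_theta_def)
  have fin: "finite G" using G(1) finite_subset by blast
  let ?H = "{h \<in> Zvec s. h s \<noteq> 0}"
  define t where "t u = (\<Sum>\<^sub>\<infinity>h\<in>{h \<in> ?H. int p dvd dot s h z u}. rho h)" for u
  have t0: "0 \<le> t u" for u unfolding t_def by (rule infsum_nonneg) (rule rho_nonneg)
  have th: "theta \<alpha> \<gamma> s z p u \<le> t u powr (2 * lam)" for u
    using rw2_le[of "{h \<in> ?H. int p dvd dot s h z u}" s] by (auto simp: theta_def t_def conj_assoc)
  let ?x = "theta \<alpha> \<gamma> s z p v"
  have x0: "0 \<le> ?x" unfolding theta_def by (rule infsum_nonneg) simp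
  have le: "?x powr (1 / (2 * lam)) \<le> t u" if "?x \<le> theta \<alpha> \<gamma> s z p u" for u
  proof -
    have "?x powr (1 / (2 * lam)) \<le> (t u powr (2 * lam)) powr (1 / (2 * lam))"
      using that th[of u] x0 lam by (intro powr_mono2) auto
    also have "\<dots> = t u" using lam t0 by (simp add: powr_powr)
    finally show ?thesis .
  qed
  \<comment> \<open>\<open>v\<close> is counted among the residues no better than itself. The extra
    element makes up for the ceiling in \<open>card G\<close>, so that \<open>?U\<close> has at
    least \<open>(1 - \<tau>) * p\<close> elements.\<close>
  let ?U = "insert v ({0..<int p} - G)"
  have cU: "card ?U = p - card G + 1"
    using assms(4) fin G(1) by (simp add: card_Diff_subset)
  have "card G \<le> p" using card_mono[OF _ G(1)] by simp
  then have "real (card ?U) = real p - real (card G) + 1" using cU by simp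
  moreover have "real (card G) \<le> \<tau> * real p + 1"
    using G(2) of_int_ceiling_le_add_one[of "\<tau> * real p"] by (metis of_int_of_nat_eq)
  ultimately have c: "(1 - \<tau>) * real p \<le> real (card ?U)" by (simp add: algebra_simps)
  have "(1 - \<tau>) * real p * ?x powr (1 / (2 * lam)) \<le> real (card ?U) * ?x powr (1 / (2 * lam))"
    by (rule mult_right_mono[OF c]) simp
  also have "\<dots> = (\<Sum>u\<in>?U. ?x powr (1 / (2 * lam)))" by simp
  also have "\<dots> \<le> (\<Sum>u\<in>?U. t u)"
    by (rule sum_mono) (use le ord in auto)
  also have "\<dots> \<le> (\<Sum>u\<in>{0..<int p}. t u)"
    by (rule sum_mono2) (use assms(4) G(1) t0 in auto)
  also have "\<dots> \<le> (\<Sum>\<^sub>\<infinity>h\<in>?H. rho h) + real (card {0..<int p}) * (\<Sum>\<^sub>\<infinity>h\<in>{h \<in> ?H. int p dvd h s}. rho h)"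
    unfolding t_def
    by (rule sum_infsum_dot_le[OF assms(2)]) (auto intro!: rho_summable[of _ s] rho_nonneg)
  \<comment> \<open>Frequencies with \<open>p\<close> dividing \<open>h s\<close> may be met by all
    \<open>p\<close> residues, but carry at most the fraction \<open>1 / p\<close> of the sum; hence
    the factor 2.\<close>
  also have "\<dots> \<le> M s + real p * (M s / real p)"
    using rho_dvd_sum[OF assms(3) p0]
    by (intro add_mono mult_mono) (auto simp: M_def conj_assoc intro!: infsum_nonneg rho_nonneg)
  also have "\<dots> = 2 * M s" using p0 by simp
  finally have "?x powr (1 / (2 * lam)) \<le> 2 * M s / ((1 - \<tau>) * real p)"
    using p0 assms(6) by (simp add: field_simps)
  then have "(?x powr (1 / (2 * lam))) powr (2 * lam) \<le> Theta \<tau> s p"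
    unfolding Theta_def using lam by (intro powr_mono2) auto
  then show ?thesis using lam x0 by (simp add: powr_powr)
qed

lemma Theta_le:
  assumes "p \<in> primes_P n" "0 < n" "0 < \<tau>" "\<tau> < 1"
  shows "Theta \<tau> s p \<le> (4 / (1 - \<tau>)) powr (2 * lam) * (real n powr (- (2 * lam)) * M s powr (2 * lam))"
proof -
  note p = primes_P_D[OF assms(1)]
  have "2 * M s / ((1 - \<tau>) * real p) \<le> 2 * M s / ((1 - \<tau>) * (real n / 2))"
    using assms p M_nonneg by (intro divide_left_mono mult_left_mono mult_pos_pos) auto
  also have "\<dots> = 4 / (1 - \<tau>) * (M s / real n)" by simp
  finally have "Theta \<tau> s p \<le> (4 / (1 - \<tau>) * (M s / real n)) powr (2 * lam)"
    unfolding Theta_def using lam M_nonneg[of s] assms p(4) by (intro powr_mono2) auto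
  also have "\<dots> = (4 / (1 - \<tau>)) powr (2 * lam) * (M s / real n) powr (2 * lam)"
    using assms M_nonneg by (intro powr_mult) 
  also have "(M s / real n) powr (2 * lam) = real n powr (- (2 * lam)) * M s powr (2 * lam)"
    using assms M_nonneg by (simp add: powr_divide powr_minus_divide)
  finally show ?thesis .
qed

lemma prime_powr_le:
  assumes "p \<in> primes_P n" "0 < n"
  shows "real p powr (- (2 * lam)) \<le> 2 powr (2 * lam) * real n powr (- (2 * lam))"
proof -
  note p = primes_P_D[OF assms(1)]
  have "real p powr (- (2 * lam)) \<le> (real n / 2) powr (- (2 * lam))"
    using p lam assms by (intro powr_mono2') auto
  also have "\<dots> = 2 powr (2 * lam) * real n powr (- (2 * lam))"
    by (simp add: powr_divide powr_minus_divide field_simps)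
  finally show ?thesis .
qed

text \<open>For \<open>q\<close> one power suffices:
  \<open>q powr (- (2 * lam)) \<le> 2 / n\<close>, and there are at most \<open>n\<close>
  primes.\<close>

lemma sum_pq_powr_le:
  assumes "p \<in> primes_P n" "0 < n" "X \<subseteq> primes_P n"
  shows "(\<Sum>q\<in>X. real (p * q) powr (- (2 * lam))) \<le> 2 * (2 powr (2 * lam) * real n powr (- (2 * lam)))"
proof -
  have fin: "finite X" by (rule finite_subset[OF assms(3) finite_primes_P])
  have "real (p * q) powr (- (2 * lam)) \<le> (2 powr (2 * lam) * real n powr (- (2 * lam))) * (2 / real n)"
    if "q \<in> X" for q
  proof -
    have qP: "q \<in> primes_P n" using that assms(3) by auto
    note q = primes_P_D[OF qP]
    have "real q powr (- (2 * lam)) \<le> real q powr (-1)"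
      using q lam by (intro powr_mono) auto
    also have "\<dots> = 1 / real q" using q by (simp add: powr_minus_divide)
    also have "\<dots> \<le> 2 / real n" using q assms(2) by (simp add: field_simps)
    finally have "real q powr (- (2 * lam)) \<le> 2 / real n" .
    then show ?thesis using prime_powr_le[OF assms(1,2)]
      unfolding of_nat_mult powr_mult by (intro mult_mono) auto
  qed
  then have "(\<Sum>q\<in>X. real (p * q) powr (- (2 * lam))) \<le>
      real (card X) * ((2 powr (2 * lam) * real n powr (- (2 * lam))) * (2 / real n))"
    by (rule sum_bounded_above)
  also have "\<dots> \<le> real n * ((2 powr (2 * lam) * real n powr (- (2 * lam))) * (2 / real n))"
  proof (rule mult_right_mono)
    have "card X \<le> card (primes_P n)" using assms(3) by (intro card_mono) auto
    then show "real (card X) \<le> real n" using card_primes_P_le(2)[OF assms(1)] by linarith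
  qed simp
  also have "\<dots> = 2 * (2 powr (2 * lam) * real n powr (- (2 * lam)))" using assms(2) by simp
  finally show ?thesis .
qed

text \<open>The minimum over \<open>G\<close> is at most the mean. For smaller \<open>q\<close> each
  frequency is met by at most one residue, and the total is bounded by \<open>theta\<close> at
  \<open>w q\<close>. For larger \<open>q\<close> the divisibility of \<open>h s\<close> by
  \<open>q\<close> makes the sum small by itself. These bounds hold for each \<open>q\<close>, and
  there are at most \<open>p \<le> card G / \<tau>\<close> of them.\<close>

lemma T_crit_le:
  assumes sel: "selected \<alpha> \<gamma> \<tau> n s z p w v" and p: "p \<in> primes_P n"
    and sels: "\<And>q. q \<in> primes_P n \<Longrightarrow> q < p \<Longrightarrow> theta \<alpha> \<gamma> s z q (w q) \<le> Theta \<tau> s q"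
    and s: "1 \<le> s" and \<tau>: "0 < \<tau>" "\<tau> < 1" and n: "0 < n"
  shows "T_crit \<alpha> \<gamma> n s z p v w \<le> K0 lam \<tau> * (real n powr (- (2 * lam)) * M s powr (2 * lam))"
proof -
  define c where "c = real n powr (- (2 * lam)) * M s powr (2 * lam)"
  have c0: "0 \<le> c" by (simp add: c_def)
  note pp = primes_P_D[OF p]
  obtain G where G: "smallest_theta \<alpha> \<gamma> \<tau> s z p G" "v \<in> G"
    and min: "\<And>u. u \<in> G \<Longrightarrow> T_crit \<alpha> \<gamma> n s z p v w \<le> T_crit \<alpha> \<gamma> n s z p u w"
    using sel by (auto simp: selected_def)
  have Gp: "G \<subseteq> {0..<int p}" "int (card G) = \<lceil>\<tau> * real p\<rceil>"
    using G by (auto simp: smallest_theta_def)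
  have fin: "finite G" using Gp(1) finite_subset by blast
  have cG: "\<tau> * real p \<le> real (card G)"
    using Gp(2) le_of_int_ceiling[of "\<tau> * real p"] by (metis of_int_of_nat_eq)
  have cG0: "0 < real (card G)" using cG \<tau> pp(4) by (smt (verit) mult_pos_pos of_nat_0_less_iff)
  let ?R = "\<lambda>h. r_weight \<alpha> \<gamma> h powr (-2)"
  let ?P1 = "{q \<in> primes_P n. q < p}" and ?P2 = "{q \<in> primes_P n. p < q}"
  define A where "A q u = (\<Sum>\<^sub>\<infinity>h\<in>{h \<in> Zvec s. h s \<noteq> 0 \<and> \<not> int p dvd h s
                     \<and> int p dvd dot s h z u \<and> int q dvd dot s h z (w q)}. ?R h)" for q u
  define B where "B q u = (\<Sum>\<^sub>\<infinity>h\<in>{h \<in> Zvec s. h s \<noteq> 0 \<and> int q dvd h s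
                     \<and> int p dvd dot s h z u \<and> int q dvd (\<Sum>j\<in>{1..<s}. h j * z j)}. ?R h)" for q u
  have T: "T_crit \<alpha> \<gamma> n s z p u w = theta \<alpha> \<gamma> s z p u + 2 * (\<Sum>q\<in>?P1. A q u) + 2 * (\<Sum>q\<in>?P2. B q u)" for u
    by (simp add: T_crit_def A_def B_def)
  let ?Th = "(4 / (1 - \<tau>)) powr (2 * lam) * c"
  have thp: "(\<Sum>u\<in>G. theta \<alpha> \<gamma> s z p u) \<le> real (card G) * ?Th"
    using theta_le[OF G(1) pp(1) s _ \<tau>] Theta_le[OF p n \<tau>, of s]
    unfolding c_def by (intro sum_bounded_above) (meson order_trans)
  have A: "(\<Sum>u\<in>G. A q u) \<le> ?Th" if q: "q \<in> ?P1" for q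
  proof -
    let ?H = "{h \<in> Zvec s. h s \<noteq> 0 \<and> \<not> int p dvd h s \<and> int q dvd dot s h z (w q)}"
    have H: "?H \<subseteq> Zvec s" by auto
    have "(\<Sum>u\<in>G. A q u) = (\<Sum>u\<in>G. \<Sum>\<^sub>\<infinity>h\<in>{h \<in> ?H. int p dvd dot s h z u}. ?R h)"
      unfolding A_def by (intro sum.cong refl infsum_cong_neutral) auto
    also have "\<dots> \<le> (\<Sum>\<^sub>\<infinity>h\<in>?H. ?R h) + real (card G) * (\<Sum>\<^sub>\<infinity>h\<in>{h \<in> ?H. int p dvd h s}. ?R h)"
      by (rule sum_infsum_dot_le[OF pp(1) Gp(1) rw2_summable[OF H]]) simp
    \<comment> \<open>Here the condition on \<open>h s\<close> in the second part of
      \<open>T_crit\<close> pays off: no frequency is met by more than one residue.\<close>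
    also have "{h \<in> ?H. int p dvd h s} = {}" by auto
    also have "(\<Sum>\<^sub>\<infinity>h\<in>?H. ?R h) + real (card G) * (\<Sum>\<^sub>\<infinity>h\<in>{}. ?R h) \<le> theta \<alpha> \<gamma> s z q (w q)"
      unfolding theta_def
      by (simp, rule infsum_mono_neutral) (auto intro!: rw2_summable[of _ s])
    also have "\<dots> \<le> Theta \<tau> s q" using sels q by auto
    also have "\<dots> \<le> ?Th" using Theta_le[OF _ n \<tau>, of q s] q by (auto simp: c_def)
    finally show ?thesis .
  qed
  have B: "(\<Sum>u\<in>G. B q u) \<le> 2 powr (2 * lam) * c + real (card G) * (real (p * q) powr (- (2 * lam)) * M s powr (2 * lam))"
    if q: "q \<in> ?P2" for q
  proof -
    have qP: "q \<in> primes_P n" using q by auto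
    note qq = primes_P_D[OF qP]
    let ?H = "{h \<in> Zvec s. h s \<noteq> 0 \<and> int q dvd h s \<and> int q dvd (\<Sum>j\<in>{1..<s}. h j * z j)}"
    have H: "?H \<subseteq> Zvec s" by auto
    have pq: "coprime (int p) (int q)"
      using pp(1) qq(1) q by (auto simp: primes_coprime)
    have "(\<Sum>u\<in>G. B q u) = (\<Sum>u\<in>G. \<Sum>\<^sub>\<infinity>h\<in>{h \<in> ?H. int p dvd dot s h z u}. ?R h)"
      unfolding B_def by (intro sum.cong refl infsum_cong_neutral) auto
    also have "\<dots> \<le> (\<Sum>\<^sub>\<infinity>h\<in>?H. ?R h) + real (card G) * (\<Sum>\<^sub>\<infinity>h\<in>{h \<in> ?H. int p dvd h s}. ?R h)"
      by (rule sum_infsum_dot_le[OF pp(1) Gp(1) rw2_summable[OF H]]) simp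
    also have "\<dots> \<le> real q powr (- (2 * lam)) * M s powr (2 * lam) +
        real (card G) * (real (p * q) powr (- (2 * lam)) * M s powr (2 * lam))"
    proof (rule add_mono)
      show "(\<Sum>\<^sub>\<infinity>h\<in>?H. ?R h) \<le> real q powr (- (2 * lam)) * M s powr (2 * lam)"
        by (rule rw2_dvd_sum[OF s qq(4)]) auto
      have "(\<Sum>\<^sub>\<infinity>h\<in>{h \<in> ?H. int p dvd h s}. ?R h) \<le> real (p * q) powr (- (2 * lam)) * M s powr (2 * lam)"
        by (rule rw2_dvd_sum[OF s]) (use pp(4) qq(4) pq in \<open>auto intro: divides_mult\<close>)
      then show "real (card G) * (\<Sum>\<^sub>\<infinity>h\<in>{h \<in> ?H. int p dvd h s}. ?R h) \<le>
          real (card G) * (real (p * q) powr (- (2 * lam)) * M s powr (2 * lam))"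
        by (rule mult_left_mono) simp
    qed
    also have "real q powr (- (2 * lam)) * M s powr (2 * lam) \<le> 2 powr (2 * lam) * c"
      unfolding c_def mult.assoc[symmetric]
      by (rule mult_right_mono) (use prime_powr_le[OF qP n] in auto)
    finally show ?thesis by simp
  qed
  have cardP: "real (card X) \<le> real p" if "X \<subseteq> primes_P n" for X
    using card_mono[OF finite_primes_P that] card_primes_P_le(1)[OF p] by simp
  have "real (card G) * T_crit \<alpha> \<gamma> n s z p v w = (\<Sum>u\<in>G. T_crit \<alpha> \<gamma> n s z p v w)" by simp
  also have "\<dots> \<le> (\<Sum>u\<in>G. T_crit \<alpha> \<gamma> n s z p u w)" by (rule sum_mono) (rule min)
  also have "\<dots> = (\<Sum>u\<in>G. theta \<alpha> \<gamma> s z p u) + 2 * (\<Sum>q\<in>?P1. \<Sum>u\<in>G. A q u) + 2 * (\<Sum>q\<in>?P2. \<Sum>u\<in>G. B q u)"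
    unfolding T sum.distrib sum_distrib_left[symmetric]
    by (simp add: sum.swap[of _ G])
  also have "\<dots> \<le> real (card G) * ?Th + 2 * (\<Sum>q\<in>?P1. ?Th) +
      2 * (\<Sum>q\<in>?P2. 2 powr (2 * lam) * c + real (card G) * (real (p * q) powr (- (2 * lam)) * M s powr (2 * lam)))"
    using A B thp by (intro add_mono mult_left_mono sum_mono) auto
  also have "\<dots> = real (card G) * ?Th + 2 * (real (card ?P1) * ?Th) + 2 * (real (card ?P2) * (2 powr (2 * lam) * c)) +
      2 * (real (card G) * ((\<Sum>q\<in>?P2. real (p * q) powr (- (2 * lam))) * M s powr (2 * lam)))"
    by (simp add: sum.distrib sum_distrib_left sum_distrib_right algebra_simps)
  also have "\<dots> \<le> real (card G) * ?Th + 2 * (real p * ?Th) + 2 * (real p * (2 powr (2 * lam) * c)) +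
      2 * (real (card G) * ((2 * (2 powr (2 * lam) * real n powr (- (2 * lam)))) * M s powr (2 * lam)))"
  proof -
    have "(\<Sum>q\<in>?P2. real (p * q) powr (- (2 * lam))) \<le> 2 * (2 powr (2 * lam) * real n powr (- (2 * lam)))"
      by (rule sum_pq_powr_le[OF p n]) auto
    moreover have "real (card ?P1) \<le> real p" "real (card ?P2) \<le> real p"
      using cardP[of ?P1] cardP[of ?P2] by auto
    ultimately show ?thesis using c0
      by (intro add_mono mult_left_mono mult_right_mono order_refl) auto
  qed
  also have "\<dots> = real (card G) * ?Th + real p * (2 * ?Th + 2 * (2 powr (2 * lam) * c)) +
      real (card G) * (4 * (2 powr (2 * lam) * c))"
    by (simp add: c_def algebra_simps)
  also have "\<dots> \<le> real (card G) * ?Th + (real (card G) / \<tau>) * (2 * ?Th + 2 * (2 powr (2 * lam) * c)) +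
      real (card G) * (4 * (2 powr (2 * lam) * c))"
    using cG \<tau> c0 by (intro add_mono mult_right_mono order_refl) (auto simp: field_simps)
  also have "\<dots> = real (card G) * (K0 lam \<tau> * c)"
    by (simp add: K0_def algebra_simps add_divide_distrib)
  finally show ?thesis using cG0 unfolding c_def by simp
qed

definition cross :: "nat \<Rightarrow> (nat \<Rightarrow> int) \<Rightarrow> nat \<Rightarrow> nat \<Rightarrow> real" where
  "cross s z p q = (\<Sum>\<^sub>\<infinity>h\<in>{h \<in> Zvec s. h s \<noteq> 0 \<and> int p dvd dot s h z (z s) \<and> int q dvd dot s h z (z s)}.
      r_weight \<alpha> \<gamma> h powr (-2))"

lemma dvd_dot_mod: "int p dvd dot s h z (v mod int p) \<longleftrightarrow> int p dvd dot s h z v"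
proof -
  have "dot s h z v = dot s h z (v mod int p) + h s * (v - v mod int p)"
    by (simp add: dot_def algebra_simps)
  moreover have "int p dvd h s * (v - v mod int p)"
    by (intro dvd_mult dvd_minus_mod)
  ultimately show ?thesis by (simp add: dvd_add_left_iff)
qed

lemma dvd_dot_zero: "int q dvd h s \<Longrightarrow> int q dvd dot s h z v \<longleftrightarrow> int q dvd (\<Sum>j\<in>{1..<s}. h j * z j)"
  unfolding dot_def by (rule dvd_add_left_iff) simp

text \<open>The contribution of a pair \<open>q < p\<close> is split by whether \<open>p\<close>
  divides \<open>h s\<close>. If not, it is charged to \<open>p\<close>, when the residue for
  \<open>q\<close> is known. If so, the congruence modulo \<open>p\<close> involves earlier
  components only, and the frequency is charged to the smaller prime \<open>q\<close>, before a
  residue for \<open>p\<close> exists.\<close>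

lemma sum_cross:
  "(\<Sum>p\<in>primes_P n. \<Sum>q\<in>primes_P n. cross s z p q) =
     (\<Sum>p\<in>primes_P n. T_crit \<alpha> \<gamma> n s z p (z s mod int p) (\<lambda>q. z s mod int q))"
proof -
  let ?P = "primes_P n"
  let ?R = "\<lambda>h. r_weight \<alpha> \<gamma> h powr (-2)"
  define A where "A p q = (\<Sum>\<^sub>\<infinity>h\<in>{h \<in> Zvec s. h s \<noteq> 0 \<and> \<not> int p dvd h s
      \<and> int p dvd dot s h z (z s) \<and> int q dvd dot s h z (z s)}. ?R h)" for p q
  define B where "B p q = (\<Sum>\<^sub>\<infinity>h\<in>{h \<in> Zvec s. h s \<noteq> 0 \<and> int p dvd h s
      \<and> int p dvd dot s h z (z s) \<and> int q dvd dot s h z (z s)}. ?R h)" for p q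
  have AB: "cross s z p q = A p q + B p q" for p q
  proof -
    have "cross s z p q = infsum ?R ({h \<in> Zvec s. h s \<noteq> 0 \<and> \<not> int p dvd h s
      \<and> int p dvd dot s h z (z s) \<and> int q dvd dot s h z (z s)} \<union> {h \<in> Zvec s. h s \<noteq> 0 \<and> int p dvd h s
      \<and> int p dvd dot s h z (z s) \<and> int q dvd dot s h z (z s)})"
      unfolding cross_def by (rule arg_cong[of _ _ "infsum ?R"]) auto
    also have "\<dots> = A p q + B p q"
      unfolding A_def B_def by (rule infsum_Un_disjoint) (auto intro!: rw2_summable[of _ s])
    finally show ?thesis .
  qed
  have T: "T_crit \<alpha> \<gamma> n s z p (z s mod int p) (\<lambda>q. z s mod int q) =
      cross s z p p + 2 * (\<Sum>q\<in>{q \<in> ?P. q < p}. A p q) + 2 * (\<Sum>q\<in>{q \<in> ?P. p < q}. B q p)" for p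
  proof -
    have "B q p = (\<Sum>\<^sub>\<infinity>h\<in>{h \<in> Zvec s. h s \<noteq> 0 \<and> int q dvd h s
                     \<and> int p dvd dot s h z (z s) \<and> int q dvd (\<Sum>j\<in>{1..<s}. h j * z j)}. ?R h)" for q
      unfolding B_def by (rule infsum_cong_neutral) (auto simp: dvd_dot_zero)
    then show ?thesis
      unfolding T_crit_def theta_def A_def cross_def dvd_dot_mod by simp
  qed
  have csym: "cross s z p q = cross s z q p" for p q
    unfolding cross_def by (rule arg_cong[of _ _ "infsum ?R"]) auto
  have lt: "(\<Sum>p\<in>?P. \<Sum>q\<in>{q \<in> ?P. p < q}. f q p) = (\<Sum>p\<in>?P. \<Sum>q\<in>{q \<in> ?P. q < p}. f p q)"
    for f :: "nat \<Rightarrow> nat \<Rightarrow> real"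
    using sum.swap_restrict[of ?P ?P "\<lambda>p q. f q p" "\<lambda>p q. p < q"] by simp
  have split: "(\<Sum>q\<in>?P. cross s z p q) = cross s z p p + (\<Sum>q\<in>{q \<in> ?P. q < p}. cross s z p q) +
      (\<Sum>q\<in>{q \<in> ?P. p < q}. cross s z q p)" if "p \<in> ?P" for p
  proof -
    have U: "?P = {p} \<union> ({q \<in> ?P. q < p} \<union> {q \<in> ?P. p < q})" using that by auto
    have "(\<Sum>q\<in>?P. cross s z p q) = (\<Sum>q\<in>{p} \<union> ({q \<in> ?P. q < p} \<union> {q \<in> ?P. p < q}). cross s z p q)"
      by (rule arg_cong[OF U])
    also have "\<dots> = cross s z p p + ((\<Sum>q\<in>{q \<in> ?P. q < p}. cross s z p q) + (\<Sum>q\<in>{q \<in> ?P. p < q}. cross s z p q))"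
    proof -
      let ?f = "cross s z p"
      have "sum ?f ({p} \<union> ({q \<in> ?P. q < p} \<union> {q \<in> ?P. p < q})) = sum ?f {p} + sum ?f ({q \<in> ?P. q < p} \<union> {q \<in> ?P. p < q})"
        by (rule sum.union_disjoint) auto
      moreover have "sum ?f ({q \<in> ?P. q < p} \<union> {q \<in> ?P. p < q}) = sum ?f {q \<in> ?P. q < p} + sum ?f {q \<in> ?P. p < q}"
        by (rule sum.union_disjoint) auto
      ultimately show ?thesis by simp
    qed
    also have "(\<Sum>q\<in>{q \<in> ?P. p < q}. cross s z p q) = (\<Sum>q\<in>{q \<in> ?P. p < q}. cross s z q p)"
      by (rule sum.cong[OF refl csym])
    finally show ?thesis by simp
  qed
  have "(\<Sum>p\<in>?P. \<Sum>q\<in>?P. cross s z p q) = (\<Sum>p\<in>?P. cross s z p p) + 2 * (\<Sum>p\<in>?P. \<Sum>q\<in>{q \<in> ?P. q < p}. cross s z p q)"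
    using lt[of "cross s z"] by (simp add: split sum.distrib cong: sum.cong)
  moreover have "(\<Sum>p\<in>?P. T_crit \<alpha> \<gamma> n s z p (z s mod int p) (\<lambda>q. z s mod int q)) =
      (\<Sum>p\<in>?P. cross s z p p) + 2 * (\<Sum>p\<in>?P. \<Sum>q\<in>{q \<in> ?P. q < p}. cross s z p q)"
    using lt[of B] by (simp add: T sum.distrib AB[of _ "_ :: nat"] sum_distrib_left[symmetric])
  ultimately show ?thesis by simp
qed

text \<open>The first component is not selected. With \<open>z 1 = 1\<close> the two congruences for
  \<open>p \<noteq> q\<close> say that \<open>p * q\<close> divides \<open>h 1\<close>, which is
  estimated directly.\<close>

lemma cross_first:
  assumes "z 1 = 1" "p \<in> primes_P n" "0 < n" "0 < \<tau>" "\<tau> < 1"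
  shows "(\<Sum>q\<in>primes_P n. cross 1 z p q) \<le> K0 lam \<tau> * (real n powr (- (2 * lam)) * M 1 powr (2 * lam))"
proof -
  let ?c = "2 powr (2 * lam) * real n powr (- (2 * lam))"
  let ?Pp = "primes_P n - {p}"
  note p = primes_P_D[OF assms(2)]
  have dot1: "dot 1 h z (z 1) = h 1" for h using assms(1) by (simp add: dot_def)
  have "cross 1 z p p \<le> real p powr (- (2 * lam)) * M 1 powr (2 * lam)"
    unfolding cross_def dot1 by (rule rw2_dvd_sum) (use p in auto)
  also have "\<dots> \<le> ?c * M 1 powr (2 * lam)"
    by (rule mult_right_mono[OF prime_powr_le[OF assms(2,3)]]) simp
  finally have 1: "cross 1 z p p \<le> ?c * M 1 powr (2 * lam)" .
  have "(\<Sum>q\<in>?Pp. cross 1 z p q) \<le> (\<Sum>q\<in>?Pp. real (p * q) powr (- (2 * lam)) * M 1 powr (2 * lam))"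
  proof (rule sum_mono)
    fix q assume q: "q \<in> ?Pp"
    then have qP: "q \<in> primes_P n" by simp
    have "coprime (int p) (int q)"
      using p(1) primes_P_D(1)[OF qP] q by (auto simp: primes_coprime)
    then show "cross 1 z p q \<le> real (p * q) powr (- (2 * lam)) * M 1 powr (2 * lam)"
      unfolding cross_def dot1
      by (intro rw2_dvd_sum) (use p primes_P_D(4)[OF qP] in \<open>auto intro: divides_mult\<close>)
  qed
  also have "\<dots> = (\<Sum>q\<in>?Pp. real (p * q) powr (- (2 * lam))) * M 1 powr (2 * lam)"
    by (rule sum_distrib_right[symmetric])
  also have "\<dots> \<le> 2 * ?c * M 1 powr (2 * lam)"
    by (rule mult_right_mono[OF sum_pq_powr_le[OF assms(2,3)]]) auto
  finally have 2: "(\<Sum>q\<in>?Pp. cross 1 z p q) \<le> 2 * ?c * M 1 powr (2 * lam)" .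
  have "(\<Sum>q\<in>primes_P n. cross 1 z p q) = cross 1 z p p + (\<Sum>q\<in>?Pp. cross 1 z p q)"
    using assms(2) by (simp add: sum.remove)
  also have "\<dots> \<le> 4 * 2 powr (2 * lam) * (real n powr (- (2 * lam)) * M 1 powr (2 * lam))"
  proof -
    define e where "e = ?c * M 1 powr (2 * lam)"
    have "0 \<le> e" "2 * ?c * M 1 powr (2 * lam) = 2 * e"
      "4 * 2 powr (2 * lam) * (real n powr (- (2 * lam)) * M 1 powr (2 * lam)) = 4 * e"
      by (simp_all add: e_def)
    then show ?thesis using 1 2 unfolding e_def by linarith
  qed
  also have "\<dots> \<le> K0 lam \<tau> * (real n powr (- (2 * lam)) * M 1 powr (2 * lam))"
    unfolding K0_def using assms(4,5) by (intro mult_right_mono) (auto simp: algebra_simps)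
  finally show ?thesis .
qed

text \<open>Sorting by the last nonzero component turns the inner product into \<open>dot s\<close>.
  It is used with a trivial \<open>P\<close> for \<open>mu_sum\<close> and with two divisibilities
  for \<open>pair_sum\<close>.\<close>

lemma infsum_Zvec_last:
  fixes f :: "(nat \<Rightarrow> int) \<Rightarrow> real"
  assumes "\<And>d. f summable_on Zvec d"
  shows "(\<Sum>\<^sub>\<infinity>h\<in>{h \<in> Zvec d - {\<lambda>_. 0}. P (\<Sum>j\<in>{1..d}. h j * z j)}. f h) =
    (\<Sum>s\<in>{1..d}. \<Sum>\<^sub>\<infinity>h\<in>{h \<in> Zvec s. h s \<noteq> 0 \<and> P (dot s h z (z s))}. f h)"
proof (induction d)
  case 0
  then show ?case by (simp add: Zvec_0)
next
  case (Suc d)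
  let ?X = "{h \<in> Zvec d - {\<lambda>_. 0}. P (\<Sum>j\<in>{1..d}. h j * z j)}"
  let ?Y = "{h \<in> Zvec (Suc d). h (Suc d) \<noteq> 0 \<and> P (dot (Suc d) h z (z (Suc d)))}"
  have dot: "dot (Suc d) h z (z (Suc d)) = (\<Sum>j\<in>{1..Suc d}. h j * z j)" for h
    by (simp add: dot_expand)
  have Zd: "h \<in> Zvec d \<longleftrightarrow> h \<in> Zvec (Suc d) \<and> h (Suc d) = 0" for h :: "nat \<Rightarrow> int"
    by (auto simp: Zvec_def) (metis atLeastAtMost_iff le_Suc_eq)
  have "{h \<in> Zvec (Suc d) - {\<lambda>_. 0}. P (\<Sum>j\<in>{1..Suc d}. h j * z j)} = ?X \<union> ?Y"
    unfolding dot by (auto simp: Zd)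
  moreover have "infsum f (?X \<union> ?Y) = infsum f ?X + infsum f ?Y"
    by (rule infsum_Un_disjoint) (auto intro: summable_on_subset[OF assms] simp: Zd)
  ultimately show ?case using Suc by simp
qed

lemma mu_sum_M: "mu_sum d \<alpha> \<gamma> lam = (\<Sum>s\<in>{1..d}. M s)"
proof -
  have "infsum rho {h \<in> Zvec d - {\<lambda>_. 0}. True} = (\<Sum>s\<in>{1..d}. infsum rho {h \<in> Zvec s. h s \<noteq> 0 \<and> True})"
    by (rule infsum_Zvec_last) (rule rho_summable[OF order_refl])
  moreover have "{h \<in> Zvec d - {\<lambda>_. 0}. True} = Zvec d - {\<lambda>_. 0}" by auto
  ultimately show ?thesis unfolding mu_sum_def M_def rho_def by (simp only: simp_thms)
qed

lemma sum_pair_sum_le: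
  assumes cbc: "cbc_pbp \<alpha> \<gamma> \<tau> n d z" and d': "d' \<in> {1..d}" and \<tau>: "0 < \<tau>" "\<tau> < 1" and n: "0 < n"
  shows "(\<Sum>p\<in>primes_P n. \<Sum>q\<in>primes_P n. pair_sum \<alpha> \<gamma> d' z p q) \<le>
    real (card (primes_P n)) * (K0 lam \<tau> * (real n powr (- (2 * lam)) * mu_sum d' \<alpha> \<gamma> lam powr (2 * lam)))"
proof -
  let ?P = "primes_P n"
  let ?c = "\<lambda>s. K0 lam \<tau> * (real n powr (- (2 * lam)) * M s powr (2 * lam))"
  have cr: "(\<Sum>p\<in>?P. \<Sum>q\<in>?P. cross s z p q) \<le> real (card ?P) * ?c s" if s: "s \<in> {1..d'}" for s
  proof (cases "s = 1")
    case True
    have "z 1 = 1" using cbc by (simp add: cbc_pbp_def)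
    then show ?thesis
      unfolding True using n \<tau> by (intro sum_bounded_above cross_first)
  next
    case False
    then have s2: "s \<in> {2..d}" "1 \<le> s" using s d' by auto
    have sel: "selected \<alpha> \<gamma> \<tau> n s z p (\<lambda>q. z s mod int q) (z s mod int p)" if "p \<in> ?P" for p
      using cbc s2 that by (auto simp: cbc_pbp_def)
    have th: "theta \<alpha> \<gamma> s z q (z s mod int q) \<le> Theta \<tau> s q" if q: "q \<in> ?P" for q
    proof -
      obtain G where "smallest_theta \<alpha> \<gamma> \<tau> s z q G" "z s mod int q \<in> G"
        using sel[OF q] by (auto simp: selected_def)
      then show ?thesis using theta_le primes_P_D(1)[OF q] s2(2) \<tau> by blast
    qed
    show ?thesis unfolding sum_cross
      by (intro sum_bounded_above T_crit_le[OF sel _ th s2(2) \<tau> n]) auto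
  qed
  have "pair_sum \<alpha> \<gamma> d' z p q = (\<Sum>s\<in>{1..d'}. cross s z p q)" for p q
    unfolding pair_sum_def cross_def
    by (rule infsum_Zvec_last) (rule rw2_summable[OF order_refl])
  then have "(\<Sum>p\<in>?P. \<Sum>q\<in>?P. pair_sum \<alpha> \<gamma> d' z p q) = (\<Sum>s\<in>{1..d'}. \<Sum>p\<in>?P. \<Sum>q\<in>?P. cross s z p q)"
  proof -
    have "(\<Sum>s\<in>{1..d'}. \<Sum>p\<in>?P. \<Sum>q\<in>?P. f s p q) = (\<Sum>p\<in>?P. \<Sum>q\<in>?P. \<Sum>s\<in>{1..d'}. f s p q)" for f :: "nat \<Rightarrow> nat \<Rightarrow> nat \<Rightarrow> real"
      by (subst sum.swap) (intro sum.cong refl sum.swap)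
    moreover assume "\<And>p q. pair_sum \<alpha> \<gamma> d' z p q = (\<Sum>s\<in>{1..d'}. cross s z p q)"
    ultimately show ?thesis by simp
  qed
  also have "\<dots> \<le> (\<Sum>s\<in>{1..d'}. real (card ?P) * ?c s)" by (rule sum_mono) (rule cr)
  also have "\<dots> = real (card ?P) * (K0 lam \<tau> * (real n powr (- (2 * lam)) * (\<Sum>s\<in>{1..d'}. M s powr (2 * lam))))"
    by (simp add: sum_distrib_left)
  also have "\<dots> \<le> real (card ?P) * (K0 lam \<tau> * (real n powr (- (2 * lam)) * (\<Sum>s\<in>{1..d'}. M s) powr (2 * lam)))"
  proof -
    \<comment> \<open>\<open>infsum_powr_le\<close> once more, now over the components: the sum of
      the bounds of the steps becomes a power of the full \<open>mu_sum\<close>.\<close>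
    have "(\<Sum>s\<in>{1..d'}. M s powr (2 * lam)) \<le> (\<Sum>s\<in>{1..d'}. M s) powr (2 * lam)"
      using infsum_powr_le(2)[of M "{1..d'}" "2 * lam"] M_nonneg lam by simp
    moreover have "0 \<le> K0 lam \<tau>" using \<tau> by (simp add: K0_def)
    ultimately show ?thesis by (intro mult_left_mono) auto
  qed
  finally show ?thesis by (simp add: mu_sum_M)
qed

end

section \<open>Fourier series of periodic functions\<close>

lemma continuous_on_expi [continuous_intros]:
  "continuous_on S f \<Longrightarrow> continuous_on S (\<lambda>x. expi (f x))"
  unfolding expi_def by (intro continuous_intros)

lemma Re_expi: "Re (expi x) = cos (2 * pi * x)"
  by (simp add: expi_def)

abbreviation unit_interval :: "real measure" where
  "unit_interval \<equiv> restrict_space lborel {0..1}"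

lemma prob_space_unit_interval: "prob_space unit_interval"
  by (rule prob_spaceI) (simp add: emeasure_restrict_space space_restrict_space)

lemma integrable_expi_unit: "integrable unit_interval (\<lambda>y. expi (c * y))"
proof -
  interpret prob_space unit_interval by (rule prob_space_unit_interval)
  have "(\<lambda>y. expi (c * y)) \<in> borel_measurable lborel"
    by (simp, rule borel_measurable_continuous_onI) (intro continuous_intros)
  then have "(\<lambda>y. expi (c * y)) \<in> borel_measurable unit_interval"
    by (rule measurable_restrict_space1)
  then show ?thesis by (intro integrable_const_bound[where B = 1]) auto
qed

lemma integral_expi_unit:
  "(LINT y|unit_interval. expi (- (real_of_int k * y))) = (if k = 0 then 1 else 0)"
proof (cases "k = 0")
  case True
  interpret prob_space unit_interval by (rule prob_space_unit_interval)
  show ?thesis using True prob_space by (simp add: space_restrict_space)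
next
  case False
  define c where "c = - (2 * pi * real_of_int k)"
  have c: "c \<noteq> 0" using False by (simp add: c_def)
  let ?F = "\<lambda>y. expi (- (real_of_int k * y)) / (\<i> * of_real c)"
  have ex: "expi (- (real_of_int k * y)) = exp (\<i> * of_real (c * y))" for y
    by (simp add: expi_def cis_conv_exp c_def algebra_simps)
  have "((\<lambda>y. exp (\<i> * of_real (c * y)) / (\<i> * of_real c)) has_vector_derivative exp (\<i> * of_real (c * y))) (at y within {0..1})" for y
  proof -
    have "((\<lambda>w. exp (\<i> * of_real c * w) / (\<i> * of_real c)) has_field_derivative exp (\<i> * of_real c * of_real y)) (at (of_real y))"
      using c by (auto intro!: derivative_eq_intros)
    from has_vector_derivative_real_field[OF this] show ?thesis by (simp add: mult.assoc)
  qed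
  then have "(LINT y|lborel. indicator {0..1} y *\<^sub>R expi (- (real_of_int k * y))) = ?F 1 - ?F 0"
    by (intro integral_FTC_Icc) (auto simp: ex intro!: continuous_intros)
  moreover have "?F 1 = ?F 0" using expi_int[of "-k"] by simp
  ultimately show ?thesis using False by (simp add: integral_restrict_space)
qed

context
  fixes d :: nat
begin

definition ip :: "(nat \<Rightarrow> int) \<Rightarrow> (nat \<Rightarrow> real) \<Rightarrow> real" where
  "ip h x = (\<Sum>j\<in>{1..d}. real_of_int (h j) * x j)"

lemma ip_diff_left: "ip (\<lambda>j. h j - k j) x = ip h x - ip k x"
  by (simp add: ip_def algebra_simps sum_subtractf)

lemma prob_space_cube: "prob_space (cube d)"
  unfolding cube_def by (rule prob_space_PiM) (rule prob_space_unit_interval)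

lemma integral_expi_cube:
  assumes "h \<in> Zvec d"
  shows "(LINT y|cube d. expi (- ip h y)) = (if h = (\<lambda>_. 0) then 1 else 0)"
proof -
  interpret U: prob_space unit_interval by (rule prob_space_unit_interval)
  interpret product_sigma_finite "\<lambda>_::nat. unit_interval"
    by (rule product_sigma_finite.intro) (rule U.sigma_finite_measure_axioms)
  have "(LINT y|cube d. expi (- ip h y)) = (LINT y|cube d. (\<Prod>j\<in>{1..d}. expi (- (real_of_int (h j) * y j))))"
    by (simp add: ip_def expi_sum[symmetric] sum_negf)
  also have "\<dots> = (\<Prod>j\<in>{1..d}. LINT y|unit_interval. expi (- (real_of_int (h j) * y)))"
    unfolding cube_def
    by (rule product_integral_prod) (use integrable_expi_unit[of "- real_of_int _"] in auto)
  also have "\<dots> = (\<Prod>j\<in>{1..d}. if h j = 0 then 1 else 0)"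
    by (simp only: integral_expi_unit)
  also have "\<dots> = (if \<forall>j\<in>{1..d}. h j = 0 then 1 else 0)"
    by (auto intro!: prod.neutral prod_zero)
  also have "(\<forall>j\<in>{1..d}. h j = 0) \<longleftrightarrow> h = (\<lambda>_. 0)"
    using assms by (auto simp: Zvec_def fun_eq_iff)
  finally show ?thesis .
qed

text \<open>The qualitative conditions of \<open>korobov_space\<close>, separated from those on
  integrability and summability.\<close>

definition periodic :: "((nat \<Rightarrow> real) \<Rightarrow> complex) \<Rightarrow> bool" where
  "periodic f \<longleftrightarrow> (\<forall>x y. (\<forall>j\<in>{1..d}. x j = y j) \<longrightarrow> f x = f y) \<and> continuous_on UNIV f \<and>
     (\<forall>x. \<forall>j\<in>{1..d}. f (x(j := x j + 1)) = f x)"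

lemma periodicD:
  assumes "periodic f"
  shows "(\<And>j. j \<in> {1..d} \<Longrightarrow> x j = y j) \<Longrightarrow> f x = f y" "continuous_on UNIV f"
    "j \<in> {1..d} \<Longrightarrow> f (x(j := x j + 1)) = f x"
  using assms by (auto simp: periodic_def)

lemma periodic_shift1:
  assumes "periodic f" "j \<in> {1..d}"
  shows "f (x(j := x j + real_of_int m)) = f x"
proof -
  have step: "f (x(j := x j + r + 1)) = f (x(j := x j + r))" for r
    using periodicD(3)[OF assms, of "x(j := x j + r)"] by (simp only: fun_upd_upd fun_upd_same)
  show ?thesis
  proof (induction m rule: int_induct[where k = 0])
    case base
    show ?case by (simp only: of_int_0 add_0_right fun_upd_triv)
  next
    case (step1 i)
    then show ?case by (simp only: of_int_add of_int_1 add.assoc[symmetric] step)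
  next
    case (step2 i)
    have "x j + real_of_int i = x j + real_of_int (i - 1) + 1" by simp
    then show ?case using step2 step[of "real_of_int (i - 1)"] by (simp only:)
  qed
qed

text \<open>The coordinates are moved one at a time; \<open>v k\<close> has the first
  \<open>k\<close> of them in place.\<close>

lemma periodic_shift:
  assumes f: "periodic f" and int: "\<And>j. j \<in> {1..d} \<Longrightarrow> y j - x j \<in> \<int>"
  shows "f y = f x"
proof -
  define v where "v k = (\<lambda>j. if j \<in> {1..k} then y j else x j)" for k :: nat
  have "k \<le> d \<Longrightarrow> f (v k) = f x" for k
  proof (induction k)
    case 0
    then show ?case by (simp add: v_def)
  next
    case (Suc k)
    then obtain m where m: "y (Suc k) - x (Suc k) = real_of_int m"
      using int[of "Suc k"] by (auto elim: Ints_cases)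
    have "v (Suc k) = (v k)(Suc k := v k (Suc k) + real_of_int m)"
      using m by (auto simp: v_def fun_eq_iff)
    then have "f (v (Suc k)) = f ((v k)(Suc k := v k (Suc k) + real_of_int m))" by (rule arg_cong)
    also have "\<dots> = f (v k)" by (rule periodic_shift1[OF f]) (use Suc in simp)
    finally show ?case using Suc by simp
  qed
  from this[of d] have "f (v d) = f x" by simp
  moreover have "f (v d) = f y" by (rule periodicD(1)[OF f]) (simp add: v_def)
  ultimately show ?thesis by simp
qed

text \<open>Arguments have infinitely many coordinates, so the compact set is the full product of
  unit intervals (Tychonoff). Fractional parts move any point into it.\<close>

lemma periodic_bounded:
  assumes "periodic f"
  obtains B where "0 \<le> B" "\<And>x. cmod (f x) \<le> B"
proof -
  let ?C = "PiE UNIV (\<lambda>_. {0..1}) :: (nat \<Rightarrow> real) set"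
  have "compactin (product_topology (\<lambda>_. euclidean) UNIV) ?C"
    unfolding compactin_PiE by simp
  then have "compact ?C" by (simp add: euclidean_product_topology)
  then have "compact (f ` ?C)"
    by (intro compact_continuous_image continuous_on_subset[OF periodicD(2)[OF assms]]) auto
  then have "bounded (f ` ?C)" by (rule compact_imp_bounded)
  then obtain B where B: "\<And>x. x \<in> ?C \<Longrightarrow> cmod (f x) \<le> B" by (auto simp: bounded_iff)
  have "cmod (f x) \<le> B" for x
  proof -
    have "f x = f (\<lambda>j. frac (x j))"
      by (rule periodic_shift[OF assms]) (simp add: frac_def)
    moreover have "(\<lambda>j. frac (x j)) \<in> ?C" by (auto simp: frac_lt_1 less_imp_le)
    ultimately show ?thesis using B by simp
  qed
  moreover from this[of "\<lambda>_. 0"] have "0 \<le> B" using norm_ge_zero order_trans by blast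
  ultimately show ?thesis using that by blast
qed

lemma continuous_on_ip [continuous_intros]: "continuous_on UNIV (ip h)"
  unfolding ip_def by (intro continuous_intros) (simp add: continuous_on_product_coordinates)

lemma periodic_measurable:
  assumes "periodic f"
  shows "f \<in> borel_measurable (cube d)"
proof -
  \<comment> \<open>Points of \<open>cube d\<close> are \<open>undefined\<close> outside
    \<open>{1..d}\<close>. Setting those coordinates to 0 gives a measurable map into the full
    function space, on which \<open>f\<close> is continuous.\<close>
  let ?r = "\<lambda>x j. if j \<in> {1..d} then x j else (0::real)"
  have "(\<lambda>x. ?r x j) \<in> borel_measurable (cube d)" for j
  proof (cases "j \<in> {1..d}")
    case True
    then have "(\<lambda>x. x j) \<in> measurable (cube d) unit_interval"
      unfolding cube_def by (rule measurable_component_singleton)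
    then have "(\<lambda>x. x j) \<in> borel_measurable (cube d)"
      by (metis (no_types, lifting) borel_measurable_integrable measurable_restrict_space2_iff sets_lborel measurable_cong_sets)
    then show ?thesis using True by simp
  next
    case False
    then have "(\<lambda>x. ?r x j) = (\<lambda>_. 0)" by auto
    then show ?thesis by simp
  qed
  then have "?r \<in> borel_measurable (cube d)"
    by (rule measurable_coordinatewise_then_product)
  moreover have "f \<in> borel_measurable borel"
    by (rule borel_measurable_continuous_onI) (rule periodicD(2)[OF assms])
  ultimately have "(\<lambda>x. f (?r x)) \<in> borel_measurable (cube d)" by (rule measurable_compose)
  moreover have "f (?r x) = f x" for x by (rule periodicD(1)[OF assms]) simp
  ultimately show ?thesis by simp
qed

lemma periodic_integrable:
  assumes "periodic f"
  shows "integrable (cube d) f"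
proof -
  interpret prob_space "cube d" by (rule prob_space_cube)
  obtain B where "\<And>x. cmod (f x) \<le> B" using periodic_bounded[OF assms] by blast
  then show ?thesis by (intro integrable_const_bound[where B = B] periodic_measurable[OF assms]) auto
qed

lemma periodic_const: "periodic (\<lambda>_. c)"
  by (simp add: periodic_def)

lemma periodic_expi: "periodic (\<lambda>x. expi (ip h x))"
  unfolding periodic_def
proof (intro conjI allI ballI impI)
  fix x :: "nat \<Rightarrow> real" and j assume j: "j \<in> {1..d}"
  have "ip h (x(j := x j + 1)) = ip h x + real_of_int (h j)"
    unfolding ip_def using j by (subst (1 2) sum.remove[of _ j]) (auto simp: algebra_simps)
  then show "expi (ip h (x(j := x j + 1))) = expi (ip h x)" by (simp add: expi_add)
qed (auto simp: ip_def intro!: continuous_intros)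

lemma periodic_mult:
  assumes "periodic f" "periodic g"
  shows "periodic (\<lambda>x. f x * g x)"
  unfolding periodic_def
proof (intro conjI allI ballI impI)
  show "f x * g x = f y * g y" if "\<forall>j\<in>{1..d}. x j = y j" for x y
    using periodicD(1)[OF assms(1), of x y] periodicD(1)[OF assms(2), of x y] that by simp
  show "continuous_on UNIV (\<lambda>x. f x * g x)"
    by (intro continuous_intros periodicD(2) assms)
  show "f (x(j := x j + 1)) * g (x(j := x j + 1)) = f x * g x" if "j \<in> {1..d}" for x j
    using periodicD(3)[OF assms(1) that] periodicD(3)[OF assms(2) that] by (simp only:)
qed

lemma periodic_diff:
  assumes "periodic f" "periodic g"
  shows "periodic (\<lambda>x. f x - g x)"
  unfolding periodic_def
proof (intro conjI allI ballI impI)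
  show "f x - g x = f y - g y" if "\<forall>j\<in>{1..d}. x j = y j" for x y
    using periodicD(1)[OF assms(1), of x y] periodicD(1)[OF assms(2), of x y] that by simp
  show "continuous_on UNIV (\<lambda>x. f x - g x)"
    by (intro continuous_intros periodicD(2) assms)
  show "f (x(j := x j + 1)) - g (x(j := x j + 1)) = f x - g x" if "j \<in> {1..d}" for x j
    using periodicD(3)[OF assms(1) that] periodicD(3)[OF assms(2) that] by (simp only:)
qed

lemma periodic_sum:
  assumes "\<And>a. a \<in> A \<Longrightarrow> periodic (f a)"
  shows "periodic (\<lambda>x. \<Sum>a\<in>A. f a x)"
  unfolding periodic_def
proof (intro conjI allI ballI impI)
  show "(\<Sum>a\<in>A. f a x) = (\<Sum>a\<in>A. f a y)" if "\<forall>j\<in>{1..d}. x j = y j" for x y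
    using periodicD(1)[OF assms, of _ x y] that by (intro sum.cong) auto
  show "continuous_on UNIV (\<lambda>x. \<Sum>a\<in>A. f a x)"
    by (intro continuous_intros periodicD(2) assms)
  show "(\<Sum>a\<in>A. f a (x(j := x j + 1))) = (\<Sum>a\<in>A. f a x)" if "j \<in> {1..d}" for x j
    using periodicD(3)[OF assms that] by (intro sum.cong) (simp_all only:)
qed

lemma periodic_cnj:
  assumes "periodic f"
  shows "periodic (\<lambda>x. cnj (f x))"
  unfolding periodic_def
proof (intro conjI allI ballI impI)
  show "cnj (f x) = cnj (f y)" if "\<forall>j\<in>{1..d}. x j = y j" for x y
    using periodicD(1)[OF assms, of x y] that by simp
  show "continuous_on UNIV (\<lambda>x. cnj (f x))"
    by (intro continuous_intros periodicD(2) assms)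
  show "cnj (f (x(j := x j + 1))) = cnj (f x)" if "j \<in> {1..d}" for x j
    using periodicD(3)[OF assms that] by (simp only:)
qed

lemma fourier_coeff_eq: "fourier_coeff d f h = (LINT x|cube d. f x * expi (- ip h x))"
proof -
  have "exp (- 2 * of_real pi * \<i> * of_real (ip h x)) = expi (- ip h x)" for x
    using expi_exp[of "- ip h x"] by simp
  then show ?thesis unfolding fourier_coeff_def ip_def by simp
qed

text \<open>The test functions of a Korovkin argument: they control the oscillation of \<open>g\<close> at \<open>x\<close>.\<close>

lemma periodic_modulus:
  assumes g: "periodic g" and e: "0 < e"
  obtains C where "0 \<le> C" "\<And>y. cmod (g x - g y) \<le> e + C * (\<Sum>j\<in>{1..d}. 1 - cos (2 * pi * (x j - y j)))"
proof -
  obtain B where B: "0 \<le> B" "\<And>x. cmod (g x) \<le> B" using periodic_bounded[OF g] by blast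
  have "open {y. cmod (g x - g y) < e}"
    using periodicD(2)[OF g] by (intro open_Collect_less continuous_intros)
  then have "openin (product_topology (\<lambda>_. euclidean) UNIV) {y. cmod (g x - g y) < e}"
    unfolding euclidean_product_topology by (simp only: open_openin)
  from product_topology_open_contains_basis[OF this, of x] e
  obtain X where X: "\<And>i. x i \<in> X i" "\<And>i. open (X i)" "PiE UNIV X \<subseteq> {y. cmod (g x - g y) < e}"
    by (auto simp: PiE_iff)
  have "\<exists>r>0. ball (x i) r \<subseteq> X i" for i using X(1,2) open_contains_ball by blast
  then obtain r where r: "\<And>i. 0 < r i" "\<And>i. ball (x i) (r i) \<subseteq> X i" by metis
  \<comment> \<open>Only the finitely many coordinates in \<open>{1..d}\<close> matter. The element
    1/4 keeps \<open>2 * pi * \<delta>\<close> where the cosine decreases, and covers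
    \<open>d = 0\<close>.\<close>
  define \<delta> where "\<delta> = Min (insert (1 / 4) (r ` {1..d}))"
  have \<delta>: "0 < \<delta>" "\<delta> \<le> 1 / 4" "\<And>j. j \<in> {1..d} \<Longrightarrow> \<delta> \<le> r j"
  proof -
    show "0 < \<delta>" unfolding \<delta>_def using r(1) by (subst Min_gr_iff) auto
    show "\<delta> \<le> 1 / 4" unfolding \<delta>_def by (rule Min_le) auto
    show "\<delta> \<le> r j" if "j \<in> {1..d}" for j unfolding \<delta>_def using that by (intro Min_le) auto
  qed
  have near: "cmod (g x - g y) < e" if y: "\<And>j. j \<in> {1..d} \<Longrightarrow> \<bar>x j - y j\<bar> < \<delta>" for y
  proof -
    let ?y = "\<lambda>j. if j \<in> {1..d} then y j else x j"
    have "?y i \<in> X i" for i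
    proof (cases "i \<in> {1..d}")
      case True
      then have "y i \<in> ball (x i) (r i)" using y[OF True] \<delta>(3)[OF True] by (simp add: dist_real_def)
      then have "y i \<in> X i" using r(2)[of i] by blast
      then show ?thesis using True by simp
    next
      case False
      then show ?thesis using X(1)[of i] by auto
    qed
    then have "?y \<in> PiE UNIV X" by (intro PiE_I) auto
    then have "cmod (g x - g ?y) < e" using X(3) by blast
    moreover have "g ?y = g y" by (rule periodicD(1)[OF g]) simp
    ultimately show ?thesis by simp
  qed
  define c where "c = 1 - cos (2 * pi * \<delta>)"
  have "cos (2 * pi * \<delta>) < cos 0" using \<delta> by (intro cos_monotone_0_pi) (auto simp: field_simps)
  then have c: "0 < c" by (simp add: c_def)
  let ?C = "2 * B / c"
  have nn: "0 \<le> (\<Sum>j\<in>{1..d}. 1 - cos (2 * pi * (x j - y j)))" for y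
    by (intro sum_nonneg) simp
  have "cmod (g x - g y) \<le> e + ?C * (\<Sum>j\<in>{1..d}. 1 - cos (2 * pi * (x j - y j)))" for y
  proof -
    \<comment> \<open>Differences are reduced to absolute value at most 1/2, which changes neither
      \<open>g\<close> nor the cosines. A coordinate that stays away from 0 then makes the cosine
      sum at least \<open>c\<close>.\<close>
    define t where "t j = x j - y j - of_int (round (x j - y j))" for j
    have t: "\<bar>t j\<bar> \<le> 1 / 2" for j
      unfolding t_def using of_int_round_abs_le[of "x j - y j"] by linarith
    have gy: "g (\<lambda>j. x j - t j) = g y"
      by (rule periodic_shift[OF g]) (simp add: t_def)
    have cs: "cos (2 * pi * (x j - y j)) = cos (2 * pi * \<bar>t j\<bar>)" for j
    proof -
      have "expi (x j - y j) = expi (t j + real_of_int (round (x j - y j)))" by (simp add: t_def)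
      then have "expi (x j - y j) = expi (t j)" by (simp add: expi_add)
      then have "cos (2 * pi * (x j - y j)) = cos (2 * pi * t j)" by (metis Re_expi)
      then show ?thesis by (simp add: abs_if)
    qed
    show ?thesis
    proof (cases "\<forall>j\<in>{1..d}. \<bar>t j\<bar> < \<delta>")
      case True
      then have "cmod (g x - g (\<lambda>j. x j - t j)) < e" by (intro near) simp
      then have "cmod (g x - g y) < e" using gy by simp
      moreover have "0 \<le> ?C * (\<Sum>j\<in>{1..d}. 1 - cos (2 * pi * (x j - y j)))"
        using nn[of y] B c by simp
      ultimately show ?thesis by linarith
    next
      case False
      then obtain j where j: "j \<in> {1..d}" "\<delta> \<le> \<bar>t j\<bar>" by force
      have "cos (2 * pi * \<bar>t j\<bar>) \<le> cos (2 * pi * \<delta>)"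
        using t[of j] j(2) \<delta> by (intro cos_monotone_0_pi_le) (auto simp: field_simps)
      then have "c \<le> 1 - cos (2 * pi * (x j - y j))" unfolding c_def cs by simp
      also have "\<dots> \<le> (\<Sum>j\<in>{1..d}. 1 - cos (2 * pi * (x j - y j)))"
        using j(1) by (intro member_le_sum) auto
      finally have "?C * c \<le> ?C * (\<Sum>j\<in>{1..d}. 1 - cos (2 * pi * (x j - y j)))"
        using B c by (intro mult_left_mono) auto
      moreover have "?C * c = 2 * B" using c by simp
      moreover have "cmod (g x - g y) \<le> 2 * B"
        using norm_triangle_ineq4[of "g x" "g y"] B(2)[of x] B(2)[of y] by linarith
      ultimately show ?thesis using e by linarith
    qed
  qed
  moreover have "0 \<le> ?C" using B c by simp
  ultimately show ?thesis using that by blast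
qed

section \<open>The multivariate Fejer kernel\<close>

definition box :: "(nat \<Rightarrow> int set) \<Rightarrow> (nat \<Rightarrow> int) set" where
  "box X = {h \<in> Zvec d. \<forall>j\<in>{1..d}. h j \<in> X j}"

lemma card_box: "card (box X) = (\<Prod>j\<in>{1..d}. card (X j))"
proof -
  have "bij_betw (\<lambda>h. restrict h {1..d}) (box X) (PiE {1..d} X)"
    by (rule bij_betw_byWitness[where f' = "\<lambda>h j. if j \<in> {1..d} then h j else 0"])
      (auto simp: box_def Zvec_def fun_eq_iff PiE_iff extensional_def)
  then show ?thesis by (simp add: bij_betw_same_card card_PiE)
qed

lemma finite_box: "(\<And>j. finite (X j)) \<Longrightarrow> finite (box X)"
proof -
  assume X: "\<And>j. finite (X j)"
  have "bij_betw (\<lambda>h. restrict h {1..d}) (box X) (PiE {1..d} X)"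
    by (rule bij_betw_byWitness[where f' = "\<lambda>h j. if j \<in> {1..d} then h j else 0"])
      (auto simp: box_def Zvec_def fun_eq_iff PiE_iff extensional_def)
  then show ?thesis using bij_betw_finite X by (metis finite_PiE finite_atLeastAtMost)
qed

definition cbox :: "nat \<Rightarrow> (nat \<Rightarrow> int) set" where
  "cbox N = box (\<lambda>_. {0..<int N})"

lemma finite_cbox [simp]: "finite (cbox N)"
  unfolding cbox_def by (rule finite_box) simp

lemma card_cbox: "card (cbox N) = N ^ d"
  by (simp add: cbox_def card_box)

lemma cbox_Zvec: "cbox N \<subseteq> Zvec d"
  by (auto simp: cbox_def box_def)

lemma Zvec_diff: "h \<in> Zvec d \<Longrightarrow> k \<in> Zvec d \<Longrightarrow> (\<lambda>j. h j - k j) \<in> Zvec d"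
  by (auto simp: Zvec_def)

definition unit_vec :: "nat \<Rightarrow> nat \<Rightarrow> int" where
  "unit_vec i = (\<lambda>j. if j = i then 1 else 0)"

text \<open>Divided by \<open>N ^ d\<close> this count is the coefficient of the Fejer kernel at a
  unit vector; its distance \<open>1 / N\<close> from 1 is the rate of concentration.\<close>

lemma card_cbox_shift:
  assumes "i \<in> {1..d}" "0 < N"
  shows "real (card {m \<in> cbox N. (\<lambda>j. m j + unit_vec i j) \<in> cbox N}) = real (N ^ d) * (1 - 1 / real N)"
proof -
  have "{m \<in> cbox N. (\<lambda>j. m j + unit_vec i j) \<in> cbox N} = box (\<lambda>j. if j = i then {0..<int N - 1} else {0..<int N})"
    using assms(1) by (auto simp: cbox_def box_def Zvec_def unit_vec_def)
  then have "card {m \<in> cbox N. (\<lambda>j. m j + unit_vec i j) \<in> cbox N} =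
      (\<Prod>j\<in>{1..d}. if j = i then N - 1 else N)"
    by (simp only: card_box) (intro prod.cong refl, auto simp: nat_diff_distrib')
  also have "\<dots> = (N - 1) * N ^ (d - 1)"
    using assms(1) by (subst prod.remove[of _ i]) (auto simp: prod.If_cases)
  finally have "real (card {m \<in> cbox N. (\<lambda>j. m j + unit_vec i j) \<in> cbox N}) = real ((N - 1) * N ^ (d - 1))"
    by (rule arg_cong)
  moreover have "real ((N - 1) * N ^ (d - 1)) = (real N - 1) * real N ^ (d - 1)"
    using assms(2) by (simp add: of_nat_diff)
  moreover have "real (N ^ d) = real N * real N ^ (d - 1)" using assms(1) by (cases d) auto
  ultimately show ?thesis using assms(2) by (simp only:) (simp add: field_simps)
qed

text \<open>As a normalised square the kernel is visibly nonnegative, and its coefficient at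
  \<open>h\<close> counts the pairs in the box with difference \<open>h\<close>.\<close>

definition fejer :: "nat \<Rightarrow> (nat \<Rightarrow> real) \<Rightarrow> (nat \<Rightarrow> real) \<Rightarrow> real" where
  "fejer N x y = (cmod (\<Sum>m\<in>cbox N. expi (ip m x - ip m y)))\<^sup>2 / real (N ^ d)"

lemma fejer_expand:
  "complex_of_real (fejer N x y) =
     (\<Sum>m\<in>cbox N. \<Sum>k\<in>cbox N. expi (ip (\<lambda>j. m j - k j) x) * expi (- ip (\<lambda>j. m j - k j) y)) / of_nat (N ^ d)"
proof -
  let ?s = "\<Sum>m\<in>cbox N. expi (ip m x - ip m y)"
  have "complex_of_real ((cmod ?s)\<^sup>2) = ?s * cnj ?s" by (simp only: complex_norm_square)
  also have "\<dots> = (\<Sum>m\<in>cbox N. \<Sum>k\<in>cbox N. expi (ip m x - ip m y) * expi (- (ip k x - ip k y)))"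
    by (simp only: cnj_sum expi_cnj sum_product)
  also have "\<dots> = (\<Sum>m\<in>cbox N. \<Sum>k\<in>cbox N. expi (ip (\<lambda>j. m j - k j) x) * expi (- ip (\<lambda>j. m j - k j) y))"
    by (simp only: expi_add[symmetric] ip_diff_left) (intro sum.cong refl arg_cong[of _ _ expi], simp)
  finally show ?thesis unfolding fejer_def by simp
qed

lemma integral_fejer:
  assumes u: "periodic u"
  shows "(LINT y|cube d. u y * complex_of_real (fejer N x y)) =
    (\<Sum>m\<in>cbox N. \<Sum>k\<in>cbox N. expi (ip (\<lambda>j. m j - k j) x) * fourier_coeff d u (\<lambda>j. m j - k j)) / of_nat (N ^ d)"
    and "integrable (cube d) (\<lambda>y. u y * complex_of_real (fejer N x y))"
proof -
  have int: "integrable (cube d) (\<lambda>y. u y * expi (- ip h y))" for h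
  proof -
    have "periodic (\<lambda>y. u y * cnj (expi (ip h y)))" by (intro periodic_mult u periodic_cnj periodic_expi)
    then show ?thesis using periodic_integrable by (simp add: expi_cnj)
  qed
  have eq: "u y * complex_of_real (fejer N x y) =
    (\<Sum>m\<in>cbox N. \<Sum>k\<in>cbox N. expi (ip (\<lambda>j. m j - k j) x) * (u y * expi (- ip (\<lambda>j. m j - k j) y))) / of_nat (N ^ d)" for y
    unfolding fejer_expand by (simp add: sum_distrib_left mult_ac)
  show "(LINT y|cube d. u y * complex_of_real (fejer N x y)) =
    (\<Sum>m\<in>cbox N. \<Sum>k\<in>cbox N. expi (ip (\<lambda>j. m j - k j) x) * fourier_coeff d u (\<lambda>j. m j - k j)) / of_nat (N ^ d)"
    unfolding eq fourier_coeff_eq using int by (simp add: Bochner_Integration.integral_sum)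
  show "integrable (cube d) (\<lambda>y. u y * complex_of_real (fejer N x y))"
    unfolding eq using int by simp
qed

lemma fourier_coeff_expi:
  assumes "h \<in> Zvec d" "k \<in> Zvec d"
  shows "fourier_coeff d (\<lambda>x. expi (ip h x)) k = (if k = h then 1 else 0)"
proof -
  have "fourier_coeff d (\<lambda>x. expi (ip h x)) k = (LINT y|cube d. expi (- ip (\<lambda>j. k j - h j) y))"
    unfolding fourier_coeff_eq by (simp add: expi_add[symmetric] ip_diff_left)
  also have "\<dots> = (if (\<lambda>j. k j - h j) = (\<lambda>_. 0) then 1 else 0)"
    by (rule integral_expi_cube[OF Zvec_diff[OF assms(2,1)]])
  also have "(\<lambda>j. k j - h j) = (\<lambda>_. 0) \<longleftrightarrow> k = h" by (auto simp: fun_eq_iff)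
  finally show ?thesis .
qed

lemma integral_fejer_one:
  assumes "0 < N"
  shows "(LINT y|cube d. fejer N x y) = 1" "integrable (cube d) (fejer N x)"
proof -
  have z: "(\<lambda>_. 1) = (\<lambda>x. expi (ip (\<lambda>_. 0) x))" by (simp add: ip_def)
  note f = integral_fejer[OF periodic_const[of 1], of N x, simplified]
  have "integrable (cube d) (\<lambda>y. Re (complex_of_real (fejer N x y)))" by (rule integrable_Re[OF f(2)])
  then show int: "integrable (cube d) (fejer N x)" by simp
  have "(LINT y|cube d. complex_of_real (fejer N x y)) =
    (\<Sum>m\<in>cbox N. \<Sum>k\<in>cbox N. expi (ip (\<lambda>j. m j - k j) x) * (if m = k then 1 else 0)) / of_nat (N ^ d)"
  proof -
    have "fourier_coeff d (\<lambda>_. 1) (\<lambda>j. m j - k j) = (if m = k then 1 else 0)" if "m \<in> cbox N" "k \<in> cbox N" for m k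
    proof -
      have "(\<lambda>j. m j - k j) \<in> Zvec d" using that cbox_Zvec by (intro Zvec_diff) auto
      from fourier_coeff_expi[OF _ this, of "\<lambda>_. 0"] show ?thesis
        unfolding z by (auto simp: fun_eq_iff)
    qed
    then show ?thesis
      using integral_fejer(1)[OF periodic_const[of 1], of N x]
      by (simp cong: sum.cong)
  qed
  also have "\<dots> = (\<Sum>m\<in>cbox N. 1) / of_nat (N ^ d)"
  proof (rule arg_cong[of _ _ "\<lambda>x. x / _"], rule sum.cong[OF refl])
    fix m assume m: "m \<in> cbox N"
    have "(\<Sum>k\<in>cbox N. expi (ip (\<lambda>j. m j - k j) x) * (if m = k then 1 else 0)) =
        (\<Sum>k\<in>cbox N. if m = k then expi (ip (\<lambda>j. m j - k j) x) else 0)"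
      by (rule sum.cong) auto
    then show "(\<Sum>k\<in>cbox N. expi (ip (\<lambda>j. m j - k j) x) * (if m = k then 1 else 0)) = 1"
      using m by (simp add: ip_def)
  qed
  also have "\<dots> = 1" using assms by (simp add: card_cbox)
  finally have "complex_of_real (LINT y|cube d. fejer N x y) = 1" by simp
  then show "(LINT y|cube d. fejer N x y) = 1" using of_real_eq_1_iff by blast
qed

text \<open>By mass one, the mean of \<open>1 - cos\<close> under the kernel is 1 minus its
  coefficient at a unit vector.\<close>

lemma integral_fejer_cos:
  assumes "0 < N" "i \<in> {1..d}"
  shows "(LINT y|cube d. (1 - cos (2 * pi * (x i - y i))) * fejer N x y) = 1 / real N"
    "integrable (cube d) (\<lambda>y. (1 - cos (2 * pi * (x i - y i))) * fejer N x y)"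
proof -
  let ?h = "\<lambda>j. - unit_vec i j"
  have ipu: "ip ?h y = - y i" for y
  proof -
    have "ip ?h y = (\<Sum>j\<in>{1..d}. if j = i then - y i else 0)"
      unfolding ip_def by (rule sum.cong) (auto simp: unit_vec_def)
    then show ?thesis using assms(2) by simp
  qed
  have hZ: "?h \<in> Zvec d" using assms(2) by (auto simp: Zvec_def unit_vec_def)
  note f = integral_fejer[OF periodic_expi[of ?h], of N x]
  let ?u = "\<lambda>y. expi (x i) * (expi (ip ?h y) * complex_of_real (fejer N x y))"
  have intu: "integrable (cube d) ?u" by (rule integrable_mult_right) (rule f(2))
  have Reu: "Re (?u y) = cos (2 * pi * (x i - y i)) * fejer N x y" for y
  proof -
    have "expi (x i) * expi (ip ?h y) = expi (x i - y i)"
      unfolding ipu expi_add[symmetric] by simp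
    then have "?u y = expi (x i - y i) * complex_of_real (fejer N x y)"
      by (simp only: mult.assoc[symmetric])
    then show ?thesis by (simp only: Re_expi times_complex.sel Re_complex_of_real Im_complex_of_real mult_zero_right diff_0_right)
  qed
  have intc: "integrable (cube d) (\<lambda>y. cos (2 * pi * (x i - y i)) * fejer N x y)"
    using integrable_Re[OF intu] unfolding Reu .
  have coeff: "fourier_coeff d (\<lambda>y. expi (ip ?h y)) (\<lambda>j. m j - k j) = (if k = (\<lambda>j. m j + unit_vec i j) then 1 else 0)"
    if "m \<in> cbox N" "k \<in> cbox N" for m k
  proof -
    have "(\<lambda>j. m j - k j) \<in> Zvec d" using that cbox_Zvec by (intro Zvec_diff) auto
    from fourier_coeff_expi[OF hZ this] show ?thesis by (auto simp: fun_eq_iff algebra_simps)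
  qed
  have "(LINT y|cube d. ?u y) = expi (x i) * (LINT y|cube d. expi (ip ?h y) * complex_of_real (fejer N x y))"
    by (rule integral_mult_right_zero)
  also have "\<dots> = expi (x i) * ((\<Sum>m\<in>cbox N. \<Sum>k\<in>cbox N. expi (ip (\<lambda>j. m j - k j) x) *
      (if k = (\<lambda>j. m j + unit_vec i j) then 1 else 0)) / of_nat (N ^ d))"
    unfolding f(1) using coeff by simp
  also have "\<dots> = expi (x i) * ((\<Sum>m\<in>cbox N. if (\<lambda>j. m j + unit_vec i j) \<in> cbox N then expi (- x i) else 0) / of_nat (N ^ d))"
  proof -
    have "(\<Sum>k\<in>cbox N. expi (ip (\<lambda>j. m j - k j) x) * (if k = (\<lambda>j. m j + unit_vec i j) then 1 else 0)) =
        (if (\<lambda>j. m j + unit_vec i j) \<in> cbox N then expi (- x i) else 0)" for m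
    proof -
      have "(\<Sum>k\<in>cbox N. expi (ip (\<lambda>j. m j - k j) x) * (if k = (\<lambda>j. m j + unit_vec i j) then 1 else 0)) =
          (\<Sum>k\<in>cbox N. if k = (\<lambda>j. m j + unit_vec i j) then expi (ip ?h x) else 0)"
        by (rule sum.cong) auto
      then show ?thesis by (simp add: ipu)
    qed
    then show ?thesis by simp
  qed
  also have "\<dots> = of_nat (card {m \<in> cbox N. (\<lambda>j. m j + unit_vec i j) \<in> cbox N}) / of_nat (N ^ d) * (expi (x i) * expi (- x i))"
    by (simp add: sum.If_cases Int_def)
  also have "expi (x i) * expi (- x i) = 1" by (simp add: expi_add[symmetric])
  also have "of_nat (card {m \<in> cbox N. (\<lambda>j. m j + unit_vec i j) \<in> cbox N}) / of_nat (N ^ d) * (1::complex) =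
      of_nat (card {m \<in> cbox N. (\<lambda>j. m j + unit_vec i j) \<in> cbox N}) / of_nat (N ^ d)"
    by simp
  also have "\<dots> = complex_of_real (real (card {m \<in> cbox N. (\<lambda>j. m j + unit_vec i j) \<in> cbox N}) / real (N ^ d))"
    by simp
  finally have "Re (LINT y|cube d. ?u y) = real (card {m \<in> cbox N. (\<lambda>j. m j + unit_vec i j) \<in> cbox N}) / real (N ^ d)"
    by (simp only: Re_complex_of_real)
  also have "\<dots> = 1 - 1 / real N" unfolding card_cbox_shift[OF assms(2,1)] using assms(1) by simp
  finally have c: "(LINT y|cube d. cos (2 * pi * (x i - y i)) * fejer N x y) = 1 - 1 / real N"
    using integral_Re[OF intu] unfolding Reu by simp
  note o = integral_fejer_one[OF assms(1), of x]
  have eq: "(1 - cos (2 * pi * (x i - y i))) * fejer N x y = fejer N x y - cos (2 * pi * (x i - y i)) * fejer N x y" for y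
    by (simp add: left_diff_distrib)
  show "(LINT y|cube d. (1 - cos (2 * pi * (x i - y i))) * fejer N x y) = 1 / real N"
    unfolding eq Bochner_Integration.integral_diff[OF o(2) intc] o(1) c by simp
  show "integrable (cube d) (\<lambda>y. (1 - cos (2 * pi * (x i - y i))) * fejer N x y)"
    unfolding eq by (rule Bochner_Integration.integrable_diff[OF o(2) intc])
qed

text \<open>All Fejer means of \<open>g\<close> vanish, so \<open>g x\<close> is the mean of
  \<open>g x - g y\<close>. By \<open>periodic_modulus\<close> its modulus is at most
  \<open>e\<close> plus a multiple of \<open>1 / N\<close> with a factor independent of
  \<open>N\<close>; then \<open>N\<close> grows and \<open>e\<close> shrinks.\<close>

lemma periodic_eq_0:
  assumes g: "periodic g" and z: "\<And>h. h \<in> Zvec d \<Longrightarrow> fourier_coeff d g h = 0"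
  shows "g x = 0"
proof -
  have le: "cmod (g x) \<le> 0 + e" if e: "0 < e" for e
  proof -
    obtain C where C: "0 \<le> C" "\<And>y. cmod (g x - g y) \<le> e + C * (\<Sum>j\<in>{1..d}. 1 - cos (2 * pi * (x j - y j)))"
      using periodic_modulus[OF g e, where x = x] by blast
    have N: "cmod (g x) \<le> e + C * real d * (1 / real (Suc N))" for N
    proof -
      let ?K = "fejer (Suc N) x"
      have K0: "0 \<le> ?K y" for y by (simp add: fejer_def)
      note o = integral_fejer_one[where N = "Suc N" and x = x, simplified]
      note c = integral_fejer_cos[where N = "Suc N" and x = x, simplified]
      have "(LINT y|cube d. g y * complex_of_real (?K y)) = 0"
        unfolding integral_fejer(1)[OF g] using z Zvec_diff cbox_Zvec
        by (auto intro!: sum.neutral simp: subset_iff)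
      moreover have "(LINT y|cube d. g x * complex_of_real (?K y)) = g x"
        using o(1) by simp
      moreover have "integrable (cube d) (\<lambda>y. g x * complex_of_real (?K y))"
        using o(2) by simp
      ultimately have "g x = (LINT y|cube d. g x * complex_of_real (?K y) - g y * complex_of_real (?K y))"
        using integral_fejer(2)[OF g, where N = "Suc N" and x = x] by (simp only: Bochner_Integration.integral_diff) simp
      also have "\<dots> = (LINT y|cube d. (g x - g y) * complex_of_real (?K y))"
        by (simp add: algebra_simps)
      finally have "cmod (g x) \<le> (LINT y|cube d. cmod ((g x - g y) * complex_of_real (?K y)))"
        using integral_norm_bound[of "cube d" "\<lambda>y. (g x - g y) * complex_of_real (?K y)"] by simp
      also have "\<dots> \<le> (LINT y|cube d. e * ?K y + C * (\<Sum>j\<in>{1..d}. (1 - cos (2 * pi * (x j - y j))) * ?K y))"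
      proof (rule integral_mono)
        show "integrable (cube d) (\<lambda>y. cmod ((g x - g y) * complex_of_real (?K y)))"
          using integral_fejer(2)[OF periodic_diff[OF periodic_const g], where N = "Suc N" and x = x] by (rule integrable_norm)
        show "integrable (cube d) (\<lambda>y. e * ?K y + C * (\<Sum>j\<in>{1..d}. (1 - cos (2 * pi * (x j - y j))) * ?K y))"
          using o(2) c(2) by (intro Bochner_Integration.integrable_add integrable_mult_right Bochner_Integration.integrable_sum) auto
        fix y
        have "cmod ((g x - g y) * complex_of_real (?K y)) = cmod (g x - g y) * ?K y"
          using K0[of y] by (simp add: norm_mult)
        also have "\<dots> \<le> (e + C * (\<Sum>j\<in>{1..d}. 1 - cos (2 * pi * (x j - y j)))) * ?K y"
          by (rule mult_right_mono[OF C(2) K0])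
        also have "\<dots> = e * ?K y + C * (\<Sum>j\<in>{1..d}. (1 - cos (2 * pi * (x j - y j))) * ?K y)"
          by (simp add: distrib_right sum_distrib_right mult.assoc)
        finally show "cmod ((g x - g y) * complex_of_real (?K y)) \<le>
          e * ?K y + C * (\<Sum>j\<in>{1..d}. (1 - cos (2 * pi * (x j - y j))) * ?K y)" .
      qed
      also have "\<dots> = e * (LINT y|cube d. ?K y) + C * (\<Sum>j\<in>{1..d}. LINT y|cube d. (1 - cos (2 * pi * (x j - y j))) * ?K y)"
      proof -
        have 1: "integrable (cube d) (\<lambda>y. e * ?K y)" using o(2) by simp
        have 2: "integrable (cube d) (\<lambda>y. \<Sum>j\<in>{1..d}. (1 - cos (2 * pi * (x j - y j))) * ?K y)"
          using c(2) by (intro Bochner_Integration.integrable_sum) auto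
        have 3: "integrable (cube d) (\<lambda>y. C * (\<Sum>j\<in>{1..d}. (1 - cos (2 * pi * (x j - y j))) * ?K y))"
          by (rule integrable_mult_right[OF 2])
        have 4: "(LINT y|cube d. (\<Sum>j\<in>{1..d}. (1 - cos (2 * pi * (x j - y j))) * ?K y)) =
            (\<Sum>j\<in>{1..d}. LINT y|cube d. (1 - cos (2 * pi * (x j - y j))) * ?K y)"
          using c(2) by (intro Bochner_Integration.integral_sum) auto
        show ?thesis unfolding Bochner_Integration.integral_add[OF 1 3] integral_mult_right_zero 4 ..
      qed
      also have "\<dots> = e + C * (\<Sum>j\<in>{1..d}. 1 / real (Suc N))"
        using o(1) c(1) by simp
      finally show ?thesis by simp
    qed
    have "(\<lambda>N. e + C * real d * (1 / real (Suc N))) \<longlonglongrightarrow> e + C * real d * 0"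
      by (intro tendsto_intros LIMSEQ_Suc lim_1_over_n)
    then show ?thesis using N by (intro LIMSEQ_le_const[of _ "0 + e"]) (simp_all del: of_nat_Suc, blast)
  qed
  have "cmod (g x) \<le> 0"
    by (rule field_le_epsilon) (rule le)
  then show ?thesis by simp
qed

lemma fourier_coeff_bound:
  assumes "periodic g" "\<And>x. cmod (g x) \<le> e"
  shows "cmod (fourier_coeff d g h) \<le> e"
proof -
  interpret prob_space "cube d" by (rule prob_space_cube)
  have int: "integrable (cube d) (\<lambda>y. g y * expi (- ip h y))"
    using periodic_integrable[OF periodic_mult[OF assms(1) periodic_cnj[OF periodic_expi[of h]]]]
    by (simp add: expi_cnj)
  have "cmod (fourier_coeff d g h) \<le> (LINT y|cube d. cmod (g y * expi (- ip h y)))"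
    unfolding fourier_coeff_eq by (rule integral_norm_bound)
  also have "\<dots> \<le> (LINT y|cube d. e)"
    by (rule integral_mono[OF integrable_norm[OF int]]) (simp_all add: norm_mult assms(2))
  finally show ?thesis by (simp add: prob_space)
qed

lemma fourier_coeff_diff:
  assumes "periodic f" "periodic g"
  shows "fourier_coeff d (\<lambda>x. f x - g x) h = fourier_coeff d f h - fourier_coeff d g h"
proof -
  have int: "integrable (cube d) (\<lambda>y. g y * expi (- ip h y))" if "periodic g" for g
    using periodic_integrable[OF periodic_mult[OF that periodic_cnj[OF periodic_expi[of h]]]]
    by (simp add: expi_cnj)
  show ?thesis unfolding fourier_coeff_eq
    using Bochner_Integration.integral_diff[OF int[OF assms(1)] int[OF assms(2)]]
    by (simp add: algebra_simps)
qed

text \<open>Uniform convergence, by the Weierstrass test, carries continuity and the coefficients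
  over from finite partial sums.\<close>

lemma periodic_series:
  assumes c: "c abs_summable_on Zvec d"
  defines "S \<equiv> (\<lambda>x. \<Sum>\<^sub>\<infinity>h\<in>Zvec d. c h * expi (ip h x))"
  shows "periodic S" and "k \<in> Zvec d \<Longrightarrow> fourier_coeff d S k = c k"
proof -
  have per: "periodic (\<lambda>x. c h * expi (ip h x))" for h
    by (intro periodic_mult periodic_const periodic_expi)
  have u: "uniform_limit UNIV (\<lambda>F x. \<Sum>h\<in>F. c h * expi (ip h x)) S (finite_subsets_at_top (Zvec d))"
    unfolding S_def by (rule Weierstrass_m_test_general[OF _ c]) (simp add: norm_mult)
  have "continuous_on UNIV S"
  proof (rule uniform_limit_theorem[OF _ u])
    show "\<forall>\<^sub>F F in finite_subsets_at_top (Zvec d). continuous_on UNIV (\<lambda>x. \<Sum>h\<in>F. c h * expi (ip h x))"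
      by (intro always_eventually allI continuous_on_sum periodicD(2)[OF per])
  qed simp
  moreover have "S x = S y" if "\<forall>j\<in>{1..d}. x j = y j" for x y
    unfolding S_def using that by (intro infsum_cong periodicD(1)[OF per]) auto
  moreover have "S (x(j := x j + 1)) = S x" if "j \<in> {1..d}" for x j
    unfolding S_def using that by (intro infsum_cong periodicD(3)[OF per])
  ultimately show S: "periodic S" by (auto simp: periodic_def)
  assume k: "k \<in> Zvec d"
  have le: "cmod (fourier_coeff d S k - c k) \<le> 0 + e" if e: "0 < e" for e
  proof -
    have "\<forall>\<^sub>F F in finite_subsets_at_top (Zvec d). \<forall>x\<in>UNIV. dist (\<Sum>h\<in>F. c h * expi (ip h x)) (S x) < e"
      by (rule uniform_limitD[OF u e])
    then obtain F0 where F0: "finite F0 \<and> F0 \<subseteq> Zvec d \<and> (\<forall>F. finite F \<and> F0 \<subseteq> F \<and> F \<subseteq> Zvec d \<longrightarrow>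
        (\<forall>x\<in>UNIV. dist (\<Sum>h\<in>F. c h * expi (ip h x)) (S x) < e))"
      unfolding eventually_finite_subsets_at_top by (rule exE)
    \<comment> \<open>Adding \<open>k\<close> keeps the partial sum within \<open>e\<close> of the
      limit and makes its coefficient at \<open>k\<close> exactly \<open>c k\<close>.\<close>
    define F where "F = insert k F0"
    have F: "finite F" "F \<subseteq> Zvec d" "k \<in> F" using F0 k by (auto simp: F_def)
    let ?P = "\<lambda>x. \<Sum>h\<in>F. c h * expi (ip h x)"
    have P: "periodic ?P" by (rule periodic_sum) (rule per)
    have "fourier_coeff d ?P k = (\<Sum>h\<in>F. c h * fourier_coeff d (\<lambda>x. expi (ip h x)) k)"
    proof -
      have int: "integrable (cube d) (\<lambda>y. expi (ip h y) * expi (- ip k y))" for h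
        using periodic_integrable[OF periodic_mult[OF periodic_expi[of h] periodic_cnj[OF periodic_expi[of k]]]]
        by (simp add: expi_cnj)
      have "?P y * expi (- ip k y) = (\<Sum>h\<in>F. c h * (expi (ip h y) * expi (- ip k y)))" for y
        by (simp add: sum_distrib_right mult.assoc)
      then show ?thesis unfolding fourier_coeff_eq using int
        by (simp add: Bochner_Integration.integral_sum)
    qed
    also have "\<dots> = (\<Sum>h\<in>F. if k = h then c h else 0)"
      using fourier_coeff_expi F(2) k by (intro sum.cong) auto
    also have "\<dots> = c k" using F by simp
    finally have "fourier_coeff d S k - c k = fourier_coeff d (\<lambda>x. S x - ?P x) k"
      using fourier_coeff_diff[OF S P] by simp
    also have "cmod \<dots> \<le> 0 + e"
      unfolding add_0_left
    proof (rule fourier_coeff_bound[OF periodic_diff[OF S P]])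
      fix x
      have "\<forall>x\<in>UNIV. dist (?P x) (S x) < e"
        using F0 F by (elim conjE allE[of _ F]) (simp add: F_def subset_insertI)
      then have "dist (?P x) (S x) < e" by simp
      then show "cmod (S x - ?P x) \<le> e" by (simp add: dist_norm norm_minus_commute)
    qed
    finally show ?thesis .
  qed
  have "cmod (fourier_coeff d S k - c k) \<le> 0"
    by (rule field_le_epsilon) (rule le)
  then show "fourier_coeff d S k = c k" by (simp only: norm_le_zero_iff right_minus_eq)
qed

text \<open>The difference of \<open>f\<close> and its series has only zero coefficients, so
  \<open>periodic_eq_0\<close> applies.\<close>

theorem fourier_series:
  assumes f: "periodic f" and c: "fourier_coeff d f abs_summable_on Zvec d"
  shows "f x = (\<Sum>\<^sub>\<infinity>h\<in>Zvec d. fourier_coeff d f h * expi (ip h x))"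
proof -
  let ?S = "\<lambda>x. \<Sum>\<^sub>\<infinity>h\<in>Zvec d. fourier_coeff d f h * expi (ip h x)"
  note S = periodic_series[OF c]
  have "fourier_coeff d (\<lambda>x. f x - ?S x) h = 0" if "h \<in> Zvec d" for h
    unfolding fourier_coeff_diff[OF f S(1)] S(2)[OF that] by simp
  then have "f x - ?S x = 0" by (rule periodic_eq_0[OF periodic_diff[OF f S(1)]])
  then show ?thesis by simp
qed

end

section \<open>The randomised error\<close>

lemma infsum_Cauchy_Schwarz:
  fixes a b :: "'a \<Rightarrow> real"
  assumes "(\<lambda>x. (a x)\<^sup>2) summable_on A" "(\<lambda>x. (b x)\<^sup>2) summable_on A"
    and "\<And>x. x \<in> A \<Longrightarrow> 0 \<le> a x" "\<And>x. x \<in> A \<Longrightarrow> 0 \<le> b x"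
  shows "(\<lambda>x. a x * b x) summable_on A"
    and "(\<Sum>\<^sub>\<infinity>x\<in>A. a x * b x) \<le> sqrt (\<Sum>\<^sub>\<infinity>x\<in>A. (a x)\<^sup>2) * sqrt (\<Sum>\<^sub>\<infinity>x\<in>A. (b x)\<^sup>2)"
proof -
  have "(\<lambda>x. a x * b x) abs_summable_on A"
    by (rule Infinite_Sum.abs_summable_product) (use assms(1,2) in \<open>simp_all add: power2_eq_square\<close>)
  then show sm: "(\<lambda>x. a x * b x) summable_on A" by (rule abs_summable_summable)
  show "(\<Sum>\<^sub>\<infinity>x\<in>A. a x * b x) \<le> sqrt (\<Sum>\<^sub>\<infinity>x\<in>A. (a x)\<^sup>2) * sqrt (\<Sum>\<^sub>\<infinity>x\<in>A. (b x)\<^sup>2)"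
  proof (rule infsum_le_finite_sums[OF sm])
    fix F assume F: "finite F" "F \<subseteq> A"
    have "(\<Sum>x\<in>F. a x * b x) \<le> sqrt ((\<Sum>x\<in>F. (a x)\<^sup>2) * (\<Sum>x\<in>F. (b x)\<^sup>2))"
      by (rule real_le_rsqrt) (rule Cauchy_Schwarz_ineq_sum)
    also have "\<dots> = sqrt (\<Sum>x\<in>F. (a x)\<^sup>2) * sqrt (\<Sum>x\<in>F. (b x)\<^sup>2)" by (rule real_sqrt_mult)
    also have "\<dots> \<le> sqrt (\<Sum>\<^sub>\<infinity>x\<in>A. (a x)\<^sup>2) * sqrt (\<Sum>\<^sub>\<infinity>x\<in>A. (b x)\<^sup>2)"
      using F assms by (intro mult_mono real_sqrt_le_mono finite_sum_le_infsum) (auto intro!: sum_nonneg infsum_nonneg)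
    finally show "(\<Sum>x\<in>F. a x * b x) \<le> sqrt (\<Sum>\<^sub>\<infinity>x\<in>A. (a x)\<^sup>2) * sqrt (\<Sum>\<^sub>\<infinity>x\<in>A. (b x)\<^sup>2)" .
  qed
qed

context
  fixes d :: nat and \<alpha> :: real and \<gamma> :: "nat \<Rightarrow> real"
  assumes \<alpha>: "1 / 2 < \<alpha>" and \<gamma>: "\<And>j. 1 \<le> j \<Longrightarrow> 0 < \<gamma> j"
begin

lemma korobov_periodic: "f \<in> korobov_space d \<alpha> \<gamma> \<Longrightarrow> periodic d f"
  by (simp add: korobov_space_def periodic_def)

lemma inv_r_square: "h \<in> Zvec d \<Longrightarrow> (inverse (r_weight \<alpha> \<gamma> h))\<^sup>2 = r_weight \<alpha> \<gamma> h powr (-2)"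
  using r_weight_pos[of \<gamma> h d \<alpha>, OF \<gamma>] by (simp add: powr_minus power_inverse)

text \<open>The Cauchy--Schwarz inequality against \<open>1 / r\<close>, whose squares are summable
  because \<open>2 * \<alpha> > 1\<close>.\<close>

lemma korobov_coeff_summable:
  assumes "f \<in> korobov_space d \<alpha> \<gamma>"
  shows "fourier_coeff d f abs_summable_on Zvec d"
proof -
  let ?r = "r_weight \<alpha> \<gamma>"
  have r: "0 < ?r h" if "h \<in> Zvec d" for h using r_weight_pos[of \<gamma> h d \<alpha>, OF \<gamma>] that by blast
  have "(\<lambda>h. (?r h * cmod (fourier_coeff d f h)) * inverse (?r h)) summable_on Zvec d"
  proof (rule infsum_Cauchy_Schwarz(1))
    show "(\<lambda>h. (?r h * cmod (fourier_coeff d f h))\<^sup>2) summable_on Zvec d"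
      using assms by (simp add: korobov_space_def power_mult_distrib)
    have "(\<lambda>h. ?r h powr (-2)) summable_on Zvec d"
      by (rule r_weight_powr_summable) (use \<alpha> \<gamma> in auto)
    then show "(\<lambda>h. (inverse (?r h))\<^sup>2) summable_on Zvec d"
      by (rule summable_on_cong[THEN iffD1, rotated]) (simp add: inv_r_square)
  qed (use r in \<open>auto simp: less_imp_le\<close>)
  then show ?thesis
    by (rule summable_on_cong[THEN iffD1, rotated]) (use r in \<open>force simp: field_simps\<close>)
qed

text \<open>Aliasing: the average of a character over the lattice points is 1 on the dual lattice
  and 0 elsewhere. The zero frequency accounts for the integral.\<close>

lemma Q_lattice_error:
  assumes f: "f \<in> korobov_space d \<alpha> \<gamma>" and p: "0 < p"
  shows "Q_lattice p z f - I_d d f =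
    (\<Sum>\<^sub>\<infinity>h\<in>{h \<in> Zvec d - {\<lambda>_. 0}. int p dvd (\<Sum>j\<in>{1..d}. h j * z j)}. fourier_coeff d f h)"
proof -
  let ?c = "fourier_coeff d f"
  let ?A = "\<lambda>h. \<Sum>j\<in>{1..d}. h j * z j"
  note per = korobov_periodic[OF f] and sm = korobov_coeff_summable[OF f]
  have pt: "f (\<lambda>j. real_of_int ((int k * z j) mod int p) / real p) =
      (\<Sum>\<^sub>\<infinity>h\<in>Zvec d. ?c h * expi (real k * real_of_int (?A h) / real p))" for k
  proof -
    have "f (\<lambda>j. real_of_int ((int k * z j) mod int p) / real p) = f (\<lambda>j. real_of_int (int k * z j) / real p)"
    proof (rule periodic_shift[OF per])
      fix j
      have "real_of_int ((int k * z j) mod int p) = real_of_int (int k * z j) - real p * real_of_int ((int k * z j) div int p)"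
        by (simp only: minus_mult_div_eq_mod[symmetric] of_int_diff of_int_mult of_int_of_nat_eq)
      then have "real_of_int ((int k * z j) mod int p) / real p - real_of_int (int k * z j) / real p = - real_of_int ((int k * z j) div int p)"
        using p by (simp add: field_simps)
      then show "real_of_int ((int k * z j) mod int p) / real p - real_of_int (int k * z j) / real p \<in> \<int>"
        by simp
    qed
    also have "\<dots> = (\<Sum>\<^sub>\<infinity>h\<in>Zvec d. ?c h * expi (ip d h (\<lambda>j. real_of_int (int k * z j) / real p)))"
      by (rule fourier_series[OF per sm])
    also have "\<dots> = (\<Sum>\<^sub>\<infinity>h\<in>Zvec d. ?c h * expi (real k * real_of_int (?A h) / real p))"
      by (simp add: ip_def sum_distrib_left sum_divide_distrib mult_ac)
    finally show ?thesis .
  qed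
  have Q: "Q_lattice p z f = (\<Sum>\<^sub>\<infinity>h\<in>{h \<in> Zvec d. int p dvd ?A h}. ?c h)"
    unfolding Q_lattice_def pt by (rule infsum_dvd[OF sm p, symmetric])
  have "fourier_coeff d f (\<lambda>_. 0) = I_d d f"
    by (simp add: fourier_coeff_def I_d_def)
  then have I: "I_d d f = (\<Sum>\<^sub>\<infinity>h\<in>{\<lambda>_. 0}. ?c h)" by simp
  let ?D = "{h \<in> Zvec d - {\<lambda>_. 0}. int p dvd ?A h}"
  have "{h \<in> Zvec d. int p dvd ?A h} = {\<lambda>_. 0} \<union> ?D" by auto
  then have "(\<Sum>\<^sub>\<infinity>h\<in>{h \<in> Zvec d. int p dvd ?A h}. ?c h) = (\<Sum>\<^sub>\<infinity>h\<in>{\<lambda>_. 0} \<union> ?D. ?c h)" by simp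
  also have "\<dots> = (\<Sum>\<^sub>\<infinity>h\<in>{\<lambda>_. 0}. ?c h) + (\<Sum>\<^sub>\<infinity>h\<in>?D. ?c h)"
    by (rule infsum_Un_disjoint) (auto intro!: summable_on_subset[OF abs_summable_summable[OF sm]])
  finally show ?thesis unfolding Q I by simp
qed

text \<open>Exchanging the sum over primes with that over frequencies produces the counting function
  \<open>N\<close>, and \<open>(N h)\<^sup>2\<close> counts the pairs of primes whose dual lattices
  both contain \<open>h\<close>. The Cauchy--Schwarz inequality is applied only after this
  exchange.\<close>

lemma e_ran_le:
  assumes ne: "primes_P n \<noteq> {}"
  shows "e_ran d \<alpha> \<gamma> (Q_ran_pr n z) \<le>
    ereal (sqrt (\<Sum>p\<in>primes_P n. \<Sum>q\<in>primes_P n. pair_sum \<alpha> \<gamma> d z p q) / real (card (primes_P n)))"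
  unfolding e_ran_def
proof (rule SUP_least)
  fix f assume "f \<in> {f \<in> korobov_space d \<alpha> \<gamma>. korobov_norm d \<alpha> \<gamma> f \<le> 1}"
  then have f: "f \<in> korobov_space d \<alpha> \<gamma>" and norm: "korobov_norm d \<alpha> \<gamma> f \<le> 1" by auto
  let ?P = "primes_P n" and ?H = "Zvec d - {\<lambda>_. 0}"
  let ?c = "fourier_coeff d f" and ?r = "r_weight \<alpha> \<gamma>"
  let ?A = "\<lambda>h. \<Sum>j\<in>{1..d}. h j * z j"
  define N where "N h = real (card {p \<in> ?P. int p dvd ?A h})" for h
  have r: "0 < ?r h" if "h \<in> Zvec d" for h using r_weight_pos[of \<gamma> h d \<alpha>, OF \<gamma>] that by blast
  have csm: "(\<lambda>h. cmod (?c h)) summable_on ?H"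
    by (rule summable_on_subset[OF korobov_coeff_summable[OF f]]) auto
  have rsm: "(\<lambda>h. ?r h powr (-2)) summable_on ?H"
    by (rule summable_on_subset[OF r_weight_powr_summable[of \<gamma> \<alpha> 2 d, OF \<gamma>]]) (use \<alpha> in auto)
  have rcsm: "(\<lambda>h. (?r h * cmod (?c h))\<^sup>2) summable_on Zvec d"
    using f by (simp add: korobov_space_def power_mult_distrib)
  have le: "cmod (Q_lattice p z f - I_d d f) \<le> (\<Sum>\<^sub>\<infinity>h\<in>{h \<in> ?H. int p dvd ?A h}. cmod (?c h))"
    if "p \<in> ?P" for p
  proof -
    have "0 < p" using primes_P_D(4)[OF that] .
    then show ?thesis unfolding Q_lattice_error[OF f \<open>0 < p\<close>]
      by (intro norm_infsum_bound) (auto intro: summable_on_subset[OF csm])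
  qed
  have count: "(\<Sum>p\<in>?P. \<Sum>\<^sub>\<infinity>h\<in>{h \<in> ?H. int p dvd ?A h}. g h) = (\<Sum>\<^sub>\<infinity>h\<in>?H. N h * g h)"
    "(\<lambda>h. N h * g h) summable_on ?H" if "g summable_on ?H" for g :: "(nat \<Rightarrow> int) \<Rightarrow> real"
    unfolding N_def using sum_infsum_count[OF finite_primes_P that, where P = "\<lambda>h p. int p dvd ?A h"] by auto
  note sN = count(2)[OF rsm]
  have "(\<Sum>p\<in>?P. \<Sum>q\<in>?P. pair_sum \<alpha> \<gamma> d z p q) = (\<Sum>q\<in>?P. \<Sum>p\<in>?P. \<Sum>\<^sub>\<infinity>h\<in>{h \<in> {h \<in> ?H. int q dvd ?A h}. int p dvd ?A h}. ?r h powr (-2))"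
    unfolding pair_sum_def by (subst sum.swap) (intro sum.cong refl infsum_cong_neutral, auto)
  also have "\<dots> = (\<Sum>q\<in>?P. \<Sum>\<^sub>\<infinity>h\<in>{h \<in> ?H. int q dvd ?A h}. N h * ?r h powr (-2))"
  proof (rule sum.cong[OF refl])
    fix q
    have "(\<lambda>h. ?r h powr (-2)) summable_on {h \<in> ?H. int q dvd ?A h}"
      by (rule summable_on_subset[OF rsm]) auto
    from sum_infsum_count(1)[OF finite_primes_P this, where P = "\<lambda>h p. int p dvd ?A h"]
    show "(\<Sum>p\<in>?P. \<Sum>\<^sub>\<infinity>h\<in>{h \<in> {h \<in> ?H. int q dvd ?A h}. int p dvd ?A h}. ?r h powr (-2)) =
        (\<Sum>\<^sub>\<infinity>h\<in>{h \<in> ?H. int q dvd ?A h}. N h * ?r h powr (-2))"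
      unfolding N_def .
  qed
  also have "\<dots> = (\<Sum>\<^sub>\<infinity>h\<in>?H. N h * (N h * ?r h powr (-2)))"
    by (rule count(1)[OF sN])
  finally have pairs: "(\<Sum>p\<in>?P. \<Sum>q\<in>?P. pair_sum \<alpha> \<gamma> d z p q) = (\<Sum>\<^sub>\<infinity>h\<in>?H. N h * (N h * ?r h powr (-2)))" .
  have sq: "N h * (N h * ?r h powr (-2)) = (N h * inverse (?r h))\<^sup>2" if "h \<in> ?H" for h
  proof -
    have "h \<in> Zvec d" using that by simp
    then have "?r h powr (-2) = inverse (?r h) * inverse (?r h)"
      by (simp only: inv_r_square[symmetric] power2_eq_square)
    then show ?thesis by (simp add: power2_eq_square)
  qed
  have "(\<Sum>p\<in>?P. cmod (Q_lattice p z f - I_d d f)) \<le> (\<Sum>p\<in>?P. \<Sum>\<^sub>\<infinity>h\<in>{h \<in> ?H. int p dvd ?A h}. cmod (?c h))"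
    by (rule sum_mono) (rule le)
  also have "\<dots> = (\<Sum>\<^sub>\<infinity>h\<in>?H. N h * cmod (?c h))" by (rule count(1)[OF csm])
  also have "\<dots> = (\<Sum>\<^sub>\<infinity>h\<in>?H. (?r h * cmod (?c h)) * (N h * inverse (?r h)))"
    by (rule infsum_cong) (use r in \<open>force simp: field_simps\<close>)
  also have "\<dots> \<le> sqrt (\<Sum>\<^sub>\<infinity>h\<in>?H. (?r h * cmod (?c h))\<^sup>2) * sqrt (\<Sum>\<^sub>\<infinity>h\<in>?H. (N h * inverse (?r h))\<^sup>2)"
  proof (rule infsum_Cauchy_Schwarz(2))
    show "(\<lambda>h. (?r h * cmod (?c h))\<^sup>2) summable_on ?H"
      by (rule summable_on_subset[OF rcsm]) auto
    show "(\<lambda>h. (N h * inverse (?r h))\<^sup>2) summable_on ?H"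
      by (rule summable_on_cong[THEN iffD1, OF _ count(2)[OF sN]]) (rule sq)
  qed (use r in \<open>auto simp: N_def less_imp_le\<close>)
  also have "\<dots> \<le> 1 * sqrt (\<Sum>\<^sub>\<infinity>h\<in>?H. (N h * inverse (?r h))\<^sup>2)"
  proof (rule mult_right_mono)
    have "(\<Sum>\<^sub>\<infinity>h\<in>?H. (?r h * cmod (?c h))\<^sup>2) \<le> (\<Sum>\<^sub>\<infinity>h\<in>Zvec d. (?r h * cmod (?c h))\<^sup>2)"
      by (rule infsum_mono_neutral) (auto intro: summable_on_subset[OF rcsm] rcsm)
    then have "sqrt (\<Sum>\<^sub>\<infinity>h\<in>?H. (?r h * cmod (?c h))\<^sup>2) \<le> korobov_norm d \<alpha> \<gamma> f"
      by (simp add: korobov_norm_def power_mult_distrib)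
    then show "sqrt (\<Sum>\<^sub>\<infinity>h\<in>?H. (?r h * cmod (?c h))\<^sup>2) \<le> 1" by (rule order_trans[OF _ norm])
  qed (auto intro!: infsum_nonneg)
  also have "(\<Sum>\<^sub>\<infinity>h\<in>?H. (N h * inverse (?r h))\<^sup>2) = (\<Sum>p\<in>?P. \<Sum>q\<in>?P. pair_sum \<alpha> \<gamma> d z p q)"
    unfolding pairs by (rule infsum_cong) (rule sq[symmetric])
  finally have main: "(\<Sum>p\<in>?P. cmod (Q_lattice p z f - I_d d f)) \<le> sqrt (\<Sum>p\<in>?P. \<Sum>q\<in>?P. pair_sum \<alpha> \<gamma> d z p q)"
    by simp
  have "measure_pmf.expectation (Q_ran_pr n z f) (\<lambda>y. cmod (y - I_d d f)) =
      (\<Sum>p\<in>?P. cmod (Q_lattice p z f - I_d d f)) / real (card ?P)"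
    unfolding Q_ran_pr_def integral_map_pmf
    by (rule integral_pmf_of_set[OF ne finite_primes_P])
  then show "ereal (measure_pmf.expectation (Q_ran_pr n z f) (\<lambda>y. cmod (y - I_d d f))) \<le>
      ereal (sqrt (\<Sum>p\<in>?P. \<Sum>q\<in>?P. pair_sum \<alpha> \<gamma> d z p q) / real (card ?P))"
    using main by (simp add: divide_right_mono)
qed

end

section \<open>A structured language on the random access machine\<close>

text \<open>
  Both memories are divided into \<open>n_slots\<close> interleaved arrays: entry \<open>i\<close> of slot \<open>a\<close> is the cell
  \<open>n_slots * i + a\<close>. Hence all slots can grow at the same time and never overlap.
\<close>

definition n_slots :: nat where
  "n_slots = 64"

record store =
  ivar :: "nat \<Rightarrow> int \<Rightarrow> int"
  rvar :: "nat \<Rightarrow> int \<Rightarrow> real"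
  outs :: "int list"

definition set_ivar :: "nat \<Rightarrow> int \<Rightarrow> int \<Rightarrow> store \<Rightarrow> store" where
  "set_ivar a i x s = s\<lparr>ivar := (ivar s)(a := (ivar s a)(i := x))\<rparr>"

definition set_rvar :: "nat \<Rightarrow> int \<Rightarrow> real \<Rightarrow> store \<Rightarrow> store" where
  "set_rvar a i x s = s\<lparr>rvar := (rvar s)(a := (rvar s a)(i := x))\<rparr>"

definition emit_out :: "int \<Rightarrow> store \<Rightarrow> store" where
  "emit_out x s = s\<lparr>outs := outs s @ [x]\<rparr>"

lemma store_simps [simp]:
  "ivar (set_ivar a i x s) b j = (if b = a \<and> j = i then x else ivar s b j)"
  "rvar (set_ivar a i x s) b j = rvar s b j"
  "outs (set_ivar a i x s) = outs s"
  "ivar (set_rvar a i y s) b j = ivar s b j"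
  "rvar (set_rvar a i y s) b j = (if b = a \<and> j = i then y else rvar s b j)"
  "outs (set_rvar a i y s) = outs s"
  "ivar (emit_out x s) b j = ivar s b j"
  "rvar (emit_out x s) b j = rvar s b j"
  "outs (emit_out x s) = outs s @ [x]"
  by (auto simp: set_ivar_def set_rvar_def emit_out_def)

datatype ie =
    Num int
  | Dim
  | Size
  | Iv nat ie
  | Res ie
  | Ib iop ie ie

datatype re =
    Cast ie
  | Tau
  | Wt ie
  | Rv nat ie
  | Rb rop re re
  | Rt re
  | Sg re

datatype be =
    Lei ie ie
  | Ler re re
  | Nt be
  | An be be

datatype prog =
    Nop
  | Iset nat ie ie
  | Rset nat ie re
  | Put ie
  | Sq prog prog (infixr ";;" 60)
  | Ifc be prog prog
  | For nat nat ie prog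

text \<open>Evaluation is total and definedness is a separate predicate, so states can be computed
  by rewriting while the side conditions are collected apart.\<close>

primrec iop_tot :: "iop \<Rightarrow> int \<Rightarrow> int \<Rightarrow> int" where
  "iop_tot IAdd a b = a + b"
| "iop_tot ISub a b = a - b"
| "iop_tot IMul a b = a * b"
| "iop_tot IDiv a b = a div b"
| "iop_tot IMod a b = a mod b"

primrec iop_ok :: "iop \<Rightarrow> int \<Rightarrow> bool" where
  "iop_ok IAdd b = True"
| "iop_ok ISub b = True"
| "iop_ok IMul b = True"
| "iop_ok IDiv b = (b \<noteq> 0)"
| "iop_ok IMod b = (b \<noteq> 0)"

primrec rop_tot :: "rop \<Rightarrow> real \<Rightarrow> real \<Rightarrow> real" where
  "rop_tot RAdd a b = a + b"
| "rop_tot RSub a b = a - b"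
| "rop_tot RMul a b = a * b"
| "rop_tot RDiv a b = a / b"

primrec rop_ok :: "rop \<Rightarrow> real \<Rightarrow> bool" where
  "rop_ok RAdd b = True"
| "rop_ok RSub b = True"
| "rop_ok RMul b = True"
| "rop_ok RDiv b = (b \<noteq> 0)"

primrec iev :: "input \<Rightarrow> store \<Rightarrow> ie \<Rightarrow> int" where
  "iev I s (Num c) = c"
| "iev I s Dim = in_dim I"
| "iev I s Size = in_size I"
| "iev I s (Iv a e) = ivar s a (iev I s e)"
| "iev I s (Res e) = outs s ! nat (iev I s e)"
| "iev I s (Ib f e1 e2) = iop_tot f (iev I s e1) (iev I s e2)"

text \<open>\<open>L\<close> is the number of entries of each slot.\<close>

primrec iok :: "input \<Rightarrow> nat \<Rightarrow> store \<Rightarrow> ie \<Rightarrow> bool" where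
  "iok I L s (Num c) = True"
| "iok I L s Dim = True"
| "iok I L s Size = True"
| "iok I L s (Iv a e) = (iok I L s e \<and> 0 \<le> iev I s e \<and> iev I s e < int L)"
| "iok I L s (Res e) = (iok I L s e \<and> 0 \<le> iev I s e \<and> iev I s e < int (length (outs s)))"
| "iok I L s (Ib f e1 e2) = (iok I L s e1 \<and> iok I L s e2 \<and> iop_ok f (iev I s e2))"

primrec rev :: "input \<Rightarrow> store \<Rightarrow> re \<Rightarrow> real" where
  "rev I s (Cast e) = real_of_int (iev I s e)"
| "rev I s Tau = in_tau I"
| "rev I s (Wt e) = in_weight I (nat (iev I s e))"
| "rev I s (Rv a e) = rvar s a (iev I s e)"
| "rev I s (Rb f e1 e2) = rop_tot f (rev I s e1) (rev I s e2)"
| "rev I s (Rt e) = sqrt (rev I s e)"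
| "rev I s (Sg e) = in_sigma I (rev I s e)"

primrec rok :: "input \<Rightarrow> nat \<Rightarrow> store \<Rightarrow> re \<Rightarrow> bool" where
  "rok I L s (Cast e) = iok I L s e"
| "rok I L s Tau = True"
| "rok I L s (Wt e) = (iok I L s e \<and> 1 \<le> iev I s e \<and> iev I s e \<le> in_dim I)"
| "rok I L s (Rv a e) = (iok I L s e \<and> 0 \<le> iev I s e \<and> iev I s e < int L)"
| "rok I L s (Rb f e1 e2) = (rok I L s e1 \<and> rok I L s e2 \<and> rop_ok f (rev I s e2))"
| "rok I L s (Rt e) = (rok I L s e \<and> 0 \<le> rev I s e)"
| "rok I L s (Sg e) = (rok I L s e \<and> 0 \<le> rev I s e \<and> rev I s e \<le> 1)"

primrec bev :: "input \<Rightarrow> store \<Rightarrow> be \<Rightarrow> bool" where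
  "bev I s (Lei e1 e2) = (iev I s e1 \<le> iev I s e2)"
| "bev I s (Ler e1 e2) = (rev I s e1 \<le> rev I s e2)"
| "bev I s (Nt b) = (\<not> bev I s b)"
| "bev I s (An b1 b2) = (bev I s b1 \<and> bev I s b2)"

primrec bok :: "input \<Rightarrow> nat \<Rightarrow> store \<Rightarrow> be \<Rightarrow> bool" where
  "bok I L s (Lei e1 e2) = (iok I L s e1 \<and> iok I L s e2)"
| "bok I L s (Ler e1 e2) = (rok I L s e1 \<and> rok I L s e2)"
| "bok I L s (Nt b) = bok I L s b"
| "bok I L s (An b1 b2) = (bok I L s b1 \<and> bok I L s b2)"

primrec iter :: "(nat \<Rightarrow> 'a \<Rightarrow> 'a) \<Rightarrow> nat \<Rightarrow> 'a \<Rightarrow> 'a" where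
  "iter f 0 s = s"
| "iter f (Suc k) s = f k (iter f k s)"

text \<open>
  In \<open>For v b e c\<close> the counter is entry 0 of slot \<open>v\<close> and the number of iterations, which is
  evaluated once, is kept in entry 1. The number \<open>b\<close> names a bound on the number of iterations;
  it is used in the time analysis only.
\<close>

primrec run :: "input \<Rightarrow> prog \<Rightarrow> store \<Rightarrow> store" where
  "run I Nop s = s"
| "run I (Iset a e x) s = set_ivar a (iev I s e) (iev I s x) s"
| "run I (Rset a e x) s = set_rvar a (iev I s e) (rev I s x) s"
| "run I (Put e) s = emit_out (iev I s e) s"
| "run I (Sq c1 c2) s = run I c2 (run I c1 s)"
| "run I (Ifc b c1 c2) s = (if bev I s b then run I c1 s else run I c2 s)"
| "run I (For v b e c) s =
     set_ivar v 0 (int (nat (iev I s e)))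
       (iter (\<lambda>k s. run I c (set_ivar v 0 (int k) s)) (nat (iev I s e))
         (set_ivar v 1 (int (nat (iev I s e))) s))"

primrec ok :: "(nat \<Rightarrow> nat) \<Rightarrow> input \<Rightarrow> nat \<Rightarrow> prog \<Rightarrow> store \<Rightarrow> bool" where
  "ok B I L Nop s = True"
| "ok B I L (Iset a e x) s = (iok I L s e \<and> iok I L s x \<and> 0 \<le> iev I s e \<and> iev I s e < int L)"
| "ok B I L (Rset a e x) s = (iok I L s e \<and> rok I L s x \<and> 0 \<le> iev I s e \<and> iev I s e < int L)"
| "ok B I L (Put e) s = iok I L s e"
| "ok B I L (Sq c1 c2) s = (ok B I L c1 s \<and> ok B I L c2 (run I c1 s))"
| "ok B I L (Ifc b c1 c2) s = (bok I L s b \<and> (if bev I s b then ok B I L c1 s else ok B I L c2 s))"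
| "ok B I L (For v b e c) s =
     (iok I L s e \<and> 0 \<le> iev I s e \<and> nat (iev I s e) \<le> B b \<and>
      (\<forall>k<nat (iev I s e). ok B I L c (set_ivar v 0 (int k)
         (iter (\<lambda>k s. run I c (set_ivar v 0 (int k) s)) k
            (set_ivar v 1 (int (nat (iev I s e))) s)))))"

section \<open>Write sets and the frame property\<close>

primrec iwr :: "prog \<Rightarrow> nat set" where
  "iwr Nop = {}"
| "iwr (Iset a e x) = {a}"
| "iwr (Rset a e x) = {}"
| "iwr (Put e) = {}"
| "iwr (Sq c1 c2) = iwr c1 \<union> iwr c2"
| "iwr (Ifc b c1 c2) = iwr c1 \<union> iwr c2"
| "iwr (For v b e c) = insert v (iwr c)"

primrec rwr :: "prog \<Rightarrow> nat set" where
  "rwr Nop = {}"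
| "rwr (Iset a e x) = {}"
| "rwr (Rset a e x) = {a}"
| "rwr (Put e) = {}"
| "rwr (Sq c1 c2) = rwr c1 \<union> rwr c2"
| "rwr (Ifc b c1 c2) = rwr c1 \<union> rwr c2"
| "rwr (For v b e c) = rwr c"

primrec emits :: "prog \<Rightarrow> bool" where
  "emits Nop = False"
| "emits (Iset a e x) = False"
| "emits (Rset a e x) = False"
| "emits (Put e) = True"
| "emits (Sq c1 c2) = (emits c1 \<or> emits c2)"
| "emits (Ifc b c1 c2) = (emits c1 \<or> emits c2)"
| "emits (For v b e c) = emits c"

definition same_outside :: "nat set \<Rightarrow> nat set \<Rightarrow> bool \<Rightarrow> store \<Rightarrow> store \<Rightarrow> bool" where
  "same_outside X Y o' s s' \<longleftrightarrow>
     (\<forall>a i. a \<notin> X \<longrightarrow> ivar s' a i = ivar s a i) \<and>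
     (\<forall>a i. a \<notin> Y \<longrightarrow> rvar s' a i = rvar s a i) \<and>
     (\<not> o' \<longrightarrow> outs s' = outs s)"

lemma same_outsideD:
  assumes "same_outside X Y o' s s'"
  shows "a \<notin> X \<Longrightarrow> ivar s' a i = ivar s a i"
    and "b \<notin> Y \<Longrightarrow> rvar s' b i = rvar s b i"
    and "\<not> o' \<Longrightarrow> outs s' = outs s"
  using assms by (auto simp: same_outside_def)

lemma same_outside_refl: "same_outside X Y o' s s"
  by (simp add: same_outside_def)

lemma same_outside_trans:
  "same_outside X Y o' s s' \<Longrightarrow> same_outside X Y o' s' s'' \<Longrightarrow> same_outside X Y o' s s''"
  by (simp add: same_outside_def)

lemma same_outside_mono:
  "same_outside X Y o' s s' \<Longrightarrow> X \<subseteq> X' \<Longrightarrow> Y \<subseteq> Y' \<Longrightarrow> (o' \<Longrightarrow> o'') \<Longrightarrow> same_outside X' Y' o'' s s'"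
  unfolding same_outside_def by blast

lemma same_outside_set_ivar:
  "a \<in> X \<Longrightarrow> same_outside X Y o' s s' \<Longrightarrow> same_outside X Y o' s (set_ivar a i x s')"
  by (auto simp: same_outside_def)

lemma same_outside_iter:
  assumes "\<And>k s. same_outside X Y o' s (f k s)"
  shows "same_outside X Y o' s (iter f n s)"
proof (induction n)
  case 0
  then show ?case by (simp add: same_outside_refl)
next
  case (Suc n)
  then show ?case using assms same_outside_trans by fastforce
qed

lemma run_frame: "same_outside (iwr c) (rwr c) (emits c) s (run I c s)"
proof (induction c arbitrary: s)
  case (Sq c1 c2)
  have "same_outside (iwr (Sq c1 c2)) (rwr (Sq c1 c2)) (emits (Sq c1 c2)) s (run I c1 s)"
    by (rule same_outside_mono[OF Sq(1)]) auto
  moreover have "same_outside (iwr (Sq c1 c2)) (rwr (Sq c1 c2)) (emits (Sq c1 c2)) (run I c1 s)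
      (run I c2 (run I c1 s))"
    by (rule same_outside_mono[OF Sq(2)]) auto
  ultimately show ?case by (auto intro: same_outside_trans)
next
  case (Ifc b c1 c2)
  show ?case
  proof (cases "bev I s b")
    case True
    then show ?thesis by simp (rule same_outside_mono[OF Ifc(1)], auto)
  next
    case False
    then show ?thesis by simp (rule same_outside_mono[OF Ifc(2)], auto)
  qed
next
  case (For v b e c)
  let ?X = "insert v (iwr c)"
  have "same_outside ?X (rwr c) (emits c) s (run I c (set_ivar v 0 (int k) s))" for k s
  proof -
    have "same_outside ?X (rwr c) (emits c) (set_ivar v 0 (int k) s)
        (run I c (set_ivar v 0 (int k) s))"
      by (rule same_outside_mono[OF For]) auto
    moreover have "same_outside ?X (rwr c) (emits c) s (set_ivar v 0 (int k) s)"
      by (simp add: same_outside_def)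
    ultimately show ?thesis by (blast intro: same_outside_trans)
  qed
  then have "same_outside ?X (rwr c) (emits c) s' (iter (\<lambda>k s. run I c (set_ivar v 0 (int k) s)) n s')"
    for n s'
    by (rule same_outside_iter)
  moreover have "same_outside ?X (rwr c) (emits c) s (set_ivar v 1 x s)" for x
    by (simp add: same_outside_def)
  ultimately show ?case
    by (simp del: One_nat_def) (blast intro: same_outside_set_ivar same_outside_trans)
qed (simp_all add: same_outside_def)

text \<open>A loop body must not write the slot of its own counter. Then counter and limit survive
  the body, and the compiled \<open>While\<close> makes the intended number of rounds.\<close>

primrec wf :: "prog \<Rightarrow> bool" where
  "wf Nop = True"
| "wf (Iset a e x) = (a < n_slots)"
| "wf (Rset a e x) = (a < n_slots)"
| "wf (Put e) = True"
| "wf (Sq c1 c2) = (wf c1 \<and> wf c2)"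
| "wf (Ifc b c1 c2) = (wf c1 \<and> wf c2)"
| "wf (For v b e c) = (v < n_slots \<and> v \<notin> iwr c \<and> wf c)"

section \<open>Compilation to the machine, with its cost\<close>

definition cell :: "nat \<Rightarrow> iexp \<Rightarrow> iexp" where
  "cell a e = IBin IAdd (IBin IMul (IConst (int n_slots)) e) (IConst (int (a mod n_slots)))"

primrec comp_i :: "ie \<Rightarrow> iexp" where
  "comp_i (Num c) = IConst c"
| "comp_i Dim = IDim"
| "comp_i Size = ISize"
| "comp_i (Iv a e) = ILoad (cell a (comp_i e))"
| "comp_i (Res e) = IOut (comp_i e)"
| "comp_i (Ib f e1 e2) = IBin f (comp_i e1) (comp_i e2)"

primrec comp_r :: "re \<Rightarrow> rexp" where
  "comp_r (Cast e) = RCast (comp_i e)"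
| "comp_r Tau = RTau"
| "comp_r (Wt e) = RWeight (comp_i e)"
| "comp_r (Rv a e) = RLoad (cell a (comp_i e))"
| "comp_r (Rb f e1 e2) = RBin f (comp_r e1) (comp_r e2)"
| "comp_r (Rt e) = RSqrt (comp_r e)"
| "comp_r (Sg e) = RSigma (comp_r e)"

primrec comp_b :: "be \<Rightarrow> bexp" where
  "comp_b (Lei e1 e2) = ILe (comp_i e1) (comp_i e2)"
| "comp_b (Ler e1 e2) = RLe (comp_r e1) (comp_r e2)"
| "comp_b (Nt b) = BNot (comp_b b)"
| "comp_b (An b1 b2) = BAnd (comp_b b1) (comp_b b2)"

primrec comp :: "prog \<Rightarrow> com" where
  "comp Nop = Skip"
| "comp (Iset a e x) = IStore (cell a (comp_i e)) (comp_i x)"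
| "comp (Rset a e x) = RStore (cell a (comp_i e)) (comp_r x)"
| "comp (Put e) = Emit (comp_i e)"
| "comp (Sq c1 c2) = Seq (comp c1) (comp c2)"
| "comp (Ifc b c1 c2) = Cond (comp_b b) (comp c1) (comp c2)"
| "comp (For v b e c) =
     Seq (IStore (cell v (IConst 1)) (comp_i e))
     (Seq (IStore (cell v (IConst 0)) (IConst 0))
     (While (BNot (ILe (ILoad (cell v (IConst 1))) (ILoad (cell v (IConst 0)))))
       (Seq (comp c)
         (IStore (cell v (IConst 0)) (IBin IAdd (ILoad (cell v (IConst 0))) (IConst 1))))))"

text \<open>Slots have to be smaller than \<open>n_slots\<close> also where they are read.\<close>

primrec iwf :: "ie \<Rightarrow> bool" where
  "iwf (Num c) = True"
| "iwf Dim = True"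
| "iwf Size = True"
| "iwf (Iv a e) = (a < n_slots \<and> iwf e)"
| "iwf (Res e) = iwf e"
| "iwf (Ib f e1 e2) = (iwf e1 \<and> iwf e2)"

primrec rwf :: "re \<Rightarrow> bool" where
  "rwf (Cast e) = iwf e"
| "rwf Tau = True"
| "rwf (Wt e) = iwf e"
| "rwf (Rv a e) = (a < n_slots \<and> iwf e)"
| "rwf (Rb f e1 e2) = (rwf e1 \<and> rwf e2)"
| "rwf (Rt e) = rwf e"
| "rwf (Sg e) = rwf e"

primrec bwf :: "be \<Rightarrow> bool" where
  "bwf (Lei e1 e2) = (iwf e1 \<and> iwf e2)"
| "bwf (Ler e1 e2) = (rwf e1 \<and> rwf e2)"
| "bwf (Nt b) = bwf b"
| "bwf (An b1 b2) = (bwf b1 \<and> bwf b2)"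

primrec ewf :: "prog \<Rightarrow> bool" where
  "ewf Nop = True"
| "ewf (Iset a e x) = (iwf e \<and> iwf x)"
| "ewf (Rset a e x) = (iwf e \<and> rwf x)"
| "ewf (Put e) = iwf e"
| "ewf (Sq c1 c2) = (ewf c1 \<and> ewf c2)"
| "ewf (Ifc b c1 c2) = (bwf b \<and> ewf c1 \<and> ewf c2)"
| "ewf (For v b e c) = (iwf e \<and> ewf c)"

text \<open>A static bound: both branches of a conditional are charged, and a loop pays for
  \<open>B b\<close> rounds. The additive constants cover address computations and loop
  control.\<close>

primrec tb :: "(nat \<Rightarrow> nat) \<Rightarrow> prog \<Rightarrow> nat" where
  "tb B Nop = 1"
| "tb B (Iset a e x) = icost (comp_i e) + icost (comp_i x) + 5"
| "tb B (Rset a e x) = icost (comp_i e) + rcost (comp_r x) + 5"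
| "tb B (Put e) = icost (comp_i e) + 1"
| "tb B (Sq c1 c2) = tb B c1 + tb B c2 + 1"
| "tb B (Ifc b c1 c2) = bcost (comp_b b) + tb B c1 + tb B c2 + 1"
| "tb B (For v b e c) = icost (comp_i e) + 40 + B b * (tb B c + 40)"

definition rep :: "nat \<Rightarrow> store \<Rightarrow> state \<Rightarrow> bool" where
  "rep L s st \<longleftrightarrow>
     (\<forall>a<n_slots. \<forall>i<L. imem st (n_slots * i + a) = ivar s a (int i) \<and>
        rmem st (n_slots * i + a) = rvar s a (int i)) \<and>
     outlist st = outs s"

lemma n_slots_pos: "0 < n_slots"
  by (simp add: n_slots_def)

lemma addr_cell:
  assumes "a < n_slots" "0 \<le> i" "i < int L"
  shows "addr (n_slots * L) (int n_slots * i + int a) = Some (n_slots * nat i + a)"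
proof -
  have i: "i = int (nat i)" using assms by simp
  have "nat i + 1 \<le> L" using assms by linarith
  then have "n_slots * (nat i + 1) \<le> n_slots * L" by (rule mult_le_mono2)
  then have lt: "n_slots * nat i + a < n_slots * L" using assms(1) by (simp add: algebra_simps)
  have e: "int n_slots * i + int a = int (n_slots * nat i + a)" using i by simp
  show ?thesis unfolding addr_def e using lt by (simp only: of_nat_0_le_iff of_nat_less_iff nat_int) simp
qed

lemma cell_inj:
  assumes "a < n_slots" "b < n_slots"
  shows "n_slots * i + a = n_slots * j + b \<longleftrightarrow> i = j \<and> a = b"
proof
  assume e: "n_slots * i + a = n_slots * j + b"
  have "(n_slots * i + a) mod n_slots = a" "(n_slots * j + b) mod n_slots = b" using assms by auto
  with e have "a = b" by simp
  with e n_slots_pos show "i = j \<and> a = b" by simp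
qed simp

lemma icost_cell: "icost (cell a e) = icost e + 4"
  by (simp add: cell_def)

lemma ival_cell:
  assumes "ival I (n_slots * L) st e = Some i" "a < n_slots" "0 \<le> i" "i < int L"
  shows "Option.bind (ival I (n_slots * L) st (cell a e)) (\<lambda>x. map_option f (addr (n_slots * L) x))
           = Some (f (n_slots * nat i + a))"
  using assms addr_cell[OF assms(2-4)] by (simp add: cell_def)

lemma comp_i_correct:
  assumes "rep L s st" "iwf e" "iok I L s e"
  shows "ival I (n_slots * L) st (comp_i e) = Some (iev I s e)"
  using assms(2,3)
proof (induction e)
  case (Iv a e)
  then have "ival I (n_slots * L) st (comp_i e) = Some (iev I s e)" by simp
  from ival_cell[OF this, of a "imem st"] Iv show ?case using assms(1)
    by (simp add: rep_def) (metis nat_less_iff int_nat_eq)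
next
  case (Res e)
  then show ?case using assms(1) by (simp add: rep_def addr_def)
next
  case (Ib f e1 e2)
  then show ?case by (cases f) auto
qed auto

lemma comp_r_correct:
  assumes "rep L s st" "rwf e" "rok I L s e"
  shows "rval I (n_slots * L) st (comp_r e) = Some (rev I s e)"
  using assms(2,3)
proof (induction e)
  case (Rv a e)
  then have "ival I (n_slots * L) st (comp_i e) = Some (iev I s e)"
    using comp_i_correct[OF assms(1)] by simp
  from ival_cell[OF this, of a "rmem st"] Rv show ?case using assms(1)
    by (simp add: rep_def) (metis nat_less_iff int_nat_eq)
next
  case (Rb f e1 e2)
  then show ?case by (cases f) auto
qed (use comp_i_correct[OF assms(1)] in auto)

lemma comp_b_correct:
  assumes "rep L s st" "bwf e" "bok I L s e"
  shows "bval I (n_slots * L) st (comp_b e) = Some (bev I s e)"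
  using assms(2,3)
  by (induction e) (use comp_i_correct[OF assms(1)] comp_r_correct[OF assms(1)] in auto)

lemma rep_set_ivar:
  assumes "rep L s st" "a < n_slots" "0 \<le> i"
  shows "rep L (set_ivar a i x s) (st\<lparr>imem := (imem st)(n_slots * nat i + a := x)\<rparr>)"
  using assms by (auto simp: rep_def cell_inj)

lemma rep_set_rvar:
  assumes "rep L s st" "a < n_slots" "0 \<le> i"
  shows "rep L (set_rvar a i x s) (st\<lparr>rmem := (rmem st)(n_slots * nat i + a := x)\<rparr>)"
  using assms by (auto simp: rep_def cell_inj)

lemma exec_set_ivar:
  assumes "rep L s st" "a < n_slots" "ival I (n_slots * L) st e = Some i" "0 \<le> i" "i < int L"
    "ival I (n_slots * L) st e' = Some x"
  shows "\<exists>st'. exec I (n_slots * L) (IStore (cell a e) e') st (icost e + icost e' + 5) st' \<and>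
           rep L (set_ivar a i x s) st'"
proof -
  have "ival I (n_slots * L) st (cell a e) = Some (int n_slots * i + int a)"
    using assms by (simp add: cell_def)
  from exec.IStore[OF this addr_cell[OF assms(2,4,5)] assms(6)]
  have "exec I (n_slots * L) (IStore (cell a e) e') st (icost e + icost e' + 5)
      (st\<lparr>imem := (imem st)(n_slots * nat i + a := x)\<rparr>)"
    by (simp only: icost_cell add.assoc add.left_commute add.commute) (simp add: numeral_eq_Suc)
  then show ?thesis using rep_set_ivar[OF assms(1,2,4)] by blast
qed

lemma exec_set_rvar:
  assumes "rep L s st" "a < n_slots" "ival I (n_slots * L) st e = Some i" "0 \<le> i" "i < int L"
    "rval I (n_slots * L) st e' = Some x"
  shows "\<exists>st'. exec I (n_slots * L) (RStore (cell a e) e') st (icost e + rcost e' + 5) st' \<and>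
           rep L (set_rvar a i x s) st'"
proof -
  have "ival I (n_slots * L) st (cell a e) = Some (int n_slots * i + int a)"
    using assms by (simp add: cell_def)
  from exec.RStore[OF this addr_cell[OF assms(2,4,5)] assms(6)]
  have "exec I (n_slots * L) (RStore (cell a e) e') st (icost e + rcost e' + 5)
      (st\<lparr>rmem := (rmem st)(n_slots * nat i + a := x)\<rparr>)"
    by (simp only: icost_cell add.assoc add.left_commute add.commute) (simp add: numeral_eq_Suc)
  then show ?thesis using rep_set_rvar[OF assms(1,2,4)] by blast
qed

lemma ivar_iter_fixed:
  assumes "\<And>k s. ivar (f k s) v j = ivar s v j"
  shows "ivar (iter f n s) v j = ivar s v j"
  by (induction n) (simp_all add: assms)

text \<open>The assumption \<open>2 \<le> L\<close> provides the entries 0 and 1 in which a loop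
  keeps its counter and its limit.\<close>

theorem comp_correct:
  assumes "rep L s st" "wf c" "ewf c" "ok B I L c s" "2 \<le> L"
  shows "\<exists>t st'. exec I (n_slots * L) (comp c) st t st' \<and> t \<le> tb B c \<and> rep L (run I c s) st'"
  using assms(1-4)
proof (induction c arbitrary: s st)
  case Nop
  then show ?case using exec.Skip by fastforce
next
  case (Iset a e x)
  then show ?case
    using exec_set_ivar[of L s st a I "comp_i e" "iev I s e" "comp_i x" "iev I s x"]
      comp_i_correct[of L s st]
    by fastforce
next
  case (Rset a e x)
  then show ?case
    using exec_set_rvar[of L s st a I "comp_i e" "iev I s e" "comp_r x" "rev I s x"]
      comp_i_correct[of L s st] comp_r_correct[of L s st]
    by fastforce
next
  case (Put e)
  have "ival I (n_slots * L) st (comp_i e) = Some (iev I s e)"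
    using Put comp_i_correct[of L s st] by simp
  note ex = exec.Emit[OF this]
  have "rep L (emit_out (iev I s e) s) (st\<lparr>outlist := outlist st @ [iev I s e]\<rparr>)"
    using Put(1) by (simp add: rep_def)
  with ex show ?case unfolding tb.simps run.simps comp.simps by blast
next
  case (Sq c1 c2)
  then obtain t1 st1 where 1: "exec I (n_slots * L) (comp c1) st t1 st1" "t1 \<le> tb B c1"
    "rep L (run I c1 s) st1" by fastforce
  with Sq obtain t2 st2 where 2: "exec I (n_slots * L) (comp c2) st1 t2 st2" "t2 \<le> tb B c2"
    "rep L (run I c2 (run I c1 s)) st2" by fastforce
  from exec.Seq[OF 1(1) 2(1)] 1 2 show ?case by fastforce
next
  case (Ifc b c1 c2)
  have b: "bval I (n_slots * L) st (comp_b b) = Some (bev I s b)"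
    using Ifc comp_b_correct[of L s st] by simp
  show ?case
  proof (cases "bev I s b")
    case True
    with Ifc obtain t1 st1 where 1: "exec I (n_slots * L) (comp c1) st t1 st1" "t1 \<le> tb B c1"
      "rep L (run I c1 s) st1" by fastforce
    from exec.CondTrue[OF _ 1(1)] b True 1 show ?thesis by fastforce
  next
    case False
    with Ifc obtain t1 st1 where 1: "exec I (n_slots * L) (comp c2) st t1 st1" "t1 \<le> tb B c2"
      "rep L (run I c2 s) st1" by fastforce
    from exec.CondFalse[OF _ 1(1)] b False 1 show ?thesis by fastforce
  qed
next
  case (For v b e c)
  let ?M = "n_slots * L"
  define N where "N = nat (iev I s e)"
  define f where "f = (\<lambda>k s. run I c (set_ivar v 0 (int k) s))"
  define s0 where "s0 = set_ivar v 1 (int N) s"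
  let ?b = "BNot (ILe (ILoad (cell v (IConst 1))) (ILoad (cell v (IConst 0))))"
  let ?inc = "IStore (cell v (IConst 0)) (IBin IAdd (ILoad (cell v (IConst 0))) (IConst 1))"
  have v: "v < n_slots" and vc: "v \<notin> iwr c" and wfc: "wf c" "ewf c" "iwf e" and NB: "N \<le> B b"
    and Ni: "int N = iev I s e" and oke: "iok I L s e"
    and okc: "\<And>k. k < N \<Longrightarrow> ok B I L c (set_ivar v 0 (int k) (iter f k s0))"
    using For.prems by (auto simp: N_def f_def s0_def)
  have run: "run I (For v b e c) s = set_ivar v 0 (int N) (iter f N s0)"
    by (simp add: N_def f_def s0_def)
  have f1: "ivar (f k s) v 1 = ivar s v 1" for k s
    using same_outsideD(1)[OF run_frame vc] by (simp add: f_def)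
  have lim: "ivar (iter f k s0) v 1 = int N" for k
    using ivar_iter_fixed[of f v 1, OF f1] by (simp add: s0_def)
  have L: "(0::int) < int L" "(1::int) < int L" using assms(5) by auto
  have ld: "ival I ?M st' (ILoad (cell v (IConst 0))) = Some (ivar s' v 0)"
           "ival I ?M st' (ILoad (cell v (IConst 1))) = Some (ivar s' v 1)" if "rep L s' st'" for s' st'
    using that v L comp_i_correct[OF that, of "Iv v (Num 0)"] comp_i_correct[OF that, of "Iv v (Num 1)"]
    by auto
  \<comment> \<open>Induction on the number of remaining rounds. The 16 covers the final failing
    test; the 40 per round covers test, increment and sequencing.\<close>
  have loop: "\<exists>t st'. exec I ?M (While ?b (Seq (comp c) ?inc)) st t st' \<and>
      t \<le> (N - k) * (tb B c + 40) + 16 \<and> rep L (set_ivar v 0 (int N) (iter f N s0)) st'"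
    if "k \<le> N" "rep L (set_ivar v 0 (int k) (iter f k s0)) st" for k st
    using that
  proof (induction "N - k" arbitrary: k st)
    case 0
    then have k: "k = N" by simp
    have "bval I ?M st ?b = Some False"
      using ld[OF 0(3)] lim[of k] by (simp add: k)
    from exec.WhileFalse[OF this] show ?case using 0 k by (fastforce simp: cell_def)
  next
    case (Suc x)
    then have k: "k < N" by simp
    let ?s = "set_ivar v 0 (int k) (iter f k s0)"
    have b: "bval I ?M st ?b = Some True"
      using ld[OF Suc(4)] lim[of k] k by simp
    obtain t1 st1 where 1: "exec I ?M (comp c) st t1 st1" "t1 \<le> tb B c" "rep L (run I c ?s) st1"
      using For.IH[OF Suc(4) wfc(1,2) okc[OF k]] by blast
    have r: "run I c ?s = iter f (Suc k) s0" by (simp add: f_def)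
    have v0: "ivar (run I c ?s) v 0 = int k"
      using same_outsideD(1)[OF run_frame[of c ?s I] vc] by simp
    have "ival I ?M st1 (IBin IAdd (ILoad (cell v (IConst 0))) (IConst 1)) = Some (int (Suc k))"
      using ld(1)[OF 1(3)] v0 by simp
    from exec_set_ivar[OF 1(3) v _ _ L(1) this, of "IConst 0"]
    obtain st2 where 2: "exec I ?M ?inc st1 14 st2" "rep L (set_ivar v 0 (int (Suc k)) (iter f (Suc k) s0)) st2"
      unfolding r by (fastforce simp: icost_cell)
    have "x = N - Suc k" "Suc k \<le> N" using Suc(2) k by auto
    from Suc(1)[OF this 2(2)] obtain t3 st3 where 3: "exec I ?M (While ?b (Seq (comp c) ?inc)) st2 t3 st3"
      "t3 \<le> (N - Suc k) * (tb B c + 40) + 16" "rep L (set_ivar v 0 (int N) (iter f N s0)) st3"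
      by auto
    have "N - k = Suc (N - Suc k)" using k by simp
    then have "(N - k) * (tb B c + 40) = (N - Suc k) * (tb B c + 40) + (tb B c + 40)" by simp
    then have "bcost ?b + (t1 + 14 + 1) + t3 + 1 \<le> (N - k) * (tb B c + 40) + 16"
      using 1(2) 3(2) by (simp add: cell_def)
    with exec.WhileTrue[OF b exec.Seq[OF 1(1) 2(1)] 3(1)] 3(3) show ?case by blast
  qed
  have "ival I ?M st (comp_i e) = Some (int N)"
    using comp_i_correct[OF For.prems(1) wfc(3) oke] Ni by simp
  from exec_set_ivar[OF For.prems(1) v _ _ L(2) this, of "IConst 1"]
  have "\<exists>st'. exec I ?M (IStore (cell v (IConst 1)) (comp_i e)) st (icost (comp_i e) + 6) st' \<and> rep L s0 st'"
    by (simp add: s0_def add.commute)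
  then obtain st1 where 1: "exec I ?M (IStore (cell v (IConst 1)) (comp_i e)) st (icost (comp_i e) + 6) st1"
    "rep L s0 st1" by blast
  from exec_set_ivar[OF 1(2) v _ _ L(1), of I "IConst 0" "IConst 0" 0]
  have "\<exists>st'. exec I ?M (IStore (cell v (IConst 0)) (IConst 0)) st1 7 st' \<and> rep L (set_ivar v 0 (int 0) (iter f 0 s0)) st'"
    by simp
  then obtain st2 where 2: "exec I ?M (IStore (cell v (IConst 0)) (IConst 0)) st1 7 st2"
    "rep L (set_ivar v 0 (int 0) (iter f 0 s0)) st2" by blast
  from loop[of 0 st2, OF _ 2(2)] obtain t3 st3 where
    3: "exec I ?M (While ?b (Seq (comp c) ?inc)) st2 t3 st3" "t3 \<le> N * (tb B c + 40) + 16"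
      "rep L (set_ivar v 0 (int N) (iter f N s0)) st3" by auto
  have "N * (tb B c + 40) \<le> B b * (tb B c + 40)" using NB by (rule mult_le_mono1)
  then have "icost (comp_i e) + 6 + (7 + t3 + 1) + 1 \<le> tb B (For v b e c)"
    using 3(2) unfolding tb.simps by linarith
  with exec.Seq[OF 1(1) exec.Seq[OF 2(1) 3(1)]] 3(3) show ?case
    unfolding run by (auto intro!: exI)
qed

section \<open>Weakest preconditions\<close>

definition wp :: "(nat \<Rightarrow> nat) \<Rightarrow> input \<Rightarrow> nat \<Rightarrow> prog \<Rightarrow> (store \<Rightarrow> bool) \<Rightarrow> store \<Rightarrow> bool" where
  "wp B I L c Q s \<longleftrightarrow> ok B I L c s \<and> Q (run I c s)"

lemma wp_simps:
  "wp B I L Nop Q s = Q s"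
  "wp B I L (Iset a e x) Q s =
     (iok I L s e \<and> iok I L s x \<and> 0 \<le> iev I s e \<and> iev I s e < int L \<and>
      Q (set_ivar a (iev I s e) (iev I s x) s))"
  "wp B I L (Rset a e y) Q s =
     (iok I L s e \<and> rok I L s y \<and> 0 \<le> iev I s e \<and> iev I s e < int L \<and>
      Q (set_rvar a (iev I s e) (rev I s y) s))"
  "wp B I L (Put e) Q s = (iok I L s e \<and> Q (emit_out (iev I s e) s))"
  "wp B I L (Sq c1 c2) Q s = wp B I L c1 (wp B I L c2 Q) s"
  "wp B I L (Ifc b c1 c2) Q s =
     (bok I L s b \<and> (if bev I s b then wp B I L c1 Q s else wp B I L c2 Q s))"
  by (auto simp: wp_def)

text \<open>Besides \<open>Q\<close>, the new state may be assumed to agree with the old one outside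
  the write sets, so postconditions list only what changes.\<close>

lemma wp_conseq:
  assumes "wp B I L c Q s"
    and "\<And>s'. same_outside (iwr c) (rwr c) (emits c) s s' \<Longrightarrow> Q s' \<Longrightarrow> R s'"
  shows "wp B I L c R s"
  using assms run_frame by (auto simp: wp_def)

text \<open>\<open>Inv k\<close> holds before round \<open>k\<close> and needs to speak only of what
  the body changes: \<open>same_outside\<close> supplies the rest, always relative to the state
  before the loop.\<close>

lemma wp_For:
  assumes "iok I L s e" "iev I s e = int N" "N \<le> B b"
    and "Inv 0 (set_ivar v 1 (int N) s)"
    and "\<And>k s'. k < N \<Longrightarrow> same_outside (insert v (iwr c)) (rwr c) (emits c) s s' \<Longrightarrow> Inv k s' \<Longrightarrow>
           wp B I L c (Inv (Suc k)) (set_ivar v 0 (int k) s')"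
    and "\<And>s'. same_outside (insert v (iwr c)) (rwr c) (emits c) s s' \<Longrightarrow> Inv N s' \<Longrightarrow>
           Q (set_ivar v 0 (int N) s')"
  shows "wp B I L (For v b e c) Q s"
proof -
  define f where "f = (\<lambda>k s. run I c (set_ivar v 0 (int k) s))"
  define s0 where "s0 = set_ivar v 1 (int N) s"
  let ?X = "insert v (iwr c)"
  have f: "same_outside ?X (rwr c) (emits c) s (f k s)" for k s
  proof -
    have "same_outside ?X (rwr c) (emits c) (set_ivar v 0 (int k) s) (f k s)"
      unfolding f_def by (rule same_outside_mono[OF run_frame]) auto
    moreover have "same_outside ?X (rwr c) (emits c) s (set_ivar v 0 (int k) s)"
      by (simp add: same_outside_def)
    ultimately show ?thesis by (blast intro: same_outside_trans)
  qed
  have "same_outside ?X (rwr c) (emits c) s s0" by (simp add: same_outside_def s0_def)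
  then have fr: "same_outside ?X (rwr c) (emits c) s (iter f k s0)" for k
    using same_outside_iter[of ?X "rwr c" "emits c" f, OF f] same_outside_trans by blast
  have inv: "k \<le> N \<Longrightarrow> Inv k (iter f k s0) \<and> (\<forall>j<k. ok B I L c (set_ivar v 0 (int j) (iter f j s0)))" for k
  proof (induction k)
    case 0
    then show ?case using assms(4) by (simp add: s0_def)
  next
    case (Suc k)
    then have "wp B I L c (Inv (Suc k)) (set_ivar v 0 (int k) (iter f k s0))"
      using assms(5)[OF _ fr] by simp
    with Suc show ?case by (auto simp: wp_def f_def less_Suc_eq)
  qed
  have N: "nat (iev I s e) = N" using assms(2) by simp
  show ?thesis
    unfolding wp_def ok.simps run.simps N f_def[symmetric] s0_def[symmetric]
    using assms(1,2,3) inv[of N] assms(6)[OF fr] by auto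
qed

section \<open>The programs\<close>

text \<open>Slot names; integer and real slots are numbered independently. \<open>iPR\<close> lists
  the \<open>iM\<close> primes, \<open>iN\<close> is the transform length and \<open>iE\<close> its
  exponent, \<open>iS\<close> is the component index minus 2, \<open>iPW\<close> holds powers of a
  primitive root, \<open>rRC\<close> and \<open>rRS\<close> roots of unity, \<open>rTab\<close> the
  kernel table. \<open>rTH\<close> and \<open>rTT\<close> hold \<open>theta\<close> and, in the end,
  \<open>T_crit\<close> up to a positive factor and, for \<open>rTT\<close>, a constant.\<close>

abbreviation (input) "iM \<equiv> (40::nat)"
abbreviation (input) "iPR \<equiv> (2::nat)"
abbreviation (input) "iN \<equiv> (3::nat)"
abbreviation (input) "iE \<equiv> (4::nat)"
abbreviation (input) "iS \<equiv> (5::nat)"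
abbreviation (input) "iI \<equiv> (6::nat)"
abbreviation (input) "iP \<equiv> (7::nat)"
abbreviation (input) "iJ \<equiv> (8::nat)"
abbreviation (input) "iQ \<equiv> (9::nat)"
abbreviation (input) "iK \<equiv> (10::nat)"
abbreviation (input) "iL \<equiv> (11::nat)"
abbreviation (input) "iT \<equiv> (12::nat)"
abbreviation (input) "iPW \<equiv> (13::nat)"
abbreviation (input) "iFound \<equiv> (14::nat)"
abbreviation (input) "iG \<equiv> (15::nat)"
abbreviation (input) "iA \<equiv> (16::nat)"
abbreviation (input) "iF \<equiv> (17::nat)"
abbreviation (input) "iV \<equiv> (18::nat)"
abbreviation (input) "iU \<equiv> (19::nat)"
abbreviation (input) "iRk \<equiv> (20::nat)"
abbreviation (input) "iBest \<equiv> (21::nat)"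
abbreviation (input) "iH \<equiv> (22::nat)"
abbreviation (input) "iStr \<equiv> (23::nat)"
abbreviation (input) "iLev \<equiv> (24::nat)"
abbreviation (input) "iC \<equiv> (25::nat)"
abbreviation (input) "iFlag \<equiv> (26::nat)"
abbreviation (input) "iW \<equiv> (27::nat)"
abbreviation (input) "iR \<equiv> (28::nat)"
abbreviation (input) "iB \<equiv> (29::nat)"

abbreviation (input) "rC \<equiv> (41::nat)"
abbreviation (input) "rS \<equiv> (2::nat)"
abbreviation (input) "rRC \<equiv> (3::nat)"
abbreviation (input) "rRS \<equiv> (4::nat)"
abbreviation (input) "rCQ \<equiv> (5::nat)"
abbreviation (input) "rWP \<equiv> (6::nat)"
abbreviation (input) "rX \<equiv> (7::nat)"
abbreviation (input) "rTH \<equiv> (8::nat)"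
abbreviation (input) "rTT \<equiv> (9::nat)"
abbreviation (input) "rW \<equiv> (10::nat)"
abbreviation (input) "rXR \<equiv> (11::nat)"
abbreviation (input) "rXI \<equiv> (12::nat)"
abbreviation (input) "rYR \<equiv> (13::nat)"
abbreviation (input) "rYI \<equiv> (14::nat)"
abbreviation (input) "rHR \<equiv> (15::nat)"
abbreviation (input) "rHI \<equiv> (16::nat)"
abbreviation (input) "rAR \<equiv> (17::nat)"
abbreviation (input) "rAI \<equiv> (18::nat)"
abbreviation (input) "rA0 \<equiv> (19::nat)"
abbreviation (input) "rAcc \<equiv> (20::nat)"
abbreviation (input) "rAcc2 \<equiv> (21::nat)"
abbreviation (input) "rBv \<equiv> (22::nat)"
abbreviation (input) "rTab \<equiv> (23::nat)"

abbreviation (input) "bD \<equiv> (0::nat)"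
abbreviation (input) "bM \<equiv> (1::nat)"
abbreviation (input) "bN \<equiv> (2::nat)"
abbreviation (input) "bLg \<equiv> (3::nat)"

abbreviation iadd (infixl "+!" 65) where "a +! b \<equiv> Ib IAdd a b"
abbreviation isub (infixl "-!" 65) where "a -! b \<equiv> Ib ISub a b"
abbreviation imul (infixl "*!" 70) where "a *! b \<equiv> Ib IMul a b"
abbreviation idiv (infixl "div!" 70) where "a div! b \<equiv> Ib IDiv a b"
abbreviation imod (infixl "mod!" 70) where "a mod! b \<equiv> Ib IMod a b"
abbreviation radd (infixl "+." 65) where "a +. b \<equiv> Rb RAdd a b"
abbreviation rsub (infixl "-." 65) where "a -. b \<equiv> Rb RSub a b"
abbreviation rmul (infixl "*." 70) where "a *. b \<equiv> Rb RMul a b"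
abbreviation rdiv (infixl "'/." 70) where "a /. b \<equiv> Rb RDiv a b"

abbreviation "sc a \<equiv> Iv a (Num 0)"
abbreviation "rsc a \<equiv> Rv a (Num 0)"
abbreviation "iset a e \<equiv> Iset a (Num 0) e"
abbreviation "rset a e \<equiv> Rset a (Num 0) e"
abbreviation "rnum k \<equiv> Cast (Num k)"
abbreviation "lti a b \<equiv> Nt (Lei b a)"
abbreviation "eqi a b \<equiv> An (Lei a b) (Lei b a)"
abbreviation "ltr a b \<equiv> Nt (Ler b a)"
text \<open>The reduction modulo \<open>y\<close> puts the argument into the unit interval, where
  \<open>sigma\<close> may be evaluated; by periodicity the value is unchanged.\<close>

abbreviation "sgx x y \<equiv> Sg (Cast (x mod! y) /. Cast y)"

text \<open>The argument is \<open>k * z / p + l * z / q\<close> over the common denominator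
  \<open>p * q\<close>. Only the residues of \<open>z\<close> modulo \<open>p\<close> and
  \<open>q\<close> enter, and these are read from the output list.\<close>

definition mulfac :: prog where
  "mulfac = rset rW (rsc rW *. (rnum 1 +. Wt (sc iT +! Num 1) *. Wt (sc iT +! Num 1) *.
     sgx (sc iK *! Res (sc iT *! sc iM +! sc iI) *! sc iQ +! sc iL *! Res (sc iT *! sc iM +! sc iJ) *! sc iP)
       (sc iP *! sc iQ)))"

abbreviation tab_idx :: ie where
  "tab_idx \<equiv> ((sc iI *! sc iM +! sc iJ) *! Size +! sc iK) *! Size +! sc iL"

text \<open>The flag decides between looking a kernel value up and recomputing it: memory against a
  factor \<open>d\<close> in time. The assignment to \<open>iT\<close> gives both versions the same
  write set.\<close>

definition getw :: "bool \<Rightarrow> prog" where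
  "getw tab = (if tab then iset iT (Num 0) ;; rset rW (Rv rTab tab_idx)
     else rset rW (rnum 1) ;; For iT bD (sc iS +! Num 1) mulfac)"

definition prep0 :: "bool \<Rightarrow> prog" where
  "prep0 tab = (if tab then
     For iI bM (sc iM) (For iJ bM (sc iM) (For iK bN Size (For iL bN Size (Rset rTab tab_idx (rnum 1)))))
     else Nop)"

text \<open>Before component \<open>S\<close> the table holds products over the components below
  \<open>S - 1\<close>. The factor of \<open>S - 1\<close> is multiplied in, so each component costs
  one pass.\<close>

definition prep :: "bool \<Rightarrow> prog" where
  "prep tab = (if tab then iset iT (sc iS) ;;
     For iI bM (sc iM) (iset iP (Iv iPR (sc iI)) ;;
       For iJ bM (sc iM) (iset iQ (Iv iPR (sc iJ)) ;;
         For iK bN (sc iP) (For iL bN (sc iQ)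
           (rset rW (Rv rTab tab_idx) ;; mulfac ;; Rset rTab tab_idx (rsc rW)))))
     else Nop)"

definition find_primes :: prog where
  "find_primes = iset iM (Num 0) ;;
     For iC bN (Size +! Num 1)
       (Ifc (An (Lei (Num 2) (sc iC)) (lti Size (Num 2 *! sc iC))) (iset iFlag (Num 1)) (iset iFlag (Num 0)) ;;
        For iA bN (sc iC)
          (Ifc (Lei (Num 2) (sc iA)) (Ifc (eqi (sc iC mod! sc iA) (Num 0)) (iset iFlag (Num 0)) Nop) Nop) ;;
        Ifc (eqi (sc iFlag) (Num 1)) (Iset iPR (sc iM) (sc iC) ;; iset iM (sc iM +! Num 1)) Nop)"

text \<open>Half-angle formulas, starting from the angle \<open>pi\<close>.\<close>

definition find_root :: prog where
  "find_root = iset iN (Num 2) ;; iset iE (Num 1) ;; rset rC (rnum (-1)) ;; rset rS (rnum 0) ;;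
     For iA bN Size
       (Ifc (lti (sc iN) (Num 2 *! Size))
          (iset iN (Num 2 *! sc iN) ;; iset iE (sc iE +! Num 1) ;;
           rset rS (Rt ((rnum 1 -. rsc rC) /. rnum 2)) ;;
           rset rC (Rt ((rnum 1 +. rsc rC) /. rnum 2))) Nop)"

definition root_table :: prog where
  "root_table = Rset rRC (Num 0) (rnum 1) ;; Rset rRS (Num 0) (rnum 0) ;;
     For iA bN (sc iN -! Num 1)
       (Rset rRC (sc iA +! Num 1) (Rv rRC (sc iA) *. rsc rC -. Rv rRS (sc iA) *. rsc rS) ;;
        Rset rRS (sc iA +! Num 1) (Rv rRS (sc iA) *. rsc rC +. Rv rRC (sc iA) *. rsc rS))"

text \<open>By \<open>sum_sigma_shift\<close> at 0, \<open>q powr (- (2 * \<alpha>))\<close> is the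
  sum of \<open>sigma \<alpha> (a / q)\<close> over \<open>a < q\<close>, divided by
  \<open>q * sigma \<alpha> 0\<close>.\<close>

definition shift_consts :: prog where
  "shift_consts = For iJ bM (sc iM)
     (iset iQ (Iv iPR (sc iJ)) ;; rset rAcc (rnum 0) ;;
      For iA bN (sc iQ) (rset rAcc (rsc rAcc +. Sg (Cast (sc iA) /. Cast (sc iQ)))) ;;
      Rset rCQ (sc iJ) (rsc rAcc /. (Cast (sc iQ) *. Sg (rnum 0))))"

definition emit_first :: prog where
  "emit_first = For iJ bM (sc iM) (Put (Num 1))"

text \<open>The pair of \<open>p\<close> with itself and \<open>l = 0\<close> yields the kernel for
  \<open>p\<close> alone. \<open>rX\<close> starts as a copy, to which the larger primes are
  added.\<close>

definition init_wp :: "bool \<Rightarrow> prog" where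
  "init_wp tab = iset iJ (sc iI) ;; iset iQ (sc iP) ;; iset iL (Num 0) ;;
     For iK bN (sc iP) (getw tab ;; Rset rWP (sc iK) (rsc rW) ;; Rset rX (sc iK) (rsc rW))"

text \<open>The term of a larger \<open>q\<close> contains \<open>sigma\<close> at
  \<open>q * k * v / p\<close>. Filing its weight under \<open>k * q mod p\<close> gives it the form
  of \<open>theta\<close>, so both are evaluated together from \<open>rX\<close>.\<close>

definition add_larger :: "bool \<Rightarrow> prog" where
  "add_larger tab = For iJ bM (sc iM) (Ifc (lti (sc iI) (sc iJ))
     (iset iQ (Iv iPR (sc iJ)) ;;
      For iK bN (sc iP)
        (rset rAcc (rnum 0) ;;
         For iL bN (sc iQ) (getw tab ;; rset rAcc (rsc rAcc +. rsc rW)) ;;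
         iset iR (sc iK *! sc iQ mod! sc iP) ;;
         Rset rX (sc iR) (Rv rX (sc iR) +. rnum 2 *. Rv rCQ (sc iJ) /. Cast (sc iQ) *. rsc rAcc))) Nop)"

definition theta_table :: prog where
  "theta_table = For iV bN (sc iP)
     (rset rAcc (rnum 0) ;; rset rAcc2 (rnum 0) ;;
      For iK bN (sc iP)
        (rset rW (sgx (sc iK *! sc iV) (sc iP)) ;;
         rset rAcc (rsc rAcc +. Rv rWP (sc iK) *. rsc rW) ;;
         rset rAcc2 (rsc rAcc2 +. Rv rX (sc iK) *. rsc rW)) ;;
      Rset rTH (sc iV) (rsc rAcc) ;; Rset rTT (sc iV) (rsc rAcc2))"

text \<open>Exhaustive search: a candidate fails if a power with positive exponent below
  \<open>p - 1\<close> is 1. Quadratic time is affordable.\<close>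

definition prim_root :: prog where
  "prim_root = iset iFound (Num 0) ;;
     For iG bN (sc iP -! Num 1) (Ifc (eqi (sc iFound) (Num 0))
       (Iset iPW (Num 0) (Num 1) ;; iset iFound (Num 1) ;;
        For iA bN (sc iP -! Num 1)
          (Iset iPW (sc iA +! Num 1) (Iv iPW (sc iA) *! (sc iG +! Num 1) mod! sc iP) ;;
           Ifc (An (eqi (Iv iPW (sc iA +! Num 1)) (Num 1)) (lti (sc iA +! Num 1) (sc iP -! Num 1)))
             (iset iFound (Num 0)) Nop)) Nop)"

text \<open>The self-sorting (Stockham) variant: passing through a second array keeps the natural
  order and avoids a bit reversal.\<close>

definition fft_level :: prog where
  "fft_level =
     For iF bN (sc iN)
       (iset iC (sc iF div! sc iStr) ;;
        iset iR (sc iC mod! sc iH *! (Num 2 *! sc iStr) +! sc iF mod! sc iStr) ;;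
        rset rC (Rv rRC (sc iC *! sc iStr)) ;; rset rS (Rv rRS (sc iC *! sc iStr)) ;;
        Rset rYR (sc iF) (Rv rXR (sc iR) +.
          (rsc rC *. Rv rXR (sc iR +! sc iStr) -. rsc rS *. Rv rXI (sc iR +! sc iStr))) ;;
        Rset rYI (sc iF) (Rv rXI (sc iR) +.
          (rsc rC *. Rv rXI (sc iR +! sc iStr) +. rsc rS *. Rv rXR (sc iR +! sc iStr)))) ;;
     For iF bN (sc iN) (Rset rXR (sc iF) (Rv rYR (sc iF)) ;; Rset rXI (sc iF) (Rv rYI (sc iF)))"

definition fft :: prog where
  "fft = iset iH (Num 1) ;; iset iStr (sc iN div! Num 2) ;;
     For iLev bLg (sc iE) (fft_level ;; iset iH (Num 2 *! sc iH) ;; iset iStr (sc iStr div! Num 2))"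

definition fill_x :: "bool \<Rightarrow> prog" where
  "fill_x tab =
     For iF bN (sc iN) (Rset rXR (sc iF) (rnum 0) ;; Rset rXI (sc iF) (rnum 0)) ;;
     For iA bN (sc iP -! Num 1)
       (iset iK (Iv iPW (sc iA)) ;; getw tab ;; Rset rXR (sc iA) (rnum 2 *. rsc rW /. Cast (sc iQ)))"

text \<open>Two periods of the sequence, then zeros: a correlation of length \<open>p - 1\<close>
  then never wraps around at the transform length.\<close>

definition fill_y :: prog where
  "fill_y = For iF bN (sc iN)
     (Ifc (lti (sc iF) (Num 2 *! (sc iP -! Num 1)))
        (Rset rXR (sc iF) (sgx (Iv iPW (sc iF mod! (sc iP -! Num 1)) *! sc iQ +! sc iL *! sc iW *! sc iP) (sc iP *! sc iQ)))
        (Rset rXR (sc iF) (rnum 0)) ;;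
      Rset rXI (sc iF) (rnum 0))"

text \<open>Spectra are accumulated, conjugated on the \<open>x\<close> side as a correlation
  requires. The residue 0 is no power of the primitive root; its value is the sum of the
  \<open>x\<close> sequence times a constant, and this sum is the coefficient 0 of the first
  transform.\<close>

definition conv_one :: "bool \<Rightarrow> prog" where
  "conv_one tab = fill_x tab ;; fft ;;
     For iF bN (sc iN) (Rset rHR (sc iF) (Rv rXR (sc iF)) ;; Rset rHI (sc iF) (Rv rXI (sc iF))) ;;
     rset rA0 (rsc rA0 +. Rv rHR (Num 0) *. sgx (sc iL *! sc iW *! sc iP) (sc iP *! sc iQ)) ;;
     fill_y ;; fft ;;
     For iF bN (sc iN)
       (Rset rAR (sc iF) (Rv rAR (sc iF) +. (Rv rHR (sc iF) *. Rv rXR (sc iF) +. Rv rHI (sc iF) *. Rv rXI (sc iF))) ;;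
        Rset rAI (sc iF) (Rv rAI (sc iF) +. (Rv rHR (sc iF) *. Rv rXI (sc iF) -. Rv rHI (sc iF) *. Rv rXR (sc iF))))"

definition conv :: "bool \<Rightarrow> prog" where
  "conv tab =
     For iF bN (sc iN) (Rset rAR (sc iF) (rnum 0) ;; Rset rAI (sc iF) (rnum 0)) ;;
     rset rA0 (rnum 0) ;;
     For iJ bM (sc iI)
       (iset iQ (Iv iPR (sc iJ)) ;; iset iW (Res ((sc iS +! Num 1) *! sc iM +! sc iJ)) ;;
        For iL bN (sc iQ) (conv_one tab))"

text \<open>The inverse transform is evaluated by its definition: it occurs once per prime, so
  quadratic time is within the budget.\<close>

definition unconv :: prog where
  "unconv = Rset rTT (Num 0) (Rv rTT (Num 0) +. rsc rA0) ;;
     For iB bN (sc iP -! Num 1)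
       (rset rAcc (rnum 0) ;;
        For iF bN (sc iN)
          (iset iR (sc iF *! sc iB mod! sc iN) ;;
           rset rAcc (rsc rAcc +. (Rv rAR (sc iF) *. Rv rRC (sc iR) +. Rv rAI (sc iF) *. Rv rRS (sc iR)))) ;;
        Rset rTT (Iv iPW (sc iB)) (Rv rTT (Iv iPW (sc iB)) +. rsc rAcc /. Cast (sc iN)))"

text \<open>Instead of the integer \<open>\<lceil>\<tau>p\<rceil>\<close>, which would require
  rounding, the rank of a residue is compared with \<open>\<tau> * p\<close>. The value -1 of
  \<open>iBest\<close> means that there is no candidate yet.\<close>

definition select :: prog where
  "select = iset iBest (Num (-1)) ;;
     For iV bN (sc iP)
       (iset iRk (Num 0) ;;
        For iU bN (sc iP)
          (Ifc (Ler (Rv rTH (sc iU)) (Rv rTH (sc iV)))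
            (Ifc (An (Ler (Rv rTH (sc iV)) (Rv rTH (sc iU))) (Lei (sc iV) (sc iU))) Nop (iset iRk (sc iRk +! Num 1)))
            Nop) ;;
        Ifc (ltr (Cast (sc iRk)) (Tau *. Cast (sc iP)))
          (Ifc (lti (sc iBest) (Num 0))
            (iset iBest (sc iV) ;; rset rBv (Rv rTT (sc iV)))
            (Ifc (ltr (Rv rTT (sc iV)) (rsc rBv)) (iset iBest (sc iV) ;; rset rBv (Rv rTT (sc iV))) Nop))
          Nop) ;;
     Put (sc iBest)"

definition prime_step :: "bool \<Rightarrow> prog" where
  "prime_step tab = iset iP (Iv iPR (sc iI)) ;; init_wp tab ;; add_larger tab ;; theta_table ;;
     prim_root ;; conv tab ;; unconv ;; select"

definition initialise :: prog where
  "initialise = find_primes ;; find_root ;; root_table ;; shift_consts ;; emit_first"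

definition construct :: "bool \<Rightarrow> prog" where
  "construct tab = initialise ;; prep0 tab ;;
     For iS bD (Dim -! Num 1) (prep tab ;; For iI bM (sc iM) (prime_step tab))"

lemmas prog_defs = mulfac_def getw_def prep0_def prep_def find_primes_def find_root_def root_table_def
  shift_consts_def emit_first_def init_wp_def add_larger_def theta_table_def prim_root_def fft_level_def
  fft_def fill_x_def fill_y_def conv_one_def conv_def unconv_def select_def prime_step_def
  initialise_def construct_def

lemma getw_frame [simp]: "iwr (getw tab) = {iT}" "rwr (getw tab) = {rW}" "\<not> emits (getw tab)"
  by (auto simp: getw_def mulfac_def)

lemma fft_level_frame [simp]:
  "iwr fft_level = {iF, iC, iR}" "rwr fft_level = {rC, rS, rYR, rYI, rXR, rXI}" "\<not> emits fft_level"
  by (auto simp: fft_level_def)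

lemma fft_frame [simp]:
  "iwr fft = {iF, iC, iR, iLev, iH, iStr}" "rwr fft = {rC, rS, rYR, rYI, rXR, rXI}" "\<not> emits fft"
  by (auto simp: fft_def)

lemma fill_x_frame [simp]:
  "iwr (fill_x tab) = {iF, iA, iK, iT}" "rwr (fill_x tab) = {rXR, rXI, rW}" "\<not> emits (fill_x tab)"
  by (auto simp: fill_x_def)

lemma fill_y_frame [simp]:
  "iwr fill_y = {iF}" "rwr fill_y = {rXR, rXI}" "\<not> emits fill_y"
  by (auto simp: fill_y_def)

lemma conv_one_frame [simp]:
  "iwr (conv_one tab) = {iF, iA, iK, iT, iC, iR, iLev, iH, iStr}"
  "rwr (conv_one tab) = {rXR, rXI, rW, rC, rS, rYR, rYI, rHR, rHI, rA0, rAR, rAI}"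
  "\<not> emits (conv_one tab)"
  by (auto simp: conv_one_def)

lemma wf_construct: "wf (construct tab)" "ewf (construct tab)"
  unfolding prog_defs by (cases tab; simp add: n_slots_def)+

section \<open>The fast Fourier transform\<close>

lemma sum_even_odd:
  fixes g :: "nat \<Rightarrow> 'a::comm_monoid_add"
  shows "(\<Sum>u<2 * n. g u) = (\<Sum>u<n. g (2 * u)) + (\<Sum>u<n. g (2 * u + 1))"
  by (induction n) (auto simp: algebra_simps)

lemma expi_shift_int: "x - y = real_of_int k \<Longrightarrow> expi x = expi y"
proof -
  assume "x - y = real_of_int k"
  then have "x = y + real_of_int k" by simp
  then show ?thesis by (simp only: expi_add expi_int mult_1_right)
qed

text \<open>
  After \<open>t\<close> rounds, the subsequences of stride \<open>R = N / 2^t\<close> have been transformed; entry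
  \<open>f * R + r\<close> holds the coefficient \<open>f\<close> of the subsequence with offset \<open>r\<close>.
\<close>

definition dft_part :: "nat \<Rightarrow> (nat \<Rightarrow> complex) \<Rightarrow> nat \<Rightarrow> nat \<Rightarrow> complex" where
  "dft_part N x t i = (let R = N div 2 ^ t in
     \<Sum>u<2 ^ t. x (i mod R + u * R) * expi (real (u * (i div R) * R) / real N))"

definition dft :: "nat \<Rightarrow> (nat \<Rightarrow> complex) \<Rightarrow> nat \<Rightarrow> complex" where
  "dft N x f = (\<Sum>u<N. x u * expi (real (u * f) / real N))"

lemma dft_part_0: "i < N \<Longrightarrow> dft_part N x 0 i = x i"
  by (simp add: dft_part_def)

lemma dft_part_last: "dft_part (2 ^ e) x e = dft (2 ^ e) x"
  by (simp add: dft_part_def dft_def fun_eq_iff)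

text \<open>Decimation in time: the sum over \<open>u\<close> splits by parity into two transforms
  of half the length and twice the stride.\<close>

lemma dft_part_Suc:
  assumes N: "N = 2 ^ e" and t: "t < e" and i: "i < N"
  defines "S \<equiv> N div 2 ^ Suc t"
  defines "f \<equiv> i div S"
  defines "src \<equiv> (f mod 2 ^ t) * (2 * S) + i mod S"
  shows "dft_part N x (Suc t) i = dft_part N x t src + expi (real (f * S) / real N) * dft_part N x t (src + S)"
    and "f * S < N" "src + S < N" "0 < S"
proof -
  have "N = 2 ^ Suc t * 2 ^ (e - Suc t)" using N t by (simp flip: power_add del: power_Suc)
  then have S: "S = 2 ^ (e - Suc t)" and NS: "N = 2 * 2 ^ t * S" by (simp_all add: S_def)
  show S0: "0 < S" using S by simp
  have R: "N div 2 ^ t = 2 * S" using NS by simp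
  have R': "N div 2 ^ Suc t = S" by (simp add: S_def)
  have r: "i mod S < S" using S0 by simp
  have dm: "src div (2 * S) = f mod 2 ^ t" "src mod (2 * S) = i mod S"
    "(src + S) div (2 * S) = f mod 2 ^ t" "(src + S) mod (2 * S) = i mod S + S"
  proof -
    have r2: "i mod S < 2 * S" "i mod S + S < 2 * S" using r by linarith+
    have dm: "(c + q * (2 * S)) div (2 * S) = q" "(c + q * (2 * S)) mod (2 * S) = c" if "c < 2 * S" for c q
      using that by (simp_all add: div_less mod_less del: mult_Suc_right)
    have e: "src + S = (i mod S + S) + (f mod 2 ^ t) * (2 * S)" "src = i mod S + (f mod 2 ^ t) * (2 * S)"
      by (simp_all add: src_def)
    show "src div (2 * S) = f mod 2 ^ t" "src mod (2 * S) = i mod S"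
      unfolding e(2) by (rule dm[OF r2(1)])+
    show "(src + S) div (2 * S) = f mod 2 ^ t" "(src + S) mod (2 * S) = i mod S + S"
      unfolding e(1) by (rule dm[OF r2(2)])+
  qed
  have "i = f * S + i mod S" by (simp add: f_def)
  then show fS: "f * S < N" using i by linarith
  have "src < 2 ^ t * (2 * S)"
  proof -
    have "(f mod 2 ^ t + 1) * (2 * S) \<le> 2 ^ t * (2 * S)"
      by (rule mult_le_mono1) (simp add: Suc_leI)
    then show ?thesis unfolding src_def using r by simp
  qed
  moreover have "src + S < 2 ^ t * (2 * S)"
  proof -
    have "(f mod 2 ^ t + 1) * (2 * S) \<le> 2 ^ t * (2 * S)"
      by (rule mult_le_mono1) (simp add: Suc_leI)
    then show ?thesis unfolding src_def using r by simp
  qed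
  ultimately show "src + S < N" using NS by simp
  have N0: "0 < N" using i by simp
  define f0 where "f0 = f mod 2 ^ t"
  \<comment> \<open>In the even terms \<open>f\<close> matters only modulo \<open>2 ^ t\<close>: the
    rest changes the phase by an integer.\<close>
  have ph: "expi (real (2 * u * f * S) / real N) = expi (real (u * f0 * (2 * S)) / real N)" for u
  proof (rule expi_shift_int[of _ _ "int (u * (f div 2 ^ t))"])
    have f: "f = 2 ^ t * (f div 2 ^ t) + f0" by (simp add: f0_def)
    have "2 * u * f * S = u * f0 * (2 * S) + u * (f div 2 ^ t) * N"
      unfolding NS by (subst f) (simp add: algebra_simps)
    then have "real (2 * u * f * S) = real (u * f0 * (2 * S)) + real (u * (f div 2 ^ t)) * real N"
      by (simp only: of_nat_add of_nat_mult)
    then show "real (2 * u * f * S) / real N - real (u * f0 * (2 * S)) / real N = real_of_int (int (u * (f div 2 ^ t)))"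
      using N0 by (simp add: field_simps)
  qed
  have "dft_part N x (Suc t) i = (\<Sum>u<2 * 2 ^ t. x (i mod S + u * S) * expi (real (u * f * S) / real N))"
    by (simp only: dft_part_def R' Let_def f_def) (simp only: power_Suc)
  also have "\<dots> = (\<Sum>u<2 ^ t. x (i mod S + (2 * u) * S) * expi (real (2 * u * f * S) / real N)) +
      (\<Sum>u<2 ^ t. x (i mod S + (2 * u + 1) * S) * expi (real ((2 * u + 1) * f * S) / real N))"
    by (rule sum_even_odd)
  also have "(\<Sum>u<2 ^ t. x (i mod S + (2 * u) * S) * expi (real (2 * u * f * S) / real N)) = dft_part N x t src"
    unfolding ph dft_part_def R Let_def dm f0_def by (simp only: mult.commute mult.left_commute mult.assoc)
  also have "(\<Sum>u<2 ^ t. x (i mod S + (2 * u + 1) * S) * expi (real ((2 * u + 1) * f * S) / real N)) =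
      expi (real (f * S) / real N) * dft_part N x t (src + S)"
  proof -
    have "expi (real ((2 * u + 1) * f * S) / real N) = expi (real (f * S) / real N) * expi (real (u * f0 * (2 * S)) / real N)" for u
      unfolding ph[symmetric] expi_add[symmetric] by (simp add: add_divide_distrib algebra_simps)
    moreover have "i mod S + (2 * u + 1) * S = i mod S + S + u * (2 * S)" for u by simp
    ultimately show ?thesis
      unfolding dft_part_def R Let_def dm f0_def[symmetric] sum_distrib_left
      by (simp only: mult.commute mult.left_commute mult.assoc)
  qed
  finally show "dft_part N x (Suc t) i = dft_part N x t src + expi (real (f * S) / real N) * dft_part N x t (src + S)" .
qed

text \<open>
  A cyclic correlation of length \<open>L\<close> is read off transforms of length \<open>N \<ge> 2 * L\<close>, because
  \<open>c = a + b\<close> is the only solution of \<open>c \<equiv> a + b\<close> modulo \<open>N\<close> with \<open>a, b < L\<close> and \<open>c < 2 * L\<close>.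
\<close>

lemma correlation_dft:
  fixes x y :: "nat \<Rightarrow> real"
  assumes L: "0 < L" "2 * L \<le> N" and b: "b < L"
  defines "X \<equiv> \<lambda>a. complex_of_real (if a < L then x a else 0)"
  defines "Y \<equiv> \<lambda>c. complex_of_real (if c < 2 * L then y (c mod L) else 0)"
  shows "(\<Sum>f<N. cnj (dft N X f) * dft N Y f * cnj (expi (real (f * b) / real N))) =
    of_nat N * complex_of_real (\<Sum>a<L. x a * y ((a + b) mod L))"
proof -
  have N0: "0 < N" using L by simp
  let ?e = "\<lambda>f a c. expi (real f * real_of_int (int c - int a - int b) / real N)"
  have trm: "cnj (dft N X f) * dft N Y f * cnj (expi (real (f * b) / real N)) =
      (\<Sum>a<N. \<Sum>c<N. X a * Y c * ?e f a c)" for f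
  proof -
    have "cnj (expi (real (a * f) / real N)) * expi (real (c * f) / real N) * cnj (expi (real (f * b) / real N)) = ?e f a c" for a c
      unfolding expi_cnj expi_add[symmetric] using N0 by (intro arg_cong[of _ _ expi]) (simp add: field_simps)
    moreover have "cnj (X a) = X a" for a by (simp add: X_def)
    ultimately show ?thesis
      unfolding dft_def cnj_sum
      unfolding sum_product
      unfolding sum_distrib_right
      by (intro sum.cong refl) (simp add: mult_ac)
  qed
  have "(\<Sum>f<N. cnj (dft N X f) * dft N Y f * cnj (expi (real (f * b) / real N))) =
      (\<Sum>a<N. \<Sum>c<N. X a * Y c * (\<Sum>f<N. ?e f a c))"
    unfolding trm sum_distrib_left by (subst sum.swap) (intro sum.cong refl sum.swap)
  also have "\<dots> = (\<Sum>a<N. \<Sum>c<N. if a < L \<and> c = a + b then of_nat N * complex_of_real (x a * y ((a + b) mod L)) else 0)"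
  proof (intro sum.cong refl)
    fix a c
    have "int N dvd int c - int a - int b \<longleftrightarrow> c = a + b" if "a < L" "c < 2 * L"
    proof
      assume dv: "int N dvd int c - int a - int b"
      have "\<bar>int c - int a - int b\<bar> < int N" using that b L by linarith
      then have "int c - int a - int b = 0"
        using dvd_imp_le_int[OF _ dv] by (cases "int c - int a - int b = 0") simp_all
      then show "c = a + b" by linarith
    qed simp
    note eq = this
    show "X a * Y c * (\<Sum>f<N. ?e f a c) =
        (if a < L \<and> c = a + b then of_nat N * complex_of_real (x a * y ((a + b) mod L)) else 0)"
    proof (cases "a < L \<and> c < 2 * L")
      case True
      then show ?thesis unfolding sum_expi[OF N0] using eq by (simp add: X_def Y_def)
    next
      case False
      moreover have "a + b < 2 * L" if "a < L" using that b by simp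
      ultimately have "X a * Y c = 0" "\<not> (a < L \<and> c = a + b)" by (auto simp: X_def Y_def)
      then show ?thesis by (simp only: mult_zero_left if_False)
    qed
  qed
  also have "\<dots> = (\<Sum>a<N. if a < L then of_nat N * complex_of_real (x a * y ((a + b) mod L)) else 0)"
  proof (rule sum.cong[OF refl])
    fix a
    show "(\<Sum>c<N. if a < L \<and> c = a + b then of_nat N * complex_of_real (x a * y ((a + b) mod L)) else 0) =
        (if a < L then of_nat N * complex_of_real (x a * y ((a + b) mod L)) else 0)"
      using b L by (cases "a < L") auto
  qed
  also have "\<dots> = (\<Sum>a<L. of_nat N * complex_of_real (x a * y ((a + b) mod L)))"
    by (rule sum.mono_neutral_cong_right) (use L in auto)
  finally show ?thesis by (simp add: sum_distrib_left)
qed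

definition roots_ok :: "nat \<Rightarrow> nat \<Rightarrow> store \<Rightarrow> bool" where
  "roots_ok N e s \<longleftrightarrow> ivar s iN 0 = int N \<and> ivar s iE 0 = int e \<and>
     (\<forall>k<N. rvar s rRC (int k) = Re (expi (real k / real N)) \<and> rvar s rRS (int k) = Im (expi (real k / real N)))"

context
  fixes B :: "nat \<Rightarrow> nat" and I :: input and L N e :: nat
  assumes N: "N = 2 ^ e" and BN: "N \<le> B bN" "e \<le> B bLg" and LN: "N < L"
begin

lemma fft_level_wp:
  assumes s: "roots_ok N e s" and t: "t < e"
    and H: "ivar s iH 0 = int (2 ^ t)" "ivar s iStr 0 = int (N div 2 ^ Suc t)"
    and x: "\<And>i. i < N \<Longrightarrow> Complex (rvar s rXR (int i)) (rvar s rXI (int i)) = dft_part N x t i"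
  shows "wp B I L fft_level (\<lambda>s'. \<forall>i<N. Complex (rvar s' rXR (int i)) (rvar s' rXI (int i)) = dft_part N x (Suc t) i) s"
  unfolding fft_level_def wp_simps
proof (rule wp_For[where N = N and Inv = "\<lambda>k s'. \<forall>i<k. Complex (rvar s' rYR (int i)) (rvar s' rYI (int i)) = dft_part N x (Suc t) i"], goal_cases)
  case (5 k s')
  note fr = same_outsideD[OF 5(2), simplified]
  define S where "S = N div 2 ^ Suc t"
  define f where "f = k div S"
  define src where "src = (f mod 2 ^ t) * (2 * S) + k mod S"
  note st = dft_part_Suc[OF N t 5(1), folded S_def, folded f_def, folded src_def]
  have vals: "ivar s' iStr 0 = int S" "ivar s' iH 0 = int (2 ^ t)" "ivar s' iN 0 = int N"
    using H s by (simp_all add: fr S_def roots_ok_def)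
  have rt: "rvar s' rRC (int (f * S)) = Re (expi (real (f * S) / real N))"
     "rvar s' rRS (int (f * S)) = Im (expi (real (f * S) / real N))"
    using s st(2) by (simp_all add: fr roots_ok_def del: of_nat_mult)
  have xs: "rvar s' rXR (int i) = Re (dft_part N x t i)" "rvar s' rXI (int i) = Im (dft_part N x t i)" if "i < N" for i
    using x[OF that] by (simp_all add: fr complex_eq_iff)
  have e1: "int k div int S = int f" by (simp add: f_def zdiv_int)
  have e2: "int f mod 2 ^ t * (2 * int S) + int k mod int S = int src"
    by (simp add: src_def zmod_int)
  have e3: "int f * int S = int (f * S)" "int src + int S = int (src + S)" by simp_all
  show ?case
    using st LN 5(1,3)
    by (simp add: wp_simps vals e1 e2 e3 rt xs less_Suc_eq complex_eq_iff del: of_nat_mult of_nat_add)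
next
  case (6 s1)
  note fr = same_outsideD[OF 6(1), simplified]
  show ?case
  proof (rule wp_For[where N = N and Inv = "\<lambda>k s'. \<forall>i<k. Complex (rvar s' rXR (int i)) (rvar s' rXI (int i)) = dft_part N x (Suc t) i"], goal_cases)
    case (5 k s2)
    note fr2 = same_outsideD[OF 5(2), simplified]
    show ?case using 5(1,3) 6(2) LN by (simp add: wp_simps fr2 less_Suc_eq complex_eq_iff)
  qed (use s BN LN in \<open>auto simp: roots_ok_def fr\<close>)
qed (use s BN LN in \<open>auto simp: roots_ok_def\<close>)

lemma fft_wp:
  assumes s: "roots_ok N e s" and e: "0 < e"
  shows "wp B I L fft (\<lambda>s'. \<forall>i<N. Complex (rvar s' rXR (int i)) (rvar s' rXI (int i)) =
    dft N (\<lambda>a. Complex (rvar s rXR (int a)) (rvar s rXI (int a))) i) s"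
proof -
  define x where "x a = Complex (rvar s rXR (int a)) (rvar s rXI (int a))" for a
  have N2: "int N div 2 = int (N div 2)" by (simp add: zdiv_int)
  have "wp B I L fft (\<lambda>s'. \<forall>i<N. Complex (rvar s' rXR (int i)) (rvar s' rXI (int i)) = dft_part N x e i) s"
    unfolding fft_def wp_simps
    using s LN
  proof (simp add: roots_ok_def N2, goal_cases)
    case 1
    show ?case
    proof (rule wp_For[where N = e and Inv = "\<lambda>t s'. ivar s' iH 0 = int (2 ^ t) \<and> ivar s' iStr 0 = int (N div 2 ^ Suc t) \<and>
        (\<forall>i<N. Complex (rvar s' rXR (int i)) (rvar s' rXI (int i)) = dft_part N x t i)"], goal_cases)
      case (5 t s1)
      note fr = same_outsideD[OF 5(2), simplified]
      show ?case unfolding wp_simps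
      proof (rule wp_conseq[OF fft_level_wp[where t = t and x = x]], goal_cases)
        case 1
        then show ?case using s by (simp add: roots_ok_def fr)
      next
        case (6 s2)
        note fr2 = same_outsideD[OF 6(1), simplified]
        have d: "int (N div (2 * 2 ^ t)) div 2 = int (N div (2 * (2 * 2 ^ t)))"
        proof -
          have "N div (2 * 2 ^ t) div 2 = N div (2 * (2 * 2 ^ t))" by (metis div_mult2_eq mult.commute)
          then show ?thesis by (metis of_nat_numeral zdiv_int)
        qed
        show ?case using 5(3) 6(2) LN d by (simp add: wp_simps fr2)
      qed (use 5 in \<open>auto simp: fr\<close>)
    qed (use s BN LN N2 in \<open>auto simp: roots_ok_def dft_part_0 x_def\<close>)
  qed
  then show ?thesis unfolding N dft_part_last x_def .
qed

end

section \<open>Initialisation\<close>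

lemmas wp_Sq = wp_simps(5)

text \<open>\<open>4 * n + 2 < L\<close> makes room for arrays of the transform length, which is at
  most \<open>4 * n\<close>.\<close>

locale construction =
  fixes \<alpha> :: real and \<gamma> :: "nat \<Rightarrow> real" and \<tau> :: real and n d L :: nat
  assumes d: "1 \<le> d" and \<alpha>: "1 / 2 < \<alpha>" and \<gamma>: "\<And>j. 1 \<le> j \<Longrightarrow> 0 < \<gamma> j"
    and \<tau>: "0 < \<tau>" "\<tau> < 1" and n: "2 \<le> n" and L: "4 * n + 2 < L"
begin

definition ps :: "nat list" where
  "ps = sorted_list_of_set (primes_P n)"

definition m :: nat where
  "m = length ps"

definition inp :: input where
  "inp = problem_input \<alpha> \<gamma> \<tau> n d"

definition lg :: nat where
  "lg = nat \<lfloor>log 2 (4 * real n)\<rfloor>"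

definition bd :: "nat \<Rightarrow> nat" where
  "bd b = (if b = 0 then d else if b = 1 then m else if b = 2 then 4 * n else lg)"

lemma inp_simps [simp]:
  "in_dim inp = int d" "in_size inp = int n" "in_tau inp = \<tau>" "in_weight inp = \<gamma>" "in_sigma inp = sigma \<alpha>"
  by (simp_all add: inp_def problem_input_def)

lemma bd_simps [simp]: "bd 0 = d" "bd (Suc 0) = m" "bd 2 = 4 * n" "bd 3 = lg"
  by (simp_all add: bd_def)

lemma fin_P: "finite (primes_P n)"
  by (rule finite_subset[of _ "{..n}"]) (auto simp: primes_P_def)

lemma ps: "set ps = primes_P n" "distinct ps" "sorted ps" "m = card (primes_P n)"
  using fin_P by (simp_all add: ps_def m_def)

lemma ps_nth:
  assumes "i < m"
  shows "ps ! i \<in> primes_P n" "prime (ps ! i)" "ps ! i \<le> n" "2 \<le> ps ! i" "0 < ps ! i"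
proof -
  show 1: "ps ! i \<in> primes_P n" using assms ps(1) nth_mem[of i ps] by (simp add: m_def)
  then show "prime (ps ! i)" "ps ! i \<le> n" by (auto simp: primes_P_def)
  then show "2 \<le> ps ! i" using prime_ge_2_nat by blast
  then show "0 < ps ! i" by simp
qed

lemma ps_less_iff: "i < m \<Longrightarrow> j < m \<Longrightarrow> ps ! i < ps ! j \<longleftrightarrow> i < j"
  using ps(2,3) unfolding m_def
  by (metis linorder_not_less nth_eq_iff_index_eq order_le_less sorted_nth_mono)

lemma m_le: "m \<le> n"
proof -
  have "primes_P n \<subseteq> {1..n}" by (auto simp: primes_P_def Suc_leI prime_gt_0_nat)
  then show ?thesis using card_mono[of "{1..n}" "primes_P n"] ps(4) by simp
qed

lemma L_bounds: "n < L" "4 * n < L" "m < L" "2 < L" "0 < L" "Suc 0 < L"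
  using L m_le n by auto

lemma mem_P_iff:
  "c \<in> primes_P n \<longleftrightarrow> 2 \<le> c \<and> n < 2 * c \<and> c \<le> n \<and> (\<forall>a<c. 2 \<le> a \<longrightarrow> c mod a \<noteq> 0)"
proof -
  have "prime c \<longleftrightarrow> 2 \<le> c \<and> (\<forall>a<c. 2 \<le> a \<longrightarrow> c mod a \<noteq> 0)"
    unfolding prime_nat_iff' by (auto simp: dvd_eq_mod_eq_0)
  moreover have "real n / 2 < real c \<longleftrightarrow> n < 2 * c" by linarith
  ultimately show ?thesis by (auto simp: primes_P_def)
qed

lemma find_primes_wp:
  "wp bd inp L find_primes (\<lambda>s'. ivar s' 40 0 = int m \<and> (\<forall>i<m. ivar s' 2 (int i) = int (ps ! i))) s"
proof -
  \<comment> \<open>The list after all numbers below \<open>c\<close> have been tested; a new prime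
    goes to its end, so the list stays sorted.\<close>
  define l where "l c = sorted_list_of_set {p \<in> primes_P n. p < c}" for c
  have fin: "finite {p \<in> primes_P n. p < c}" for c using fin_P by simp
  have llen: "length (l c) \<le> n" for c
    using card_mono[OF fin_P, of "{p \<in> primes_P n. p < c}"] m_le ps(4) by (simp add: l_def)
  have lSuc: "l (Suc c) = (if c \<in> primes_P n then l c @ [c] else l c)" for c
  proof (cases "c \<in> primes_P n")
    case True
    have "{p \<in> primes_P n. p < Suc c} = insert c {p \<in> primes_P n. p < c}" using True by (auto simp: less_Suc_eq)
    then have "l (Suc c) = insort c (l c)" using fin by (simp add: l_def)
    also have "\<dots> = l c @ [c]" by (rule sorted_insort_is_snoc) (use fin in \<open>auto simp: l_def\<close>)
    finally show ?thesis using True by simp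
  next
    case False
    then have "{p \<in> primes_P n. p < Suc c} = {p \<in> primes_P n. p < c}" by (auto simp: less_Suc_eq)
    then show ?thesis using False by (simp add: l_def)
  qed
  have l0: "l 0 = []" by (simp add: l_def)
  have lend: "l (Suc n) = ps"
  proof -
    have "{p \<in> primes_P n. p < Suc n} = primes_P n" by (auto simp: primes_P_def)
    then show ?thesis by (simp add: l_def ps_def)
  qed
  show ?thesis unfolding find_primes_def wp_Sq
  proof (simp add: wp_simps(2,3) L_bounds, rule wp_For[where N = "Suc n" and Inv = "\<lambda>c s'. ivar s' 40 0 = int (length (l c)) \<and>
      (\<forall>i<length (l c). ivar s' 2 (int i) = int (l c ! i))"], goal_cases)
    case (5 c s1)
    note fr = same_outsideD[OF 5(2), simplified]
    define c0 where "c0 \<longleftrightarrow> 2 \<le> c \<and> n < 2 * c"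
    have loop: "wp bd inp L (For 16 2 (Iv 25 (Num 0))
          (Ifc (Lei (Num 2) (Iv 16 (Num 0))) (Ifc (An (Lei (Iv 25 (Num 0) mod! Iv 16 (Num 0)) (Num 0)) (Lei (Num 0) (Iv 25 (Num 0) mod! Iv 16 (Num 0)))) (Iset 26 (Num 0) (Num 0)) Nop) Nop))
        (\<lambda>s'. ivar s' 26 0 = (if c0 \<and> (\<forall>a<c. 2 \<le> a \<longrightarrow> c mod a \<noteq> 0) then 1 else 0)) s2"
      if s2: "ivar s2 25 0 = int c" "ivar s2 26 0 = (if c0 then 1 else 0)" for s2
    proof (rule wp_For[where N = c and Inv = "\<lambda>t s'. ivar s' 26 0 = (if c0 \<and> (\<forall>a<t. 2 \<le> a \<longrightarrow> c mod a \<noteq> 0) then 1 else 0)"], goal_cases)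
      case (5 a s3)
      note fr3 = same_outsideD[OF 5(2), simplified]
      have "int c mod int a = 0 \<longleftrightarrow> c mod a = 0" by (simp flip: zmod_int)
      moreover have "\<not> int c mod int a \<le> 0 \<longleftrightarrow> c mod a \<noteq> 0" by (simp flip: zmod_int)
      ultimately show ?case using 5(3) L_bounds s2 by (auto simp: wp_simps fr3 less_Suc_eq)
    qed (use s2 5(1) L_bounds n in auto)
    have fin: "wp bd inp L (Ifc (An (Lei (Iv 26 (Num 0)) (Num 1)) (Lei (Num 1) (Iv 26 (Num 0))))
          (Iset 2 (Iv 40 (Num 0)) (Iv 25 (Num 0)) ;; Iset 40 (Num 0) (Iv 40 (Num 0) +! Num 1)) Nop)
        (\<lambda>s'. ivar s' 40 0 = int (length (l (Suc c))) \<and> (\<forall>i<length (l (Suc c)). ivar s' 2 (int i) = int (l (Suc c) ! i))) s3"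
      if "ivar s3 26 0 = (if c0 \<and> (\<forall>a<c. 2 \<le> a \<longrightarrow> c mod a \<noteq> 0) then 1 else 0)" "ivar s3 25 0 = int c"
        "ivar s3 40 0 = int (length (l c))" "\<forall>i<length (l c). ivar s3 2 (int i) = int (l c ! i)" for s3
    proof -
      have cP: "c \<in> primes_P n \<longleftrightarrow> c0 \<and> (\<forall>a<c. 2 \<le> a \<longrightarrow> c mod a \<noteq> 0)"
        using 5(1) by (auto simp: mem_P_iff c0_def)
      show ?thesis
        using that L_bounds llen[of c] unfolding cP[symmetric] lSuc
        by (auto simp: wp_simps nth_append less_Suc_eq)
    qed
    have fl: "wp bd inp L (Ifc (An (Lei (Num 2) (Iv 25 (Num 0))) (Nt (Lei (Num 2 *! Iv 25 (Num 0)) Size))) (Iset 26 (Num 0) (Num 1)) (Iset 26 (Num 0) (Num 0)))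
        (\<lambda>s'. ivar s' 26 0 = (if c0 then 1 else 0)) (set_ivar 25 0 (int c) s1)"
      using L_bounds by (auto simp: wp_simps c0_def)
    show ?case unfolding wp_Sq
    proof (rule wp_conseq[OF fl], goal_cases)
      case (1 s2)
      note fr2 = same_outsideD[OF 1(1), simplified]
      show ?case
      proof (rule wp_conseq[OF loop], goal_cases)
        case (3 s3)
        note fr3 = same_outsideD[OF 3(1), simplified]
        show ?case
          by (rule fin) (use 5(3) 3(2) in \<open>simp_all add: fr2 fr3\<close>)
      qed (use 1(2) in \<open>simp_all add: fr2\<close>)
    qed
  qed (use n l0 lend m_def in auto)
qed

text \<open>A correlation of length \<open>p - 1\<close> needs
  \<open>2 * (p - 1) \<le> 2 ^ e\<close>; a power of two between \<open>2 * n\<close> and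
  \<open>4 * n\<close> serves all primes.\<close>

lemma find_root_wp:
  "wp bd inp L find_root (\<lambda>s'. \<exists>e. 1 \<le> e \<and> 2 * n \<le> 2 ^ e \<and> 2 ^ e \<le> 4 * n \<and> ivar s' 3 0 = 2 ^ e \<and> ivar s' 4 0 = int e \<and>
     rvar s' 41 0 = cos (2 * pi / 2 ^ e) \<and> rvar s' 2 0 = sin (2 * pi / 2 ^ e)) s"
  unfolding find_root_def wp_Sq
\<comment> \<open>Either the length has reached \<open>2 * n\<close>, or it was doubled in each of
  the \<open>k\<close> rounds and \<open>e = Suc k\<close>. After \<open>n\<close> rounds the second
  case implies the first.\<close>
proof (simp add: wp_simps(2,3) L_bounds, rule wp_For[where N = n and Inv = "\<lambda>k s'. \<exists>e. 1 \<le> e \<and> 2 ^ e \<le> 4 * n \<and> (2 * n \<le> 2 ^ e \<or> e = Suc k) \<and>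
    ivar s' 3 0 = 2 ^ e \<and> ivar s' 4 0 = int e \<and> rvar s' 41 0 = cos (2 * pi / 2 ^ e) \<and> rvar s' 2 0 = sin (2 * pi / 2 ^ e)"], goal_cases)
  case 4
  then show ?case using n by (intro exI[of _ 1]) simp
next
  case (5 k s1)
  then obtain e where e: "1 \<le> e" "2 ^ e \<le> 4 * n" "2 * n \<le> 2 ^ e \<or> e = Suc k" "ivar s1 3 0 = 2 ^ e" "ivar s1 4 0 = int e"
    "rvar s1 41 0 = cos (2 * pi / 2 ^ e)" "rvar s1 2 0 = sin (2 * pi / 2 ^ e)" by blast
  show ?case
  proof (cases "2 * n \<le> 2 ^ e")
    case True
    then have "\<not> (2::int) ^ e < 2 * int n" by (metis of_nat_less_iff of_nat_mult of_nat_numeral of_nat_power not_le)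
    then show ?thesis using True e L_bounds by (auto simp: wp_simps intro!: exI[of _ e])
  next
    case False
    then have lt: "(2::int) ^ e < 2 * int n" by (metis of_nat_less_iff of_nat_mult of_nat_numeral of_nat_power not_le)
    define x where "x = 2 * pi / 2 ^ e"
    have x: "0 \<le> x" "x \<le> pi"
    proof -
      have "(2::real) ^ 1 \<le> 2 ^ e" using e(1) by (intro power_increasing) auto
      then show "x \<le> pi" by (simp add: x_def field_simps)
    qed (simp add: x_def)
    have half: "2 * pi / 2 ^ Suc e = x / 2" by (simp add: x_def)
    \<comment> \<open>The angle lies between 0 and \<open>pi\<close>, so sine and cosine of its half
      are nonnegative and the square roots have the right sign.\<close>
    have "cos (x / 2) = sqrt ((1 + cos x) / 2)" "sin (x / 2) = sqrt ((1 - cos x) / 2)"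
    proof -
      have "0 \<le> cos (x / 2)" using x by (intro cos_ge_zero) auto
      moreover have "(cos (x / 2))\<^sup>2 = (1 + cos x) / 2" using cos_double_cos[of "x / 2"] by simp
      ultimately show "cos (x / 2) = sqrt ((1 + cos x) / 2)" by (metis real_sqrt_unique)
      have "0 \<le> sin (x / 2)" using x by (intro sin_ge_zero) auto
      moreover have "(sin (x / 2))\<^sup>2 = (1 - cos x) / 2" using cos_double_sin[of "x / 2"] by simp
      ultimately show "sin (x / 2) = sqrt ((1 - cos x) / 2)" by (metis real_sqrt_unique)
    qed
    then have hc: "sqrt ((1 + cos x) / 2) = cos (2 * pi / 2 ^ Suc e)" "sqrt ((1 - cos x) / 2) = sin (2 * pi / 2 ^ Suc e)"
      unfolding half by simp_all
    have vals: "rvar s1 41 0 = cos x" "rvar s1 2 0 = sin x" using e(6,7) by (simp_all add: x_def)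
    have "1 \<le> Suc e" "2 ^ Suc e \<le> 4 * n" "2 * n \<le> 2 ^ Suc e \<or> Suc e = Suc (Suc k)"
      using False e(3) by auto
    then have "\<exists>e'. 1 \<le> e' \<and> 2 ^ e' \<le> 4 * n \<and> (2 * n \<le> 2 ^ e' \<or> e' = Suc (Suc k)) \<and>
        2 * 2 ^ e = (2::int) ^ e' \<and> int e + 1 = int e' \<and> cos (2 * pi / 2 ^ Suc e) = cos (2 * pi / 2 ^ e') \<and>
        sin (2 * pi / 2 ^ Suc e) = sin (2 * pi / 2 ^ e')"
      by (intro exI[of _ "Suc e"]) simp
    moreover have "0 \<le> 1 + cos x" "0 \<le> 1 - cos x" using cos_ge_minus_one[of x] cos_le_one[of x] by linarith+
    ultimately show ?thesis using lt L_bounds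
      by (simp add: wp_simps vals e(4,5) hc del: power_Suc)
  qed
next
  case (6 s1)
  then obtain e where e: "1 \<le> e" "2 ^ e \<le> 4 * n" "2 * n \<le> 2 ^ e \<or> e = Suc n" "ivar s1 3 0 = 2 ^ e" "ivar s1 4 0 = int e"
    "rvar s1 41 0 = cos (2 * pi / 2 ^ e)" "rvar s1 2 0 = sin (2 * pi / 2 ^ e)" by blast
  have "n < 2 ^ n" by simp
  then have "2 * n \<le> 2 ^ Suc n" by simp
  then have "2 * n \<le> 2 ^ e" using e(3) by blast
  then show ?case using e by (intro exI[of _ e]) simp
qed (use n in auto)

lemma root_table_wp:
  assumes s: "ivar s 3 0 = int N" "rvar s 41 0 = cos (2 * pi / real N)" "rvar s 2 0 = sin (2 * pi / real N)"
    and N: "0 < N" "N \<le> 4 * n"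
  shows "wp bd inp L root_table (\<lambda>s'. \<forall>k<N. rvar s' 3 (int k) = Re (expi (real k / real N)) \<and> rvar s' 4 (int k) = Im (expi (real k / real N))) s"
proof -
  have st: "expi (real (Suc k) / real N) = expi (real k / real N) * Complex (cos (2 * pi / real N)) (sin (2 * pi / real N))" for k
  proof -
    have "Complex (cos (2 * pi / real N)) (sin (2 * pi / real N)) = expi (1 / real N)"
      by (simp add: expi_def complex_eq_iff)
    then show ?thesis by (simp add: expi_add[symmetric] add_divide_distrib add.commute)
  qed
  show ?thesis unfolding root_table_def wp_Sq
  proof (simp add: wp_simps(2,3) L_bounds, rule wp_For[where N = "N - 1" and Inv = "\<lambda>k s'. \<forall>i\<le>k. rvar s' 3 (int i) = Re (expi (real i / real N)) \<and>
      rvar s' 4 (int i) = Im (expi (real i / real N))"], goal_cases)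
    case (5 k s1)
    note fr = same_outsideD[OF 5(2), simplified]
    have "int k + 1 = int (Suc k)" by simp
    then show ?case using 5(1,3) L_bounds N
      by (auto simp: wp_simps fr s le_Suc_eq st simp del: of_nat_Suc)
  qed (use s N L_bounds in \<open>auto simp: of_nat_diff\<close>)
qed

lemma shift_consts_wp:
  assumes s: "ivar s 40 0 = int m" "\<forall>i<m. ivar s 2 (int i) = int (ps ! i)"
  shows "wp bd inp L shift_consts (\<lambda>s'. \<forall>j<m. rvar s' 5 (int j) = real (ps ! j) powr (- (2 * \<alpha>))) s"
  unfolding shift_consts_def
proof (rule wp_For[where N = m and Inv = "\<lambda>k s'. \<forall>j<k. rvar s' 5 (int j) = real (ps ! j) powr (- (2 * \<alpha>))"], goal_cases)
  case (5 j s1)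
  note fr = same_outsideD[OF 5(2), simplified]
  define q where "q = ps ! j"
  have q: "0 < q" "q \<le> n" using ps_nth[OF 5(1)] by (simp_all add: q_def)
  have loop: "wp bd inp L (For 16 2 (Iv 9 (Num 0)) (Rset 20 (Num 0) (Rv 20 (Num 0) +. Sg (Cast (Iv 16 (Num 0)) /. Cast (Iv 9 (Num 0))))))
      (\<lambda>s'. rvar s' 20 0 = (\<Sum>a<q. sigma \<alpha> (real a / real q))) s2" if s2: "ivar s2 9 0 = int q" "rvar s2 20 0 = 0" for s2
  proof (rule wp_For[where N = q and Inv = "\<lambda>k s'. rvar s' 20 0 = (\<Sum>a<k. sigma \<alpha> (real a / real q))"], goal_cases)
    case (5 k s3)
    note fr3 = same_outsideD[OF 5(2), simplified]
    show ?case using 5(1,3) L_bounds s2 by (simp add: wp_simps fr3)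
  qed (use s2 q L_bounds in auto)
  have val: "(\<Sum>a<q. sigma \<alpha> (real a / real q)) / (real q * sigma \<alpha> 0) = real q powr (- (2 * \<alpha>))"
  proof -
    have "(\<Sum>a<q. sigma \<alpha> (0 + real a / real q)) = real q powr (1 - 2 * \<alpha>) * sigma \<alpha> (real q * 0)"
      by (rule sum_sigma_shift[OF \<alpha> q(1)])
    moreover have "real q powr (1 - 2 * \<alpha>) = real q * real q powr (- (2 * \<alpha>))"
      using q(1) powr_add[of "real q" 1 "- (2 * \<alpha>)"] by simp
    ultimately show ?thesis using q(1) sigma_0_pos[OF \<alpha>] by simp
  qed
  have "wp bd inp L (For 16 2 (Iv 9 (Num 0)) (Rset 20 (Num 0) (Rv 20 (Num 0) +. Sg (Cast (Iv 16 (Num 0)) /. Cast (Iv 9 (Num 0))))))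
      (wp bd inp L (Rset 5 (Iv 8 (Num 0)) (Rv 20 (Num 0) /. (Cast (Iv 9 (Num 0)) *. Sg (Cast (Num 0)))))
        (\<lambda>s'. \<forall>i<Suc j. rvar s' 5 (int i) = real (ps ! i) powr (- (2 * \<alpha>))))
      (set_rvar 20 0 0 (set_ivar 9 0 (int q) (set_ivar 8 0 (int j) s1)))"
  proof (rule wp_conseq[OF loop], goal_cases)
    case (3 s2)
    note fr2 = same_outsideD[OF 3(1), simplified]
    show ?case using 3(2) 5(1,3) L_bounds q(1) sigma_0_pos[OF \<alpha>] val
      by (simp add: wp_simps fr2 less_Suc_eq q_def)
  qed simp_all
  moreover have "ivar s1 2 (int j) = int q" using s 5(1) by (simp add: fr q_def)
  ultimately show ?case using 5(1) L_bounds by (simp add: wp_simps)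
qed (use s L_bounds in auto)

lemma emit_first_wp:
  assumes s: "ivar s 40 0 = int m"
  shows "wp bd inp L emit_first (\<lambda>s'. outs s' = outs s @ replicate m 1) s"
  unfolding emit_first_def
proof (rule wp_For[where N = m and Inv = "\<lambda>k s'. outs s' = outs s @ replicate k 1"], goal_cases)
  case (5 j s1)
  then show ?case by (simp add: wp_simps replicate_append_same)
qed (use s L_bounds in auto)

definition fixed_ok :: "nat \<Rightarrow> store \<Rightarrow> bool" where
  "fixed_ok e s \<longleftrightarrow> ivar s 40 0 = int m \<and> (\<forall>i<m. ivar s 2 (int i) = int (ps ! i)) \<and> roots_ok (2 ^ e) e s \<and>
     (\<forall>j<m. rvar s 5 (int j) = real (ps ! j) powr (- (2 * \<alpha>)))"

definition good_exp :: "nat \<Rightarrow> bool" where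
  "good_exp e \<longleftrightarrow> 1 \<le> e \<and> 2 * n \<le> 2 ^ e \<and> 2 ^ e \<le> 4 * n \<and> e \<le> lg"

lemma fixed_ok_frame:
  assumes "same_outside X Y o' s s'" "X \<inter> {40, 2, 3, 4} = {}" "Y \<inter> {3, 4, 5} = {}" "fixed_ok e s"
  shows "fixed_ok e s'"
proof -
  have "40 \<notin> X" "2 \<notin> X" "3 \<notin> X" "4 \<notin> X" "3 \<notin> Y" "4 \<notin> Y" "5 \<notin> Y" using assms by auto
  then show ?thesis using assms(4) same_outsideD[OF assms(1)] by (simp add: fixed_ok_def roots_ok_def)
qed

lemma initialise_wp:
  "wp bd inp L initialise (\<lambda>s'. \<exists>e. good_exp e \<and> fixed_ok e s' \<and> outs s' = outs s @ replicate m 1) s"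
  unfolding initialise_def wp_Sq
proof (rule wp_conseq[OF find_primes_wp], goal_cases)
  case (1 s1)
  note fr1 = same_outsideD[OF 1(1), unfolded prog_defs, simplified]
  show ?case
  proof (rule wp_conseq[OF find_root_wp], goal_cases)
    case (1 s2)
    note fr2 = same_outsideD[OF 1(1), unfolded prog_defs, simplified]
    obtain e where e: "1 \<le> e" "2 * n \<le> 2 ^ e" "2 ^ e \<le> 4 * n" "ivar s2 3 0 = 2 ^ e" "ivar s2 4 0 = int e"
     "rvar s2 41 0 = cos (2 * pi / 2 ^ e)" "rvar s2 2 0 = sin (2 * pi / 2 ^ e)" using 1(2) by blast
    have "real e = log 2 (2 ^ e)" by simp
    also have "\<dots> \<le> log 2 (4 * real n)"
      using e(3) n by (intro log_mono) (auto, metis of_nat_le_iff of_nat_mult of_nat_numeral of_nat_power)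
    finally have "e \<le> lg" unfolding lg_def by (simp add: le_nat_floor)
    then have ge: "good_exp e" using e by (simp add: good_exp_def)
    show ?case
    proof (rule wp_conseq[OF root_table_wp[where N = "2 ^ e"]], goal_cases)
      case (6 s3)
      note fr3 = same_outsideD[OF 6(1), unfolded prog_defs, simplified]
      show ?case
      proof (rule wp_conseq[OF shift_consts_wp], goal_cases)
        case (3 s4)
        note fr4 = same_outsideD[OF 3(1), unfolded prog_defs, simplified]
        show ?case
        proof (rule wp_conseq[OF emit_first_wp], goal_cases)
          case (2 s5)
          note fr5 = same_outsideD[OF 2(1), unfolded prog_defs, simplified]
          have "fixed_ok e s5" unfolding fixed_ok_def roots_ok_def
            using \<open>ivar s1 40 0 = int m \<and> _\<close> e 6(2) 3(2) by (simp add: fr2 fr3 fr4 fr5)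
          then show ?case using ge 2(2) by (auto simp: fr1 fr2 fr3 fr4)
        qed (use \<open>ivar s1 40 0 = int m \<and> _\<close> in \<open>simp add: fr2 fr3 fr4\<close>)
      qed (use \<open>ivar s1 40 0 = int m \<and> _\<close> in \<open>simp_all add: fr2 fr3\<close>)
    qed (use e in simp_all)
  qed
qed

end

section \<open>One step of the construction\<close>

locale construction_step = construction +
  fixes tab :: bool and e :: nat
  assumes ge: "good_exp e" and Lt: "tab \<Longrightarrow> m * m * n * n \<le> L"
begin

definition fac :: "(nat \<Rightarrow> int) \<Rightarrow> nat \<Rightarrow> nat \<Rightarrow> nat \<Rightarrow> nat \<Rightarrow> nat \<Rightarrow> real" where
  "fac z t p q k l = 1 + \<gamma> t * \<gamma> t * sigma \<alpha> (real_of_int ((int k * (z t mod int p) * int q +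
      int l * (z t mod int q) * int p) mod (int p * int q)) / real_of_int (int p * int q))"

text \<open>The kernel at \<open>k * z / p + l * z / q\<close> in the form in which the program
  computes it; \<open>Wf_eq_ker\<close> identifies it with \<open>ker\<close>.\<close>

definition Wf :: "(nat \<Rightarrow> int) \<Rightarrow> nat \<Rightarrow> nat \<Rightarrow> nat \<Rightarrow> nat \<Rightarrow> nat \<Rightarrow> real" where
  "Wf z S p q k l = (\<Prod>t\<in>{1..<S}. fac z t p q k l)"

text \<open>Only a lower bound on the length, because residues of component \<open>S\<close> are
  appended while the condition is in force.\<close>

definition resd :: "(nat \<Rightarrow> int) \<Rightarrow> nat \<Rightarrow> store \<Rightarrow> bool" where
  "resd z S s \<longleftrightarrow> (S - 1) * m \<le> length (outs s) \<and>
     (\<forall>t<S - 1. \<forall>j<m. outs s ! (t * m + j) = z (Suc t) mod int (ps ! j))"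

abbreviation tidx :: "nat \<Rightarrow> nat \<Rightarrow> nat \<Rightarrow> nat \<Rightarrow> nat" where
  "tidx i j k l \<equiv> ((i * m + j) * n + k) * n + l"

definition tab_ok :: "(nat \<Rightarrow> int) \<Rightarrow> nat \<Rightarrow> store \<Rightarrow> bool" where
  "tab_ok z S s \<longleftrightarrow> (tab \<longrightarrow> (\<forall>i<m. \<forall>j<m. \<forall>k<ps ! i. \<forall>l<ps ! j.
     rvar s 23 (int (tidx i j k l)) = Wf z S (ps ! i) (ps ! j) k l))"

definition ctx :: "(nat \<Rightarrow> int) \<Rightarrow> nat \<Rightarrow> nat \<Rightarrow> store \<Rightarrow> bool" where
  "ctx z S i s \<longleftrightarrow> fixed_ok e s \<and> resd z S s \<and> tab_ok z S s \<and> ivar s 5 0 = int (S - 2) \<and>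
     ivar s 6 0 = int i \<and> ivar s 7 0 = int (ps ! i)"

lemma ctx_frame:
  assumes "ctx z S i s" "same_outside X Y o' s s'" "\<not> o'" "X \<inter> {40, 2, 3, 4, 5, 6, 7} = {}" "Y \<inter> {3, 4, 5, 23} = {}"
  shows "ctx z S i s'"
proof -
  have X: "5 \<notin> X" "6 \<notin> X" "7 \<notin> X" "23 \<notin> Y" using assms(4,5) by auto
  have "fixed_ok e s'" by (rule fixed_ok_frame[OF assms(2)]) (use assms in \<open>auto simp: ctx_def\<close>)
  then show ?thesis using assms(1,3) X same_outsideD[OF assms(2)]
    by (simp add: ctx_def resd_def tab_ok_def)
qed

lemma ctxD:
  assumes "ctx z S i s"
  shows "ivar s 40 0 = int m" "j < m \<Longrightarrow> ivar s 2 (int j) = int (ps ! j)" "roots_ok (2 ^ e) e s"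
    "j < m \<Longrightarrow> rvar s 5 (int j) = real (ps ! j) powr (- (2 * \<alpha>))"
    "ivar s 5 0 = int (S - 2)" "ivar s 6 0 = int i" "ivar s 7 0 = int (ps ! i)" "resd z S s" "tab_ok z S s"
    "ivar s 3 0 = 2 ^ e" "ivar s 3 0 = int (2 ^ e)" "ivar s 4 0 = int e"
  using assms by (auto simp: ctx_def fixed_ok_def roots_ok_def)

lemma frac_mod:
  assumes "0 < (b::int)"
  shows "0 \<le> real_of_int (a mod b) / real_of_int b" "real_of_int (a mod b) / real_of_int b \<le> 1"
  using assms pos_mod_bound[OF assms, of a] pos_mod_sign[OF assms, of a] by (simp_all add: divide_le_eq)

lemma mulfac_wp:
  assumes "ivar s 12 0 = int t" "ivar s 40 0 = int m" "ivar s 6 0 = int i" "ivar s 7 0 = int p"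
    "ivar s 8 0 = int j" "ivar s 9 0 = int q" "ivar s 10 0 = int k" "ivar s 11 0 = int l"
    and "0 < p" "0 < q" "t < d" "t < S - 1" "i < m" "j < m" "p = ps ! i" "q = ps ! j" "resd z S s"
  shows "wp bd inp L mulfac (\<lambda>s'. rvar s' 10 0 = rvar s 10 0 * fac z (Suc t) p q k l) s"
proof -
  have len: "t * m + x < length (outs s)" "nat (int t * int m + int x) = t * m + x"
      "int t * int m + int x < int (length (outs s))" if "x < m" for x
  proof -
    have "(t + 1) * m \<le> (S - 1) * m" by (rule mult_le_mono1) (use assms(12) in simp)
    then show "t * m + x < length (outs s)" using assms(17) that by (simp add: resd_def)
    then have "int (t * m + x) < int (length (outs s))" by (simp only: of_nat_less_iff)
    then show "int t * int m + int x < int (length (outs s))" by simp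
    show "nat (int t * int m + int x) = t * m + x" by (metis nat_int of_nat_add of_nat_mult)
  qed
  have o: "outs s ! (t * m + i) = z (Suc t) mod int p" "outs s ! (t * m + j) = z (Suc t) mod int q"
    using assms(12-17) by (auto simp: resd_def)
  have pq: "0 < int p * int q" using assms(9,10) by simp
  have t1: "nat (int t + 1) = Suc t" by simp
  show ?thesis
    unfolding mulfac_def wp_simps
    using len[OF assms(13)] len[OF assms(14)] frac_mod[OF pq] pq L_bounds assms(9-14)
    by (simp add: assms(1-8) o t1 fac_def)
qed

text \<open>Both variants meet the same specification, so the rest of a prime step is verified
  without regard to the flag.\<close>

lemma getw_wp:
  assumes c: "ctx z S i s" and s: "ivar s 8 0 = int j" "ivar s 9 0 = int (ps ! j)" "ivar s 10 0 = int k" "ivar s 11 0 = int l"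
    and b: "i < m" "j < m" "k < ps ! i" "l < ps ! j" and S: "2 \<le> S" "S \<le> d"
  shows "wp bd inp L (getw tab) (\<lambda>s'. rvar s' 10 0 = Wf z S (ps ! i) (ps ! j) k l) s"
proof (cases tab)
  case True
  have kl: "k < n" "l < n" using b ps_nth(3)[OF b(1)] ps_nth(3)[OF b(2)] by linarith+
  have "tidx i j k l < m * m * n * n"
  proof -
    have "i * m + j < m * m" using b by (metis add_less_le_mono mult_Suc mult_le_mono1 Suc_leI less_le_trans nat_add_left_cancel_less add.commute)
    then have "(i * m + j + 1) * n \<le> m * m * n" by (intro mult_le_mono1) simp
    then have "(i * m + j) * n + k < m * m * n" using kl by simp
    then have "((i * m + j) * n + k + 1) * n \<le> m * m * n * n" by (intro mult_le_mono1) simp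
    then show ?thesis using kl by simp
  qed
  then have lt: "tidx i j k l < L" using Lt[OF True] by linarith
  have idx: "((int i * int m + int j) * int n + int k) * int n + int l = int (tidx i j k l)" by simp
  have "rvar s 23 (int (tidx i j k l)) = Wf z S (ps ! i) (ps ! j) k l"
    using ctxD(9)[OF c] True b unfolding tab_ok_def by blast
  then show ?thesis using True lt L_bounds ctxD[OF c] s
    by (simp add: getw_def wp_simps idx del: of_nat_add of_nat_mult)
next
  case False
  have Sm: "S - 2 + 1 = S - 1" "int (S - 2) + 1 = int (S - 1)" using S by auto
  have "wp bd inp L (For 12 0 (Iv 5 (Num 0) +! Num 1) mulfac) (\<lambda>s'. rvar s' 10 0 = Wf z S (ps ! i) (ps ! j) k l) (set_rvar 10 0 1 s)"
  proof (rule wp_For[where N = "S - 1" and Inv = "\<lambda>t s'. rvar s' 10 0 = Wf z (Suc t) (ps ! i) (ps ! j) k l"], goal_cases)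
    case (5 t s1)
    note fr = same_outsideD[OF 5(2), unfolded mulfac_def, simplified]
    have r: "resd z S s1" using ctxD(8)[OF c] by (simp add: resd_def fr)
    show ?case
    proof (rule wp_conseq[OF mulfac_wp[where t = t and i = i and j = j and k = k and l = l and p = "ps ! i" and q = "ps ! j" and z = z and S = S]], goal_cases)
      case (18 s2)
      then show ?case using 5(3) by (simp add: Wf_def prod.atLeastLessThan_Suc)
    qed (use 5 S b s r ctxD[OF c] ps_nth(5) in \<open>simp_all add: fr resd_def\<close>)
  qed (use S Sm L_bounds ctxD[OF c] in \<open>auto simp: Wf_def\<close>)
  then show ?thesis using False L_bounds by (simp add: getw_def wp_simps)
qed

lemma init_wp_wp:
  assumes c: "ctx z S i s" and b: "i < m" and S: "2 \<le> S" "S \<le> d"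
  shows "wp bd inp L (init_wp tab) (\<lambda>s'. \<forall>k<ps ! i. rvar s' 6 (int k) = Wf z S (ps ! i) (ps ! i) k 0 \<and> rvar s' 7 (int k) = Wf z S (ps ! i) (ps ! i) k 0) s"
  unfolding init_wp_def wp_Sq
proof (simp add: wp_simps(2,3) L_bounds ctxD(6,7)[OF c], rule wp_For[where N = "ps ! i" and
    Inv = "\<lambda>a s'. \<forall>k<a. rvar s' 6 (int k) = Wf z S (ps ! i) (ps ! i) k 0 \<and> rvar s' 7 (int k) = Wf z S (ps ! i) (ps ! i) k 0"], goal_cases)
  case (5 k s1)
  note fr = same_outsideD[OF 5(2), simplified]
  have c1: "ctx z S i (set_ivar 10 0 (int k) s1)"
    by (rule ctx_frame[OF c, of "{8, 9, 10, 11, 12}" "{10, 6, 7}" False]) (auto simp: same_outside_def fr)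
  show ?case unfolding wp_Sq
  proof (rule wp_conseq[OF getw_wp[OF c1, where j = i and k = k and l = 0]], goal_cases)
    case (11 s2)
    note fr2 = same_outsideD[OF 11(1), simplified]
    show ?case using 5(1,3) 11(2) L_bounds ps_nth(3)[OF b]
      by (simp add: wp_simps fr2 less_Suc_eq)
  qed (use b S 5(1) ps_nth(5)[OF b] in \<open>simp_all add: fr\<close>)
qed (use L_bounds ctxD[OF c] ps_nth(3)[OF b] in auto)

lemma sum_update:
  fixes f g :: "nat \<Rightarrow> real"
  assumes "a < p" "\<And>u. u < p \<Longrightarrow> f' u = (if u = a then f a + y else f u)"
  shows "(\<Sum>u<p. f' u * g u) = (\<Sum>u<p. f u * g u) + y * g a"
proof -
  have "(\<Sum>u<p. f' u * g u) = (\<Sum>u<p. f u * g u + (if u = a then y * g a else 0))"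
    by (rule sum.cong) (auto simp: assms(2) algebra_simps)
  also have "\<dots> = (\<Sum>u<p. f u * g u) + y * g a" using assms(1) by (simp add: sum.distrib)
  finally show ?thesis .
qed

definition yl :: "(nat \<Rightarrow> int) \<Rightarrow> nat \<Rightarrow> nat \<Rightarrow> nat \<Rightarrow> nat \<Rightarrow> real" where
  "yl z S i j k = 2 * real (ps ! j) powr (- (2 * \<alpha>)) / real (ps ! j) * (\<Sum>l<ps ! j. Wf z S (ps ! i) (ps ! j) k l)"

text \<open>The effect is described by sums against arbitrary \<open>g\<close>, so the position
  \<open>k * q mod p\<close> need not be inverted.\<close>

lemma add_larger_wp:
  assumes c: "ctx z S i s" and b: "i < m" and S: "2 \<le> S" "S \<le> d"
  shows "wp bd inp L (add_larger tab) (\<lambda>s'. \<forall>g. (\<Sum>u<ps ! i. rvar s' 7 (int u) * g u) =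
     (\<Sum>u<ps ! i. rvar s 7 (int u) * g u) + (\<Sum>j<m. if i < j then \<Sum>k<ps ! i. yl z S i j k * g (k * (ps ! j) mod (ps ! i)) else (0::real))) s"
  unfolding add_larger_def
proof (rule wp_For[where N = m and Inv = "\<lambda>j0 s'. \<forall>g. (\<Sum>u<ps ! i. rvar s' 7 (int u) * g u) =
     (\<Sum>u<ps ! i. rvar s 7 (int u) * g u) + (\<Sum>j<j0. if i < j then \<Sum>k<ps ! i. yl z S i j k * g (k * (ps ! j) mod (ps ! i)) else (0::real))"], goal_cases)
  case (5 j s1)
  note fr = same_outsideD[OF 5(2), simplified]
  have c1: "ctx z S i s1" by (rule ctx_frame[OF c 5(2)]) auto
  define p where "p = ps ! i"
  define q where "q = ps ! j"
  have pq: "0 < p" "p \<le> n" "0 < q" "q \<le> n" using ps_nth[OF b] ps_nth[OF 5(1)] by (simp_all add: p_def q_def)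
  show ?case
  proof (cases "i < j")
    case False
    then show ?thesis using 5(3) ctxD[OF c1] L_bounds by (simp add: wp_simps)
  next
    case True
    let ?ls = "For 11 2 (sc 9) (getw tab ;; rset 20 (rsc 20 +. rsc 10))"
    let ?ks = "For 10 2 (Iv 7 (Num 0))
        (rset 20 (rnum 0) ;; ?ls ;;
         iset 28 (sc 10 *! sc 9 mod! sc 7) ;;
         Rset 7 (sc 28) (Rv 7 (sc 28) +. rnum 2 *. Rv 5 (sc 8) /. Cast (sc 9) *. rsc 20))"
    let ?s2 = "set_ivar 9 0 (int q) (set_ivar 8 0 (int j) s1)"
    have "wp bd inp L ?ks
       (\<lambda>s'. \<forall>g. (\<Sum>u<p. rvar s' 7 (int u) * g u) = (\<Sum>u<p. rvar s1 7 (int u) * g u) + (\<Sum>k<p. yl z S i j k * g (k * q mod p))) ?s2"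
    proof (rule wp_For[where N = p and Inv = "\<lambda>k0 s'. \<forall>g. (\<Sum>u<p. rvar s' 7 (int u) * g u) =
        (\<Sum>u<p. rvar s1 7 (int u) * g u) + (\<Sum>k<k0. yl z S i j k * g (k * q mod p))"], goal_cases)
      case (5 k s3)
      note fr3 = same_outsideD[OF 5(2), simplified]
      let ?s4 = "set_rvar 20 0 0 (set_ivar 10 0 (int k) s3)"
      have c4: "ctx z S i ?s4"
        by (rule ctx_frame[OF c1, of "{8, 9, 10, 11, 12, 28}" "{20, 10, 7}" False]) (auto simp: same_outside_def fr3)
      have loop: "wp bd inp L ?ls
          (\<lambda>s'. rvar s' 20 0 = (\<Sum>l<q. Wf z S p q k l)) ?s4"
      proof (rule wp_For[where N = q and Inv = "\<lambda>l0 s'. rvar s' 20 0 = (\<Sum>l<l0. Wf z S p q k l)"], goal_cases)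
        case (5 l s5)
        note fr5 = same_outsideD[OF 5(2), simplified]
        have c6: "ctx z S i (set_ivar 11 0 (int l) s5)"
          by (rule ctx_frame[OF c4, of "{11, 12}" "{20, 10}" False]) (auto simp: same_outside_def fr5)
        show ?case unfolding wp_Sq
        proof (rule wp_conseq[OF getw_wp[OF c6, where j = j and k = k and l = l]], goal_cases)
          case (11 s6)
          note fr6 = same_outsideD[OF 11(1), simplified]
          show ?case using 5(3) 11(2) L_bounds by (simp add: wp_simps fr6 p_def q_def)
        qed (use b S \<open>j < m\<close> \<open>k < p\<close> 5(1) in \<open>simp_all add: fr3 fr5 p_def q_def\<close>)
      qed (use L_bounds pq in \<open>auto simp: fr3\<close>)
      have "wp bd inp L ?ls
         (wp bd inp L (iset 28 (sc 10 *! sc 9 mod! sc 7)) (wp bd inp L (Rset 7 (sc 28) (Rv 7 (sc 28) +. rnum 2 *. Rv 5 (sc 8) /. Cast (sc 9) *. rsc 20))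
        (\<lambda>s'. \<forall>g. (\<Sum>u<p. rvar s' 7 (int u) * g u) = (\<Sum>u<p. rvar s1 7 (int u) * g u) + (\<Sum>k<Suc k. yl z S i j k * g (k * q mod p))))) ?s4"
      proof (rule wp_conseq[OF loop], goal_cases)
        case (1 s7)
        note fr7 = same_outsideD[OF 1(1), simplified]
        define r where "r = k * q mod p"
        have r: "int k * int q mod int p = int r" "r < p" using pq by (simp_all add: r_def zmod_int)
        have v7: "ivar s7 10 0 = int k" "ivar s7 9 0 = int q" "ivar s7 7 0 = int p" "ivar s7 8 0 = int j"
            "rvar s7 5 (int j) = real q powr (- (2 * \<alpha>))"
          using ctxD[OF c4] ctxD(4)[OF c4 \<open>j < m\<close>] by (simp_all add: fr7 fr3 p_def q_def)
        have up: "(\<Sum>u<p. (if u = r then rvar s3 7 (int r) + yl z S i j k else rvar s3 7 (int u)) * g u) =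
            (\<Sum>u<p. rvar s3 7 (int u) * g u) + yl z S i j k * g r" for g
          by (rule sum_update[OF r(2)]) simp
        have y: "2 * real q powr (- (2 * \<alpha>)) / real q * rvar s7 20 0 = yl z S i j k"
          using 1(2) by (simp add: yl_def p_def q_def)
        show ?case using 5(3) pq L_bounds r(2) v7 \<open>j < m\<close>
          by (simp add: wp_simps r(1) y[simplified] fr7 up r_def[symmetric] cong: if_cong)
      qed
      then show ?case unfolding wp_Sq using L_bounds by (simp add: wp_simps(3))
    qed (use L_bounds ctxD[OF c1] pq in \<open>auto simp: p_def\<close>)
    then have "wp bd inp L ?ks
       (\<lambda>s'. \<forall>g. (\<Sum>u<ps ! i. rvar s' 7 (int u) * g u) =
     (\<Sum>u<ps ! i. rvar s 7 (int u) * g u) + (\<Sum>j<Suc j. if i < j then \<Sum>k<ps ! i. yl z S i j k * g (k * (ps ! j) mod (ps ! i)) else (0::real))) ?s2"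
      by (rule wp_conseq) (use 5(3) True in \<open>simp add: p_def q_def\<close>)
    then show ?thesis using True ctxD[OF c1] L_bounds \<open>j < m\<close> by (simp add: wp_simps(2,5,6) q_def)
  qed
qed (use L_bounds ctxD[OF c] in auto)

abbreviation sg1 :: "nat \<Rightarrow> nat \<Rightarrow> real" where
  "sg1 p x \<equiv> sigma \<alpha> (real (x mod p) / real p)"

lemma theta_table_wp:
  assumes c: "ctx z S i s" and b: "i < m"
  shows "wp bd inp L theta_table (\<lambda>s'. \<forall>v<ps ! i. rvar s' 8 (int v) = (\<Sum>k<ps ! i. rvar s 6 (int k) * sg1 (ps ! i) (k * v)) \<and>
     rvar s' 9 (int v) = (\<Sum>k<ps ! i. rvar s 7 (int k) * sg1 (ps ! i) (k * v))) s"
  unfolding theta_table_def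
proof (rule wp_For[where N = "ps ! i" and Inv = "\<lambda>v0 s'. \<forall>v<v0. rvar s' 8 (int v) = (\<Sum>k<ps ! i. rvar s 6 (int k) * sg1 (ps ! i) (k * v)) \<and>
     rvar s' 9 (int v) = (\<Sum>k<ps ! i. rvar s 7 (int k) * sg1 (ps ! i) (k * v))"], goal_cases)
  case (5 v s1)
  note fr = same_outsideD[OF 5(2), simplified]
  define p where "p = ps ! i"
  have p: "0 < p" "p \<le> n" using ps_nth[OF b] by (simp_all add: p_def)
  let ?s2 = "set_rvar 21 0 0 (set_rvar 20 0 0 (set_ivar 18 0 (int v) s1))"
  have loop: "wp bd inp L (For 10 2 (sc 7) (rset 10 (sgx (sc 10 *! sc 18) (sc 7)) ;;
         rset 20 (rsc 20 +. Rv 6 (sc 10) *. rsc 10) ;; rset 21 (rsc 21 +. Rv 7 (sc 10) *. rsc 10)))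
      (\<lambda>s'. rvar s' 20 0 = (\<Sum>k<p. rvar s 6 (int k) * sg1 p (k * v)) \<and> rvar s' 21 0 = (\<Sum>k<p. rvar s 7 (int k) * sg1 p (k * v))) ?s2"
  proof (rule wp_For[where N = p and Inv = "\<lambda>k0 s'. rvar s' 20 0 = (\<Sum>k<k0. rvar s 6 (int k) * sg1 p (k * v)) \<and> rvar s' 21 0 = (\<Sum>k<k0. rvar s 7 (int k) * sg1 p (k * v))"], goal_cases)
    case (5 k s3)
    note fr3 = same_outsideD[OF 5(2), simplified]
    have md: "int k * int v mod int p = int (k * v mod p)" by (simp add: zmod_int)
    have "real (k * v mod p) / real p \<le> 1" using p mod_less_divisor[of p "k * v"] by (simp add: divide_le_eq)
    then show ?case using 5(1,3) L_bounds p ctxD(7)[OF c]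
      by (simp add: wp_simps fr3 fr p_def[symmetric] md)
  qed (use L_bounds ctxD[OF c] p in \<open>auto simp: fr p_def\<close>)
  show ?case unfolding wp_Sq
  proof (simp add: wp_simps(3) L_bounds, rule wp_conseq[OF loop], goal_cases)
    case (1 s4)
    note fr4 = same_outsideD[OF 1(1), simplified]
    show ?case using 5(1,3) 1(2) L_bounds p by (simp add: wp_simps fr4 less_Suc_eq p_def)
  qed
qed (use L_bounds ctxD[OF c] ps_nth[OF b] in auto)

text \<open>For prime \<open>p\<close> the last condition says that \<open>g\<close> has order
  \<open>p - 1\<close> modulo \<open>p\<close>.\<close>

definition gen_tab :: "nat \<Rightarrow> nat \<Rightarrow> store \<Rightarrow> bool" where
  "gen_tab p g s \<longleftrightarrow> 0 < g \<and> g < p \<and> (\<forall>a<p. ivar s 13 (int a) = int (g ^ a mod p)) \<and>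
     (\<forall>a. 1 \<le> a \<longrightarrow> a < p - 1 \<longrightarrow> g ^ a mod p \<noteq> 1)"

text \<open>From the existence of primitive roots modulo a prime; for \<open>p = 2\<close> the
  condition on the exponents is empty.\<close>

lemma ex_generator:
  assumes "prime p"
  shows "\<exists>g. 0 < g \<and> g < p \<and> (\<forall>a. 1 \<le> a \<longrightarrow> a < p - 1 \<longrightarrow> g ^ a mod p \<noteq> 1)"
proof (cases "p = 2")
  case True
  then show ?thesis by (intro exI[of _ 1]) auto
next
  case False
  have p: "1 < p" using assms prime_gt_1_nat by blast
  obtain g where g: "residue_primroot p g"
    using prime_primitive_root_exists[of p] assms p by auto
  then have g': "residue_primroot p (g mod p)" by simp
  have inj: "inj_on (\<lambda>i. (g mod p) ^ i mod p) {..<p - 1}"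
    using residue_primroot_is_generator[OF p g'] assms by (simp add: totient_prime bij_betw_def)
  have "(g mod p) ^ a mod p \<noteq> 1" if "1 \<le> a" "a < p - 1" for a
    using inj_onD[OF inj, of a 0] that p by auto
  moreover have "0 < g mod p"
  proof (rule ccontr)
    assume "\<not> 0 < g mod p"
    then have "g mod p = 0" by simp
    then show False using g' p by simp
  qed
  ultimately show ?thesis using p by (intro exI[of _ "g mod p"]) auto
qed

lemma prim_root_wp:
  assumes c: "ctx z S i s" and b: "i < m"
  shows "wp bd inp L prim_root (\<lambda>s'. \<exists>g. gen_tab (ps ! i) g s') s"
proof -
  define p where "p = ps ! i"
  have p: "0 < p" "p \<le> n" "2 \<le> p" "prime p" using ps_nth[OF b] by (simp_all add: p_def)
  define good where "good g \<longleftrightarrow> (\<forall>a. 1 \<le> a \<longrightarrow> a < p - 1 \<longrightarrow> g ^ a mod p \<noteq> 1)" for g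
  have p1: "int p - 1 = int (p - 1)" using p by simp
  show ?thesis unfolding prim_root_def wp_Sq
  proof (simp add: wp_simps(2) L_bounds, rule wp_For[where N = "p - 1" and Inv = "\<lambda>g0 s'. ivar s' 14 0 \<in> {0, 1} \<and>
      (ivar s' 14 0 = 1 \<longrightarrow> (\<exists>g. gen_tab p g s')) \<and> (ivar s' 14 0 = 0 \<longrightarrow> (\<forall>g\<in>{1..g0}. \<not> good g))"], goal_cases)
    case (5 g0 s1)
    note fr = same_outsideD[OF 5(2), simplified]
    show ?case
    proof (cases "ivar s1 14 0 = 0")
      case False
      then have one: "ivar s1 14 0 = 1" using 5(3) by simp
      then obtain g where "gen_tab p g s1" using 5(3) by auto
      then have "gen_tab p g (set_ivar 15 0 (int g0) s1)" by (simp add: gen_tab_def)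
      then show ?thesis using one L_bounds by (auto simp: wp_simps)
    next
      case True
      define g where "g = Suc g0"
      have g: "0 < g" "g < p" using 5(1) p by (simp_all add: g_def)
      let ?pow = "For 16 2 (sc 7 -! Num 1)
          (Iset 13 (sc 16 +! Num 1) (Iv 13 (sc 16) *! (sc 15 +! Num 1) mod! sc 7) ;;
           Ifc (An (eqi (Iv 13 (sc 16 +! Num 1)) (Num 1)) (lti (sc 16 +! Num 1) (sc 7 -! Num 1)))
             (iset 14 (Num 0)) Nop)"
      let ?s2 = "set_ivar 14 0 1 (set_ivar 13 0 1 (set_ivar 15 0 (int g0) s1))"
      have "wp bd inp L ?pow
          (\<lambda>s'. ivar s' 14 0 = (if good g then 1 else 0) \<and> (\<forall>a<p. ivar s' 13 (int a) = int (g ^ a mod p))) ?s2"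
      proof (rule wp_For[where N = "p - 1" and Inv = "\<lambda>a0 s'. ivar s' 14 0 = (if \<forall>a. 1 \<le> a \<longrightarrow> a \<le> a0 \<longrightarrow> a < p - 1 \<longrightarrow> g ^ a mod p \<noteq> 1 then 1 else 0) \<and>
          (\<forall>a\<le>a0. ivar s' 13 (int a) = int (g ^ a mod p))"], goal_cases)
        case 4
        have "1 mod p = 1" using p by simp
        then show ?case by auto
      next
        case (5 a s3)
        note fr3 = same_outsideD[OF 5(2), simplified]
        have nx: "int (g ^ a mod p) * (int g0 + 1) mod int p = int (g ^ Suc a mod p)"
        proof -
          have "int (g ^ a mod p) * (int g0 + 1) mod int p = int ((g ^ a mod p) * g mod p)"
            by (simp add: zmod_int g_def algebra_simps)
          also have "(g ^ a mod p) * g mod p = g ^ Suc a mod p" by (metis mod_mult_left_eq mult.commute power_Suc)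
          finally show ?thesis .
        qed
        have a1: "int a + 1 = int (Suc a)" by simp
        have pw: "ivar s3 13 (int a) = int (g ^ a mod p)" using 5(3) by simp
        have c0: "(\<forall>b. 1 \<le> b \<longrightarrow> b \<le> Suc a \<longrightarrow> b < p - 1 \<longrightarrow> g ^ b mod p \<noteq> 1) \<longleftrightarrow>
           (\<forall>b. 1 \<le> b \<longrightarrow> b \<le> a \<longrightarrow> b < p - 1 \<longrightarrow> g ^ b mod p \<noteq> 1) \<and> \<not> (g ^ Suc a mod p = 1 \<and> Suc a < p - 1)"
          by (auto simp: le_Suc_eq)
        have v: "ivar s3 15 0 = int g0" "ivar s3 7 0 = int p"
          using ctxD(7)[OF c] by (simp_all add: fr3 fr p_def)
        have lt: "Suc a < L" using 5(1) p L_bounds by linarith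
        have q1: "(int (g ^ Suc a mod p) \<le> 1 \<and> 1 \<le> int (g ^ Suc a mod p)) \<longleftrightarrow> g ^ Suc a mod p = 1" by linarith
        have q2: "\<not> int p - 1 \<le> int (Suc a) \<longleftrightarrow> Suc a < p - 1" using p by linarith
        show ?case unfolding c0
          using 5(3) L_bounds lt p
          by (simp add: wp_simps v a1 nx pw q1 q2 le_Suc_eq del: of_nat_Suc power_Suc One_nat_def)
      next
        case (6 s3)
        have "(\<forall>a. 1 \<le> a \<longrightarrow> a \<le> p - 1 \<longrightarrow> a < p - 1 \<longrightarrow> g ^ a mod p \<noteq> 1) \<longleftrightarrow> good g"
          by (auto simp: good_def)
        then show ?case using 6(2) by auto
      qed (use L_bounds ctxD[OF c] p in \<open>auto simp: fr p_def of_nat_diff\<close>)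
      then have "wp bd inp L ?pow
          (\<lambda>s'. ivar s' 14 0 \<in> {0, 1} \<and> (ivar s' 14 0 = 1 \<longrightarrow> (\<exists>g. gen_tab p g s')) \<and> (ivar s' 14 0 = 0 \<longrightarrow> (\<forall>g\<in>{1..Suc g0}. \<not> good g))) ?s2"
      proof (rule wp_conseq, goal_cases)
        case (1 s3)
        show ?case
        proof (cases "good g")
          case True
          then have "gen_tab p g s3" using 1(2) g by (simp add: gen_tab_def good_def)
          then show ?thesis using True 1(2) by auto
        next
          case False
          then have "\<forall>g\<in>{1..Suc g0}. \<not> good g"
            using 5(3) \<open>ivar s1 14 0 = 0\<close> by (auto simp: g_def le_Suc_eq)
          then show ?thesis using False 1(2) by simp
        qed
      qed
      then show ?thesis using True L_bounds by (simp add: wp_simps(1,2,5,6))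
    qed
  next
    case (6 s1)
    obtain g where g: "0 < g" "g < p" "good g" using ex_generator[OF p(4)] unfolding good_def by blast
    then have "g \<in> {1..p - 1}" by auto
    then have "ivar s1 14 0 = 1" using 6(2) g(3) by blast
    then obtain g' where "gen_tab p g' s1" using 6(2) by blast
    then have "gen_tab p g' (set_ivar 15 0 (int (p - 1)) s1)" by (simp add: gen_tab_def)
    then show ?case by (auto simp: p_def)
  qed (use L_bounds ctxD[OF c] p in \<open>auto simp: p_def of_nat_diff\<close>)
qed

end

lemma dft_cong: "(\<And>a. a < N \<Longrightarrow> x a = y a) \<Longrightarrow> dft N x f = dft N y f"
  by (simp add: dft_def)

context construction_step
begin

abbreviation Ne :: nat where "Ne \<equiv> 2 ^ e"

lemma Ne: "2 * n \<le> Ne" "Ne \<le> 4 * n" "Ne < L" "e \<le> lg" "0 < e" "0 < Ne"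
  using ge L_bounds by (auto simp: good_exp_def)

definition sg2 :: "nat \<Rightarrow> nat \<Rightarrow> nat \<Rightarrow> nat \<Rightarrow> int \<Rightarrow> real" where
  "sg2 p q x l w = sigma \<alpha> (real_of_int ((int x * int q + int l * w * int p) mod (int p * int q)) / real_of_int (int p * int q))"

definition xv :: "(nat \<Rightarrow> int) \<Rightarrow> nat \<Rightarrow> nat \<Rightarrow> nat \<Rightarrow> nat \<Rightarrow> nat \<Rightarrow> nat \<Rightarrow> real" where
  "xv z S p q g l a = 2 * Wf z S p q (g ^ a mod p) l / real q"

definition yv :: "nat \<Rightarrow> nat \<Rightarrow> nat \<Rightarrow> nat \<Rightarrow> int \<Rightarrow> nat \<Rightarrow> real" where
  "yv p q g l w c = sg2 p q (g ^ c mod p) l w"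

definition hx :: "(nat \<Rightarrow> int) \<Rightarrow> nat \<Rightarrow> nat \<Rightarrow> nat \<Rightarrow> nat \<Rightarrow> nat \<Rightarrow> nat \<Rightarrow> complex" where
  "hx z S p q g l = dft Ne (\<lambda>a. complex_of_real (if a < p - 1 then xv z S p q g l a else 0))"

definition hy :: "nat \<Rightarrow> nat \<Rightarrow> nat \<Rightarrow> nat \<Rightarrow> int \<Rightarrow> nat \<Rightarrow> complex" where
  "hy p q g l w = dft Ne (\<lambda>c. complex_of_real (if c < 2 * (p - 1) then yv p q g l w (c mod (p - 1)) else 0))"

definition step_ok :: "(nat \<Rightarrow> int) \<Rightarrow> nat \<Rightarrow> nat \<Rightarrow> nat \<Rightarrow> nat \<Rightarrow> nat \<Rightarrow> store \<Rightarrow> bool" where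
  "step_ok z S i g j l s \<longleftrightarrow> ctx z S i s \<and> gen_tab (ps ! i) g s \<and>
     ivar s 8 0 = int j \<and> ivar s 9 0 = int (ps ! j) \<and> ivar s 11 0 = int l"

lemma step_ok_frame:
  assumes "step_ok z S i g j l s" "same_outside X Y o' s s'" "\<not> o'" "X \<inter> {40, 2, 3, 4, 5, 6, 7, 8, 9, 11, 13} = {}" "Y \<inter> {3, 4, 5, 23} = {}"
  shows "step_ok z S i g j l s'"
proof -
  have X: "8 \<notin> X" "9 \<notin> X" "11 \<notin> X" "13 \<notin> X" using assms(4) by auto
  have "ctx z S i s'" using assms by (intro ctx_frame[of z S i s X Y o' s']) (auto simp: step_ok_def)
  then show ?thesis using assms(1) X same_outsideD[OF assms(2)]
    by (simp add: step_ok_def gen_tab_def)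
qed

lemma step_okD:
  assumes "step_ok z S i g j l s"
  shows "ctx z S i s" "gen_tab (ps ! i) g s" "ivar s 8 0 = int j" "ivar s 9 0 = int (ps ! j)" "ivar s 11 0 = int l"
    "ivar s 7 0 = int (ps ! i)" "ivar s 3 0 = int Ne" "ivar s 40 0 = int m"
    "a < ps ! i \<Longrightarrow> ivar s 13 (int a) = int (g ^ a mod ps ! i)"
  using assms ctxD[of z S i s] by (auto simp: step_ok_def gen_tab_def)

lemma fill_x_wp:
  assumes c: "step_ok z S i g j l s" and b: "i < m" "j < m" "l < ps ! j" and S: "2 \<le> S" "S \<le> d"
  shows "wp bd inp L (fill_x tab) (\<lambda>s'. \<forall>a<Ne. rvar s' 11 (int a) = (if a < ps ! i - 1 then xv z S (ps ! i) (ps ! j) g l a else 0) \<and>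
    rvar s' 12 (int a) = 0) s"
proof -
  define p where "p = ps ! i"
  have p: "0 < p" "p \<le> n" "2 \<le> p" using ps_nth[OF b(1)] by (simp_all add: p_def)
  have p1: "int p - 1 = int (p - 1)" using p by simp
  have clear: "wp bd inp L (For 17 2 (Iv 3 (Num 0)) (Rset 11 (Iv 17 (Num 0)) (rnum 0) ;; Rset 12 (Iv 17 (Num 0)) (rnum 0)))
      (\<lambda>s'. \<forall>a<Ne. rvar s' 11 (int a) = 0 \<and> rvar s' 12 (int a) = 0) s"
  proof (rule wp_For[where N = Ne and Inv = "\<lambda>f s'. \<forall>a<f. rvar s' 11 (int a) = 0 \<and> rvar s' 12 (int a) = 0"], goal_cases)
    case (5 f s1)
    then show ?case using L_bounds Ne by (auto simp: wp_simps less_Suc_eq)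
  qed (use step_okD[OF c] Ne L_bounds in auto)
  show ?thesis unfolding fill_x_def wp_Sq
  proof (rule wp_conseq[OF clear], goal_cases)
    case (1 s1)
    note fr1 = same_outsideD[OF 1(1), simplified]
    have c1: "step_ok z S i g j l s1" by (rule step_ok_frame[OF c 1(1)]) auto
    have pN: "p - 1 < Ne" using p Ne by linarith
    show ?case
    proof (rule wp_For[where N = "p - 1" and Inv = "\<lambda>a0 s'. \<forall>a<Ne. rvar s' 11 (int a) = (if a < a0 then xv z S (ps ! i) (ps ! j) g l a else 0) \<and>
        rvar s' 12 (int a) = 0"], goal_cases)
      case (5 a s2)
      note fr2 = same_outsideD[OF 5(2), simplified]
      let ?s3 = "set_ivar 10 0 (int (g ^ a mod p)) (set_ivar 16 0 (int a) s2)"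
      have c3: "step_ok z S i g j l ?s3"
        by (rule step_ok_frame[OF c1, of "{16, 10, 12}" "{11, 10}" False]) (auto simp: same_outside_def fr2)
      have pw: "ivar s2 13 (int a) = int (g ^ a mod p)" using step_okD(9)[OF c1, of a] 5(1) by (simp add: fr2 p_def)
      have qq: "ivar s2 9 0 = int (ps ! j)" using step_okD(4)[OF c1] by (simp add: fr2)
      have "wp bd inp L (getw tab) (\<lambda>s'. rvar s' 10 0 = Wf z S (ps ! i) (ps ! j) (g ^ a mod p) l) ?s3"
        by (rule getw_wp[OF step_okD(1)[OF c3]]) (use step_okD[OF c3] b S p in \<open>simp_all add: p_def\<close>)
      then have "wp bd inp L (getw tab) (wp bd inp L (Rset 11 (Iv 16 (Num 0)) (rnum 2 *. Rv 10 (Num 0) /. Cast (Iv 9 (Num 0))))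
         (\<lambda>s'. \<forall>b<Ne. rvar s' 11 (int b) = (if b < Suc a then xv z S (ps ! i) (ps ! j) g l b else 0) \<and> rvar s' 12 (int b) = 0)) ?s3"
      proof (rule wp_conseq, goal_cases)
        case (1 s4)
        note fr4 = same_outsideD[OF 1(1), simplified]
        have "a < L" using 5(1) p L_bounds by linarith
        then show ?case using 5(1,3) 1(2) L_bounds p ps_nth[OF b(2)]
          by (auto simp: wp_simps fr4 qq xv_def p_def less_Suc_eq)
      qed
      then show ?case unfolding wp_Sq using L_bounds 5(1) p by (simp add: wp_simps(2) pw)
    qed (use L_bounds step_okD[OF c1] 1(2) p p1 in \<open>auto simp: p_def\<close>)
  qed
qed

lemma fill_y_wp:
  assumes c: "step_ok z S i g j l s" and w: "ivar s 27 0 = w" and b: "i < m" "j < m"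
  shows "wp bd inp L fill_y (\<lambda>s'. \<forall>a<Ne. rvar s' 11 (int a) = (if a < 2 * (ps ! i - 1) then yv (ps ! i) (ps ! j) g l w (a mod (ps ! i - 1)) else 0) \<and>
    rvar s' 12 (int a) = 0) s"
proof -
  define p where "p = ps ! i"
  define q where "q = ps ! j"
  have p: "0 < p" "p \<le> n" "2 \<le> p" "0 < q" using ps_nth[OF b(1)] ps_nth[OF b(2)] by (simp_all add: p_def q_def)
  have p1: "int p - 1 = int (p - 1)" "0 < p - 1" using p by simp_all
  have pq: "0 < int p * int q" using p by simp
  show ?thesis unfolding fill_y_def
  proof (rule wp_For[where N = Ne and Inv = "\<lambda>a0 s'. \<forall>a<a0. rvar s' 11 (int a) = (if a < 2 * (ps ! i - 1) then yv (ps ! i) (ps ! j) g l w (a mod (ps ! i - 1)) else 0) \<and>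
    rvar s' 12 (int a) = 0"], goal_cases)
    case (5 f s1)
    note fr = same_outsideD[OF 5(2), simplified]
    define r where "r = p - 1"
    have r: "p - Suc 0 = r" "int p - 1 = int r" "0 < r" "r < p" using p by (simp_all add: r_def)
    have md: "int f mod int r = int (f mod r)" by (simp add: zmod_int)
    have ml: "f mod r < r" using r by simp
    have f: "f < L" using 5(1) Ne by linarith
    have pw: "ivar s1 13 (int (f mod r)) = int (g ^ (f mod r) mod p)"
      using step_okD(9)[OF c, of "f mod r"] less_trans[OF ml r(4)] by (simp add: fr p_def)
    have v: "ivar s1 7 0 = int p" "ivar s1 9 0 = int q" "ivar s1 11 0 = int l" "ivar s1 27 0 = w"
      using step_okD[OF c] w by (simp_all add: fr p_def q_def)
    have lt: "2 * int r \<le> int f \<longleftrightarrow> \<not> f < 2 * r" by linarith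
    have ml2: "f mod r < L" using ml r p L_bounds by linarith
    show ?case
      unfolding wp_simps
      using 5(1,3) L_bounds f r ml2 pq frac_mod[OF pq] p
      by (simp add: v md pw lt yv_def sg2_def p_def[symmetric] q_def[symmetric] less_Suc_eq)
  qed (use step_okD[OF c] Ne L_bounds in auto)
qed

lemma conv_one_wp:
  assumes c: "step_ok z S i g j l s" and w: "ivar s 27 0 = w" and b: "i < m" "j < m" "l < ps ! j" and S: "2 \<le> S" "S \<le> d"
  shows "wp bd inp L (conv_one tab) (\<lambda>s'.
    (\<forall>f<Ne. Complex (rvar s' 17 (int f)) (rvar s' 18 (int f)) = Complex (rvar s 17 (int f)) (rvar s 18 (int f)) +
       cnj (hx z S (ps ! i) (ps ! j) g l f) * hy (ps ! i) (ps ! j) g l w f) \<and>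
    rvar s' 19 0 = rvar s 19 0 + (\<Sum>a<ps ! i - 1. xv z S (ps ! i) (ps ! j) g l a) * sg2 (ps ! i) (ps ! j) 0 l w) s"
proof -
  define p where "p = ps ! i"
  define q where "q = ps ! j"
  have p: "0 < p" "p \<le> n" "2 \<le> p" "0 < q" using ps_nth[OF b(1)] ps_nth[OF b(2)] by (simp_all add: p_def q_def)
  have pq: "0 < int p * int q" using p by simp
  note fft = fft_wp[where N = Ne and e = e and B = bd and I = inp and L = L, OF refl]
  define H where "H = hx z S p q g l"
  show ?thesis unfolding conv_one_def wp_Sq
  proof (rule wp_conseq[OF fill_x_wp[OF c b S]], goal_cases)
    case (1 s1)
    note fr1 = same_outsideD[OF 1(1), simplified]
    have c1: "step_ok z S i g j l s1" by (rule step_ok_frame[OF c 1(1)]) auto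
    note x1 = 1(2)
    show ?case
    proof (rule wp_conseq[OF fft], goal_cases)
      case 4 then show ?case using ctxD(3)[OF step_okD(1)[OF c1]] .
    next
      case (6 s2)
      note fr2 = same_outsideD[OF 6(1), simplified]
      have c2: "step_ok z S i g j l s2" by (rule step_ok_frame[OF c1 6(1)]) auto
      have h2: "Complex (rvar s2 11 (int f)) (rvar s2 12 (int f)) = H f" if "f < Ne" for f
      proof -
        have "Complex (rvar s2 11 (int f)) (rvar s2 12 (int f)) = dft Ne (\<lambda>a. Complex (rvar s1 11 (int a)) (rvar s1 12 (int a))) f"
          using 6(2) that by blast
        also have "\<dots> = H f" unfolding H_def hx_def
          by (rule dft_cong) (use x1 in \<open>auto simp: complex_eq_iff p_def q_def\<close>)
        finally show ?thesis .
      qed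
      have H0: "Re (H 0) = (\<Sum>a<p - 1. xv z S p q g l a)"
      proof -
        have "H 0 = (\<Sum>a<Ne. complex_of_real (if a < p - 1 then xv z S p q g l a else 0))"
          by (simp add: H_def hx_def dft_def)
        also have "\<dots> = complex_of_real (\<Sum>a<Ne. if a < p - 1 then xv z S p q g l a else 0)" by simp
        also have "(\<Sum>a<Ne. if a < p - 1 then xv z S p q g l a else 0) = (\<Sum>a<p - 1. xv z S p q g l a)"
          by (rule sum.mono_neutral_cong_right) (use p Ne in auto)
        finally show ?thesis by simp
      qed
      have cp: "wp bd inp L (For 17 2 (Iv 3 (Num 0)) (Rset 15 (Iv 17 (Num 0)) (Rv 11 (Iv 17 (Num 0))) ;; Rset 16 (Iv 17 (Num 0)) (Rv 12 (Iv 17 (Num 0)))))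
          (\<lambda>s'. \<forall>f<Ne. Complex (rvar s' 15 (int f)) (rvar s' 16 (int f)) = H f) s2"
      proof (rule wp_For[where N = Ne and Inv = "\<lambda>k s'. \<forall>f<k. Complex (rvar s' 15 (int f)) (rvar s' 16 (int f)) = H f"], goal_cases)
        case (5 f s3)
        note fr3 = same_outsideD[OF 5(2), simplified]
        show ?case using 5(1,3) L_bounds Ne h2[OF 5(1)] by (simp add: wp_simps less_Suc_eq fr3)
      qed (use step_okD[OF c2] Ne L_bounds in auto)
      show ?case
      proof (rule wp_conseq[OF cp], goal_cases)
        case (1 s3)
        note fr3 = same_outsideD[OF 1(1), simplified]
        have c3: "step_ok z S i g j l s3" by (rule step_ok_frame[OF c2 1(1)]) auto
        note h3 = 1(2)
        have h30: "rvar s3 15 0 = (\<Sum>a<p - 1. xv z S p q g l a)"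
          using h3[rule_format, of 0] Ne H0 by (simp add: complex_eq_iff)
        let ?s4 = "set_rvar 19 0 (rvar s 19 0 + (\<Sum>a<p - 1. xv z S p q g l a) * sg2 p q 0 l w) s3"
        have c4: "step_ok z S i g j l ?s4"
          by (rule step_ok_frame[OF c3, of "{}" "{19}" False]) (auto simp: same_outside_def)
        have w4: "ivar ?s4 27 0 = w" using w by (simp add: fr1 fr2 fr3)
        have "wp bd inp L fill_y (wp bd inp L fft (wp bd inp L (For 17 2 (Iv 3 (Num 0))
            (Rset 17 (Iv 17 (Num 0)) (Rv 17 (Iv 17 (Num 0)) +. (Rv 15 (Iv 17 (Num 0)) *. Rv 11 (Iv 17 (Num 0)) +. Rv 16 (Iv 17 (Num 0)) *. Rv 12 (Iv 17 (Num 0)))) ;;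
             Rset 18 (Iv 17 (Num 0)) (Rv 18 (Iv 17 (Num 0)) +. (Rv 15 (Iv 17 (Num 0)) *. Rv 12 (Iv 17 (Num 0)) -. Rv 16 (Iv 17 (Num 0)) *. Rv 11 (Iv 17 (Num 0))))))
            (\<lambda>s'. (\<forall>f<Ne. Complex (rvar s' 17 (int f)) (rvar s' 18 (int f)) = Complex (rvar s 17 (int f)) (rvar s 18 (int f)) +
                cnj (H f) * hy p q g l w f) \<and> rvar s' 19 0 = rvar s 19 0 + (\<Sum>a<p - 1. xv z S p q g l a) * sg2 p q 0 l w))) ?s4"
        proof (rule wp_conseq[OF fill_y_wp[OF c4 w4 b(1,2)]], goal_cases)
          case (1 s5)
          note fr5 = same_outsideD[OF 1(1), simplified]
          have c5: "step_ok z S i g j l s5" by (rule step_ok_frame[OF c4 1(1)]) auto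
          note y5 = 1(2)
          show ?case
          proof (rule wp_conseq[OF fft], goal_cases)
            case 4 then show ?case using ctxD(3)[OF step_okD(1)[OF c5]] .
          next
            case (6 s6)
            note fr6 = same_outsideD[OF 6(1), simplified]
            have c6: "step_ok z S i g j l s6" by (rule step_ok_frame[OF c5 6(1)]) auto
            define HY where "HY = hy p q g l w"
            have h6: "Complex (rvar s6 11 (int f)) (rvar s6 12 (int f)) = HY f" if "f < Ne" for f
            proof -
              have "Complex (rvar s6 11 (int f)) (rvar s6 12 (int f)) = dft Ne (\<lambda>a. Complex (rvar s5 11 (int a)) (rvar s5 12 (int a))) f"
                using 6(2) that by blast
              also have "\<dots> = HY f" unfolding HY_def hy_def
                by (rule dft_cong) (use y5 in \<open>auto simp: complex_eq_iff p_def q_def\<close>)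
              finally show ?thesis .
            qed
            have hr: "rvar s6 11 (int f) = Re (HY f)" "rvar s6 12 (int f) = Im (HY f)"
               "rvar s6 15 (int f) = Re (H f)" "rvar s6 16 (int f) = Im (H f)" if "f < Ne" for f
              using h6[OF that] h3[rule_format, OF that] by (simp_all add: complex_eq_iff fr5 fr6)
            show ?case unfolding HY_def[symmetric]
            proof (rule wp_For[where N = Ne and Inv = "\<lambda>k s'. (\<forall>f<k. Complex (rvar s' 17 (int f)) (rvar s' 18 (int f)) = Complex (rvar s 17 (int f)) (rvar s 18 (int f)) +
                cnj (H f) * HY f) \<and> (\<forall>f\<ge>k. rvar s' 17 (int f) = rvar s 17 (int f) \<and> rvar s' 18 (int f) = rvar s 18 (int f))"], goal_cases)
              case 4
              then show ?case by (simp add: fr1 fr2 fr3 fr5 fr6)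
            next
              case (5 f s7)
              note fr7 = same_outsideD[OF 5(2), simplified]
              show ?case using 5(1,3) L_bounds Ne hr[OF 5(1)]
                by (simp add: wp_simps less_Suc_eq fr7 complex_eq_iff)
            next
              case (6 s7)
              note fr7 = same_outsideD[OF 6(1), simplified]
              then show ?case using 6(2) by (simp add: fr7 fr5 fr6)
            qed (use step_okD[OF c6] Ne L_bounds in auto)
          qed (use Ne in auto)
        qed
        moreover have v3: "ivar s3 7 0 = int p" "ivar s3 9 0 = int q" "ivar s3 11 0 = int l" "ivar s3 27 0 = w" "rvar s3 19 0 = rvar s 19 0"
          using step_okD[OF c3] w by (simp_all add: fr1 fr2 fr3 p_def q_def)
        ultimately show ?case using L_bounds p frac_mod[of "int q"]
          by (simp add: wp_simps(3) h30 sg2_def p_def[symmetric] q_def[symmetric] H_def)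
      qed
    qed (use Ne in auto)
  qed
qed

definition conv_sum :: "(nat \<Rightarrow> int) \<Rightarrow> nat \<Rightarrow> nat \<Rightarrow> nat \<Rightarrow> (nat \<Rightarrow> int) \<Rightarrow> nat \<Rightarrow> complex" where
  "conv_sum z S i g w f = (\<Sum>j<i. \<Sum>l<ps ! j. cnj (hx z S (ps ! i) (ps ! j) g l f) * hy (ps ! i) (ps ! j) g l (w j) f)"

definition zero_sum :: "(nat \<Rightarrow> int) \<Rightarrow> nat \<Rightarrow> nat \<Rightarrow> nat \<Rightarrow> (nat \<Rightarrow> int) \<Rightarrow> real" where
  "zero_sum z S i g w = (\<Sum>j<i. \<Sum>l<ps ! j. (\<Sum>a<ps ! i - 1. xv z S (ps ! i) (ps ! j) g l a) * sg2 (ps ! i) (ps ! j) 0 l (w j))"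

lemma conv_wp:
  assumes c: "ctx z S i s" and g: "gen_tab (ps ! i) g s" and i: "i < m" and S: "2 \<le> S" "S \<le> d"
    and w: "\<And>j. j < i \<Longrightarrow> (S - 1) * m + j < length (outs s) \<and> outs s ! ((S - 1) * m + j) = w j"
  shows "wp bd inp L (conv tab) (\<lambda>s'. (\<forall>f<Ne. Complex (rvar s' 17 (int f)) (rvar s' 18 (int f)) = conv_sum z S i g w f) \<and>
      rvar s' 19 0 = zero_sum z S i g w) s"
proof -
  have clear: "wp bd inp L (For 17 2 (Iv 3 (Num 0)) (Rset 17 (Iv 17 (Num 0)) (rnum 0) ;; Rset 18 (Iv 17 (Num 0)) (rnum 0)))
      (\<lambda>s'. \<forall>a<Ne. rvar s' 17 (int a) = 0 \<and> rvar s' 18 (int a) = 0) s"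
  proof (rule wp_For[where N = Ne and Inv = "\<lambda>f s'. \<forall>a<f. rvar s' 17 (int a) = 0 \<and> rvar s' 18 (int a) = 0"], goal_cases)
    case (5 f s1)
    then show ?case using L_bounds Ne by (auto simp: wp_simps less_Suc_eq)
  qed (use ctxD[OF c] Ne L_bounds in auto)
  let ?pairs = "For 8 1 (Iv 6 (Num 0))
       (iset 9 (Iv 2 (sc 8)) ;; iset 27 (Res ((sc 5 +! Num 1) *! sc 40 +! sc 8)) ;;
        For 11 2 (sc 9) (conv_one tab))"
  \<comment> \<open>Partial sums after \<open>j0\<close> complete primes and \<open>l0\<close>
    further values of \<open>l\<close>; \<open>Z\<close> is the analogue for the residue 0. Both
    nested loops can then share the invariant \<open>P\<close>.\<close>
  define F where "F j0 l0 f = (\<Sum>j<j0. \<Sum>l<ps ! j. cnj (hx z S (ps ! i) (ps ! j) g l f) * hy (ps ! i) (ps ! j) g l (w j) f)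
     + (\<Sum>l<l0. cnj (hx z S (ps ! i) (ps ! j0) g l f) * hy (ps ! i) (ps ! j0) g l (w j0) f)" for j0 l0 f
  define Z where "Z j0 l0 = (\<Sum>j<j0. \<Sum>l<ps ! j. (\<Sum>a<ps ! i - 1. xv z S (ps ! i) (ps ! j) g l a) * sg2 (ps ! i) (ps ! j) 0 l (w j))
     + (\<Sum>l<l0. (\<Sum>a<ps ! i - 1. xv z S (ps ! i) (ps ! j0) g l a) * sg2 (ps ! i) (ps ! j0) 0 l (w j0))" for j0 l0
  define P where "P j0 l0 s' \<longleftrightarrow> (\<forall>f<Ne. Complex (rvar s' 17 (int f)) (rvar s' 18 (int f)) = F j0 l0 f) \<and> rvar s' 19 0 = Z j0 l0" for j0 l0 and s' :: store
  have P_upd: "P j0 l0 (set_ivar x a y s') \<longleftrightarrow> P j0 l0 s'" for j0 l0 x a y and s' :: store by (simp add: P_def)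
  show ?thesis unfolding conv_def wp_Sq
  proof (rule wp_conseq[OF clear], goal_cases)
    case (1 s1)
    note fr1 = same_outsideD[OF 1(1), simplified]
    have P0: "P 0 0 (set_rvar 19 0 0 s1)" using 1(2) by (simp add: P_def F_def Z_def complex_eq_iff)
    have c1: "ctx z S i (set_rvar 19 0 0 s1)" by (rule ctx_frame[OF c, of "{17}" "{17, 18, 19}" False]) (auto simp: same_outside_def fr1)
    have "wp bd inp L ?pairs (\<lambda>s'. P i 0 s') (set_rvar 19 0 0 s1)"
    proof (rule wp_For[where N = i and Inv = "\<lambda>j s'. P j 0 s'"], goal_cases)
      case (5 j s2)
      note fr2 = same_outsideD[OF 5(2), simplified]
      have jm: "j < m" using 5(1) i by simp
      define q where "q = ps ! j"
      have q: "0 < q" "q \<le> n" using ps_nth[OF jm] by (simp_all add: q_def)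
      let ?s3 = "set_ivar 27 0 (w j) (set_ivar 9 0 (int q) (set_ivar 8 0 (int j) s2))"
      have loop: "wp bd inp L (For 11 2 (sc 9) (conv_one tab)) (\<lambda>s'. P (Suc j) 0 s') ?s3"
      proof (rule wp_For[where N = q and Inv = "\<lambda>l s'. P j l s'"], goal_cases)
        case 4
        show ?case using 5(3) by (simp add: P_upd)
      next
        case (5 l s4)
        note fr4 = same_outsideD[OF 5(2), simplified]
        let ?s5 = "set_ivar 11 0 (int l) s4"
        have "ctx z S i ?s5"
          by (rule ctx_frame[OF c, of "{17, 27, 9, 8, 11, 16, 10, 12, 25, 28, 24, 22, 23}" "{17, 18, 19, 11, 12, 10, 41, 2, 13, 14, 15, 16}" False])
            (auto simp: same_outside_def fr4 fr2 fr1)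
        then have c5: "step_ok z S i g j l ?s5"
          using g by (simp add: step_ok_def gen_tab_def fr4 fr2 fr1 q_def)
        have w5: "ivar ?s5 27 0 = w j" by (simp add: fr4)
        show ?case
        proof (rule wp_conseq[OF conv_one_wp[OF c5 w5 i jm _ S]], goal_cases)
          case 1 then show ?case using 5(1) by (simp add: q_def)
        next
          case (2 s6)
          then show ?case using 5(3) by (simp add: P_def F_def Z_def)
        qed
      next
        case (6 s4)
        then show ?case by (simp add: P_def F_def Z_def q_def)
      qed (use L_bounds q in auto)
      have idx: "(int (S - 2) + 1) * int m + int j = int ((S - 1) * m + j)"
      proof -
        have "S - 1 = S - 2 + 1" using S by simp
        then show ?thesis by (simp only: of_nat_add of_nat_mult of_nat_1)
      qed
      have v: "ivar s2 2 (int j) = int q" "ivar s2 5 0 = int (S - 2)" "ivar s2 40 0 = int m"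
        using ctxD[OF c1] ctxD(2)[OF c1 jm] by (simp_all add: fr2 q_def)
      have o: "outs s2 = outs s" by (simp add: fr2 fr1)
      have oj: "outs s ! ((S - 1) * m + j) = w j" "int ((S - 1) * m + j) < int (length (outs s))"
        using w[OF 5(1)] by (auto simp only: of_nat_less_iff)
      show ?case unfolding wp_Sq using loop L_bounds jm oj
        by (simp add: wp_simps(2) v o idx del: of_nat_add of_nat_mult)
    next
      case (6 s2)
      then show ?case by (simp add: P_upd)
    qed (use L_bounds i ctxD[OF c1] P0 in \<open>auto simp: P_upd\<close>)
    then have "wp bd inp L ?pairs (\<lambda>s'. (\<forall>f<Ne. Complex (rvar s' 17 (int f)) (rvar s' 18 (int f)) = conv_sum z S i g w f) \<and>
      rvar s' 19 0 = zero_sum z S i g w) (set_rvar 19 0 0 s1)"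
      by (rule wp_conseq) (simp add: P_def F_def Z_def conv_sum_def zero_sum_def)
    then show ?case using L_bounds by (simp add: wp_simps(3))
  qed
qed

end

text \<open>Ties in \<open>f\<close> are broken by the index, so that the ranks are a permutation of \<open>{..<p}\<close>.\<close>

definition rank_of :: "(nat \<Rightarrow> real) \<Rightarrow> nat \<Rightarrow> nat \<Rightarrow> nat" where
  "rank_of f p v = card {u. u < p \<and> (f u < f v \<or> f u = f v \<and> u < v)}"

lemma rank_of_less:
  assumes "u < p" "f u < f v \<or> f u = f v \<and> u < v"
  shows "rank_of f p u < rank_of f p v"
  unfolding rank_of_def by (rule psubset_card_mono) (use assms in auto)

text \<open>The order with tie-breaking is total, so ranks are distinct; an injection of
  \<open>{..<p}\<close> into itself is onto.\<close>

lemma bij_betw_rank_of: "bij_betw (rank_of f p) {..<p} {..<p}"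
proof -
  have inj: "inj_on (rank_of f p) {..<p}"
  proof (rule inj_onI)
    fix u v assume u: "u \<in> {..<p}" "v \<in> {..<p}" "rank_of f p u = rank_of f p v"
    show "u = v"
      using rank_of_less[of u p f v] rank_of_less[of v p f u] u by (cases "f u" "f v" rule: linorder_cases; cases u v rule: linorder_cases) auto
  qed
  have "rank_of f p v < p" if "v < p" for v
  proof -
    have "{u. u < p \<and> (f u < f v \<or> f u = f v \<and> u < v)} \<subset> {..<p}" using that by auto
    then have "rank_of f p v < card {..<p}" unfolding rank_of_def by (intro psubset_card_mono) auto
    then show ?thesis by simp
  qed
  then have "rank_of f p ` {..<p} = {..<p}" using inj by (intro endo_inj_surj) auto
  then show ?thesis using inj by (simp add: bij_betw_def)
qed

text \<open>The ranks run exactly through \<open>{..<p}\<close>, and the naturals below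
  \<open>t * p\<close> are those below its ceiling. Comparing ranks with \<open>t * p\<close> thus
  selects the prescribed number without computing it.\<close>

lemma card_rank_of_less:
  assumes "0 < t" "t < 1"
  shows "int (card {v. v < p \<and> real (rank_of f p v) < t * real p}) = \<lceil>t * real p\<rceil>"
proof -
  define c where "c = nat \<lceil>t * real p\<rceil>"
  have "0 \<le> t * real p" using assms by simp
  then have c: "\<lceil>t * real p\<rceil> = int c" unfolding c_def by linarith
  have "t * real p \<le> real p" using assms by (simp add: mult_left_le_one_le)
  then have cp: "c \<le> p" using c by linarith
  have lt: "real r < t * real p \<longleftrightarrow> r < c" for r
    using c by (metis ceiling_le_iff linorder_not_less of_int_of_nat_eq of_nat_le_iff)
  have "rank_of f p ` {v. v < p \<and> real (rank_of f p v) < t * real p} = {..<c}"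
  proof
    show "{..<c} \<subseteq> rank_of f p ` {v. v < p \<and> real (rank_of f p v) < t * real p}"
    proof
      fix r assume r: "r \<in> {..<c}"
      then have "r \<in> rank_of f p ` {..<p}" using bij_betw_rank_of[of f p] cp by (simp add: bij_betw_def)
      then obtain v where "v < p" "rank_of f p v = r" by auto
      then show "r \<in> rank_of f p ` {v. v < p \<and> real (rank_of f p v) < t * real p}" using r by (auto simp: lt)
    qed
  qed (auto simp: lt)
  moreover have "inj_on (rank_of f p) {v. v < p \<and> real (rank_of f p v) < t * real p}"
    using bij_betw_rank_of[of f p] by (auto simp: bij_betw_def intro: inj_on_subset)
  ultimately have "card {v. v < p \<and> real (rank_of f p v) < t * real p} = card {..<c}"
    using card_image[of "rank_of f p" "{v. v < p \<and> real (rank_of f p v) < t * real p}"] by simp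
  then show ?thesis using c by simp
qed

context construction_step
begin

text \<open>Two equal powers would give a smaller positive exponent with power 1; injectivity and
  the count \<open>p - 1\<close> yield surjectivity. The reduction of exponents is Fermat's
  theorem.\<close>

lemma gen_tab_bij:
  assumes "gen_tab p g s" "prime p"
  shows "bij_betw (\<lambda>a. g ^ a mod p) {..<p - 1} {1..<p}" "g ^ (a mod (p - 1)) mod p = g ^ a mod p"
proof -
  have g: "0 < g" "g < p" "\<And>a. 1 \<le> a \<Longrightarrow> a < p - 1 \<Longrightarrow> g ^ a mod p \<noteq> 1" using assms(1) by (auto simp: gen_tab_def)
  have p: "1 < p" using assms(2) prime_gt_1_nat by blast
  have nd: "\<not> p dvd g" using g by (auto dest: dvd_imp_le)
  have cop: "coprime (g ^ a) p" for a
    using prime_imp_coprime[OF assms(2) nd] by (simp add: coprime_commute)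
  have lt: "\<not> [g ^ a = g ^ b] (mod p)" if "a < b" "b < p - 1" for a b
  proof
    assume "[g ^ a = g ^ b] (mod p)"
    then have "[g ^ a * 1 = g ^ a * g ^ (b - a)] (mod p)" using that by (simp flip: power_add)
    then have "[1 = g ^ (b - a)] (mod p)" using cop cong_mult_lcancel_nat by blast
    then have "g ^ (b - a) mod p = 1" using p by (simp add: cong_def)
    moreover have "1 \<le> b - a" "b - a < p - 1" using that by linarith+
    ultimately show False using g(3) by blast
  qed
  have inj: "inj_on (\<lambda>a. g ^ a mod p) {..<p - 1}"
  proof (rule inj_onI)
    fix a b assume ab: "a \<in> {..<p - 1}" "b \<in> {..<p - 1}" "g ^ a mod p = g ^ b mod p"
    then show "a = b" using lt[of a b] lt[of b a] by (cases a b rule: linorder_cases) (auto simp: cong_def)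
  qed
  have "0 < g ^ a mod p" for a
    using prime_dvd_power[OF assms(2), of g a] nd by (auto simp: dvd_eq_mod_eq_0)
  then have "(\<lambda>a. g ^ a mod p) ` {..<p - 1} \<subseteq> {1..<p}" using p by (auto simp: Suc_leI)
  then have "(\<lambda>a. g ^ a mod p) ` {..<p - 1} = {1..<p}"
    using inj by (intro card_subset_eq) (auto simp: card_image)
  then show "bij_betw (\<lambda>a. g ^ a mod p) {..<p - 1} {1..<p}" using inj by (simp add: bij_betw_def)
  have "[g ^ (p - 1) = 1] (mod p)" using fermat_theorem[OF assms(2) nd] .
  then have "[(g ^ (p - 1)) ^ (a div (p - 1)) * g ^ (a mod (p - 1)) = 1 ^ (a div (p - 1)) * g ^ (a mod (p - 1))] (mod p)"
    by (intro cong_mult cong_pow) auto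
  then have "[g ^ a = g ^ (a mod (p - 1))] (mod p)"
    by (simp flip: power_mult power_add)
  then show "g ^ (a mod (p - 1)) mod p = g ^ a mod p" by (simp add: cong_def)
qed

lemma sg2_cong:
  assumes "x mod p = y mod p"
  shows "sg2 p q x l w = sg2 p q y l w"
proof -
  have "int p dvd int x - int y" using assms by (metis mod_eq_dvd_iff of_nat_mod)
  then have "int p * int q dvd (int x - int y) * int q" by (rule mult_dvd_mono) simp
  then have "(int x * int q + int l * w * int p) mod (int p * int q) = (int y * int q + int l * w * int p) mod (int p * int q)"
    unfolding mod_eq_dvd_iff by (simp add: algebra_simps)
  then show ?thesis by (simp add: sg2_def)
qed

definition corr :: "(nat \<Rightarrow> int) \<Rightarrow> nat \<Rightarrow> nat \<Rightarrow> (nat \<Rightarrow> int) \<Rightarrow> nat \<Rightarrow> real" where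
  "corr z S i w v = (\<Sum>j<i. \<Sum>l<ps ! j. \<Sum>k\<in>{1..<ps ! i}.
     2 * Wf z S (ps ! i) (ps ! j) k l / real (ps ! j) * sg2 (ps ! i) (ps ! j) (k * v) l (w j))"

lemma zero_sum_eq:
  assumes "gen_tab (ps ! i) g s" "i < m"
  shows "zero_sum z S i g w = corr z S i w 0"
proof -
  note bij = gen_tab_bij(1)[OF assms(1) ps_nth(2)[OF assms(2)]]
  have "(\<Sum>a<ps ! i - 1. xv z S (ps ! i) (ps ! j) g l a) * sg2 (ps ! i) (ps ! j) 0 l (w j) =
      (\<Sum>k\<in>{1..<ps ! i}. 2 * Wf z S (ps ! i) (ps ! j) k l / real (ps ! j) * sg2 (ps ! i) (ps ! j) (k * 0) l (w j))" for j l
    unfolding sum_distrib_right sum.reindex_bij_betw[OF bij, symmetric] by (simp add: xv_def)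
  then show ?thesis by (simp add: zero_sum_def corr_def)
qed

text \<open>Multiplying residues adds exponents, so the sum over \<open>k\<close> at
  \<open>v = g ^ b\<close> is a cyclic correlation at shift \<open>b\<close>. By linearity the
  inversion can wait until all \<open>q\<close> and \<open>l\<close> have been added up.\<close>

lemma conv_read:
  assumes "gen_tab (ps ! i) g s" "i < m" "b < ps ! i - 1"
  shows "(\<Sum>f<Ne. Re (conv_sum z S i g w f * cnj (expi (real (f * b) / real Ne)))) / real Ne = corr z S i w (g ^ b mod ps ! i)"
proof -
  define p where "p = ps ! i"
  note bij = gen_tab_bij[OF assms(1) ps_nth(2)[OF assms(2)], folded p_def]
  have b: "b < p - 1" "0 < p - 1" "2 * (p - 1) \<le> Ne"
    using assms(3) Ne(1) ps_nth(3)[OF assms(2)] by (auto simp: p_def)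
  have one: "(\<Sum>f<Ne. cnj (hx z S p q g l f) * hy p q g l w' f * cnj (expi (real (f * b) / real Ne))) =
      of_nat Ne * complex_of_real (\<Sum>k\<in>{1..<p}. 2 * Wf z S p q k l / real q * sg2 p q (k * (g ^ b mod p)) l w')" for q l w'
  proof -
    have "xv z S p q g l a * yv p q g l w' ((a + b) mod (p - 1)) =
        2 * Wf z S p q (g ^ a mod p) l / real q * sg2 p q (g ^ a mod p * (g ^ b mod p)) l w'" for a
    proof -
      have "sg2 p q (g ^ (a + b) mod p) l w' = sg2 p q (g ^ a mod p * (g ^ b mod p)) l w'"
        by (rule sg2_cong) (simp add: power_add mod_mult_eq)
      then show ?thesis unfolding xv_def yv_def bij(2) by simp
    qed
    then show ?thesis unfolding hx_def hy_def correlation_dft[OF b(2,3,1)] sum.reindex_bij_betw[OF bij(1), symmetric] by simp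
  qed
  have "(\<Sum>f<Ne. conv_sum z S i g w f * cnj (expi (real (f * b) / real Ne))) =
     (\<Sum>j<i. \<Sum>l<ps ! j. \<Sum>f<Ne. cnj (hx z S p (ps ! j) g l f) * hy p (ps ! j) g l (w j) f * cnj (expi (real (f * b) / real Ne)))"
    unfolding conv_sum_def sum_distrib_right p_def
    by (subst sum.swap) (intro sum.cong refl sum.swap)
  also have "\<dots> = of_nat Ne * complex_of_real (corr z S i w (g ^ b mod p))"
    unfolding one unfolding corr_def p_def of_real_sum sum_distrib_left by simp
  finally have "Re (\<Sum>f<Ne. conv_sum z S i g w f * cnj (expi (real (f * b) / real Ne))) = real Ne * corr z S i w (g ^ b mod p)"
    by simp
  then show ?thesis using Ne by (simp add: p_def)
qed

lemma unconv_wp: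
  assumes c: "ctx z S i s" and g: "gen_tab (ps ! i) g s" and i: "i < m"
    and f: "\<And>f. f < Ne \<Longrightarrow> Complex (rvar s 17 (int f)) (rvar s 18 (int f)) = conv_sum z S i g w f"
    and f0: "rvar s 19 0 = zero_sum z S i g w"
  shows "wp bd inp L unconv (\<lambda>s'. \<forall>v<ps ! i. rvar s' 9 (int v) = rvar s 9 (int v) + corr z S i w v) s"
proof -
  define p where "p = ps ! i"
  have p: "0 < p" "p \<le> n" "2 \<le> p" using ps_nth[OF i] by (simp_all add: p_def)
  have p1: "int p - 1 = int (p - 1)" using p by simp
  note bij = gen_tab_bij[OF g ps_nth(2)[OF i], folded p_def]
  \<comment> \<open>The residues whose entry of \<open>rTT\<close> has been corrected: 0 beforehand,
    then one power per round. Each power is new, so nothing is added twice.\<close>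
  define T where "T b = insert 0 ((\<lambda>a. g ^ a mod p) ` {..<b})" for b :: nat
  let ?inv = "For 17 2 (sc 3)
          (iset 28 (sc 17 *! sc 29 mod! sc 3) ;;
           rset 20 (rsc 20 +. (Rv 17 (sc 17) *. Rv 3 (sc 28) +. Rv 18 (sc 17) *. Rv 4 (sc 28))))"
  let ?s1 = "set_rvar 9 0 (rvar s 9 0 + corr z S i w 0) s"
  have "wp bd inp L (For 29 2 (sc 7 -! Num 1)
       (rset 20 (rnum 0) ;;
        ?inv ;;
        Rset 9 (Iv 13 (sc 29)) (Rv 9 (Iv 13 (sc 29)) +. rsc 20 /. Cast (sc 3))))
      (\<lambda>s'. \<forall>v<p. rvar s' 9 (int v) = rvar s 9 (int v) + corr z S i w v) ?s1"
  proof (rule wp_For[where N = "p - 1" and Inv = "\<lambda>b s'. \<forall>v<p. rvar s' 9 (int v) = rvar s 9 (int v) + (if v \<in> T b then corr z S i w v else 0)"], goal_cases)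
    case 4
    then show ?case by (simp add: T_def)
  next
    case (5 b s2)
    note fr2 = same_outsideD[OF 5(2), simplified]
    have A: "Complex (rvar s2 17 (int f)) (rvar s2 18 (int f)) = conv_sum z S i g w f" if "f < Ne" for f
      using f[OF that] by (simp add: fr2)
    have c2: "ctx z S i (set_ivar 29 0 (int b) s2)"
      by (rule ctx_frame[OF c, of "{29, 17, 28}" "{9, 20}" False]) (auto simp: same_outside_def fr2)
    have loop: "wp bd inp L ?inv
        (\<lambda>s'. rvar s' 20 0 = (\<Sum>f<Ne. Re (conv_sum z S i g w f * cnj (expi (real (f * b) / real Ne))))) (set_rvar 20 0 0 (set_ivar 29 0 (int b) s2))"
    proof (rule wp_For[where N = Ne and Inv = "\<lambda>k s'. rvar s' 20 0 = (\<Sum>f<k. Re (conv_sum z S i g w f * cnj (expi (real (f * b) / real Ne))))"], goal_cases)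
      case (5 f s3)
      note fr3 = same_outsideD[OF 5(2), simplified]
      define r where "r = f * b mod Ne"
      have r: "r < Ne" "int f * int b mod int Ne = int r" using Ne by (simp_all add: r_def zmod_int)
      have rt: "rvar s2 3 (int r) = Re (expi (real r / real Ne))" "rvar s2 4 (int r) = Im (expi (real r / real Ne))"
        using ctxD(3)[OF c2] r(1) by (simp_all add: roots_ok_def)
      have ex: "expi (real (f * b) / real Ne) = expi (real r / real Ne)"
      proof (rule expi_shift_int[of _ _ "int (f * b div Ne)"])
        have "real (f * b) = real (f * b div Ne) * real Ne + real r"
          unfolding r_def of_nat_mult[symmetric] of_nat_add[symmetric] by (simp only: div_mult_mod_eq)
        then show "real (f * b) / real Ne - real r / real Ne = real_of_int (int (f * b div Ne))"
          using Ne by (simp add: field_simps)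
      qed
      have v: "ivar s2 3 0 = int Ne" using ctxD(11)[OF c2] by simp
      have AA: "rvar s2 17 (int f) = Re (conv_sum z S i g w f)" "rvar s2 18 (int f) = Im (conv_sum z S i g w f)"
        using A[OF 5(1)] by (simp_all add: complex_eq_iff)
      have rL: "int r < int L" "int f < int L" "int Ne \<noteq> 0" using r(1) 5(1) Ne by auto
      show ?case using 5(3) L_bounds rL
        by (simp add: wp_simps fr3 r(2) v rt AA ex del: of_nat_mult of_nat_power)
    qed (use ctxD[OF c2] Ne L_bounds in auto)
    have "wp bd inp L ?inv
        (wp bd inp L (Rset 9 (Iv 13 (sc 29)) (Rv 9 (Iv 13 (sc 29)) +. rsc 20 /. Cast (sc 3)))
          (\<lambda>s'. \<forall>v<p. rvar s' 9 (int v) = rvar s 9 (int v) + (if v \<in> T (Suc b) then corr z S i w v else 0)))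
        (set_rvar 20 0 0 (set_ivar 29 0 (int b) s2))"
    proof (rule wp_conseq[OF loop], goal_cases)
      case (1 s4)
      note fr4 = same_outsideD[OF 1(1), simplified]
      define v where "v = g ^ b mod p"
      have bl: "b < p - 1" using 5(1) .
      have vp: "v < p" using p by (simp add: v_def)
      have val: "rvar s4 20 0 / real Ne = corr z S i w v"
        using conv_read[OF g i, of b z S w] bl 1(2) by (simp add: p_def v_def)
      have new: "v \<notin> T b"
      proof -
        have "v \<in> {1..<p}" unfolding v_def using bij(1) bl by (auto simp: bij_betw_def)
        moreover have "v \<noteq> g ^ a mod p" if "a < b" for a
          using inj_onD[OF bij_betw_imp_inj_on[OF bij(1)], of b a] that bl by (auto simp: v_def)
        ultimately show ?thesis by (auto simp: T_def)
      qed
      have TS: "T (Suc b) = insert v (T b)" by (auto simp: T_def v_def lessThan_Suc)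
      have pw: "ivar s2 13 (int b) = int v" using g bl by (simp add: fr2 gen_tab_def p_def v_def)
      have nv: "ivar s2 3 0 = int Ne" using ctxD(11)[OF c2] by simp
      have bL: "int b < int L" "int v < int L" "int Ne \<noteq> 0" using bl vp p L_bounds Ne by auto
      show ?case using 5(3) L_bounds bL vp new
        by (simp add: wp_simps fr4 pw nv val TS del: of_nat_power)
    qed
    then show ?case unfolding wp_Sq using L_bounds by (simp add: wp_simps(3))
  next
    case (6 s2)
    have "v \<in> T (p - 1)" if "v < p" for v
      using that bij(1) by (cases "v = 0") (auto simp: T_def bij_betw_def)
    then show ?case using 6(2) by simp
  qed (use ctxD[OF c] p p1 L_bounds in \<open>auto simp: p_def\<close>)
  then show ?thesis unfolding unconv_def wp_Sq p_def
    using L_bounds f0 by (simp add: wp_simps(3) zero_sum_eq[OF g i])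
qed

lemma select_wp:
  assumes p: "ivar s 7 0 = int p" "2 \<le> p" "p \<le> n"
  defines "G \<equiv> {v. v < p \<and> real (rank_of (\<lambda>u. rvar s 8 (int u)) p v) < \<tau> * real p}"
  shows "wp bd inp L select (\<lambda>s'. \<exists>b\<in>G. (\<forall>u\<in>G. rvar s 9 (int b) \<le> rvar s 9 (int u)) \<and> outs s' = outs s @ [int b]) s"
proof -
  let ?rank = "For 19 2 (sc 7)
        (Ifc (Ler (Rv 8 (sc 19)) (Rv 8 (sc 18)))
          (Ifc (An (Ler (Rv 8 (sc 18)) (Rv 8 (sc 19))) (Lei (sc 18) (sc 19))) Nop (iset 20 (sc 20 +! Num 1)))
          Nop)"
  let ?pick = "Ifc (ltr (Cast (sc 20)) (Tau *. Cast (sc 7)))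
        (Ifc (lti (sc 21) (Num 0))
          (iset 21 (sc 18) ;; rset 22 (Rv 9 (sc 18)))
          (Ifc (ltr (Rv 9 (sc 18)) (rsc 22)) (iset 21 (sc 18) ;; rset 22 (Rv 9 (sc 18))) Nop))
        Nop"
  let ?loop = "For 18 2 (sc 7) (iset 20 (Num 0) ;; ?rank ;; ?pick)"
  define TH TT where "TH u = rvar s 8 (int u)" and "TT u = rvar s 9 (int u)" for u :: nat
  define I where "I v s' \<longleftrightarrow> (if G \<inter> {..<v} = {} then ivar s' 21 0 = -1
      else \<exists>b\<in>G \<inter> {..<v}. ivar s' 21 0 = int b \<and> rvar s' 22 0 = TT b \<and> (\<forall>u\<in>G \<inter> {..<v}. TT b \<le> TT u))" for v and s' :: store
  have Gn: "G \<noteq> {}"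
  proof -
    have "0 < \<lceil>\<tau> * real p\<rceil>" using \<tau> p by simp
    then have "0 < int (card {v. v < p \<and> real (rank_of TH p v) < \<tau> * real p})"
      unfolding card_rank_of_less[OF \<tau>] .
    then have "{v. v < p \<and> real (rank_of TH p v) < \<tau> * real p} \<noteq> {}" by (metis card.empty of_nat_0 less_irrefl)
    then show ?thesis by (simp add: G_def TH_def[abs_def])
  qed
  have "wp bd inp L ?loop (\<lambda>s'. I p s' \<and> outs s' = outs s) (set_ivar 21 0 (-1) s)"
  proof (rule wp_For[where N = p and Inv = "\<lambda>v s'. I v s'"], goal_cases)
    case 4
    then show ?case by (simp add: I_def)
  next
    case (5 v s1)
    note fr1 = same_outsideD[OF 5(2), simplified]
    have loop: "wp bd inp L ?rank (\<lambda>s'. ivar s' 20 0 = int (rank_of TH p v)) (set_ivar 20 0 0 (set_ivar 18 0 (int v) s1))"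
    proof (rule wp_For[where N = p and Inv = "\<lambda>u0 s'. ivar s' 20 0 = int (card {u. u < u0 \<and> (TH u < TH v \<or> TH u = TH v \<and> u < v)})"], goal_cases)
      case (5 u s2)
      note fr2 = same_outsideD[OF 5(2), simplified]
      have cS: "card {x. x < Suc u \<and> (TH x < TH v \<or> TH x = TH v \<and> x < v)} =
          card {x. x < u \<and> (TH x < TH v \<or> TH x = TH v \<and> x < v)} + (if TH u < TH v \<or> TH u = TH v \<and> u < v then 1 else 0)"
      proof (cases "TH u < TH v \<or> TH u = TH v \<and> u < v")
        case True
        then have "{x. x < Suc u \<and> (TH x < TH v \<or> TH x = TH v \<and> x < v)} =
           insert u {x. x < u \<and> (TH x < TH v \<or> TH x = TH v \<and> x < v)}" by (auto simp: less_Suc_eq)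
        then show ?thesis using True by simp
      next
        case False
        then have "{x. x < Suc u \<and> (TH x < TH v \<or> TH x = TH v \<and> x < v)} =
           {x. x < u \<and> (TH x < TH v \<or> TH x = TH v \<and> x < v)}" by (auto simp: less_Suc_eq)
        then show ?thesis using False by simp
      qed
      have t: "rvar s 8 (int x) = TH x" for x by (simp add: TH_def)
      show ?case unfolding cS
        using 5(1,3) \<open>v < p\<close> L_bounds p by (auto simp: wp_simps fr2 fr1 t)
    qed (use p L_bounds in \<open>auto simp: fr1 rank_of_def\<close>)
    have "wp bd inp L ?rank (wp bd inp L ?pick (I (Suc v))) (set_ivar 20 0 0 (set_ivar 18 0 (int v) s1))"
    proof (rule wp_conseq[OF loop], goal_cases)
      case (1 s3)
      note fr3 = same_outsideD[OF 1(1), simplified]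
      have tt: "rvar s3 9 (int v) = TT v" by (simp add: fr3 fr1 TT_def)
      have vs: "ivar s3 7 0 = int p" "ivar s3 18 0 = int v" "ivar s3 21 0 = ivar s1 21 0" "rvar s3 22 0 = rvar s1 22 0"
        using p by (simp_all add: fr3 fr1)
      have vL: "v < L" using 5(1) p L_bounds by linarith
      show ?case
      proof (cases "v \<in> G")
        case False
        then have "G \<inter> {..<Suc v} = G \<inter> {..<v}" by (auto simp: less_Suc_eq)
        then have "I (Suc v) s3" using 5(3) vs by (simp add: I_def)
        moreover have "\<not> real (rank_of TH p v) < \<tau> * real p" using False 5(1) by (simp add: G_def TH_def[abs_def])
        ultimately show ?thesis using 1(2) L_bounds vs by (simp add: wp_simps)
      next
        case True
        then have lt: "real (rank_of TH p v) < \<tau> * real p" by (simp add: G_def TH_def[abs_def])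
        have GS: "G \<inter> {..<Suc v} = insert v (G \<inter> {..<v})" using True by (auto simp: less_Suc_eq)
        show ?thesis
        proof (cases "G \<inter> {..<v} = {}")
          case True
          then show ?thesis using 5(3) lt 1(2) L_bounds vL
            by (simp add: wp_simps vs tt I_def GS)
        next
          case False
          then obtain b where b: "b \<in> G \<inter> {..<v}" "ivar s1 21 0 = int b" "rvar s1 22 0 = TT b" "\<forall>u\<in>G \<inter> {..<v}. TT b \<le> TT u"
            using 5(3) by (auto simp: I_def)
          show ?thesis
          proof (cases "TT v < TT b")
            case True
            then have "\<forall>u\<in>G \<inter> {..<v}. TT v \<le> TT u" using b(4) by (meson less_eq_real_def order_trans)
            then show ?thesis using True lt 1(2) L_bounds vL b(2,3)
              by (simp add: wp_simps vs tt I_def GS)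
          next
            case F: False
            then have "I (Suc v) s3" unfolding I_def GS using b vs by (auto intro!: bexI[of _ b])
            then show ?thesis using F lt 1(2) L_bounds vL b(2,3)
              by (simp add: wp_simps vs tt)
          qed
        qed
      qed
    qed
    then show ?case unfolding wp_Sq using L_bounds by (simp add: wp_simps(2))
  next
    case (6 s1)
    note fr1 = same_outsideD[OF 6(1), simplified]
    then show ?case using 6(2) by (simp add: I_def fr1)
  qed (use p L_bounds in auto)
  then have "wp bd inp L ?loop (wp bd inp L (Put (sc 21)) (\<lambda>s'. \<exists>b\<in>G. (\<forall>u\<in>G. rvar s 9 (int b) \<le> rvar s 9 (int u)) \<and> outs s' = outs s @ [int b])) (set_ivar 21 0 (-1) s)"
  proof (rule wp_conseq, goal_cases)
    case (1 s1)
    have "G \<inter> {..<p} = G" by (auto simp: G_def)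
    then obtain b where "b \<in> G" "ivar s1 21 0 = int b" "\<forall>u\<in>G. TT b \<le> TT u" using 1(2) Gn by (auto simp: I_def)
    then show ?case using 1(2) L_bounds by (auto simp: wp_simps TT_def)
  qed
  then show ?thesis unfolding select_def wp_Sq using L_bounds by (simp add: wp_simps(2))
qed

text \<open>\<open>THf\<close> is \<open>theta\<close> without the factor
  \<open>(\<gamma> S)\<^sup>2 / p\<close>, and \<open>TTf\<close> below is \<open>T_crit\<close>
  without it and up to a constant. Only values for one prime and one component are ever
  compared.\<close>

definition THf :: "(nat \<Rightarrow> int) \<Rightarrow> nat \<Rightarrow> nat \<Rightarrow> nat \<Rightarrow> real" where
  "THf z S i v = (\<Sum>k<ps ! i. Wf z S (ps ! i) (ps ! i) k 0 * sg1 (ps ! i) (k * v))"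

definition TTf :: "(nat \<Rightarrow> int) \<Rightarrow> nat \<Rightarrow> nat \<Rightarrow> (nat \<Rightarrow> int) \<Rightarrow> nat \<Rightarrow> real" where
  "TTf z S i w v = THf z S i v +
     (\<Sum>j<m. if i < j then \<Sum>k<ps ! i. yl z S i j k * sg1 (ps ! i) (k * (ps ! j) mod (ps ! i) * v) else 0) + corr z S i w v"

lemma prime_step_wp:
  assumes s: "fixed_ok e s" "resd z S s" "tab_ok z S s" "ivar s 5 0 = int (S - 2)" "ivar s 6 0 = int i"
    and i: "i < m" and S: "2 \<le> S" "S \<le> d"
    and w: "\<And>j. j < i \<Longrightarrow> (S - 1) * m + j < length (outs s) \<and> outs s ! ((S - 1) * m + j) = w j"
  defines "G \<equiv> {v. v < ps ! i \<and> real (rank_of (THf z S i) (ps ! i) v) < \<tau> * real (ps ! i)}"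
  shows "wp bd inp L (prime_step tab) (\<lambda>s'. \<exists>b\<in>G. (\<forall>u\<in>G. TTf z S i w b \<le> TTf z S i w u) \<and> outs s' = outs s @ [int b]) s"
proof -
  define p where "p = ps ! i"
  have p: "0 < p" "p \<le> n" "2 \<le> p" using ps_nth[OF i] by (simp_all add: p_def)
  have c0: "ctx z S i (set_ivar 7 0 (int p) s)"
    unfolding ctx_def using s fixed_ok_frame[of "{7}" "{}" False s "set_ivar 7 0 (int p) s" e]
    by (simp add: p_def resd_def tab_ok_def same_outside_def)
  have pr: "ivar s 2 (int i) = int p" using s(1) i by (simp add: fixed_ok_def p_def)
  have "wp bd inp L (init_wp tab) (wp bd inp L (add_larger tab) (wp bd inp L theta_table (wp bd inp L prim_root
      (wp bd inp L (conv tab) (wp bd inp L unconv (wp bd inp L select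
      (\<lambda>s'. \<exists>b\<in>G. (\<forall>u\<in>G. TTf z S i w b \<le> TTf z S i w u) \<and> outs s' = outs s @ [int b]))))))) (set_ivar 7 0 (int p) s)"
  proof (rule wp_conseq[OF init_wp_wp[OF c0 i S]], goal_cases)
    case (1 s1)
    note fr1 = same_outsideD[OF 1(1), unfolded init_wp_def, simplified]
    have c1: "ctx z S i s1" by (rule ctx_frame[OF c0 1(1)]) (auto simp: init_wp_def)
    note r1 = 1(2)
    show ?case
    proof (rule wp_conseq[OF add_larger_wp[OF c1 i S]], goal_cases)
      case (1 s2)
      note fr2 = same_outsideD[OF 1(1), unfolded add_larger_def, simplified]
      have c2: "ctx z S i s2" by (rule ctx_frame[OF c1 1(1)]) (auto simp: add_larger_def)
      note r2 = 1(2)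
      show ?case
      proof (rule wp_conseq[OF theta_table_wp[OF c2 i]], goal_cases)
        case (1 s3)
        note fr3 = same_outsideD[OF 1(1), unfolded theta_table_def, simplified]
        have c3: "ctx z S i s3" by (rule ctx_frame[OF c2 1(1)]) (auto simp: theta_table_def)
        have th: "rvar s3 8 (int v) = THf z S i v" if "v < p" for v
          using 1(2) that r1 by (simp add: fr2 THf_def p_def)
        have tt: "rvar s3 9 (int v) + corr z S i w v = TTf z S i w v" if "v < p" for v
        proof -
          have "rvar s3 9 (int v) = (\<Sum>u<ps ! i. rvar s2 7 (int u) * sg1 (ps ! i) (u * v))"
            using 1(2) that by (simp add: p_def)
          then show ?thesis using r1 unfolding TTf_def THf_def
            by (simp add: r2[rule_format, of "\<lambda>u. sg1 (ps ! i) (u * v)"])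
        qed
        show ?case
        proof (rule wp_conseq[OF prim_root_wp[OF c3 i]], goal_cases)
          case (1 s4)
          note fr4 = same_outsideD[OF 1(1), unfolded prim_root_def, simplified]
          have c4: "ctx z S i s4" by (rule ctx_frame[OF c3 1(1)]) (auto simp: prim_root_def)
          obtain g where g: "gen_tab (ps ! i) g s4" using 1(2) by blast
          show ?case
          proof (rule wp_conseq[OF conv_wp[OF c4 g i S, of w]], goal_cases)
            case (1 j) then show ?case using w[of j] by (simp add: fr4 fr3 fr2 fr1)
          next
            case (2 s5)
            note fr5 = same_outsideD[OF 2(1), unfolded conv_def, simplified]
            have c5: "ctx z S i s5" by (rule ctx_frame[OF c4 2(1)]) (auto simp: conv_def)
            have g5: "gen_tab (ps ! i) g s5" using g by (simp add: gen_tab_def fr5)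
            show ?case
            proof (rule wp_conseq[OF unconv_wp[OF c5 g5 i, where w = w]], goal_cases)
              case (3 s6)
              note fr6 = same_outsideD[OF 3(1), unfolded unconv_def, simplified]
              have v6: "rvar s6 8 (int v) = THf z S i v" "rvar s6 9 (int v) = TTf z S i w v" if "v < p" for v
                using 3(2) th[OF that] tt[OF that] that by (simp_all add: fr6 fr5 fr4 p_def)
              have o6: "outs s6 = outs s" by (simp add: fr6 fr5 fr4 fr3 fr2 fr1)
              have "rank_of (\<lambda>u. rvar s6 8 (int u)) p v = rank_of (THf z S i) p v" if "v < p" for v
                unfolding rank_of_def by (intro arg_cong[of _ _ card]) (use v6 that in auto)
              then have G6: "G = {v. v < p \<and> real (rank_of (\<lambda>u. rvar s6 8 (int u)) p v) < \<tau> * real p}"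
                unfolding G_def p_def by auto
              have Gp: "v < p" if "v \<in> G" for v using that by (simp add: G_def p_def)
              have p6: "ivar s6 7 0 = int p" using ctxD(7)[OF c5] by (simp add: fr6 p_def)
              show ?case
                by (rule wp_conseq[OF select_wp[OF p6 p(3,2), folded G6]]) (use v6 Gp o6 in auto)
            qed (use 2(2) in auto)
          qed
        qed
      qed
    qed
  qed
  then show ?thesis unfolding prime_step_def wp_Sq using i L_bounds s(5) pr
    by (simp add: wp_simps(2))
qed

end

section \<open>The computed tables and the criteria \<open>theta\<close> and
  \<open>T_crit\<close>\<close>

lemma sigma_two_mod:
  assumes pq: "0 < p" "0 < q" and A: "[A = A'] (mod int p)" and B: "[B = B'] (mod int q)"
  shows "sigma \<alpha> (real_of_int ((A * int q + B * int p) mod (int p * int q)) / real_of_int (int p * int q)) =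
    sigma \<alpha> (real_of_int A' / real p + real_of_int B' / real q)"
proof (rule sigma_shift)
  obtain s t where s: "A = A' + int p * s" and t: "B = B' + int q * t"
    using A B by (metis cong_iff_lin cong_sym)
  define c where "c = (A * int q + B * int p) div (int p * int q)"
  have mc: "(A * int q + B * int p) mod (int p * int q) = A * int q + B * int p - int p * int q * c"
    by (simp add: c_def minus_mult_div_eq_mod)
  have "real_of_int ((A * int q + B * int p) mod (int p * int q)) / real_of_int (int p * int q) -
      (real_of_int A' / real p + real_of_int B' / real q) = real_of_int (s + t - c)"
    using pq unfolding mc unfolding s t by (simp add: field_simps)
  then show "real_of_int ((A * int q + B * int p) mod (int p * int q)) / real_of_int (int p * int q) -
      (real_of_int A' / real p + real_of_int B' / real q) \<in> \<int>" by (simp only: Ints_of_int)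
qed

lemma sigma_mod:
  assumes "0 < p" "[int a = b] (mod int p)"
  shows "sigma \<alpha> (real (a mod p) / real p) = sigma \<alpha> (real_of_int b / real p)"
proof -
  have "sigma \<alpha> (real_of_int ((int a * int 1 + 0 * int p) mod (int p * int 1)) / real_of_int (int p * int 1)) =
      sigma \<alpha> (real_of_int b / real p + real_of_int 0 / real 1)"
    by (rule sigma_two_mod) (use assms in auto)
  moreover have "real_of_int (int a mod int p) = real (a mod p)" by (simp flip: zmod_int)
  ultimately show ?thesis by simp
qed

context construction_step
begin

lemma Wf_eq_ker:
  assumes "0 < p" "0 < q"
  shows "Wf z S p q k l = ker \<alpha> \<gamma> S (\<lambda>j. real k * real_of_int (z j) / real p + real l * real_of_int (z j) / real q)"
  unfolding Wf_def ker_def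
proof (rule prod.cong[OF refl])
  fix t
  have "[int k * (z t mod int p) = int k * z t] (mod int p)" "[int l * (z t mod int q) = int l * z t] (mod int q)"
    by (simp_all add: cong_def mod_mult_right_eq)
  from sigma_two_mod[OF assms this, of \<alpha>]
  show "fac z t p q k l = 1 + (\<gamma> t)\<^sup>2 * sigma \<alpha> (real k * real_of_int (z t) / real p + real l * real_of_int (z t) / real q)"
    by (simp add: fac_def power2_eq_square)
qed

lemma theta_eq:
  assumes i: "i < m" and S: "1 \<le> S"
  shows "theta \<alpha> \<gamma> S z (ps ! i) (int v) = (\<gamma> S)\<^sup>2 / real (ps ! i) * THf z S i v"
proof -
  define p where "p = ps ! i"
  have p: "0 < p" using ps_nth[OF i] by (simp add: p_def)
  have "sigma \<alpha> (real k * real_of_int (int v) / real p) = sg1 p (k * v)" for k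
    using sigma_mod[OF p, of "k * v" "int (k * v)" \<alpha>] by simp
  moreover have "Wf z S p p k 0 = ker \<alpha> \<gamma> S (\<lambda>j. real k * real_of_int (z j) / real p)" for k
    by (simp add: Wf_eq_ker p)
  moreover have "theta \<alpha> \<gamma> S z p (int v) = (\<gamma> S)\<^sup>2 / real p * (\<Sum>k<p.
      ker \<alpha> \<gamma> S (\<lambda>j. real k * real_of_int (z j) / real p) * sigma \<alpha> (real k * real_of_int (int v) / real p))"
    unfolding theta_def by (rule infsum_dual1) (use \<alpha> \<gamma> S p in auto)
  ultimately show ?thesis by (simp add: THf_def p_def)
qed

text \<open>The constant absorbs the character \<open>k = 0\<close> and, through the complement, the
  frequencies with \<open>p\<close> dividing \<open>h S\<close>; both are independent of
  \<open>v\<close>.\<close>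

lemma smaller_eq:
  assumes ij: "i < m" "j < i" and S: "1 \<le> S" and W: "w j = W (ps ! j)"
  defines "p \<equiv> ps ! i" and "q \<equiv> ps ! j"
  shows "\<exists>c. \<forall>v. 2 * (\<Sum>\<^sub>\<infinity>h\<in>{h \<in> Zvec S. h S \<noteq> 0 \<and> \<not> int p dvd h S \<and> int p dvd dot S h z (int v) \<and> int q dvd dot S h z (W q)}.
      r_weight \<alpha> \<gamma> h powr (- 2)) = (\<gamma> S)\<^sup>2 / real p * (\<Sum>l<q. \<Sum>k\<in>{1..<p}. 2 * Wf z S p q k l / real q * sg2 p q (k * v) l (w j)) + c"
proof -
  have jm: "j < m" using ij by simp
  have p: "0 < p" "0 < q" using ps_nth[OF ij(1)] ps_nth[OF jm] by (simp_all add: p_def q_def)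
  define R where "R h = r_weight \<alpha> \<gamma> h powr (- 2)" for h
  define A where "A v = {h \<in> Zvec S. h S \<noteq> 0 \<and> int p dvd dot S h z v \<and> int q dvd dot S h z (W q)}" for v
  define B where "B = {h \<in> Zvec S. h S \<noteq> 0 \<and> int p dvd h S \<and> int p dvd dot S h z 0 \<and> int q dvd dot S h z (W q)}"
  have sm: "R summable_on X" if "X \<subseteq> Zvec S" for X
    unfolding R_def by (rule summable_on_subset_banach[OF r_weight_powr_summable that]) (use \<alpha> \<gamma> in auto)
  have dv: "int p dvd dot S h z v \<longleftrightarrow> int p dvd dot S h z 0" if "int p dvd h S" for h v
    using that by (simp add: dot_def dvd_add_left_iff)
  have set: "{h \<in> Zvec S. h S \<noteq> 0 \<and> \<not> int p dvd h S \<and> int p dvd dot S h z v \<and> int q dvd dot S h z (W q)} = A v - B" for v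
    using dv by (auto simp: A_def B_def)
  have BA: "B \<subseteq> A v" for v using dv by (auto simp: A_def B_def)
  have split: "infsum R (A v - B) = infsum R (A v) - infsum R B" for v
    by (rule infsum_Diff) (use sm BA in \<open>auto simp: A_def B_def\<close>)
  define K where "K l k = ker \<alpha> \<gamma> S (\<lambda>j. real k * real_of_int (z j) / real p + real l * real_of_int (z j) / real q)" for l k
  define c0 where "c0 = (\<gamma> S)\<^sup>2 / (real p * real q) * (\<Sum>l<q. K l 0 * sigma \<alpha> (real l * real_of_int (W q) / real q))"
  have "2 * infsum R (A (int v)) = (\<gamma> S)\<^sup>2 / real p * (\<Sum>l<q. \<Sum>k\<in>{1..<p}. 2 * Wf z S p q k l / real q * sg2 p q (k * v) l (w j)) + 2 * c0" for v
  proof -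
    have sg: "sigma \<alpha> (real k * real_of_int (int v) / real p + real l * real_of_int (W q) / real q) = sg2 p q (k * v) l (w j)" for k l
      unfolding sg2_def W q_def[symmetric] by (subst sigma_two_mod[OF p, of "int (k * v)" "int (k * v)" "int l * W q" "int l * W q"]) simp_all
    have "infsum R (A (int v)) = (\<gamma> S)\<^sup>2 / (real p * real q) * (\<Sum>l<q. \<Sum>k<p. K l k *
       sigma \<alpha> (real k * real_of_int (int v) / real p + real l * real_of_int (W q) / real q))"
      unfolding R_def A_def K_def by (rule infsum_dual2) (use \<alpha> \<gamma> S p in auto)
    also have "(\<Sum>l<q. \<Sum>k<p. K l k * sigma \<alpha> (real k * real_of_int (int v) / real p + real l * real_of_int (W q) / real q)) =
       (\<Sum>l<q. K l 0 * sigma \<alpha> (real l * real_of_int (W q) / real q)) + (\<Sum>l<q. \<Sum>k\<in>{1..<p}. K l k * sg2 p q (k * v) l (w j))"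
    proof -
      have ins: "{..<p} = insert 0 {1..<p}" using p by auto
      have "(\<Sum>k<p. K l k * sigma \<alpha> (real k * real_of_int (int v) / real p + real l * real_of_int (W q) / real q)) =
         K l 0 * sigma \<alpha> (real l * real_of_int (W q) / real q) + (\<Sum>k\<in>{1..<p}. K l k * sg2 p q (k * v) l (w j))" for l
        unfolding ins sg[symmetric] by (subst sum.insert) simp_all
      then show ?thesis by (simp add: sum.distrib)
    qed
    finally have "infsum R (A (int v)) = c0 + (\<gamma> S)\<^sup>2 / (real p * real q) * (\<Sum>l<q. \<Sum>k\<in>{1..<p}. K l k * sg2 p q (k * v) l (w j))"
      by (simp add: c0_def distrib_left)
    moreover have "(\<gamma> S)\<^sup>2 / real p * (\<Sum>l<q. \<Sum>k\<in>{1..<p}. 2 * Wf z S p q k l / real q * sg2 p q (k * v) l (w j)) =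
        2 * ((\<gamma> S)\<^sup>2 / (real p * real q) * (\<Sum>l<q. \<Sum>k\<in>{1..<p}. K l k * sg2 p q (k * v) l (w j)))"
      unfolding Wf_eq_ker[OF p] K_def[symmetric] sum_distrib_left by (intro sum.cong refl) (simp add: field_simps)
    ultimately show ?thesis by simp
  qed
  then show ?thesis unfolding set R_def[symmetric] split
    by (intro exI[of _ "2 * c0 - 2 * infsum R B"]) (simp add: algebra_simps)
qed

lemma larger_eq:
  assumes ij: "i < m" "j < m" and S: "1 \<le> S"
  defines "p \<equiv> ps ! i" and "q \<equiv> ps ! j"
  shows "2 * (\<Sum>\<^sub>\<infinity>h\<in>{h \<in> Zvec S. h S \<noteq> 0 \<and> int q dvd h S \<and> int p dvd dot S h z (int v) \<and> int q dvd (\<Sum>j\<in>{1..<S}. h j * z j)}.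
      r_weight \<alpha> \<gamma> h powr (- 2)) = (\<gamma> S)\<^sup>2 / real p * (\<Sum>k<p. yl z S i j k * sg1 p (k * q mod p * v))"
proof -
  have p: "0 < p" "0 < q" using ps_nth[OF ij(1)] ps_nth[OF ij(2)] by (simp_all add: p_def q_def)
  have "sigma \<alpha> (real q * (real k * real_of_int (int v) / real p)) = sg1 p (k * q mod p * v)" for k
  proof -
    have "[int (k * q mod p * v) = int (k * q * v)] (mod int p)"
      unfolding cong_int_iff by (simp add: cong_def mod_mult_left_eq)
    from sigma_mod[OF p(1) this, of \<alpha>] show ?thesis by (simp add: mult_ac)
  qed
  moreover have "(\<Sum>\<^sub>\<infinity>h\<in>{h \<in> Zvec S. h S \<noteq> 0 \<and> int q dvd h S \<and> int p dvd dot S h z (int v) \<and> int q dvd (\<Sum>j\<in>{1..<S}. h j * z j)}.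
      r_weight \<alpha> \<gamma> h powr (- 2)) = (\<gamma> S)\<^sup>2 / (real p * real q) * real q powr (- (2 * \<alpha>)) * (\<Sum>k<p. (\<Sum>l<q.
       ker \<alpha> \<gamma> S (\<lambda>j. real k * real_of_int (z j) / real p + real l * real_of_int (z j) / real q)) *
       sigma \<alpha> (real q * (real k * real_of_int (int v) / real p)))"
    by (rule infsum_dual3) (use \<alpha> \<gamma> S p in auto)
  ultimately show ?thesis
    unfolding yl_def p_def[symmetric] q_def[symmetric] Wf_eq_ker[OF p]
    by (simp add: sum_distrib_left field_simps)
qed

lemma T_crit_eq:
  assumes i: "i < m" and S: "1 \<le> S" and W: "\<And>j. j < i \<Longrightarrow> w j = W (ps ! j)"
  shows "\<exists>c. \<forall>v. T_crit \<alpha> \<gamma> n S z (ps ! i) (int v) W = (\<gamma> S)\<^sup>2 / real (ps ! i) * TTf z S i w v + c"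
proof -
  define p where "p = ps ! i"
  have mem: "q \<in> primes_P n \<longleftrightarrow> (\<exists>j<m. q = ps ! j)" for q
    using ps(1) by (metis in_set_conv_nth m_def)
  have inj: "inj_on ((!) ps) {..<m}" using ps(2) by (auto intro: inj_on_nth simp: m_def)
  have b1: "bij_betw ((!) ps) {..<i} {q \<in> primes_P n. q < p}"
    unfolding bij_betw_def
  proof
    show "inj_on ((!) ps) {..<i}" using inj i by (auto intro: inj_on_subset)
    show "(!) ps ` {..<i} = {q \<in> primes_P n. q < p}"
      using i by (auto simp: mem p_def ps_less_iff intro: less_trans)
  qed
  have b2: "bij_betw ((!) ps) {i<..<m} {q \<in> primes_P n. p < q}"
    unfolding bij_betw_def
  proof
    show "inj_on ((!) ps) {i<..<m}" by (rule inj_on_subset[OF inj]) auto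
    show "(!) ps ` {i<..<m} = {q \<in> primes_P n. p < q}"
      using i by (auto simp: mem p_def ps_less_iff)
  qed
  have "\<forall>j\<in>{..<i}. \<exists>c. \<forall>v. 2 * (\<Sum>\<^sub>\<infinity>h\<in>{h \<in> Zvec S. h S \<noteq> 0 \<and> \<not> int p dvd h S \<and> int p dvd dot S h z (int v) \<and> int (ps ! j) dvd dot S h z (W (ps ! j))}.
      r_weight \<alpha> \<gamma> h powr (- 2)) = (\<gamma> S)\<^sup>2 / real p * (\<Sum>l<ps ! j. \<Sum>k\<in>{1..<p}. 2 * Wf z S p (ps ! j) k l / real (ps ! j) * sg2 p (ps ! j) (k * v) l (w j)) + c"
    unfolding p_def by (intro ballI smaller_eq[where w = w and W = W]) (use i S W in auto)
  then obtain c where c: "\<And>j v. j < i \<Longrightarrow> 2 * (\<Sum>\<^sub>\<infinity>h\<in>{h \<in> Zvec S. h S \<noteq> 0 \<and> \<not> int p dvd h S \<and> int p dvd dot S h z (int v) \<and> int (ps ! j) dvd dot S h z (W (ps ! j))}.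
      r_weight \<alpha> \<gamma> h powr (- 2)) = (\<gamma> S)\<^sup>2 / real p * (\<Sum>l<ps ! j. \<Sum>k\<in>{1..<p}. 2 * Wf z S p (ps ! j) k l / real (ps ! j) * sg2 p (ps ! j) (k * v) l (w j)) + c j"
    unfolding bchoice_iff by auto
  have "T_crit \<alpha> \<gamma> n S z p (int v) W = (\<gamma> S)\<^sup>2 / real p * TTf z S i w v + (\<Sum>j<i. c j)" for v
  proof -
    have gt: "(\<Sum>j<m. if i < j then f j else 0) = sum f {i<..<m}" for f :: "nat \<Rightarrow> real"
      by (rule sum.mono_neutral_cong_right) auto
    have la: "2 * (\<Sum>\<^sub>\<infinity>h\<in>{h \<in> Zvec S. h S \<noteq> 0 \<and> int (ps ! j) dvd h S \<and> int p dvd dot S h z (int v) \<and> int (ps ! j) dvd (\<Sum>j\<in>{1..<S}. h j * z j)}.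
      r_weight \<alpha> \<gamma> h powr (- 2)) = (\<gamma> S)\<^sup>2 / real p * (\<Sum>k<p. yl z S i j k * sg1 p (k * ps ! j mod p * v))" if "j \<in> {i<..<m}" for j
      using larger_eq[OF i _ S, of j z v] that by (simp add: p_def)
    have "2 * (\<Sum>j<i. (\<Sum>\<^sub>\<infinity>h\<in>{h \<in> Zvec S. h S \<noteq> 0 \<and> \<not> int p dvd h S \<and> int p dvd dot S h z (int v) \<and> int (ps ! j) dvd dot S h z (W (ps ! j))}. r_weight \<alpha> \<gamma> h powr (- 2))) = (\<gamma> S)\<^sup>2 / real p * corr z S i w v + (\<Sum>j<i. c j)"
      unfolding sum_distrib_left[of 2] corr_def p_def[symmetric] sum_distrib_left[of "(\<gamma> S)\<^sup>2 / real p" _ "{..<i}"] sum.distrib[symmetric]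
      by (rule sum.cong[OF refl], rule c) simp
    moreover have "2 * (\<Sum>j\<in>{i<..<m}. (\<Sum>\<^sub>\<infinity>h\<in>{h \<in> Zvec S. h S \<noteq> 0 \<and> int (ps ! j) dvd h S \<and> int p dvd dot S h z (int v) \<and> int (ps ! j) dvd (\<Sum>j\<in>{1..<S}. h j * z j)}. r_weight \<alpha> \<gamma> h powr (- 2))) = (\<gamma> S)\<^sup>2 / real p * (\<Sum>j\<in>{i<..<m}. \<Sum>k<p. yl z S i j k * sg1 p (k * ps ! j mod p * v))"
      unfolding sum_distrib_left[of 2] sum_distrib_left[of "(\<gamma> S)\<^sup>2 / real p" _ "{i<..<m}"]
      by (rule sum.cong[OF refl], rule la) simp
    moreover have "theta \<alpha> \<gamma> S z p (int v) = (\<gamma> S)\<^sup>2 / real p * THf z S i v" using theta_eq[OF i S] by (simp add: p_def)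
    ultimately show ?thesis
      unfolding T_crit_def sum.reindex_bij_betw[OF b1, symmetric] sum.reindex_bij_betw[OF b2, symmetric] TTf_def gt p_def[symmetric]
      by (simp only: distrib_left add_ac)
  qed
  then show ?thesis by (auto simp: p_def)
qed

text \<open>Both criteria are affine in the computed values with positive slope, so ranks and minima
  carry over. The ranks fix one admissible way of breaking ties.\<close>

lemma selected_best:
  fixes z :: "nat \<Rightarrow> int" and w :: "nat \<Rightarrow> int"
  assumes i: "i < m" and S: "1 \<le> S" and W: "\<And>j. j < i \<Longrightarrow> w j = W (ps ! j)"
  defines "G \<equiv> {v. v < ps ! i \<and> real (rank_of (THf z S i) (ps ! i) v) < \<tau> * real (ps ! i)}"
  assumes b: "b \<in> G" "\<And>u. u \<in> G \<Longrightarrow> TTf z S i w b \<le> TTf z S i w u"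
  shows "selected \<alpha> \<gamma> \<tau> n S z (ps ! i) W (int b)"
proof -
  have g: "0 < (\<gamma> S)\<^sup>2 / real (ps ! i)" using \<gamma>[OF S] ps_nth[OF i] by simp
  have th: "theta \<alpha> \<gamma> S z (ps ! i) (int u) \<le> theta \<alpha> \<gamma> S z (ps ! i) (int v)" if "u \<in> G" "v < ps ! i" "v \<notin> G" for u v
  proof -
    have "\<not> rank_of (THf z S i) (ps ! i) v < rank_of (THf z S i) (ps ! i) u" using that by (auto simp: G_def)
    then have "THf z S i u \<le> THf z S i v" using rank_of_less[of v "ps ! i" "THf z S i" u] that by force
    then show ?thesis unfolding theta_eq[OF i S] using g by (intro mult_left_mono) auto
  qed
  have "smallest_theta \<alpha> \<gamma> \<tau> S z (ps ! i) (int ` G)"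
    unfolding smallest_theta_def
  proof (intro conjI ballI)
    show "int (card (int ` G)) = \<lceil>\<tau> * real (ps ! i)\<rceil>"
      unfolding G_def by (subst card_image) (simp_all add: card_rank_of_less[OF \<tau>])
    fix u v assume "u \<in> int ` G" "v \<in> {0..<int (ps ! i)} - int ` G"
    then obtain u' v' where "u = int u'" "u' \<in> G" "v = int v'" "v' < ps ! i" "v' \<notin> G"
      by (metis (no_types, lifting) DiffE atLeastLessThan_iff image_iff nonneg_int_cases of_nat_less_iff)
    then show "theta \<alpha> \<gamma> S z (ps ! i) u \<le> theta \<alpha> \<gamma> S z (ps ! i) v" using th by simp
  qed (auto simp: G_def)
  moreover obtain c where c: "\<And>v. T_crit \<alpha> \<gamma> n S z (ps ! i) (int v) W = (\<gamma> S)\<^sup>2 / real (ps ! i) * TTf z S i w v + c"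
    using T_crit_eq[OF i S, of w W z] W by blast
  have "T_crit \<alpha> \<gamma> n S z (ps ! i) (int b) W \<le> T_crit \<alpha> \<gamma> n S z (ps ! i) u W" if "u \<in> int ` G" for u
    using that b(2) g by (auto simp: c intro!: divide_right_mono mult_left_mono)
  ultimately show ?thesis using b(1) unfolding selected_def by blast
qed

end

text \<open>Selection looks only at earlier components and smaller primes, so a partial outcome can
  be extended without disturbing it.\<close>

lemma selected_cong:
  assumes "\<And>j. 1 \<le> j \<Longrightarrow> j < S \<Longrightarrow> z j = z' j" "\<And>q. q \<in> primes_P n \<Longrightarrow> q < p \<Longrightarrow> W q = W' q"
  shows "selected \<alpha> \<gamma> \<tau> n S z p W v \<longleftrightarrow> selected \<alpha> \<gamma> \<tau> n S z' p W' v"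
proof -
  have d: "dot S h z u = dot S h z' u" for h u using assms(1) by (simp add: dot_def)
  have d2: "(\<Sum>j\<in>{1..<S}. h j * z j) = (\<Sum>j\<in>{1..<S}. h j * z' j)" for h using assms(1) by simp
  have th: "theta \<alpha> \<gamma> S z p u = theta \<alpha> \<gamma> S z' p u" for u by (simp add: theta_def d)
  have "T_crit \<alpha> \<gamma> n S z p u W = T_crit \<alpha> \<gamma> n S z' p u W'" for u
    unfolding T_crit_def th d d2 using assms(2) by (simp cong: sum.cong_simp)
  then show ?thesis by (simp add: selected_def smallest_theta_def th)
qed

section \<open>The whole construction\<close>

context construction
begin

lemma residues_of_Suc: "residues_of n (Suc k) z = residues_of n k z @ map (\<lambda>p. z (Suc k) mod int p) ps"
  by (simp add: residues_of_def ps_def)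

lemma length_residues_of: "length (residues_of n k z) = k * m"
  by (induction k) (simp add: residues_of_def, simp add: residues_of_Suc m_def)

lemma residues_of_nth:
  "t < k \<Longrightarrow> j < m \<Longrightarrow> residues_of n k z ! (t * m + j) = z (Suc t) mod int (ps ! j)"
proof (induction k)
  case (Suc k)
  show ?case
  proof (cases "t < k")
    case True
    have "(t + 1) * m \<le> k * m" by (rule mult_le_mono1) (use True in simp)
    then have "t * m + j < k * m" using Suc.prems by simp
    then show ?thesis using Suc True by (simp add: residues_of_Suc nth_append length_residues_of)
  next
    case False
    then show ?thesis using Suc.prems by (simp add: residues_of_Suc nth_append length_residues_of m_def less_Suc_eq)
  qed
qed simp

lemma residues_of_cong: "(\<And>j. j \<in> {1..k} \<Longrightarrow> z j = z' j) \<Longrightarrow> residues_of n k z = residues_of n k z'"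
  unfolding residues_of_def by (intro arg_cong[of _ _ concat] map_cong refl) auto

text \<open>The Chinese remainder theorem combines the separately chosen residues into one
  component.\<close>

lemma exists_residues:
  assumes "\<And>i. i < m \<Longrightarrow> b i < ps ! i"
  shows "\<exists>x\<in>{0..<int (\<Prod>(primes_P n))}. \<forall>i<m. x mod int (ps ! i) = int (b i)"
proof -
  have "\<exists>!x. x < (\<Prod>i<m. ps ! i) \<and> (\<forall>i\<in>{..<m}. [x = b i] (mod ps ! i))"
  proof (rule chinese_remainder_unique_nat)
    show "\<forall>i\<in>{..<m}. \<forall>j\<in>{..<m}. i \<noteq> j \<longrightarrow> coprime (ps ! i) (ps ! j)"
      using ps_nth(2) ps(2) by (auto simp: primes_coprime nth_eq_iff_index_eq m_def)
    show "\<forall>i\<in>{..<m}. ps ! i \<noteq> 0" using ps_nth(5) by auto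
  qed simp
  then obtain x where x: "x < (\<Prod>i<m. ps ! i)" "\<forall>i<m. x mod (ps ! i) = b i mod (ps ! i)" by (auto simp: cong_def)
  have "(\<Prod>i<m. ps ! i) = \<Prod>(primes_P n)"
    unfolding ps(1)[symmetric] using ps(2) by (simp add: prod.distinct_set_conv_list prod.list_conv_set_nth m_def lessThan_atLeast0)
  then show ?thesis using x assms by (intro bexI[of _ "int x"]) (auto simp del: of_nat_prod simp flip: zmod_int)
qed

end

context construction_step
begin

lemma tidx_less:
  assumes "i < m" "j < m" "k < n" "l < n"
  shows "tidx i j k l < m * m * n * n"
proof -
  have "(i + 1) * m \<le> m * m" by (intro mult_le_mono1) (use assms in simp)
  then have "(i * m + j + 1) * n \<le> m * m * n" using assms by (intro mult_le_mono1) simp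
  then have "((i * m + j) * n + k + 1) * n \<le> m * m * n * n" using assms by (intro mult_le_mono1) simp
  then show ?thesis using assms by simp
qed

lemma tidx_inj:
  assumes "tidx i j k l = tidx i' j' k' l'" "j < m" "k < n" "l < n" "j' < m" "k' < n" "l' < n"
  shows "i = i' \<and> j = j' \<and> k = k' \<and> l = l'"
proof -
  have inj: "a = a' \<and> b = b'" if "a * c + b = a' * c + b'" "b < c" "b' < c" for a a' b b' c :: nat
  proof -
    have "(a * c + b) div c = (a' * c + b') div c" "(a * c + b) mod c = (a' * c + b') mod c" using that(1) by simp_all
    then show ?thesis using that(2,3) by simp
  qed
  show ?thesis using inj assms by metis
qed

lemma prep0_wp:
  assumes s: "fixed_ok e s"
  shows "wp bd inp L (prep0 tab) (tab_ok z 1) s"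
proof (cases tab)
  case False
  then show ?thesis unfolding prep0_def tab_ok_def by (simp add: wp_simps)
next
  case True
  have mm: "ivar s 40 0 = int m" using s by (simp add: fixed_ok_def)
  \<comment> \<open>The nested loops visit the cells in the order of their addresses, so the
    initialised cells form an initial segment.\<close>
  define P where "P X s' \<longleftrightarrow> (\<forall>x<X. rvar s' 23 (int x) = 1)" for X and s' :: store
  have P_upd: "P X (set_ivar a b y s') \<longleftrightarrow> P X s'" for X a b y and s' :: store by (simp add: P_def)
  have "wp bd inp L (For 6 1 (sc 40) (For 8 1 (sc 40) (For 10 2 Size (For 11 2 Size (Rset 23 tab_idx (rnum 1)))))) (P (m * m * n * n)) s"
  proof (rule wp_For[where N = m and Inv = "\<lambda>i s'. P (tidx i 0 0 0) s'"], goal_cases)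
    case (5 i s1)
    note fr1 = same_outsideD[OF 5(2), simplified]
    show ?case
    proof (rule wp_For[where N = m and Inv = "\<lambda>j s'. P (tidx i j 0 0) s'"], goal_cases)
      case (5 j s2)
      note fr2 = same_outsideD[OF 5(2), simplified]
      show ?case
      proof (rule wp_For[where N = n and Inv = "\<lambda>k s'. P (tidx i j k 0) s'"], goal_cases)
        case (5 k s3)
        note fr3 = same_outsideD[OF 5(2), simplified]
        show ?case
        proof (rule wp_For[where N = n and Inv = "\<lambda>l s'. P (tidx i j k l) s'"], goal_cases)
          case (5 l s4)
          note fr4 = same_outsideD[OF 5(2), simplified]
          have idx: "((int i * int m + int j) * int n + int k) * int n + int l = int (tidx i j k l)" by simp
          have lt: "tidx i j k l < L" using tidx_less[OF \<open>i < m\<close> \<open>j < m\<close> \<open>k < n\<close> 5(1)] Lt[OF True] by linarith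
          have "P (Suc (tidx i j k l)) (set_rvar 23 (int (tidx i j k l)) 1 (set_ivar 11 0 (int l) s4))"
            using 5(3) by (simp add: P_def less_Suc_eq del: of_nat_add of_nat_mult)
          then show ?case using L_bounds lt
            by (simp add: wp_simps fr4 fr3 fr2 fr1 mm idx del: of_nat_add of_nat_mult)
        next
          case (6 s4)
          then show ?case by (simp add: P_upd algebra_simps)
        qed (use 5 n L_bounds in \<open>auto simp: P_upd\<close>)
      next
        case (6 s3)
        then show ?case by (simp add: P_upd algebra_simps)
      qed (use 5 n L_bounds in \<open>auto simp: P_upd\<close>)
    next
      case (6 s2)
      then show ?case by (simp add: P_upd algebra_simps)
    qed (use 5 mm L_bounds in \<open>auto simp: P_upd fr1\<close>)
  next
    case (6 s1)
    then show ?case by (simp add: P_upd algebra_simps)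
  qed (use mm L_bounds in \<open>auto simp: P_upd P_def\<close>)
  then have "wp bd inp L (prep0 tab) (P (m * m * n * n)) s" using True by (simp add: prep0_def)
  then show ?thesis
  proof (rule wp_conseq)
    fix s' assume P: "P (m * m * n * n) s'"
    show "tab_ok z 1 s'" unfolding tab_ok_def
    proof (intro impI allI)
      fix i j k l assume a: "i < m" "j < m" "k < ps ! i" "l < ps ! j"
      then have "tidx i j k l < m * m * n * n"
        using ps_nth(3)[OF a(1)] ps_nth(3)[OF a(2)] by (intro tidx_less) auto
      then show "rvar s' 23 (int (tidx i j k l)) = Wf z 1 (ps ! i) (ps ! j) k l"
        using P by (simp add: P_def Wf_def del: of_nat_add of_nat_mult)
    qed
  qed
qed

lemma prep_wp:
  assumes s: "fixed_ok e s" "resd z S s" "tab_ok z (S - 1) s" "ivar s 5 0 = int (S - 2)" and S: "2 \<le> S" "S \<le> d"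
  shows "wp bd inp L (prep tab) (tab_ok z S) s"
proof (cases tab)
  case False
  then show ?thesis unfolding prep_def tab_ok_def by (simp add: wp_simps)
next
  case True
  have mm: "ivar s 40 0 = int m" and pr: "i < m \<Longrightarrow> ivar s 2 (int i) = int (ps ! i)" for i
    using s(1) by (simp_all add: fixed_ok_def)
  define Q where "Q D s' \<longleftrightarrow> (\<forall>i<m. \<forall>j<m. \<forall>k<ps ! i. \<forall>l<ps ! j. rvar s' 23 (int (tidx i j k l)) =
      Wf z (if D i j k l then S else S - 1) (ps ! i) (ps ! j) k l)" for D and s' :: store
  have Q_upd: "Q D (set_ivar a b y s') \<longleftrightarrow> Q D s'" for D a b y and s' :: store by (simp add: Q_def)
  have Q_cong: "Q D s' \<Longrightarrow> (\<And>i j k l. i < m \<Longrightarrow> j < m \<Longrightarrow> k < ps ! i \<Longrightarrow> l < ps ! j \<Longrightarrow> D i j k l = D' i j k l) \<Longrightarrow> Q D' s'"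
    for D D' and s' :: store by (simp add: Q_def)
  \<comment> \<open>The index tuples already updated, in lexicographic order; each cell is
    multiplied once.\<close>
  define D where "D i0 j0 k0 l0 i j k l \<longleftrightarrow> i < i0 \<or> i = i0 \<and> (j < j0 \<or> j = j0 \<and> (k < k0 \<or> k = k0 \<and> l < l0))"
    for i0 j0 k0 l0 i j k l :: nat
  have Q0: "Q (D 0 0 0 0) s" using s(3) unfolding tab_ok_def using True by (simp add: Q_def D_def)
  have WS: "Wf z (S - 1) p q k l * fac z (S - 1) p q k l = Wf z S p q k l" for p q k l
    using S by (cases S) (auto simp: Wf_def prod.atLeastLessThan_Suc)
  have S2: "Suc (S - 2) = S - 1" using S by simp
  have "wp bd inp L (For 6 1 (sc 40) (iset 7 (Iv 2 (sc 6)) ;;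
       For 8 1 (sc 40) (iset 9 (Iv 2 (sc 8)) ;;
         For 10 2 (sc 7) (For 11 2 (sc 9)
           (rset 10 (Rv 23 tab_idx) ;; mulfac ;; Rset 23 tab_idx (rsc 10)))))) (Q (D m 0 0 0)) (set_ivar 12 0 (int (S - 2)) s)"
  proof (rule wp_For[where N = m and Inv = "\<lambda>i s'. Q (D i 0 0 0) s'"], goal_cases)
    case (5 i s1)
    note fr1 = same_outsideD[OF 5(2), unfolded mulfac_def, simplified]
    have i: "i < m" by fact
    have "wp bd inp L (For 8 1 (sc 40) (iset 9 (Iv 2 (sc 8)) ;;
         For 10 2 (sc 7) (For 11 2 (sc 9)
           (rset 10 (Rv 23 tab_idx) ;; mulfac ;; Rset 23 tab_idx (rsc 10))))) (Q (D (Suc i) 0 0 0)) (set_ivar 7 0 (int (ps ! i)) (set_ivar 6 0 (int i) s1))"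
    proof (rule wp_For[where N = m and Inv = "\<lambda>j s'. Q (D i j 0 0) s'"], goal_cases)
      case (5 j s2)
      note fr2 = same_outsideD[OF 5(2), unfolded mulfac_def, simplified]
      have j: "j < m" by fact
      have "wp bd inp L (For 10 2 (sc 7) (For 11 2 (sc 9)
           (rset 10 (Rv 23 tab_idx) ;; mulfac ;; Rset 23 tab_idx (rsc 10)))) (Q (D i (Suc j) 0 0)) (set_ivar 9 0 (int (ps ! j)) (set_ivar 8 0 (int j) s2))"
      proof (rule wp_For[where N = "ps ! i" and Inv = "\<lambda>k s'. Q (D i j k 0) s'"], goal_cases)
        case (5 k s3)
        note fr3 = same_outsideD[OF 5(2), unfolded mulfac_def, simplified]
        have k: "k < ps ! i" by fact
        show ?case
        proof (rule wp_For[where N = "ps ! j" and Inv = "\<lambda>l s'. Q (D i j k l) s'"], goal_cases)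
          case (5 l s4)
          note fr4 = same_outsideD[OF 5(2), unfolded mulfac_def, simplified]
          have l: "l < ps ! j" by fact
          have kl: "k < n" "l < n" using k l ps_nth(3)[OF i] ps_nth(3)[OF j] by linarith+
          have idx: "((int i * int m + int j) * int n + int k) * int n + int l = int (tidx i j k l)" by simp
          have lt: "tidx i j k l < L" using tidx_less[OF i j kl] Lt[OF True] by linarith
          have old: "rvar s4 23 (int (tidx i j k l)) = Wf z (S - 1) (ps ! i) (ps ! j) k l"
            using 5(3) i j k l by (simp add: Q_def D_def del: of_nat_add of_nat_mult)
          let ?s5 = "set_rvar 10 0 (Wf z (S - 1) (ps ! i) (ps ! j) k l) (set_ivar 11 0 (int l) s4)"
          have v: "ivar ?s5 12 0 = int (S - 2)" "ivar ?s5 40 0 = int m" "ivar ?s5 6 0 = int i" "ivar ?s5 7 0 = int (ps ! i)"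
            "ivar ?s5 8 0 = int j" "ivar ?s5 9 0 = int (ps ! j)" "ivar ?s5 10 0 = int k" "ivar ?s5 11 0 = int l"
            using mm by (simp_all add: fr4 fr3 fr2 fr1)
          have r5: "resd z S ?s5" using s(2) by (simp add: resd_def fr4 fr3 fr2 fr1)
          have "wp bd inp L mulfac (wp bd inp L (Rset 23 tab_idx (rsc 10)) (Q (D i j k (Suc l)))) ?s5"
          proof (rule wp_conseq[OF mulfac_wp[OF v ps_nth(5)[OF i] ps_nth(5)[OF j] _ _ i j refl refl r5]], goal_cases)
            case (3 s6)
            note fr6 = same_outsideD[OF 3(1), unfolded mulfac_def, simplified]
            have new: "rvar s6 10 0 = Wf z S (ps ! i) (ps ! j) k l" using 3(2) WS[of "ps ! i" "ps ! j" k l] by (simp add: S2)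
            have vs: "ivar s6 40 0 = int m" "ivar s6 6 0 = int i" "ivar s6 8 0 = int j" "ivar s6 10 0 = int k" "ivar s6 11 0 = int l"
              using v by (simp_all add: fr6)
            have "Q (D i j k (Suc l)) (set_rvar 23 (int (tidx i j k l)) (Wf z S (ps ! i) (ps ! j) k l) s6)"
              unfolding Q_def
            proof (intro allI impI)
              fix i' j' k' l' assume a: "i' < m" "j' < m" "k' < ps ! i'" "l' < ps ! j'"
              have kl': "k' < n" "l' < n" using a ps_nth(3)[OF a(1)] ps_nth(3)[OF a(2)] by linarith+
              have o: "rvar s4 23 (int (tidx i' j' k' l')) = Wf z (if D i j k l i' j' k' l' then S else S - 1) (ps ! i') (ps ! j') k' l'"
                using 5(3) a by (simp add: Q_def del: of_nat_add of_nat_mult)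
              show "rvar (set_rvar 23 (int (tidx i j k l)) (Wf z S (ps ! i) (ps ! j) k l) s6) 23 (int (tidx i' j' k' l')) =
                 Wf z (if D i j k (Suc l) i' j' k' l' then S else S - 1) (ps ! i') (ps ! j') k' l'"
              proof (cases "tidx i j k l = tidx i' j' k' l'")
                case True
                then have "i = i' \<and> j = j' \<and> k = k' \<and> l = l'" using tidx_inj[OF True j kl a(2) kl'] by blast
                then show ?thesis by (simp add: D_def)
              next
                case False
                then have "D i j k (Suc l) i' j' k' l' = D i j k l i' j' k' l'" by (auto simp: D_def less_Suc_eq)
                then show ?thesis using False o by (simp add: fr6 del: of_nat_add of_nat_mult)
              qed
            qed
            then show ?case using L_bounds lt
              by (simp add: wp_simps vs idx new del: of_nat_add of_nat_mult)
          qed (use S in auto)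
          moreover have "ivar s4 40 0 = int m" "ivar s4 6 0 = int i" "ivar s4 8 0 = int j" "ivar s4 10 0 = int k"
            using mm by (simp_all add: fr4 fr3 fr2 fr1)
          ultimately show ?case unfolding wp_Sq using L_bounds lt
            by (simp add: wp_simps(3) idx old del: of_nat_add of_nat_mult)
        next
          case 4
          show ?case using 5(3) by (simp add: Q_upd)
        next
          case (6 s4)
          have "Q (D i j (Suc k) 0) s4" by (rule Q_cong[OF 6(2)]) (auto simp: D_def)
          then show ?case by (simp add: Q_upd)
        qed (use ps_nth[OF j] L_bounds in \<open>auto simp: fr3\<close>)
      next
        case 4
        show ?case using 5(3) by (simp add: Q_upd)
      next
        case (6 s3)
        have "Q (D i (Suc j) 0 0) s3" by (rule Q_cong[OF 6(2)]) (auto simp: D_def)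
        then show ?case by (simp add: Q_upd)
      qed (use ps_nth[OF i] L_bounds in \<open>auto simp: fr2\<close>)
      moreover have "ivar s2 2 (int j) = int (ps ! j)" using pr[OF j] by (simp add: fr2 fr1)
      ultimately show ?case unfolding wp_Sq using L_bounds j by (simp add: wp_simps(2))
    next
      case 4
      show ?case using 5(3) by (simp add: Q_upd)
    next
      case (6 s2)
      have "Q (D (Suc i) 0 0 0) s2" by (rule Q_cong[OF 6(2)]) (auto simp: D_def)
      then show ?case by (simp add: Q_upd)
    qed (use mm L_bounds in \<open>auto simp: fr1\<close>)
    moreover have "ivar s1 2 (int i) = int (ps ! i)" using pr[OF i] by (simp add: fr1)
    ultimately show ?case unfolding wp_Sq using L_bounds i by (simp add: wp_simps(2))
  next
    case (6 s1)
    then show ?case by (simp add: Q_upd)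
  qed (use mm L_bounds Q0 in \<open>auto simp: Q_upd\<close>)
  then have "wp bd inp L (prep tab) (Q (D m 0 0 0)) s"
    using True L_bounds s(4) by (simp add: prep_def wp_simps(2,5))
  then show ?thesis
    by (rule wp_conseq) (simp add: Q_def D_def tab_ok_def)
qed

end

context construction_step
begin

definition good_choice :: "(nat \<Rightarrow> int) \<Rightarrow> nat \<Rightarrow> nat \<Rightarrow> nat list \<Rightarrow> bool" where
  "good_choice z S i bs \<longleftrightarrow> bs ! i < ps ! i \<and> real (rank_of (THf z S i) (ps ! i) (bs ! i)) < \<tau> * real (ps ! i) \<and>
     (\<forall>u<ps ! i. real (rank_of (THf z S i) (ps ! i) u) < \<tau> * real (ps ! i) \<longrightarrow>
        TTf z S i (\<lambda>j. int (bs ! j)) (bs ! i) \<le> TTf z S i (\<lambda>j. int (bs ! j)) u)"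

lemma TTf_cong: "(\<And>j. j < i \<Longrightarrow> w j = w' j) \<Longrightarrow> TTf z S i w v = TTf z S i w' v"
  by (simp add: TTf_def corr_def)

lemma good_choice_snoc: "i < length bs \<Longrightarrow> good_choice z S i (bs @ [b]) \<longleftrightarrow> good_choice z S i bs"
proof -
  assume i: "i < length bs"
  have "TTf z S i (\<lambda>j. int ((bs @ [b]) ! j)) v = TTf z S i (\<lambda>j. int (bs ! j)) v" for v
    by (rule TTf_cong) (use i in \<open>simp add: nth_append\<close>)
  then show ?thesis using i by (simp add: good_choice_def nth_append)
qed

lemma prime_step_frame [simp]:
  "iwr (prime_step tab) \<inter> {40, 2, 3, 4, 5, 6} = {}" "rwr (prime_step tab) \<inter> {3, 4, 5, 23} = {}"
  by (auto simp: prog_defs)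

lemma tab_ok_frame: "tab_ok z S s \<Longrightarrow> (\<And>x. rvar s' 23 x = rvar s 23 x) \<Longrightarrow> tab_ok z S s'"
  by (simp add: tab_ok_def)

lemma prime_loop_wp:
  assumes s: "fixed_ok e s" "resd z S s" "tab_ok z S s" "ivar s 5 0 = int (S - 2)" "length (outs s) = (S - 1) * m"
    and S: "2 \<le> S" "S \<le> d"
  shows "wp bd inp L (For 6 1 (sc 40) (prime_step tab)) (\<lambda>s'. \<exists>bs. length bs = m \<and> outs s' = outs s @ map int bs \<and>
    (\<forall>i<m. good_choice z S i bs)) s"
proof (rule wp_For[where N = m and Inv = "\<lambda>i s'. \<exists>bs. length bs = i \<and> outs s' = outs s @ map int bs \<and>
    (\<forall>i<length bs. good_choice z S i bs)"], goal_cases)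
  case (5 i s1)
  note fr = same_outsideD[OF 5(2)]
  obtain bs where bs: "length bs = i" "outs s1 = outs s @ map int bs" "\<forall>i<length bs. good_choice z S i bs"
    using 5(3) by blast
  let ?s2 = "set_ivar 6 0 (int i) s1"
  have nw: "40 \<notin> iwr (prime_step tab)" "2 \<notin> iwr (prime_step tab)" "3 \<notin> iwr (prime_step tab)" "4 \<notin> iwr (prime_step tab)"
     "5 \<notin> iwr (prime_step tab)" "23 \<notin> rwr (prime_step tab)" "3 \<notin> rwr (prime_step tab)" "4 \<notin> rwr (prime_step tab)" "5 \<notin> rwr (prime_step tab)"
    using prime_step_frame by blast+
  have so: "same_outside (insert 6 (iwr (prime_step tab))) (rwr (prime_step tab)) True s ?s2"
    using fr by (simp add: same_outside_def)
  have f2: "fixed_ok e ?s2"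
    by (rule fixed_ok_frame[OF so _ _ s(1)]) (use nw in auto)
  have r2: "resd z S ?s2"
  proof -
    have lt: "t * m + j < length (outs s)" if "t < S - 1" "j < m" for t j
    proof -
      have "(t + 1) * m \<le> (S - 1) * m" by (rule mult_le_mono1) (use that in simp)
      then show ?thesis using that s(5) by simp
    qed
    show ?thesis using s(2,5) lt bs(2) by (simp add: resd_def nth_append)
  qed
  have t2: "tab_ok z S ?s2" by (rule tab_ok_frame[OF s(3)]) (use fr nw in simp)
  have i2: "ivar ?s2 5 0 = int (S - 2)" "ivar ?s2 6 0 = int i" using s(4) fr nw by simp_all
  have w2: "(S - 1) * m + j < length (outs ?s2) \<and> outs ?s2 ! ((S - 1) * m + j) = int (bs ! j)" if "j < i" for j
    using that bs(1,2) s(5) by (simp add: nth_append)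
  show ?case
  proof (rule wp_conseq[OF prime_step_wp[OF f2 r2 t2 i2 5(1) S w2]], goal_cases)
    case (2 s3)
    then obtain b where b: "b < ps ! i" "real (rank_of (THf z S i) (ps ! i) b) < \<tau> * real (ps ! i)"
      "\<And>u. u < ps ! i \<Longrightarrow> real (rank_of (THf z S i) (ps ! i) u) < \<tau> * real (ps ! i) \<Longrightarrow>
         TTf z S i (\<lambda>j. int (bs ! j)) b \<le> TTf z S i (\<lambda>j. int (bs ! j)) u"
      "outs s3 = outs ?s2 @ [int b]" by auto
    have "TTf z S i (\<lambda>j. int ((bs @ [b]) ! j)) v = TTf z S i (\<lambda>j. int (bs ! j)) v" for v
      by (rule TTf_cong) (use bs(1) in \<open>simp add: nth_append\<close>)
    then have "good_choice z S i (bs @ [b])" using b bs(1) by (simp add: good_choice_def nth_append)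
    then have "\<forall>i'<length (bs @ [b]). good_choice z S i' (bs @ [b])"
      using bs(1,3) by (auto simp: less_Suc_eq good_choice_snoc)
    then show ?case using bs b(4) by (intro exI[of _ "bs @ [b]"]) simp
  qed
qed (use s L_bounds in \<open>auto simp: fixed_ok_def\<close>)

lemma good_choice_selected:
  assumes i: "i < m" and S: "2 \<le> S" and bs: "good_choice z S i bs" and x: "\<And>j. j < m \<Longrightarrow> x mod int (ps ! j) = int (bs ! j)"
  shows "selected \<alpha> \<gamma> \<tau> n S z (ps ! i) (\<lambda>q. x mod int q) (x mod int (ps ! i))"
  unfolding x[OF i]
  by (rule selected_best[where w = "\<lambda>j. int (bs ! j)"]) (use assms in \<open>auto simp: good_choice_def\<close>)

lemma cbc_pbp_extend:
  assumes z: "cbc_pbp \<alpha> \<gamma> \<tau> n k z" and k: "1 \<le> k" and bs: "length bs = m" "\<forall>i<m. good_choice z (Suc k) i bs"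
  shows "\<exists>z'. cbc_pbp \<alpha> \<gamma> \<tau> n (Suc k) z' \<and> (\<forall>j\<in>{1..k}. z' j = z j) \<and>
    residues_of n (Suc k) z' = residues_of n k z @ map int bs"
proof -
  obtain x where x: "x \<in> {0..<int (\<Prod>(primes_P n))}" "\<And>i. i < m \<Longrightarrow> x mod int (ps ! i) = int (bs ! i)"
    using exists_residues[of "\<lambda>i. bs ! i"] bs(2) by (auto simp: good_choice_def)
  define z' where "z' = z(Suc k := x)"
  have new: "selected \<alpha> \<gamma> \<tau> n (Suc k) z' p (\<lambda>q. z' (Suc k) mod int q) (z' (Suc k) mod int p)" if p: "p \<in> primes_P n" for p
  proof -
    obtain i where i: "i < m" "p = ps ! i" using p ps(1) by (metis in_set_conv_nth m_def)
    have "selected \<alpha> \<gamma> \<tau> n (Suc k) z p (\<lambda>q. x mod int q) (x mod int p)"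
      unfolding i(2) by (rule good_choice_selected[of i "Suc k" z bs]) (use i k bs x in auto)
    then show ?thesis
      by (subst selected_cong[of "Suc k" z' z]) (simp_all add: z'_def)
  qed
  have old: "selected \<alpha> \<gamma> \<tau> n s z' p (\<lambda>q. z' s mod int q) (z' s mod int p)" if "p \<in> primes_P n" "2 \<le> s" "s \<le> k" for s p
  proof -
    have "selected \<alpha> \<gamma> \<tau> n s z p (\<lambda>q. z s mod int q) (z s mod int p)" using z that by (simp add: cbc_pbp_def)
    then show ?thesis using that
      by (subst selected_cong[of s z' z]) (simp_all add: z'_def)
  qed
  have "cbc_pbp \<alpha> \<gamma> \<tau> n (Suc k) z'"
    unfolding cbc_pbp_def
  proof (intro conjI ballI)
    show "z' 1 = 1" using z k by (simp add: cbc_pbp_def z'_def)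
    fix s assume s: "s \<in> {2..Suc k}"
    show "z' s \<in> {0..<int (\<Prod>(primes_P n))}" using z s x(1) by (auto simp: cbc_pbp_def z'_def)
    fix p assume p: "p \<in> primes_P n"
    show "selected \<alpha> \<gamma> \<tau> n s z' p (\<lambda>q. z' s mod int q) (z' s mod int p)"
      using s new[OF p] old[OF p, of s] by (cases "s = Suc k") auto
  qed
  moreover have "residues_of n k z' = residues_of n k z" by (rule residues_of_cong) (auto simp: z'_def)
  moreover have "map (\<lambda>p. x mod int p) ps = map int bs"
    using x(2) bs(1) by (intro nth_equalityI) (simp_all add: m_def)
  ultimately show ?thesis by (intro exI[of _ z']) (simp add: residues_of_Suc z'_def)
qed

lemma Wf_cong: "(\<And>j. j \<in> {1..<S} \<Longrightarrow> z j = z' j) \<Longrightarrow> Wf z S p q k l = Wf z' S p q k l"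
  unfolding Wf_def fac_def by (rule prod.cong) auto

lemma tab_ok_cong: "(\<And>j. j \<in> {1..<S} \<Longrightarrow> z j = z' j) \<Longrightarrow> tab_ok z S s = tab_ok z' S s"
  unfolding tab_ok_def using Wf_cong[of S z z'] by simp

text \<open>The vector exists only in the proof: the invariant asserts some partial outcome whose
  residues form the output list. \<open>tab_ok\<close> passes to the extended vector because it
  involves earlier components only.\<close>

lemma main_loop_wp:
  assumes s: "fixed_ok e s" "tab_ok z0 1 s" "outs s = replicate m 1"
  shows "wp bd inp L (For 5 0 (Dim -! Num 1) (prep tab ;; For 6 1 (sc 40) (prime_step tab)))
    (\<lambda>s'. \<exists>z. cbc_pbp \<alpha> \<gamma> \<tau> n d z \<and> outs s' = residues_of n d z) s"
proof (rule wp_For[where N = "d - 1" and Inv = "\<lambda>k s'. \<exists>z. cbc_pbp \<alpha> \<gamma> \<tau> n (Suc k) z \<and> outs s' = residues_of n (Suc k) z \<and>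
    tab_ok z (Suc k) s'"], goal_cases)
  case 4
  let ?z = "\<lambda>_. 1 :: int"
  have one: "1 mod int (ps ! i) = 1" if "i < m" for i using ps_nth(4)[OF that] by simp
  have "residues_of n (Suc 0) ?z = replicate m 1"
    using one by (intro nth_equalityI) (simp_all add: residues_of_Suc, simp_all add: residues_of_def m_def)
  moreover have "cbc_pbp \<alpha> \<gamma> \<tau> n (Suc 0) ?z" by (simp add: cbc_pbp_def)
  moreover have "tab_ok ?z (Suc 0) s" using s(2) tab_ok_cong[of 1 z0 ?z s] by simp
  ultimately show ?case using s(3) by (intro exI[of _ ?z]) (simp add: tab_ok_def)
next
  case (5 k s1)
  note fr = same_outsideD[OF 5(2)]
  obtain z where z: "cbc_pbp \<alpha> \<gamma> \<tau> n (Suc k) z" "outs s1 = residues_of n (Suc k) z" "tab_ok z (Suc k) s1"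
    using 5(3) by blast
  let ?S = "Suc (Suc k)"
  let ?s2 = "set_ivar 5 0 (int k) s1"
  have S: "2 \<le> ?S" "?S \<le> d" using 5(1) by auto
  have f2: "fixed_ok e ?s2"
    by (rule fixed_ok_frame[OF _ _ _ s(1), where X = "insert 5 (iwr (prep tab ;; For 6 1 (sc 40) (prime_step tab)))"
      and Y = "rwr (prep tab ;; For 6 1 (sc 40) (prime_step tab))" and o' = True])
      (use fr in \<open>auto simp: same_outside_def prog_defs\<close>)
  have r2: "resd z ?S ?s2"
    using z(2) by (simp add: resd_def length_residues_of residues_of_nth)
  have t2: "tab_ok z (?S - 1) ?s2" using z(3) by (simp add: tab_ok_def)
  show ?case unfolding wp_Sq
  proof (rule wp_conseq[OF prep_wp[OF f2 r2 t2 _ S]], goal_cases)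
    case (2 s3)
    note fr3 = same_outsideD[OF 2(1)]
    have o3: "outs s3 = residues_of n (Suc k) z" "ivar s3 5 0 = int k"
      using fr3 z(2) by (simp_all add: prog_defs)
    have f3: "fixed_ok e s3"
      by (rule fixed_ok_frame[OF 2(1) _ _ f2]) (auto simp: prog_defs)
    have r3: "resd z ?S s3" using r2 o3 z(2) by (simp add: resd_def)
    show ?case
    proof (rule wp_conseq[OF prime_loop_wp[OF f3 r3 2(2) _ _ S]], goal_cases)
      case (3 s4)
      note fr4 = same_outsideD[OF 3(1)]
      obtain bs where bs: "length bs = m" "outs s4 = outs s3 @ map int bs" "\<forall>i<m. good_choice z ?S i bs" using 3(2) by blast
      obtain z' where z': "cbc_pbp \<alpha> \<gamma> \<tau> n ?S z'" "\<forall>j\<in>{1..Suc k}. z' j = z j"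
         "residues_of n ?S z' = residues_of n (Suc k) z @ map int bs"
        using cbc_pbp_extend[OF z(1) _ bs(1,3)] by auto
      have nw: "23 \<notin> rwr (prime_step tab)" using prime_step_frame by blast
      have "tab_ok z ?S s4" by (rule tab_ok_frame[OF 2(2)]) (use fr4 nw in simp)
      then have "tab_ok z' ?S s4" using tab_ok_cong[of ?S z z' s4] z'(2) by simp
      then show ?case using z' bs(2) o3 by (intro exI[of _ z']) simp
    qed (use o3 in \<open>simp_all add: length_residues_of\<close>)
  qed simp
next
  case (6 s1)
  have "Suc (d - 1) = d" using d by simp
  then show ?case using 6(2) by auto
qed (use d in auto)

end

lemma (in construction) construct_wp:
  assumes Lt: "tab \<Longrightarrow> m * m * n * n \<le> L" and s: "outs s = []"
  shows "wp bd inp L (construct tab) (\<lambda>s'. \<exists>z. cbc_pbp \<alpha> \<gamma> \<tau> n d z \<and> outs s' = residues_of n d z) s"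
  unfolding construct_def wp_Sq
proof (rule wp_conseq[OF initialise_wp], goal_cases)
  case (1 s1)
  obtain e where e: "good_exp e" "fixed_ok e s1" "outs s1 = replicate m 1" using 1(2) s by auto
  \<comment> \<open>The exponent \<open>e\<close> is known only after initialisation, so the locale
    that fixes it is entered here.\<close>
  interpret construction_step \<alpha> \<gamma> \<tau> n d L tab e by unfold_locales (use e Lt in auto)
  show ?case
  proof (rule wp_conseq[OF prep0_wp[OF e(2), of "\<lambda>_. 1"]], goal_cases)
    case (1 s2)
    have f2: "fixed_ok e s2" by (rule fixed_ok_frame[OF 1(1) _ _ e(2)]) (auto simp: prog_defs)
    have o2: "outs s2 = replicate m 1" using same_outsideD[OF 1(1)] e(3) by (simp add: prog_defs)
    show ?case by (rule main_loop_wp[OF f2 1(2) o2])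
  qed
qed

section \<open>Running time and memory\<close>

context construction
begin

lemma sizes: "1 \<le> m" "1 \<le> lg" "1 \<le> n" "1 \<le> d"
proof -
  show "1 \<le> m" using primes_P_nonempty[OF n] fin_P ps(4) by (metis One_nat_def Suc_leI card_gt_0_iff)
  have "(2::real) powr 1 \<le> 4 * real n" using n by simp
  then have "1 \<le> log 2 (4 * real n)" using n by (subst le_log_iff) auto
  then show "1 \<le> lg" unfolding lg_def by linarith
qed (use n d in auto)

text \<open>The cost factor of a kernel value: a table access, or a product over up to
  \<open>d\<close> components.\<close>

definition D :: "bool \<Rightarrow> nat" where
  "D tab = (if tab then 1 else d)"

lemma D: "1 \<le> D tab" using d by (simp add: D_def)

lemma tb_getw: "tb bd (getw tab) \<le> 300 * D tab"
proof (cases tab)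
  case True
  then show ?thesis by (simp add: getw_def D_def cell_def)
next
  case False
  then show ?thesis using sizes by (simp add: getw_def mulfac_def D_def cell_def)
qed

lemma tb_fft: "tb bd fft \<le> 10000 * (n * lg)"
proof -
  have "tb bd fft_level \<le> 2000 * n" unfolding fft_level_def using sizes by (simp add: cell_def)
  then have f: "lg * tb bd fft_level \<le> lg * (2000 * n)" by (rule mult_le_mono2)
  \<comment> \<open>Lower-order monomials are padded with ones and then dominated by the leading
    one. The numerical constants of these bounds are generous roundings.\<close>
  have g: "lg * 1 \<le> lg * n" "1 * 1 \<le> n * lg" using sizes by (intro mult_le_mono; simp)+
  show ?thesis unfolding fft_def
    apply (simp add: cell_def algebra_simps)
    using f g by (simp only: mult_ac mult_1_left mult_1_right)
qed

lemma tb_fill_x: "tb bd (fill_x tab) \<le> 5000 * (n * D tab)"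
proof -
  have f: "n * tb bd (getw tab) \<le> n * (300 * D tab)" using tb_getw by (rule mult_le_mono2)
  have g: "n * 1 \<le> n * D tab" "1 * 1 \<le> n * D tab" using sizes D by (intro mult_le_mono; simp)+
  show ?thesis unfolding fill_x_def
    apply (simp add: cell_def algebra_simps)
    using f g by (simp only: mult_ac mult_1_left mult_1_right)
qed

lemma tb_fill_y: "tb bd fill_y \<le> 1000 * n"
  unfolding fill_y_def using sizes by (simp add: cell_def)

lemma tb_conv_one: "tb bd (conv_one tab) \<le> 50000 * (n * lg * D tab)"
proof -
  have g: "n * lg * 1 \<le> n * lg * D tab" "n * 1 * D tab \<le> n * lg * D tab" "n * 1 * 1 \<le> n * lg * D tab" "1 * 1 * 1 \<le> n * lg * D tab"
    using sizes D by (intro mult_le_mono; simp)+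
  show ?thesis unfolding conv_one_def
    apply (simp add: cell_def algebra_simps)
    using g tb_fill_x[of tab] tb_fft tb_fill_y by (simp only: mult_ac mult_1_left mult_1_right)
qed

text \<open>The dominant cost: two transforms for each smaller prime \<open>q\<close> and each
  \<open>l < q\<close>.\<close>

lemma tb_conv: "tb bd (conv tab) \<le> 500000 * (m * n * n * lg * D tab)"
proof -
  have f: "m * n * tb bd (conv_one tab) \<le> m * n * (50000 * (n * lg * D tab))" using tb_conv_one by (rule mult_le_mono2)
  have g: "m * n * 1 * 1 * 1 \<le> m * n * n * lg * D tab" "m * 1 * 1 * 1 * 1 \<le> m * n * n * lg * D tab"
    "1 * n * 1 * 1 * 1 \<le> m * n * n * lg * D tab" "1 * 1 * 1 * 1 * 1 \<le> m * n * n * lg * D tab"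
    using sizes D by (intro mult_le_mono; simp)+
  show ?thesis unfolding conv_def
    apply (simp add: cell_def algebra_simps)
    using f g by (simp only: mult_ac mult_1_left mult_1_right)
qed

lemma tb_quadratic:
  "tb bd unconv \<le> 20000 * (n * n)" "tb bd select \<le> 20000 * (n * n)" "tb bd theta_table \<le> 20000 * (n * n)"
  "tb bd prim_root \<le> 20000 * (n * n)" "tb bd find_primes \<le> 20000 * (n * n)" "tb bd find_root \<le> 20000 * (n * n)"
  "tb bd root_table \<le> 20000 * (n * n)"
proof -
  have "n * 1 \<le> n * n" "1 * 1 \<le> n * n" using sizes by (intro mult_le_mono; simp)+
  then have g: "n \<le> n * n" "1 \<le> n * n" by simp_all
  show "tb bd unconv \<le> 20000 * (n * n)" "tb bd select \<le> 20000 * (n * n)" "tb bd theta_table \<le> 20000 * (n * n)"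
    "tb bd prim_root \<le> 20000 * (n * n)" "tb bd find_primes \<le> 20000 * (n * n)" "tb bd find_root \<le> 20000 * (n * n)"
    "tb bd root_table \<le> 20000 * (n * n)"
    unfolding unconv_def select_def theta_table_def prim_root_def find_primes_def find_root_def root_table_def
    apply (simp_all add: cell_def algebra_simps)
    using g by linarith+
qed

lemma tb_init_wp: "tb bd (init_wp tab) \<le> 5000 * (n * D tab)"
proof -
  have f: "n * tb bd (getw tab) \<le> n * (300 * D tab)" using tb_getw by (rule mult_le_mono2)
  have g: "n * 1 \<le> n * D tab" "1 * 1 \<le> n * D tab" using sizes D by (intro mult_le_mono; simp)+
  show ?thesis unfolding init_wp_def
    apply (simp add: cell_def algebra_simps)
    using f g by (simp only: mult_ac mult_1_left mult_1_right)
qed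

lemma tb_add_larger: "tb bd (add_larger tab) \<le> 20000 * (m * n * n * D tab)"
proof -
  have f: "m * n * n * tb bd (getw tab) \<le> m * n * n * (300 * D tab)" using tb_getw by (rule mult_le_mono2)
  have g: "m * n * n * 1 \<le> m * n * n * D tab" "m * n * 1 * 1 \<le> m * n * n * D tab" "m * 1 * 1 * 1 \<le> m * n * n * D tab"
    "1 * 1 * 1 * 1 \<le> m * n * n * D tab"
    using sizes D by (intro mult_le_mono; simp)+
  show ?thesis unfolding add_larger_def
    apply (simp add: cell_def algebra_simps)
    using f g by (simp only: mult_ac mult_1_left mult_1_right)
qed

lemma tb_prime_step: "tb bd (prime_step tab) \<le> 1000000 * (m * n * n * lg * D tab)"
proof -
  have g: "m * n * n * 1 * D tab \<le> m * n * n * lg * D tab" "1 * n * n * 1 * 1 \<le> m * n * n * lg * D tab"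
    "1 * n * 1 * 1 * D tab \<le> m * n * n * lg * D tab" "1 * 1 * 1 * 1 * 1 \<le> m * n * n * lg * D tab"
    using sizes D by (intro mult_le_mono; simp)+
  show ?thesis unfolding prime_step_def
    apply (simp add: cell_def algebra_simps)
    using g tb_conv[of tab] tb_add_larger[of tab] tb_init_wp[of tab] tb_quadratic(1-4)
    by (simp only: mult_ac mult_1_left mult_1_right)
qed

lemma tb_tables: "tb bd (prep tab) \<le> 20000 * (m * m * n * n)" "tb bd (prep0 tab) \<le> 20000 * (m * m * n * n)"
  "tb bd initialise \<le> 1000000 * (m * m * n * n)"
proof -
  have g: "m * m * n * 1 \<le> m * m * n * n" "m * m * 1 * 1 \<le> m * m * n * n" "m * 1 * 1 * 1 \<le> m * m * n * n"
    "1 * 1 * 1 * 1 \<le> m * m * n * n" "1 * 1 * n * n \<le> m * m * n * n" "m * 1 * n * 1 \<le> m * m * n * n"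
    using sizes by (intro mult_le_mono; simp)+
  show "tb bd (prep tab) \<le> 20000 * (m * m * n * n)"
  proof (cases tab)
    case True
    show ?thesis unfolding prep_def mulfac_def
      apply (simp add: True cell_def algebra_simps)
      using g by (simp only: mult_ac mult_1_left mult_1_right)
  next
    case False
    then show ?thesis using sizes by (simp add: prep_def)
  qed
  show "tb bd (prep0 tab) \<le> 20000 * (m * m * n * n)"
  proof (cases tab)
    case True
    show ?thesis unfolding prep0_def
      apply (simp add: True cell_def algebra_simps)
      using g by (simp only: mult_ac mult_1_left mult_1_right)
  next
    case False
    then show ?thesis using sizes by (simp add: prep0_def)
  qed
  have s: "tb bd shift_consts \<le> 2000 * (m * m * n * n)"
    unfolding shift_consts_def
    apply (simp add: cell_def algebra_simps)
    using g by (simp only: mult_ac mult_1_left mult_1_right)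
  have e: "tb bd emit_first \<le> 1000 * (m * m * n * n)"
    unfolding emit_first_def
    apply (simp add: cell_def algebra_simps)
    using g by (simp only: mult_ac mult_1_left mult_1_right)
  show "tb bd initialise \<le> 1000000 * (m * m * n * n)" unfolding initialise_def
    apply (simp add: cell_def algebra_simps)
    using s e g tb_quadratic(5-7) by (simp only: mult_ac mult_1_left mult_1_right)
qed

lemma tb_construct: "tb bd (construct tab) \<le> 10000000 * (d * (m * m * n * n * lg * D tab))"
proof -
  define X where "X = m * m * n * n * lg * D tab"
  have le: "m * m * n * n * 1 * 1 \<le> X" "m * 1 * 1 * 1 * 1 * 1 \<le> X" "1 * 1 * 1 * 1 * 1 * 1 \<le> X"
    unfolding X_def using sizes D by (intro mult_le_mono; simp)+
  have t: "tb bd (prep tab) \<le> 20000 * X" "tb bd (prep0 tab) \<le> 20000 * X" "tb bd initialise \<le> 1000000 * X"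
    using tb_tables(1)[of tab] tb_tables(2)[of tab] tb_tables(3) le(1) by linarith+
  have "m * tb bd (prime_step tab) \<le> m * (1000000 * (m * n * n * lg * D tab))" using tb_prime_step by (rule mult_le_mono2)
  also have "\<dots> = 1000000 * X" by (simp add: X_def)
  finally have ps: "m * tb bd (prime_step tab) \<le> 1000000 * X" .
  define body where "body = (prep tab ;; For 6 1 (sc 40) (prime_step tab))"
  have "tb bd body \<le> 2000000 * X"
    unfolding body_def
    apply (simp add: cell_def algebra_simps)
    using ps le t by (simp only: mult_ac mult_1_left mult_1_right)
  then have b: "d * tb bd body \<le> d * (2000000 * X)" by (rule mult_le_mono2)
  have g: "1 * X \<le> d * X" "d * 1 \<le> d * X" "1 * 1 \<le> d * X" using sizes le by (intro mult_le_mono; simp)+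
  show ?thesis unfolding construct_def X_def[symmetric] body_def[symmetric]
    apply (simp add: cell_def algebra_simps)
    using b g t by (simp only: mult_ac mult_1_left mult_1_right)
qed

text \<open>From \<open>4 * n \<le> n ^ 3\<close>, which holds from \<open>n = 2\<close> on, and
  \<open>ln 2 \<ge> 1 / 2\<close>.\<close>

lemma lg_le: "real lg \<le> 6 * ln (real n)"
proof -
  have "4 * real n \<le> real n ^ 3"
  proof -
    have "(2::real) * 2 \<le> real n * real n" using n by (intro mult_mono) auto
    then have "(4::real) * real n \<le> (real n * real n) * real n" by (intro mult_right_mono) auto
    then show ?thesis by (simp add: power3_eq_cube)
  qed
  then have "ln (4 * real n) \<le> ln (real n ^ 3)" using n by (subst ln_le_cancel_iff) auto
  also have "\<dots> = 3 * ln (real n)" using n by (simp add: ln_realpow)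
  finally have l: "ln (4 * real n) \<le> 3 * ln (real n)" .
  have "1 / 2 \<le> ln (2::real)" using ln2_ge_two_thirds by simp
  have "real lg \<le> log 2 (4 * real n)" unfolding lg_def using sizes n by (simp add: le_log_iff)
  also have "\<dots> = ln (4 * real n) / ln 2" by (simp add: log_def)
  also have "\<dots> \<le> 6 * ln (real n)"
  proof -
    have "0 \<le> ln (real n)" using n by simp
    then have "6 * ln (real n) * (1 / 2) \<le> 6 * ln (real n) * ln 2"
      using \<open>1 / 2 \<le> ln 2\<close> by (intro mult_left_mono) auto
    then show ?thesis using l by (simp add: divide_le_eq)
  qed
  finally show ?thesis .
qed

lemma table_size_le: "real (m * m * n * n) \<le> 9 * (real n ^ 4 / (ln (real n))\<^sup>2)"
proof -
  have ln: "0 < ln (real n)" using n by simp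
  have "real m \<le> 3 * real n / ln (real n)"
    using card_primes_P_upper[OF n] ln ps(4) by (simp add: le_divide_eq)
  then have "real m * real m \<le> (3 * real n / ln (real n)) * (3 * real n / ln (real n))"
    by (intro mult_mono) auto
  then have "(real m * real m) * (real n * real n) \<le> (3 * real n / ln (real n)) * (3 * real n / ln (real n)) * (real n * real n)"
    by (intro mult_right_mono) auto
  also have "\<dots> = 9 * (real n ^ 4 / (ln (real n))\<^sup>2)" using ln
    by (simp add: power2_eq_square power4_eq_xxxx)
  finally show ?thesis by (simp add: mult_ac)
qed

text \<open>The constant is the product of 10000000, of 9 from the table size and of 6 from
  \<open>lg_le\<close>. One of the two logarithms in the denominator cancels against
  \<open>lg\<close>.\<close>

lemma time_le: "real (tb bd (construct tab)) \<le> 540000000 * (real (D tab) * (real d * real n ^ 4 / ln (real n)))"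
proof -
  have ln: "0 < ln (real n)" using n by simp
  have "real (tb bd (construct tab)) \<le> real (10000000 * (d * (m * m * n * n * lg * D tab)))"
    using tb_construct by (rule of_nat_mono)
  also have "\<dots> = 10000000 * (real d * real (D tab)) * (real (m * m * n * n) * real lg)" by (simp add: mult_ac)
  also have "\<dots> \<le> 10000000 * (real d * real (D tab)) * ((9 * (real n ^ 4 / (ln (real n))\<^sup>2)) * (6 * ln (real n)))"
    using table_size_le lg_le ln by (intro mult_left_mono mult_mono) auto
  also have "\<dots> = 540000000 * (real (D tab) * (real d * real n ^ 4 / ln (real n)))"
    using ln by (simp add: power2_eq_square field_simps)
  finally show ?thesis .
qed

text \<open>The arrays of linear length must fit into the claimed memory as well;
  \<open>ln n \<le> n\<close> suffices for this.\<close>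

lemma n_le_table: "real n \<le> real n ^ 4 / (ln (real n))\<^sup>2"
proof -
  have ln: "0 < ln (real n)" using n by simp
  have "ln (real n) \<le> real n" using n ln_le_minus_one[of "real n"] by simp
  then have "(ln (real n))\<^sup>2 \<le> (real n)\<^sup>2" using ln by (intro power_mono) auto
  moreover have "(real n)\<^sup>2 * real n \<le> real n ^ 4"
    using power_increasing[of 3 4 "real n"] n by (simp add: power2_eq_square power3_eq_cube)
  ultimately have "real n * (ln (real n))\<^sup>2 \<le> real n ^ 4"
    by (metis mult.commute mult_left_mono of_nat_0_le_iff order_trans)
  then show ?thesis using ln by (simp add: le_divide_eq)
qed

lemma construct_exec:
  assumes "tab \<Longrightarrow> m * m * n * n \<le> L"
  shows "\<exists>z t st. cbc_pbp \<alpha> \<gamma> \<tau> n d z \<and> exec inp (n_slots * L) (comp (construct tab)) init_state t st \<and>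
    outlist st = residues_of n d z \<and> t \<le> tb bd (construct tab)"
proof -
  define s0 where "s0 = \<lparr>ivar = \<lambda>_ _. 0, rvar = \<lambda>_ _. 0, outs = []\<rparr>"
  have r0: "rep L s0 init_state" by (simp add: rep_def s0_def init_state_def)
  have "wp bd inp L (construct tab) (\<lambda>s'. \<exists>z. cbc_pbp \<alpha> \<gamma> \<tau> n d z \<and> outs s' = residues_of n d z) s0"
    by (rule construct_wp) (use assms in \<open>simp_all add: s0_def\<close>)
  then obtain z where z: "ok bd inp L (construct tab) s0" "cbc_pbp \<alpha> \<gamma> \<tau> n d z"
    "outs (run inp (construct tab) s0) = residues_of n d z" by (auto simp: wp_def)
  obtain t st where "exec inp (n_slots * L) (comp (construct tab)) init_state t st" "t \<le> tb bd (construct tab)"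
    "rep L (run inp (construct tab) s0) st"
    using comp_correct[OF r0 wf_construct z(1)] L_bounds by auto
  then show ?thesis using z by (auto simp: rep_def)
qed

end

lemma constructs_within_table:
  "constructs_within (comp (construct True)) (\<lambda>d n. real d * real n ^ 4 / ln (real n)) (\<lambda>n. real n ^ 4 / (ln (real n))\<^sup>2)"
  unfolding constructs_within_def
proof (intro exI[of _ "1000000000"] conjI allI impI)
  fix d :: nat and \<alpha> :: real and \<gamma> :: "nat \<Rightarrow> real" and \<tau> :: real and n :: nat
  assume a: "1 \<le> d" "1 / 2 < \<alpha>" "\<forall>j\<ge>1. 0 < \<gamma> j" "0 < \<tau>" "\<tau> < 1" "2 \<le> n"
  define c where "c = card (primes_P n)"
  \<comment> \<open>Room for the linear arrays and for the kernel table. Interleaving gives every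
    slot this size, at the price of the constant factor \<open>n_slots\<close>.\<close>
  define L where "L = 4 * n + 3 + c * c * n * n"
  interpret construction \<alpha> \<gamma> \<tau> n d L by unfold_locales (use a in \<open>auto simp: L_def\<close>)
  have mm: "m = c" using ps(4) by (simp add: c_def)
  obtain z t st where z: "cbc_pbp \<alpha> \<gamma> \<tau> n d z" "exec inp (n_slots * L) (comp (construct True)) init_state t st"
    "outlist st = residues_of n d z" "t \<le> tb bd (construct True)"
    using construct_exec[of True] by (auto simp: mm L_def)
  have "real t \<le> real (tb bd (construct True))" using z(4) by simp
  also have "\<dots> \<le> 540000000 * (real d * real n ^ 4 / ln (real n))" using time_le[of True] by (simp add: D_def)
  also have "\<dots> \<le> 1000000000 * (real d * real n ^ 4 / ln (real n))" using a by (intro mult_right_mono) auto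
  finally have t: "real t \<le> 1000000000 * (real d * real n ^ 4 / ln (real n))" .
  have "real L \<le> 6 * real n + real (c * c * n * n)" using a by (simp add: L_def)
  also have "\<dots> \<le> 15 * (real n ^ 4 / (ln (real n))\<^sup>2)" using n_le_table table_size_le unfolding mm by linarith
  finally have "real (2 * (n_slots * L)) \<le> 1000000000 * (real n ^ 4 / (ln (real n))\<^sup>2)" using n_le_table by (simp add: n_slots_def)
  then show "\<exists>z M t st. cbc_pbp \<alpha> \<gamma> \<tau> n d z \<and> exec (problem_input \<alpha> \<gamma> \<tau> n d) M (comp (construct True)) init_state t st \<and>
      outlist st = residues_of n d z \<and> real t \<le> 1000000000 * (real d * real n ^ 4 / ln (real n)) \<and>
      real (2 * M) \<le> 1000000000 * (real n ^ 4 / (ln (real n))\<^sup>2)"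
    using z t unfolding inp_def by blast
qed simp

lemma constructs_within_linear:
  "constructs_within (comp (construct False)) (\<lambda>d n. real d * (real d * real n ^ 4 / ln (real n))) (\<lambda>n. real n)"
  unfolding constructs_within_def
proof (intro exI[of _ "1000000000"] conjI allI impI)
  fix d :: nat and \<alpha> :: real and \<gamma> :: "nat \<Rightarrow> real" and \<tau> :: real and n :: nat
  assume a: "1 \<le> d" "1 / 2 < \<alpha>" "\<forall>j\<ge>1. 0 < \<gamma> j" "0 < \<tau>" "\<tau> < 1" "2 \<le> n"
  define L where "L = 4 * n + 3"
  interpret construction \<alpha> \<gamma> \<tau> n d L by unfold_locales (use a in \<open>auto simp: L_def\<close>)
  obtain z t st where z: "cbc_pbp \<alpha> \<gamma> \<tau> n d z" "exec inp (n_slots * L) (comp (construct False)) init_state t st"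
    "outlist st = residues_of n d z" "t \<le> tb bd (construct False)"
    using construct_exec[of False] by auto
  have "real t \<le> real (tb bd (construct False))" using z(4) by simp
  also have "\<dots> \<le> 540000000 * (real d * (real d * real n ^ 4 / ln (real n)))" using time_le[of False] by (simp add: D_def)
  also have "\<dots> \<le> 1000000000 * (real d * (real d * real n ^ 4 / ln (real n)))" using a by (intro mult_right_mono) auto
  finally have t: "real t \<le> 1000000000 * (real d * (real d * real n ^ 4 / ln (real n)))" .
  have "real (2 * (n_slots * L)) \<le> 1000000000 * real n" using a by (simp add: n_slots_def L_def)
  then show "\<exists>z M t st. cbc_pbp \<alpha> \<gamma> \<tau> n d z \<and> exec (problem_input \<alpha> \<gamma> \<tau> n d) M (comp (construct False)) init_state t st \<and>
      outlist st = residues_of n d z \<and> real t \<le> 1000000000 * (real d * (real d * real n ^ 4 / ln (real n))) \<and>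
      real (2 * M) \<le> 1000000000 * real n"
    using z t unfolding inp_def by blast
qed simp

text \<open>A run of the program exhibits an outcome.\<close>

lemma exists_cbc_pbp:
  assumes "1 \<le> d" "1 / 2 < \<alpha>" "\<And>j. 1 \<le> j \<Longrightarrow> 0 < \<gamma> j" "0 < \<tau>" "\<tau> < 1" "2 \<le> n"
  shows "\<exists>z. cbc_pbp \<alpha> \<gamma> \<tau> n d z"
proof -
  interpret construction \<alpha> \<gamma> \<tau> n d "4 * n + 3" by unfold_locales (use assms in auto)
  show ?thesis using construct_exec[of False] by auto
qed

section \<open>The theorem\<close>

lemma error_bound:
  assumes "1 / 2 < \<alpha>" "\<And>j. 1 \<le> j \<Longrightarrow> 0 < \<gamma> j" "0 < \<tau>" "\<tau> < 1" "2 \<le> n"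
    and z: "cbc_pbp \<alpha> \<gamma> \<tau> n d z" and d': "d' \<in> {1..d}" and lam: "1 / 2 \<le> lam" "lam < \<alpha>"
  shows "e_ran d' \<alpha> \<gamma> (Q_ran_pr n z) \<le> ereal (sqrt (12288 * K0 lam \<tau> * ln (real n)) / real n powr (lam + 1 / 2)
    * mu_sum d' \<alpha> \<gamma> lam powr lam)"
proof -
  let ?S = "\<Sum>p\<in>primes_P n. \<Sum>q\<in>primes_P n. pair_sum \<alpha> \<gamma> d' z p q"
  define c where "c = real (card (primes_P n))"
  define \<mu> where "\<mu> = mu_sum d' \<alpha> \<gamma> lam"
  have ne: "primes_P n \<noteq> {}" using primes_P_nonempty[OF assms(5)] .
  then have c: "0 < c" using finite_primes_P by (simp add: c_def card_gt_0_iff)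
  have K: "0 \<le> K0 lam \<tau>" using assms(3,4) by (simp add: K0_def)
  have nc: "real n \<le> 12288 * (ln (real n) * c)" using card_primes_P_lower[OF assms(5)] by (simp add: c_def)
  have ln: "0 \<le> ln (real n)" using assms(5) by simp
  have S: "?S \<le> c * (K0 lam \<tau> * (real n powr (- (2 * lam)) * \<mu> powr (2 * lam)))"
    unfolding c_def \<mu>_def by (rule sum_pair_sum_le) (use assms in auto)
  have "K0 lam \<tau> * real n \<le> K0 lam \<tau> * (12288 * (ln (real n) * c))" using nc K by (rule mult_left_mono)
  \<comment> \<open>By Chebyshev's lower bound a division by \<open>c\<close> costs at most a
    constant times \<open>ln n / n\<close>; after the square root this yields both the logarithm and
    the extra \<open>n powr (1 / 2)\<close>.\<close>
  then have Kc: "K0 lam \<tau> / c \<le> 12288 * K0 lam \<tau> * ln (real n) / real n"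
    using c assms(5) by (simp add: field_simps)
  have "e_ran d' \<alpha> \<gamma> (Q_ran_pr n z) \<le> ereal (sqrt ?S / c)"
    unfolding c_def by (rule e_ran_le) (use assms ne in auto)
  also have "sqrt ?S / c \<le> sqrt (12288 * K0 lam \<tau> * ln (real n)) / real n powr (lam + 1 / 2) * \<mu> powr lam"
  proof -
    have sq: "x powr (2 * lam) = (x powr lam)\<^sup>2" "x powr (- (2 * lam)) = (x powr (- lam))\<^sup>2" for x :: real
      by (simp_all add: power2_eq_square flip: powr_add)
    have "sqrt ?S / c \<le> sqrt (c * (K0 lam \<tau> * (real n powr (- (2 * lam)) * \<mu> powr (2 * lam)))) / c"
      using S c by (intro divide_right_mono) auto
    also have "\<dots> = sqrt (K0 lam \<tau> / c) * (real n powr (- lam) * \<mu> powr lam)"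
    proof -
      have "c * (K0 lam \<tau> * (real n powr (- (2 * lam)) * \<mu> powr (2 * lam))) =
          K0 lam \<tau> / c * (c * (real n powr (- lam) * \<mu> powr lam))\<^sup>2"
        unfolding sq using c by (simp add: power2_eq_square)
      then show ?thesis using c by (simp add: real_sqrt_mult del: times_divide_eq_left)
    qed
    also have "\<dots> \<le> sqrt (12288 * K0 lam \<tau> * ln (real n) / real n) * (real n powr (- lam) * \<mu> powr lam)"
      using Kc by (intro mult_right_mono) auto
    also have "\<dots> = sqrt (12288 * K0 lam \<tau> * ln (real n)) / real n powr (lam + 1 / 2) * \<mu> powr lam"
    proof -
      have "real n powr (lam + 1 / 2) = real n powr lam * sqrt (real n)"
        using powr_half_sqrt[of "real n"] by (simp only: powr_add)
      then show ?thesis using assms(5) by (simp add: real_sqrt_divide powr_minus divide_simps)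
    qed
    finally show ?thesis .
  qed
  finally show ?thesis by (simp add: \<mu>_def)
qed

theorem proposition4p5:
  shows
    "(\<exists>C :: real \<Rightarrow> real \<Rightarrow> real.
        (\<forall>\<tau> lam. 0 < \<tau> \<longrightarrow> \<tau> < 1 \<longrightarrow> 1 / 2 \<le> lam \<longrightarrow> 0 < C \<tau> lam) \<and>
        (\<forall>(d::nat) (\<alpha>::real) (\<gamma> :: nat \<Rightarrow> real) (\<tau>::real) (n::nat).
           1 \<le> d \<longrightarrow> 1 / 2 < \<alpha> \<longrightarrow> (\<forall>j\<ge>1. 0 < \<gamma> j) \<longrightarrow> 0 < \<tau> \<longrightarrow> \<tau> < 1 \<longrightarrow> 2 \<le> n \<longrightarrow>
             (\<exists>z. cbc_pbp \<alpha> \<gamma> \<tau> n d z) \<and>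
             (\<forall>z. cbc_pbp \<alpha> \<gamma> \<tau> n d z \<longrightarrow>
                (\<forall>d'\<in>{1..d}. \<forall>lam. 1 / 2 \<le> lam \<longrightarrow> lam < \<alpha> \<longrightarrow>
                   e_ran d' \<alpha> \<gamma> (Q_ran_pr n z)
                     \<le> ereal (sqrt (C \<tau> lam * ln (real n)) / real n powr (lam + 1 / 2)
                               * mu_sum d' \<alpha> \<gamma> lam powr lam)))))
     \<and> (\<exists>c. constructs_within c
              (\<lambda>d n. real d * real n ^ 4 / ln (real n))
              (\<lambda>n. real n ^ 4 / (ln (real n))\<^sup>2))
     \<and> (\<exists>c. constructs_within c
              (\<lambda>d n. real d * (real d * real n ^ 4 / ln (real n)))
              (\<lambda>n. real n))"
proof (intro conjI)
  \<comment> \<open>The witness for \<open>C\<close>: the constant of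
    \<open>card_primes_P_lower\<close> times \<open>K0\<close>, which involves \<tau> and
    \<open>lam\<close> alone.\<close>
  have "0 < 12288 * K0 lam \<tau>" if "0 < \<tau>" "\<tau> < 1" for \<tau> lam :: real
    unfolding K0_def using that by (intro mult_pos_pos add_pos_pos) auto
  moreover have "(\<exists>z. cbc_pbp \<alpha> \<gamma> \<tau> n d z) \<and>
             (\<forall>z. cbc_pbp \<alpha> \<gamma> \<tau> n d z \<longrightarrow>
                (\<forall>d'\<in>{1..d}. \<forall>lam. 1 / 2 \<le> lam \<longrightarrow> lam < \<alpha> \<longrightarrow>
                   e_ran d' \<alpha> \<gamma> (Q_ran_pr n z)
                     \<le> ereal (sqrt (12288 * K0 lam \<tau> * ln (real n)) / real n powr (lam + 1 / 2)
                               * mu_sum d' \<alpha> \<gamma> lam powr lam)))"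
    if "1 \<le> d" "1 / 2 < \<alpha>" "\<forall>j\<ge>1. 0 < \<gamma> j" "0 < \<tau>" "\<tau> < 1" "2 \<le> n" for d n :: nat and \<alpha> \<tau> :: real and \<gamma> :: "nat \<Rightarrow> real"
    using that by (intro conjI exists_cbc_pbp allI impI ballI error_bound[of \<alpha> \<gamma> \<tau> n d]) auto
  ultimately show "\<exists>C :: real \<Rightarrow> real \<Rightarrow> real.
        (\<forall>\<tau> lam. 0 < \<tau> \<longrightarrow> \<tau> < 1 \<longrightarrow> 1 / 2 \<le> lam \<longrightarrow> 0 < C \<tau> lam) \<and>
        (\<forall>(d::nat) (\<alpha>::real) (\<gamma> :: nat \<Rightarrow> real) (\<tau>::real) (n::nat).
           1 \<le> d \<longrightarrow> 1 / 2 < \<alpha> \<longrightarrow> (\<forall>j\<ge>1. 0 < \<gamma> j) \<longrightarrow> 0 < \<tau> \<longrightarrow> \<tau> < 1 \<longrightarrow> 2 \<le> n \<longrightarrow>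
             (\<exists>z. cbc_pbp \<alpha> \<gamma> \<tau> n d z) \<and>
             (\<forall>z. cbc_pbp \<alpha> \<gamma> \<tau> n d z \<longrightarrow>
                (\<forall>d'\<in>{1..d}. \<forall>lam. 1 / 2 \<le> lam \<longrightarrow> lam < \<alpha> \<longrightarrow>
                   e_ran d' \<alpha> \<gamma> (Q_ran_pr n z)
                     \<le> ereal (sqrt (C \<tau> lam * ln (real n)) / real n powr (lam + 1 / 2)
                               * mu_sum d' \<alpha> \<gamma> lam powr lam))))"
    by (intro exI[of _ "\<lambda>\<tau> lam. 12288 * K0 lam \<tau>"]) blast
qed (use constructs_within_table constructs_within_linear in blast)+

end
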